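(* Let $A\in\mathbb R^{n\times n}$, $B\in\mathbb R^{n\times m}$, $C\in\mathbb R^{m\times n}$, let $f:\mathbb R^m\to\mathbb R^m$ be locally Lipschitz, and consider the forced Lur'e equation $$\dot x(t)=Ax(t)-Bf(Cx(t))+Bv(t).\qquad(\ast)$$ Let $w\in S^1(\mathbb R_+,\mathbb R^m)$, and assume that: (i) the pair $(C,A)$ is detectable; (ii) there exists a symmetric positive definite $P\in\mathbb R^{n\times n}$ such that $\begin{pmatrix}A^\top P+PA & PB-C^\top\\ B^\top P-C & 0\end{pmatrix}\le 0$; (iii) for every compact $\Gamma\subset\mathbb R^m$ there exist $\theta_\Gamma\in\mathcal K_\infty$ and $\alpha_\Gamma\in\mathcal P$ such that $\|f(y+z)-f(z)\|\le\theta_\Gamma(\|y\|)$ and $\|y\|\alpha_\Gamma(\|y\|)\le\langle y,f(y+z)-f(z)\rangle$ for all $y\in\mathbb R^m$, $z\in\Gamma$; (iv) there exists $(w,z)\in\mathcal B$ with bounded $z$. Then there exists a unique $z^{\rm ap}\in AP(\mathbb R_+,\mathbb R^n)$ such that $(w,z^{\rm ap})\in\mathcal B$ and, for every $\varepsilon>0$, there exists $\delta>0$ such that $P_1(w,\delta)\subset P(z^{\rm ap},\varepsilon)$. Moreover, for $(v,x)\in\mathcal B$ the following statements hold. (1) If $v\in L^1_{\rm loc}(\mathbb R_+,\mathbb R^m)$ with $v-w\in L^1(\mathbb R_+,\mathbb R^m)$, then $\lim_{t\to\infty}(x(t)-z^{\rm ap}(t))=0$, that is, $x\in AAP(\mathbb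 R_+,\mathbb R^n)$ with $x^{\rm ap}=z^{\rm ap}$. (2) If $w$ is periodic with period $\tau$, then $z^{\rm ap}$ is $\tau$-periodic. (3) $(w_{\rm e},z^{\rm ap}_{\rm e})\in\mathcal{BB}$ and there is no other bounded function $\hat x:\mathbb R\to\mathbb R^n$ such that $(w_{\rm e},\hat x)\in\mathcal{BB}$. (4) ${\rm mod}(z^{\rm ap}_{\rm e})\subseteq{\rm mod}(\widetilde{w_{\rm e}})$, and ${\rm mod}(\widetilde{w_{\rm e}})={\rm mod}(w_{\rm e})$ if $w\in AP(\mathbb R_+,\mathbb R^m)$.
   Context: $\mathcal P$: continuous functions $\mathbb R_+\to\mathbb R_+$ vanishing at $0$ and positive for positive arguments; $\mathcal K_\infty$: strictly increasing unbounded functions in $\mathcal P$. $(C,A)$ is detectable if there is $H$ with $A-HC$ Hurwitz. Matrix inequalities are in the sense of semi-definiteness. $\mathcal B$ is the set of $(v,x)\in L^1_{\rm loc}(\mathbb R_+,\mathbb R^m)\times W^{1,1}_{\rm loc}(\mathbb R_+,\mathbb R^n)$ satisfying $(\ast)$ a.e. on $\mathbb R_+$. $\mathcal{BB}$ is the set of $(v,x)\in L^1_{\rm loc}(\mathbb R,\mathbb R^m)\times W^{1,1}_{\rm loc}(\mathbb R,\mathbb R^n)$ satisfying $(\ast)$ a.e. on $\mathbb R$. Let $\mathcal T=\mathbb R_+$ or $\mathbb R$ and $X$ a Banach space. $S\subseteq\mathcal T$ is relatively dense if there is $l>0$ with $[a,a+l]\cap S\ne\emptyset$ for all $a\in\mathcal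 T$. For $v\in C(\mathcal T,X)$ and $\varepsilon>0$, $P(v,\varepsilon)$ is the set of $\tau\in\mathcal T$ with $\|v(t)-v(t+\tau)\|\le\varepsilon$ for all $t\in\mathcal T$; $AP(\mathcal T,X)$ (Bohr almost periodic functions) is the set of $v\in C(\mathcal T,X)$ with $P(v,\varepsilon)$ relatively dense for every $\varepsilon>0$. For $v\in L^1_{\rm loc}(\mathcal T,X)$, $P_1(v,\varepsilon)$ is the set of $\tau\in\mathcal T$ with $\sup_{a\in\mathcal T}\int_a^{a+1}\|v(s+\tau)-v(s)\|\,{\rm d}s\le\varepsilon$; $S^1(\mathcal T,X)$ (Stepanov almost periodic functions) is the set of $v\in L^1_{\rm loc}(\mathcal T,X)$ with $P_1(v,\varepsilon)$ relatively dense for every $\varepsilon>0$. $C_0(\mathbb R_+,X)$: continuous functions converging to $0$ at $\infty$. $AAP(\mathbb R_+,X):=AP(\mathbb R_+,X)\oplus C_0(\mathbb R_+,X)$ (the sum is direct); for $v\in AAP(\mathbb R_+,X)$, $v^{\rm ap}$ is the unique element of $AP(\mathbb R_+,X)$ with $v-v^{\rm ap}\in C_0(\mathbb R_+,X)$. Each $v\in AP(\mathbb R_+,X)$ has a unique extension $v_{\rm e}\in AP(\mathbb R,X)$, given by $v_{\rm e}(t)=\lim_{k\to\infty}v(t+\tau_k)$ with $\tau_k\in P(v,1/k)$, $\tau_k\to\infty$. Analogously, each $v\in S^1(\mathbb R_+,X)$ has a unique extension $v_{\rm e}\in S^1(\mathbb R,X)$ (same formula with $\tau_k\in P_1(v,1/k)$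 and the limit in $L^1_{\rm loc}$); these agree on $AP(\mathbb R_+,X)$. For $v\in AP(\mathbb R,X)$, the generalized Fourier coefficients are $\hat v(\lambda):=\lim_{T\to\infty}\frac1{2T}\int_{-T}^Te^{-i\lambda t}v(t)\,{\rm d}t$, $\lambda\in\mathbb R$ (values in the complexification of $X$ if $X$ is real); $\sigma_{\rm f}(v):=\{\lambda:\hat v(\lambda)\ne0\}$, which is countable; and ${\rm mod}(v):=\{\sum_{\lambda\in\sigma_{\rm f}(v)}m(\lambda)\lambda:\ m:\sigma_{\rm f}(v)\to\mathbb Z\text{ has finite support}\}$. The Bochner transform of $v\in L^1_{\rm loc}(\mathbb R,X)$ is $\tilde v:\mathbb R\to L^1([0,1],X)$, $(\tilde v(t))(s):=v(t+s)$; $v\in S^1(\mathbb R,X)$ if and only if $\tilde v\in AP(\mathbb R,L^1([0,1],X))$. *)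

theory Defs
  imports "HOL-Analysis.Analysis"
begin

section \<open>The Banach space \<open>L\<^sup>1([0,1], X)\<close>\<close>

abbreviation leb01 :: "real measure"
  where "leb01 \<equiv> lebesgue_on {0..1}"

definition L1_rel :: "(real \<Rightarrow> 'a::{banach, second_countable_topology}) \<Rightarrow> (real \<Rightarrow> 'a) \<Rightarrow> bool"
  where "L1_rel f g \<longleftrightarrow> integrable leb01 f \<and> integrable leb01 g \<and> (AE s in leb01. f s = g s)"

lemma L1_rel_part_equivp: "part_equivp (L1_rel :: (real \<Rightarrow> 'a::{banach, second_countable_topology}) \<Rightarrow> _)"
proof (rule part_equivpI)
  show "\<exists>x::real \<Rightarrow> 'a. L1_rel x x"
    by (rule exI[of _ "\<lambda>_. 0"]) (simp add: L1_rel_def)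
  show "symp (L1_rel :: (real \<Rightarrow> 'a) \<Rightarrow> _)"
    unfolding symp_def L1_rel_def by (auto simp: eq_commute)
  show "transp (L1_rel :: (real \<Rightarrow> 'a) \<Rightarrow> _)"
    unfolding transp_def L1_rel_def by auto
qed

text \<open>Integrable functions on \<open>[0,1]\<close> modulo equality almost everywhere.\<close>

quotient_type (overloaded) 'a L1 = "real \<Rightarrow> 'a::{banach, second_countable_topology}" / partial: L1_rel
  by (rule L1_rel_part_equivp)

instantiation L1 :: ("{banach, second_countable_topology}") real_vector
begin

lift_definition zero_L1 :: "'a L1" is "\<lambda>_. 0"
  by (simp add: L1_rel_def)

lift_definition plus_L1 :: "'a L1 \<Rightarrow> 'a L1 \<Rightarrow> 'a L1" is "\<lambda>f g s. f s + g s"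
  by (auto simp: L1_rel_def)

lift_definition minus_L1 :: "'a L1 \<Rightarrow> 'a L1 \<Rightarrow> 'a L1" is "\<lambda>f g s. f s - g s"
  by (auto simp: L1_rel_def)

lift_definition uminus_L1 :: "'a L1 \<Rightarrow> 'a L1" is "\<lambda>f s. - f s"
  by (auto simp: L1_rel_def)

lift_definition scaleR_L1 :: "real \<Rightarrow> 'a L1 \<Rightarrow> 'a L1" is "\<lambda>r f s. r *\<^sub>R f s"
  by (auto simp: L1_rel_def)

instance
proof
  fix a b c :: "'a L1" and r q :: real
  show "a + b + c = a + (b + c)" by transfer (auto simp: L1_rel_def add.assoc)
  show "a + b = b + a" by transfer (auto simp: L1_rel_def add.commute)
  show "0 + a = a" by transfer (auto simp: L1_rel_def)
  show "- a + a = 0" by transfer (auto simp: L1_rel_def)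
  show "a - b = a + - b" by transfer (auto simp: L1_rel_def)
  show "r *\<^sub>R (a + b) = r *\<^sub>R a + r *\<^sub>R b" by transfer (auto simp: L1_rel_def scaleR_add_right)
  show "(r + q) *\<^sub>R a = r *\<^sub>R a + q *\<^sub>R a" by transfer (auto simp: L1_rel_def scaleR_add_left)
  show "r *\<^sub>R q *\<^sub>R a = (r * q) *\<^sub>R a" by transfer (auto simp: L1_rel_def)
  show "1 *\<^sub>R a = a" by transfer (auto simp: L1_rel_def)
qed

end

instantiation L1 :: ("{banach, second_countable_topology}") real_normed_vector
begin

lift_definition norm_L1 :: "'a L1 \<Rightarrow> real" is "\<lambda>f. \<integral>s. norm (f s) \<partial>leb01"
  by (auto simp: L1_rel_def intro!: integral_cong_AE)

definition sgn_L1 :: "'a L1 \<Rightarrow> 'a L1"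
  where "sgn_L1 f = f /\<^sub>R norm f"

definition dist_L1 :: "'a L1 \<Rightarrow> 'a L1 \<Rightarrow> real"
  where "dist_L1 f g = norm (f - g)"

definition uniformity_L1 :: "('a L1 \<times> 'a L1) filter"
  where "uniformity_L1 = (INF e\<in>{0 <..}. principal {(x, y). dist x y < e})"

definition open_L1 :: "'a L1 set \<Rightarrow> bool"
  where "open_L1 S = (\<forall>x\<in>S. \<forall>\<^sub>F (x', y) in uniformity. x' = x \<longrightarrow> y \<in> S)"

instance
proof
  fix a b :: "'a L1" and r :: real and U :: "'a L1 set"
  show "sgn a = a /\<^sub>R norm a" by (rule sgn_L1_def)
  show "dist a b = norm (a - b)" by (rule dist_L1_def)
  show "uniformity = (INF e\<in>{0 <..}. principal {(x::'a L1, y). dist x y < e})"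
    by (rule uniformity_L1_def)
  show "open U = (\<forall>x\<in>U. \<forall>\<^sub>F (x', y) in uniformity. x' = x \<longrightarrow> y \<in> U)"
    by (rule open_L1_def)
  show "norm a = 0 \<longleftrightarrow> a = 0"
    by transfer (auto simp: L1_rel_def integral_nonneg_eq_0_iff_AE)
  show "norm (a + b) \<le> norm a + norm b"
  proof transfer
    fix f g :: "real \<Rightarrow> 'a"
    assume "L1_rel f f" "L1_rel g g"
    then have i: "integrable leb01 f" "integrable leb01 g" by (auto simp: L1_rel_def)
    have "(\<integral>s. norm (f s + g s) \<partial>leb01) \<le> (\<integral>s. norm (f s) + norm (g s) \<partial>leb01)"
      by (rule integral_mono) (auto simp: i norm_triangle_ineq)
    then show "(\<integral>s. norm (f s + g s) \<partial>leb01) \<le> (\<integral>s. norm (f s) \<partial>leb01) + (\<integral>s. norm (g s) \<partial>leb01)"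
      by (simp add: i)
  qed
  show "norm (r *\<^sub>R a) = \<bar>r\<bar> * norm a" by transfer simp
qed

end

lemma abs_L1_eq_iff:
  assumes "integrable leb01 f" "integrable leb01 g"
  shows "abs_L1 f = abs_L1 g \<longleftrightarrow> (AE s in leb01. f s = g s)"
  using assms Quotient_rel[OF Quotient_L1, of f g] by (auto simp: L1_rel_def)

lemma norm_abs_L1:
  assumes "integrable leb01 f"
  shows "norm (abs_L1 f) = (\<integral>s. norm (f s) \<partial>leb01)"
  using assms by (subst norm_L1.abs_eq) (auto simp: L1_rel_def)

lemma abs_L1_diff:
  assumes "integrable leb01 f" "integrable leb01 g"
  shows "abs_L1 f - abs_L1 g = abs_L1 (\<lambda>s. f s - g s)"
  using assms by (subst minus_L1.abs_eq) (auto simp: L1_rel_def)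

lemma abs_L1_sum:
  assumes "\<And>i. integrable leb01 (f i)"
  shows "(\<Sum>i<n::nat. abs_L1 (f i)) = abs_L1 (\<lambda>s. \<Sum>i<n. f i s)"
proof (induction n)
  case 0
  then show ?case by (simp add: zero_L1.abs_eq)
next
  case (Suc n)
  have "abs_L1 (\<lambda>s. \<Sum>i<n. f i s) + abs_L1 (f n) = abs_L1 (\<lambda>s. (\<Sum>i<n. f i s) + f n s)"
    using assms by (subst plus_L1.abs_eq) (auto simp: L1_rel_def)
  with Suc show ?case by simp
qed

lemma L1_repE:
  fixes F :: "'a::{banach, second_countable_topology} L1"
  obtains f where "integrable leb01 f" "F = abs_L1 f"
proof -
  have "\<exists>f. integrable leb01 f \<and> F = abs_L1 f"
    by (induction F rule: L1.abs_induct) (auto simp: L1_rel_def)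
  then show ?thesis using that by blast
qed

instance L1 :: ("{banach, second_countable_topology}") banach
proof
  fix X :: "nat \<Rightarrow> 'a L1"
  assume "Cauchy X"
  have "\<exists>r. \<forall>n. (\<forall>m\<ge>r n. norm (X m - X (r n)) < (1/2) ^ n) \<and> r n < r (Suc n)"
  proof (rule dependent_nat_choice)
    fix p n :: nat
    obtain M where "\<forall>m\<ge>M. \<forall>k\<ge>M. norm (X m - X k) < (1/2) ^ Suc n"
      using CauchyD[OF \<open>Cauchy X\<close>, of "(1/2) ^ Suc n"] by auto
    then show "\<exists>q. (\<forall>m\<ge>q. norm (X m - X q) < (1/2) ^ Suc n) \<and> p < q"
      by (intro exI[of _ "max M (Suc p)"]) auto
  next
    show "\<exists>q. \<forall>m\<ge>q. norm (X m - X q) < (1/2) ^ 0"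
      using CauchyD[OF \<open>Cauchy X\<close>, of 1] by auto
  qed
  then obtain r where r: "\<And>n m. r n \<le> m \<Longrightarrow> norm (X m - X (r n)) < (1/2) ^ n"
    and r_lt: "\<And>n. r n < r (Suc n)" by blast
  have mono: "strict_mono r" using r_lt by (simp add: strict_mono_Suc_iff)
  define D where "D = (\<lambda>n. X (r (Suc n)) - X (r n))"
  have "\<exists>f. integrable leb01 f \<and> D n = abs_L1 f" for n
    by (rule L1_repE[of "D n"]) blast
  then obtain f where f: "\<And>n. integrable leb01 (f n)" "\<And>n. D n = abs_L1 (f n)" by metis
  have nD: "norm (D n) = (\<integral>s. norm (f n s) \<partial>leb01)" for n
    by (simp add: f norm_abs_L1)
  have le: "(\<integral>s. norm (f n s) \<partial>leb01) \<le> (1/2) ^ n" for n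
    using r[of n "r (Suc n)"] r_lt[of n] by (simp add: nD[symmetric] D_def)
  have sums: "summable (\<lambda>n. \<integral>s. norm (f n s) \<partial>leb01)"
    by (rule summable_comparison_test'[where g="\<lambda>n. (1/2) ^ n" and N=0]) (auto simp: le)
  have meas[measurable]: "f n \<in> borel_measurable leb01" for n
    using f(1) by auto
  have "(\<integral>\<^sup>+s. (\<Sum>n. ennreal (norm (f n s))) \<partial>leb01) = (\<Sum>n. \<integral>\<^sup>+s. norm (f n s) \<partial>leb01)"
    by (intro nn_integral_suminf) auto
  also have "\<dots> = (\<Sum>n. ennreal (\<integral>s. norm (f n s) \<partial>leb01))"
    by (intro arg_cong[where f=suminf] ext nn_integral_eq_integral integrable_norm f) auto
  also have "\<dots> \<noteq> \<infinity>"
    using sums by (simp add: ennreal_suminf_neq_top)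
  finally have "AE s in leb01. (\<Sum>n. ennreal (norm (f n s))) \<noteq> \<infinity>"
    by (intro nn_integral_PInf_AE) auto
  then have ae: "AE s in leb01. summable (\<lambda>n. norm (f n s))"
    by eventually_elim (auto intro: summable_suminf_not_top)
  define S where "S = (\<lambda>s. \<Sum>n. f n s)"
  have S: "integrable leb01 S"
    unfolding S_def by (rule integrable_suminf[OF f(1) ae sums])
  then have [measurable]: "S \<in> borel_measurable leb01" by auto
  have N: "integrable leb01 (\<lambda>s. \<Sum>n. norm (f n s))"
    by (rule integrable_suminf) (use f ae sums in auto)
  have "(\<lambda>n. \<integral>s. norm ((\<Sum>i<n. f i s) - S s) \<partial>leb01) \<longlonglongrightarrow> (\<integral>s. 0 \<partial>leb01)"
  proof (rule integral_dominated_convergence)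
    show "integrable leb01 (\<lambda>s. (\<Sum>n. norm (f n s)) + norm (S s))"
      using N S by auto
    show "AE s in leb01. (\<lambda>n. norm ((\<Sum>i<n. f i s) - S s)) \<longlonglongrightarrow> 0"
      using ae
    proof eventually_elim
      case (elim s)
      have "(\<lambda>n. \<Sum>i<n. f i s) \<longlonglongrightarrow> S s"
        unfolding S_def using elim by (rule summable_LIMSEQ[OF summable_norm_cancel])
      then show ?case
        by (rule tendsto_norm_zero[OF LIM_zero])
    qed
    show "AE s in leb01. norm (norm ((\<Sum>i<n. f i s) - S s)) \<le> (\<Sum>n. norm (f n s)) + norm (S s)" for n
      using ae
    proof eventually_elim
      case (elim s)
      have "norm (\<Sum>i<n. f i s) \<le> (\<Sum>i<n. norm (f i s))" by (rule norm_sum)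
      also have "\<dots> \<le> (\<Sum>i. norm (f i s))"
        using elim by (intro sum_le_suminf) auto
      finally show ?case
        using norm_triangle_ineq4[of "\<Sum>i<n. f i s" "S s"] by simp
    qed
    show "(\<lambda>s. norm ((\<Sum>i<n. f i s) - S s)) \<in> borel_measurable leb01" for n
      by measurable
  qed simp
  moreover have "norm (X (r n) - X (r 0) - abs_L1 S) = (\<integral>s. norm ((\<Sum>i<n. f i s) - S s) \<partial>leb01)" for n
  proof -
    have "X (r n) - X (r 0) = (\<Sum>i<n. D i)"
      unfolding D_def by (rule sum_lessThan_telescope[of "\<lambda>n. X (r n)", symmetric])
    also have "\<dots> = abs_L1 (\<lambda>s. \<Sum>i<n. f i s)"
      by (simp add: f abs_L1_sum)
    finally show ?thesis
      using f S by (simp add: abs_L1_diff norm_abs_L1)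
  qed
  ultimately have "(\<lambda>n. norm (X (r n) - X (r 0) - abs_L1 S)) \<longlonglongrightarrow> 0"
    by simp
  then have "(\<lambda>n. X (r n) - X (r 0) - abs_L1 S) \<longlonglongrightarrow> 0"
    by (rule tendsto_norm_zero_cancel)
  then have "(\<lambda>n. (X (r n) - X (r 0) - abs_L1 S) + (X (r 0) + abs_L1 S)) \<longlonglongrightarrow> 0 + (X (r 0) + abs_L1 S)"
    by (intro tendsto_intros)
  then have lim: "(\<lambda>n. X (r n)) \<longlonglongrightarrow> X (r 0) + abs_L1 S"
    by simp
  have "X \<longlonglongrightarrow> X (r 0) + abs_L1 S"
  proof (rule LIMSEQ_I)
    fix e :: real
    assume "e > 0"
    then obtain n0 where n0: "\<And>n. n \<ge> n0 \<Longrightarrow> norm (X (r n) - (X (r 0) + abs_L1 S)) < e / 2"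
      using LIMSEQ_D[OF lim, of "e / 2"] by auto
    obtain M where M: "\<And>m k. m \<ge> M \<Longrightarrow> k \<ge> M \<Longrightarrow> norm (X m - X k) < e / 2"
      using CauchyD[OF \<open>Cauchy X\<close>, of "e / 2"] \<open>e > 0\<close> by auto
    define n where "n = max n0 M"
    have "r n \<ge> M" using seq_suble[OF mono, of n] by (simp add: n_def)
    then have "norm (X m - (X (r 0) + abs_L1 S)) < e" if "m \<ge> M" for m
      using norm_diff_triangle_less[OF M[OF that \<open>r n \<ge> M\<close>] n0[of n]] by (simp add: n_def)
    then show "\<exists>M. \<forall>m\<ge>M. norm (X m - (X (r 0) + abs_L1 S)) < e" by blast
  qed
  then show "convergent X" by (rule convergentI)
qed


section \<open>Function spaces on \<open>\<real>\<^sub>+\<close> and \<open>\<real>\<close>\<close>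

text \<open>
  The time domain \<open>T\<close> is \<^term>\<open>{0..} :: real set\<close> or \<^term>\<open>UNIV :: real set\<close>. A function on
  \<open>T\<close> is represented by a function on \<^typ>\<open>real\<close> whose values off \<open>T\<close> are irrelevant, so equality
  of functions on \<open>T\<close> has to be stated pointwise on \<open>T\<close>. An element of \<open>L\<^sup>1\<^sub>l\<^sub>o\<^sub>c\<close> is represented by any
  of its representatives.
\<close>

definition L1_loc :: "real set \<Rightarrow> (real \<Rightarrow> 'a::{banach, second_countable_topology}) set"
  where "L1_loc T = {v. \<forall>K. compact K \<and> K \<subseteq> T \<longrightarrow> v absolutely_integrable_on K}"

text \<open>
  The elements of \<open>W\<^sup>1\<^sup>,\<^sup>1\<^sub>l\<^sub>o\<^sub>c\<close> are represented by their (locally absolutely) continuous representatives,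
  the primitives of functions in \<open>L\<^sup>1\<^sub>l\<^sub>o\<^sub>c\<close>.
\<close>

definition W11_loc :: "real set \<Rightarrow> (real \<Rightarrow> 'a::{banach, second_countable_topology}) set"
  where "W11_loc T = {x. \<exists>g\<in>L1_loc T. \<forall>s\<in>T. \<forall>t\<in>T. s \<le> t \<longrightarrow>
    x t - x s = (LINT u:{s..t}|lebesgue. g u)}"

text \<open>
  Pairs \<open>(v, x)\<close> satisfying \<open>x' = A x - B f(C x) + B v\<close> almost everywhere on \<open>T\<close>: this is \<open>\<B>\<close> for
  \<open>T = \<real>\<^sub>+\<close> and \<open>\<B>\<B>\<close> for \<open>T = \<real>\<close>.
\<close>

definition behavior ::
  "real set \<Rightarrow> real^'n^'n \<Rightarrow> real^'m^'n \<Rightarrow> real^'n^'m \<Rightarrow> (real^'m \<Rightarrow> real^'m) \<Rightarrow>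
    ((real \<Rightarrow> real^'m) \<times> (real \<Rightarrow> real^'n)) set"
  where "behavior T A B C f = {(v, x). v \<in> L1_loc T \<and> x \<in> W11_loc T \<and>
    (AE t in lebesgue. t \<in> T \<longrightarrow>
      (x has_vector_derivative (A *v x t - B *v f (C *v x t) + B *v v t)) (at t within T))}"


section \<open>Almost periodic functions\<close>

definition relatively_dense :: "real set \<Rightarrow> real set \<Rightarrow> bool"
  where "relatively_dense T S \<longleftrightarrow> S \<subseteq> T \<and> (\<exists>l>0. \<forall>a\<in>T. {a..a + l} \<inter> S \<noteq> {})"

definition almost_periods :: "real set \<Rightarrow> (real \<Rightarrow> 'a::real_normed_vector) \<Rightarrow> real \<Rightarrow> real set"
  where "almost_periods T v \<epsilon> = {\<tau>\<in>T. \<forall>t\<in>T. norm (v t - v (t + \<tau>)) \<le> \<epsilon>}"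

definition AP :: "real set \<Rightarrow> (real \<Rightarrow> 'a::real_normed_vector) set"
  where "AP T = {v. continuous_on T v \<and> (\<forall>\<epsilon>>0. relatively_dense T (almost_periods T v \<epsilon>))}"

definition stepanov_periods ::
    "real set \<Rightarrow> (real \<Rightarrow> 'a::{banach, second_countable_topology}) \<Rightarrow> real \<Rightarrow> real set"
  where "stepanov_periods T v \<epsilon> =
    {\<tau>\<in>T. \<forall>a\<in>T. (LINT s:{a..a + 1}|lebesgue. norm (v (s + \<tau>) - v s)) \<le> \<epsilon>}"

definition S1 :: "real set \<Rightarrow> (real \<Rightarrow> 'a::{banach, second_countable_topology}) set"
  where "S1 T = {v \<in> L1_loc T. \<forall>\<epsilon>>0. relatively_dense T (stepanov_periods T v \<epsilon>)}"

definition C0 :: "(real \<Rightarrow> 'a::real_normed_vector) set"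
  where "C0 = {v. continuous_on {0..} v \<and> (v \<longlongrightarrow> 0) at_top}"

definition AAP :: "(real \<Rightarrow> 'a::real_normed_vector) set"
  where "AAP = {v. \<exists>u\<in>AP {0..}. (\<lambda>t. v t - u t) \<in> C0}"

text \<open>The function \<open>v\<^sup>a\<^sup>p\<close>; it is determined by \<open>v\<close> on \<open>\<real>\<^sub>+\<close> only.\<close>

definition ap_part :: "(real \<Rightarrow> 'a::real_normed_vector) \<Rightarrow> real \<Rightarrow> 'a"
  where "ap_part v = (SOME u. u \<in> AP {0..} \<and> (\<lambda>t. v t - u t) \<in> C0)"

text \<open>The extension \<open>v\<^sub>e\<close> of \<open>v \<in> AP(\<real>\<^sub>+, X)\<close>.\<close>

definition ap_ext :: "(real \<Rightarrow> 'a::real_normed_vector) \<Rightarrow> real \<Rightarrow> 'a"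
  where "ap_ext v = (THE u. u \<in> AP UNIV \<and> (\<forall>t\<ge>0. u t = v t))"

text \<open>The extension \<open>v\<^sub>e\<close> of \<open>v \<in> S\<^sup>1(\<real>\<^sub>+, X)\<close>; it is unique up to null sets, hence the choice operator.\<close>

definition S1_ext :: "(real \<Rightarrow> 'a::{banach, second_countable_topology}) \<Rightarrow> real \<Rightarrow> 'a"
  where "S1_ext v = (SOME u. u \<in> S1 UNIV \<and> (AE t in lebesgue. 0 \<le> t \<longrightarrow> u t = v t))"

text \<open>
  The complexification of \<open>X\<close> is \<open>X \<times> X\<close>, where \<open>(x, y)\<close> stands for \<open>x + i y\<close>; thus
  \<open>exp(- i \<omega> t) v(t)\<close> is \<open>(cos (\<omega> t) v(t), - sin (\<omega> t) v(t))\<close>. For \<open>v \<in> AP(\<real>, X)\<close> the integrands are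
  continuous, so that the Henstock-Kurzweil integral below is an integral of a continuous function.
\<close>

definition fourier_coeff :: "(real \<Rightarrow> 'a::real_normed_vector) \<Rightarrow> real \<Rightarrow> 'a \<times> 'a"
  where "fourier_coeff v \<omega> = Lim at_top (\<lambda>T. (1 / (2 * T)) *\<^sub>R
    integral {-T..T} (\<lambda>t. (cos (\<omega> * t) *\<^sub>R v t, - sin (\<omega> * t) *\<^sub>R v t)))"

definition fourier_spectrum :: "(real \<Rightarrow> 'a::real_normed_vector) \<Rightarrow> real set"
  where "fourier_spectrum v = {\<omega>. fourier_coeff v \<omega> \<noteq> 0}"

definition frequency_module :: "(real \<Rightarrow> 'a::real_normed_vector) \<Rightarrow> real set"
  where "frequency_module v =
    {\<Sum>\<omega> | \<omega> \<in> fourier_spectrum v \<and> m \<omega> \<noteq> 0. of_int (m \<omega>) * \<omega> |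
      m :: real \<Rightarrow> int. finite {\<omega>. \<omega> \<in> fourier_spectrum v \<and> m \<omega> \<noteq> 0}}"

definition bochner_transform ::
    "(real \<Rightarrow> 'a::{banach, second_countable_topology}) \<Rightarrow> real \<Rightarrow> 'a L1"
  where "bochner_transform v t = abs_L1 (\<lambda>s. v (t + s))"


section \<open>Matrices, comparison functions, Lipschitz continuity\<close>

definition hurwitz :: "real^'n^'n \<Rightarrow> bool"
  where "hurwitz M \<longleftrightarrow> (\<forall>(z::complex) v::complex^'n.
    v \<noteq> 0 \<and> map_matrix complex_of_real M *v v = z *s v \<longrightarrow> Re z < 0)"

definition detectable :: "real^'n^'m \<Rightarrow> real^'n^'n \<Rightarrow> bool"
  where "detectable C A \<longleftrightarrow> (\<exists>H :: real^'m^'n. hurwitz (A - H ** C))"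

definition positive_definite :: "real^'n^'n \<Rightarrow> bool"
  where "positive_definite M \<longleftrightarrow> transpose M = M \<and> (\<forall>x. x \<noteq> 0 \<longrightarrow> x \<bullet> (M *v x) > 0)"

definition negative_semidefinite :: "real^'n^'n \<Rightarrow> bool"
  where "negative_semidefinite M \<longleftrightarrow> transpose M = M \<and> (\<forall>x. x \<bullet> (M *v x) \<le> 0)"

definition block_matrix ::
    "real^'n^'n \<Rightarrow> real^'m^'n \<Rightarrow> real^'n^'m \<Rightarrow> real^'m^'m \<Rightarrow> real^('n + 'm)^('n + 'm)"
  where "block_matrix M11 M12 M21 M22 = (\<chi> i j.
    case i of
      Inl k \<Rightarrow> (case j of Inl l \<Rightarrow> M11 $ k $ l | Inr l \<Rightarrow> M12 $ k $ l)
    | Inr k \<Rightarrow> (case j of Inl l \<Rightarrow> M21 $ k $ l | Inr l \<Rightarrow> M22 $ k $ l))"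

definition class_P :: "(real \<Rightarrow> real) set"
  where "class_P = {\<alpha>. continuous_on {0..} \<alpha> \<and> \<alpha> 0 = 0 \<and> (\<forall>s>0. \<alpha> s > 0)}"

definition class_K_inf :: "(real \<Rightarrow> real) set"
  where "class_K_inf = {\<theta> \<in> class_P. strict_mono_on {0..} \<theta> \<and> \<not> bounded (\<theta> ` {0..})}"

definition locally_lipschitz :: "('a::metric_space \<Rightarrow> 'b::metric_space) \<Rightarrow> bool"
  where "locally_lipschitz f \<longleftrightarrow> (\<forall>x. \<exists>u>0. \<exists>L. L-lipschitz_on (cball x u) f)"

end

(*
  The matrix inequality gives P B = C^T, and x^T P A x <= 0, so the difference e of two solutions
  satisfies d/dt <e, P e> <= -2 <C e, f(C x1) - f(C x2)> + 2 <C e, v1 - v2>. Hence the output products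
  <C e, f(C x1) - f(C x2)> have bounded integral, which by (iii) controls C e and the difference of the
  nonlinearities; through the output injection of a Hurwitz matrix A - H C this forces the integral of
  |e|^2 to be small relative to the length of a long window, so e is small at some time of the window and
  stays small afterwards. The resulting estimate, uniform over bounded solutions, shows that the translates
  z(t + tau_k) along Stepanov almost periods tau_k of the input converge uniformly. The limit is the almost
  periodic solution, and all uniqueness and convergence claims follow from the same estimate.
  For the frequency modules, let u, v be almost periodic such that small almost periods of v are almost
  periods of u. Almost periods contain Bohr neighbourhoods given by finitely many frequencies of v, while
  for a frequency of u outside the integer span of these, Kronecker's theorem yields a translation in the
  Bohr neighbourhood that moves this frequency by a definite amount.
*)
theory Submission
  imports Defs "HOL-Analysis.Bounded_Continuous_Function" "HOL-Computational_Algebra.Fundamental_Theorem_Algebra"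
begin

section \<open>Integrable functions of a real variable\<close>

text \<open>The functions \<open>\<theta>\<close> and \<open>\<alpha>\<close> carry no rate, so no
  exponential decay can be expected. On a bounded range one only gets
  \<open>p * s + q * \<theta> s \<le> \<eta> + k * (s * \<alpha> s)\<close> with
  \<open>\<eta>\<close> arbitrarily small: the first term costs \<open>\<eta>\<close> per unit of
  time, the second is paid for by the bounded integral of the output products. Hence the bounded
  solutions, the long window, and a contradiction argument that finds one good time in it; the
  storage form, which grows only through the forcing, keeps the gain until the end of the window.
  Inputs are only locally integrable, so the equation is used in integrated form, which rests on
  Lebesgue's differentiation theorem. Bohr neighbourhoods consist of almost periods because Fourier
  coefficients determine the function. This uniqueness comes from discrete Fourier transforms over
  long almost periods: recurrence makes the cyclic autocorrelation large on a set of shifts of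
  positive density, so the coefficients cannot all be small. Values in \<open>L\<^sup>1\<close> are
  reduced to scalars by functionals.\<close>

lemma bounded_continuous_truncation:
  fixes k :: real
  assumes "k > 0"
  shows "norm ((k / max k (norm y)) *\<^sub>R y) \<le> k" "norm ((k / max k (norm y)) *\<^sub>R y) \<le> norm y"
    and "norm y \<le> k \<Longrightarrow> (k / max k (norm y)) *\<^sub>R y = y"
  using assms by (auto simp: max_def field_simps)

text \<open>Lebesgue measurability of \<open>f\<close> supplies continuous functions converging to
  it off a null set, but without domination. Composing them with the radial truncation
  \<open>T k\<close>, which is continuous and bounded by \<open>k\<close>, makes dominated
  convergence applicable; truncating \<open>f\<close> itself uses up the first half of
  \<open>e\<close>.\<close>

lemma L1_dense_continuous:
  fixes f :: "real \<Rightarrow> 'a::euclidean_space"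
  assumes f: "f absolutely_integrable_on {a..b}" and e: "e > 0"
  obtains g where "continuous_on UNIV g" "integral {a..b} (\<lambda>x. norm (f x - g x)) < e"
proof -
  define M where "M = lebesgue_on {a..b}"
  define F where "F = (\<lambda>x. if x \<in> {a..b} then f x else 0)"
  define T where "T = (\<lambda>(k::real) (y::'a). (k / max k (norm y)) *\<^sub>R y)"
  have T1: "norm (T k y) \<le> k" and T2: "norm (T k y) \<le> norm y" and T3: "norm y \<le> k \<Longrightarrow> T k y = y"
    if "k > 0" for k y
    unfolding T_def using bounded_continuous_truncation[OF that, of y] by auto
  have intf: "integrable M f"
    using absolutely_integrable_imp_integrable[OF f] by (simp add: M_def)
  then have [measurable]: "f \<in> borel_measurable M" by auto
  have "F absolutely_integrable_on UNIV"
    unfolding F_def using absolutely_integrable_restrict_UNIV[of "{a..b}" f] f by simp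
  then have "F \<in> borel_measurable lebesgue"
    by (auto simp: set_integrable_def dest: borel_measurable_integrable)
  then have "F measurable_on UNIV" by (simp add: lebesgue_measurable_imp_measurable_on)
  then obtain N g where N: "negligible N" and g: "\<And>n. continuous_on UNIV (g n)"
    and lim: "\<And>x. x \<notin> N \<Longrightarrow> (\<lambda>n. g n x) \<longlonglongrightarrow> F x"
    unfolding measurable_on_def by auto
  have gm[measurable]: "g n \<in> borel_measurable M" for n
    unfolding M_def by (rule continuous_imp_measurable_on_sets_lebesgue) (auto intro: continuous_on_subset[OF g])
  have AEN: "AE x in M. x \<notin> N"
  proof -
    have "AE x in lebesgue. x \<notin> N" using N by (simp add: negligible_iff_null_sets AE_not_in)
    then show ?thesis unfolding M_def by (subst AE_restrict_space_iff) (auto elim!: eventually_mono)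
  qed
  have fin: "integrable M (\<lambda>_. c::real)" for c
    unfolding M_def by (intro finite_measure.integrable_const) (simp add: finite_measure_lebesgue_on)
  have meas[measurable]: "(\<lambda>x. T k (h x)) \<in> borel_measurable M" if [measurable]: "h \<in> borel_measurable M" for k h
    unfolding T_def by measurable
  have l1: "(\<lambda>n. \<integral>x. norm (f x - T (Suc n) (f x)) \<partial>M) \<longlonglongrightarrow> (\<integral>x. 0 \<partial>M)"
  proof (rule integral_dominated_convergence[where w="\<lambda>x. 2 * norm (f x)"])
    show "AE x in M. (\<lambda>n. norm (f x - T (Suc n) (f x))) \<longlonglongrightarrow> 0"
    proof (rule AE_I2, rule tendsto_eventually)
      fix x
      obtain n0 :: nat where "norm (f x) \<le> n0" using real_arch_simple by blast
      then have "T (Suc n) (f x) = f x" if "n \<ge> n0" for n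
        using that by (intro T3) auto
      then show "\<forall>\<^sub>F n in sequentially. norm (f x - T (Suc n) (f x)) = 0"
        by (intro eventually_sequentiallyI[of n0]) simp
    qed
    show "AE x in M. norm (norm (f x - T (Suc n) (f x))) \<le> 2 * norm (f x)" for n
    proof (rule AE_I2)
      fix x
      show "norm (norm (f x - T (Suc n) (f x))) \<le> 2 * norm (f x)"
        using T2[of "Suc n" "f x"] norm_triangle_ineq4[of "f x" "T (Suc n) (f x)"] by simp
    qed
  qed (use intf in auto)
  then have "\<forall>\<^sub>F n in sequentially. (\<integral>x. norm (f x - T (Suc n) (f x)) \<partial>M) < e / 2"
    using e by (intro order_tendstoD(2)[OF l1]) auto
  then obtain n0 where n0: "(\<integral>x. norm (f x - T (Suc n0) (f x)) \<partial>M) < e / 2"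
    by (auto simp: eventually_sequentially)
  define k where "k = real (Suc n0)"
  have k: "k > 0" by (simp add: k_def)
  have contT: "continuous_on UNIV (T k)"
    unfolding T_def using k by (intro continuous_intros) auto
  have l2: "(\<lambda>n. \<integral>x. norm (T k (f x) - T k (g n x)) \<partial>M) \<longlonglongrightarrow> (\<integral>x. 0 \<partial>M)"
  proof (rule integral_dominated_convergence[where w="\<lambda>x. 2 * k"])
    show "AE x in M. (\<lambda>n. norm (T k (f x) - T k (g n x))) \<longlonglongrightarrow> 0"
      using AEN AE_space
    proof eventually_elim
      case (elim x)
      have "(\<lambda>n. g n x) \<longlonglongrightarrow> f x" using lim[of x] elim by (auto simp: F_def M_def)
      then have "(\<lambda>n. T k (g n x)) \<longlonglongrightarrow> T k (f x)"
        using contT by (intro isCont_tendsto_compose[of _ "T k"]) (auto simp: continuous_on_eq_continuous_at)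
      then have "(\<lambda>n. T k (f x) - T k (g n x)) \<longlonglongrightarrow> T k (f x) - T k (f x)"
        by (intro tendsto_intros)
      then show ?case
        by (simp add: tendsto_norm_zero)
    qed
    show "AE x in M. norm (norm (T k (f x) - T k (g n x))) \<le> 2 * k" for n
    proof (rule AE_I2)
      fix x
      show "norm (norm (T k (f x) - T k (g n x))) \<le> 2 * k"
        using T1[OF k, of "f x"] T1[OF k, of "g n x"] norm_triangle_ineq4[of "T k (f x)" "T k (g n x)"] by simp
    qed
  qed (use fin in auto)
  then have "\<forall>\<^sub>F n in sequentially. (\<integral>x. norm (T k (f x) - T k (g n x)) \<partial>M) < e / 2"
    using e by (intro order_tendstoD(2)[OF l2]) auto
  then obtain n1 where n1: "(\<integral>x. norm (T k (f x) - T k (g n1 x)) \<partial>M) < e / 2"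
    by (auto simp: eventually_sequentially)
  have i0: "integrable M (\<lambda>x. T k (h x))" if [measurable]: "h \<in> borel_measurable M" for h
    by (rule Bochner_Integration.integrable_bound[OF fin[of k]]) (use T1[OF k] k in auto)
  have i1: "integrable M (\<lambda>x. norm (f x - T k (f x)))" "integrable M (\<lambda>x. norm (T k (f x) - T k (g n1 x)))"
    "integrable M (\<lambda>x. norm (f x - T k (g n1 x)))"
    using i0 intf by auto
  have "(\<integral>x. norm (f x - T k (g n1 x)) \<partial>M)
      \<le> (\<integral>x. norm (f x - T k (f x)) + norm (T k (f x) - T k (g n1 x)) \<partial>M)"
    using i1 by (intro integral_mono) (auto intro: order_trans[OF _ norm_triangle_ineq])
  also have "\<dots> < e"
    using n0 n1 i1 by (simp add: k_def)
  finally have *: "(\<integral>x. norm (f x - T k (g n1 x)) \<partial>M) < e" .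
  show thesis
  proof (rule that)
    show "continuous_on UNIV (\<lambda>x. T k (g n1 x))"
      by (rule continuous_on_compose2[OF contT g]) auto
    show "integral {a..b} (\<lambda>x. norm (f x - T k (g n1 x))) < e"
      using * lebesgue_integral_eq_integral[of "{a..b}" "\<lambda>x. norm (f x - T k (g n1 x))"] i1(3)
      by (simp add: M_def)
  qed
qed

lemma absolutely_integrable_diff_norm:
  fixes f g :: "real \<Rightarrow> 'a::euclidean_space"
  assumes "f absolutely_integrable_on S" "g absolutely_integrable_on S"
  shows "(\<lambda>x. norm (f x - g x)) integrable_on S"
  using set_integral_diff(1)[OF assms] unfolding absolutely_integrable_on_def by simp

lemma absolutely_integrable_bilinear:
  fixes h :: "'b::euclidean_space \<Rightarrow> 'c::euclidean_space \<Rightarrow> 'd::euclidean_space"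
    and f :: "real \<Rightarrow> 'b"
  assumes "bounded_bilinear h" "continuous_on {a..b} f" "g absolutely_integrable_on {a..b}"
  shows "(\<lambda>x. h (f x) (g x)) absolutely_integrable_on {a..b}"
    and "\<And>h' :: 'c \<Rightarrow> 'b \<Rightarrow> 'd. bounded_bilinear h' \<Longrightarrow> (\<lambda>x. h' (g x) (f x)) absolutely_integrable_on {a..b}"
proof -
  have *: "f \<in> borel_measurable (lebesgue_on {a..b})" "bounded (f ` {a..b})"
    using assms(2) by (auto intro!: continuous_imp_measurable_on_sets_lebesgue compact_imp_bounded compact_continuous_image)
  show "(\<lambda>x. h (f x) (g x)) absolutely_integrable_on {a..b}"
    using assms * by (intro absolutely_integrable_bounded_measurable_product[of h f _ g]) (auto simp: bilinear_conv_bounded_bilinear)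
  fix h' :: "'c \<Rightarrow> 'b \<Rightarrow> 'd" assume "bounded_bilinear h'"
  then have "bounded_bilinear (\<lambda>x y. h' y x)" by (rule bounded_bilinear.flip)
  then show "(\<lambda>x. h' (g x) (f x)) absolutely_integrable_on {a..b}"
    using assms * by (intro absolutely_integrable_bounded_measurable_product[of "\<lambda>x y. h' y x" f _ g]) (auto simp: bilinear_conv_bounded_bilinear)
qed

text \<open>The product rule for an absolutely continuous \<open>e\<close> whose derivative
  \<open>g\<close> is only integrable. It holds for primitives \<open>E k\<close> of continuous
  \<open>G k\<close>; as \<open>G k\<close> tends to \<open>g\<close> in the mean,
  \<open>E k\<close> tends to \<open>e\<close> uniformly, and both sides of the identity pass to the
  limit.\<close>

lemma quadratic_primitive:
  fixes S :: "'a::euclidean_space \<Rightarrow> 'a \<Rightarrow> real" and e g :: "real \<Rightarrow> 'a"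
  assumes S: "bounded_bilinear S" and g: "g absolutely_integrable_on {a..b}" and ab: "a \<le> b"
    and e: "\<And>t. t \<in> {a..b} \<Longrightarrow> e t = e a + integral {a..t} g"
  shows "((\<lambda>u. S (e u) (g u) + S (g u) (e u)) has_integral S (e b) (e b) - S (e a) (e a)) {a..b}"
proof -
  interpret bounded_bilinear S by fact
  obtain K where K: "K > 0" "\<And>x y. norm (S x y) \<le> norm x * norm y * K"
    using pos_bounded by blast
  have gi: "g integrable_on {a..b}" "(\<lambda>x. norm (g x)) integrable_on {a..b}"
    using g by (auto simp: absolutely_integrable_on_def)
  have ec: "continuous_on {a..b} e"
    using continuous_on_add[OF continuous_on_const[of _ "e a"] indefinite_integral_continuous_1[OF gi(1)]]
    by (rule continuous_on_eq) (rule e[symmetric])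
  have int: "(\<lambda>u. S (e u) (g u) + S (g u) (e u)) absolutely_integrable_on {a..b}"
    by (rule set_integral_add(1)[OF absolutely_integrable_bilinear(1)[OF S ec g]
          absolutely_integrable_bilinear(2)[OF S ec g S]])
  have "\<exists>G. continuous_on UNIV G \<and> integral {a..b} (\<lambda>x. norm (g x - G x)) < 1 / real (Suc k)" for k
    by (rule L1_dense_continuous[OF g, of "1 / real (Suc k)"]) auto
  then obtain G where G: "\<And>k. continuous_on UNIV (G k)"
    and Gg: "\<And>k. integral {a..b} (\<lambda>x. norm (g x - G k x)) < 1 / real (Suc k)"
    by metis
  define E where "E = (\<lambda>k t. e a + integral {a..t} (G k))"
  have Gc: "continuous_on X (G k)" for k X using G continuous_on_subset by blast
  have Gi: "G k absolutely_integrable_on {a..t}" for k t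
    by (intro absolutely_integrable_continuous_real Gc)
  have E: "(E k has_vector_derivative G k t) (at t within {a..b})" if "t \<in> {a..b}" for k t
    unfolding E_def using that by (auto intro!: derivative_eq_intros integral_has_vector_derivative Gc)
  have Ec: "continuous_on {a..b} (E k)" for k
    using has_vector_derivative_continuous[OF E] by (auto simp: continuous_on_eq_continuous_within)
  have ftc: "((\<lambda>u. S (E k u) (G k u) + S (G k u) (E k u)) has_integral S (E k b) (E k b) - S (E k a) (E k a)) {a..b}" for k
    using ab by (intro fundamental_theorem_of_calculus has_vector_derivative E) auto
  have dE: "norm (E k t - e t) \<le> 1 / real (Suc k)" if t: "t \<in> {a..b}" for k t
  proof -
    have sub: "{a..t} \<subseteq> {a..b}" using t by auto
    have gt: "g absolutely_integrable_on {a..t}" using absolutely_integrable_on_subinterval[OF g sub] .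
    have "norm (E k t - e t) = norm (integral {a..t} (\<lambda>x. G k x - g x))"
      using Gi[of t k] gt e[OF t] by (simp add: E_def integral_diff absolutely_integrable_on_def)
    also have "\<dots> \<le> integral {a..t} (\<lambda>x. norm (g x - G k x))"
      using Gi[of t k] gt by (intro integral_norm_bound_integral absolutely_integrable_diff_norm)
        (auto simp: norm_minus_commute absolutely_integrable_on_def intro!: integrable_diff)
    also have "\<dots> \<le> integral {a..b} (\<lambda>x. norm (g x - G k x))"
      using Gi gt g by (intro integral_subset_le sub absolutely_integrable_diff_norm) auto
    finally show ?thesis using Gg[of k] by simp
  qed
  obtain R where R: "R > 0" "\<And>t. t \<in> {a..b} \<Longrightarrow> norm (e t) \<le> R"
    using compact_imp_bounded[OF compact_continuous_image[OF ec]] by (auto simp: bounded_pos)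
  define I where "I = integral {a..b} (\<lambda>u. S (e u) (g u) + S (g u) (e u))"
  \<comment> \<open>Up to the factor \<open>2 * K\<close> the error is the integral of
    \<open>d * norm g + d * norm (g - G k) + R * norm (g - G k)\<close> with
    \<open>d = 1 / Suc k\<close>. The three parts are at most \<open>d\<close> times the three
    summands here, the middle one because \<open>d \<le> 1\<close>.\<close>
  define C where "C = 2 * K * (integral {a..b} (\<lambda>x. norm (g x)) + 1 + R)"
  have "norm ((S (E k b) (E k b) - S (E k a) (E k a)) - I) \<le> C * (1 / real (Suc k))" for k
  proof -
    define d where "d = 1 / real (Suc k)"
    have d: "0 < d" "d \<le> 1" by (auto simp: d_def)
    have ni: "(\<lambda>x. norm (g x - G k x)) integrable_on {a..b}"
      using Gi g by (intro absolutely_integrable_diff_norm)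
    have "norm ((S (E k b) (E k b) - S (E k a) (E k a)) - I)
      = norm (integral {a..b} (\<lambda>u. (S (E k u) (G k u) + S (G k u) (E k u)) - (S (e u) (g u) + S (g u) (e u))))"
      using ftc[of k] int by (simp add: I_def integral_diff has_integral_iff absolutely_integrable_on_def)
    also have "\<dots> \<le> integral {a..b} (\<lambda>u. 2 * K * (d * norm (g u) + d * norm (g u - G k u) + R * norm (g u - G k u)))"
    proof (rule integral_norm_bound_integral)
      fix u assume u: "u \<in> {a..b}"
      have n1: "norm (E k u - e u) \<le> d" using dE[OF u] by (simp add: d_def)
      have n2: "norm (G k u) \<le> norm (g u) + norm (g u - G k u)"
        using norm_triangle_ineq4[of "g u" "g u - G k u"] by simp
      have b1: "norm (E k u - e u) * norm (G k u) \<le> d * (norm (g u) + norm (g u - G k u))"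
        using n1 n2 d by (intro mult_mono) auto
      have b2: "norm (e u) * norm (g u - G k u) \<le> R * norm (g u - G k u)"
        using R(2)[OF u] by (intro mult_right_mono) auto
      have e1: "(S (E k u) (G k u) + S (G k u) (E k u)) - (S (e u) (g u) + S (g u) (e u))
         = S (E k u - e u) (G k u) - S (e u) (g u - G k u) + (S (G k u) (E k u - e u) - S (g u - G k u) (e u))"
        by (simp add: diff_left diff_right)
      have "norm (S (E k u - e u) (G k u)) \<le> norm (E k u - e u) * norm (G k u) * K"
           "norm (S (G k u) (E k u - e u)) \<le> norm (E k u - e u) * norm (G k u) * K"
           "norm (S (e u) (g u - G k u)) \<le> norm (e u) * norm (g u - G k u) * K"
           "norm (S (g u - G k u) (e u)) \<le> norm (e u) * norm (g u - G k u) * K"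
        using K(2)[of "E k u - e u" "G k u"] K(2)[of "G k u" "E k u - e u"] K(2)[of "e u" "g u - G k u"]
          K(2)[of "g u - G k u" "e u"] by (simp_all add: mult.commute)
      then have "norm ((S (E k u) (G k u) + S (G k u) (E k u)) - (S (e u) (g u) + S (g u) (e u)))
        \<le> 2 * (norm (E k u - e u) * norm (G k u) * K) + 2 * (norm (e u) * norm (g u - G k u) * K)"
        unfolding e1
        using norm_triangle_le[OF add_mono[OF norm_triangle_ineq4[of "S (E k u - e u) (G k u)" "S (e u) (g u - G k u)"]
            norm_triangle_ineq4[of "S (G k u) (E k u - e u)" "S (g u - G k u) (e u)"]]] by linarith
      also have "\<dots> = 2 * K * (norm (E k u - e u) * norm (G k u) + norm (e u) * norm (g u - G k u))"
        by (simp add: algebra_simps)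
      also have "\<dots> \<le> 2 * K * (d * (norm (g u) + norm (g u - G k u)) + R * norm (g u - G k u))"
        using b1 b2 K by (intro mult_left_mono) auto
      finally show "norm ((S (E k u) (G k u) + S (G k u) (E k u)) - (S (e u) (g u) + S (g u) (e u)))
        \<le> 2 * K * (d * norm (g u) + d * norm (g u - G k u) + R * norm (g u - G k u))"
        by (simp add: algebra_simps)
    next
      show "(\<lambda>u. S (E k u) (G k u) + S (G k u) (E k u) - (S (e u) (g u) + S (g u) (e u))) integrable_on {a..b}"
        using ftc[of k] int by (intro integrable_diff) (auto simp: absolutely_integrable_on_def)
    next
      show "(\<lambda>u. 2 * K * (d * norm (g u) + d * norm (g u - G k u) + R * norm (g u - G k u))) integrable_on {a..b}"
        using ni gi by (intro integrable_on_mult_right integrable_add) auto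
    qed
    also have "\<dots> = 2 * K * (d * integral {a..b} (\<lambda>u. norm (g u)) + d * integral {a..b} (\<lambda>u. norm (g u - G k u))
        + R * integral {a..b} (\<lambda>u. norm (g u - G k u)))"
      using ni gi by (simp add: integral_add integrable_add integrable_on_mult_right)
    also have "\<dots> \<le> 2 * K * (d * integral {a..b} (\<lambda>u. norm (g u)) + d * 1 + R * d)"
    proof -
      have "integral {a..b} (\<lambda>u. norm (g u - G k u)) \<le> d" using Gg[of k] by (simp add: d_def)
      then show ?thesis using K R d by (intro mult_left_mono add_mono order_refl) auto
    qed
    also have "\<dots> = C * d" by (simp add: C_def algebra_simps)
    finally show ?thesis by (simp add: d_def)
  qed
  then have lim: "(\<lambda>k. (S (E k b) (E k b) - S (E k a) (E k a)) - I) \<longlonglongrightarrow> 0"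
    by (intro tendsto_0_le[OF LIMSEQ_inverse_real_of_nat, of _ C] eventuallyI)
       (simp add: inverse_eq_divide mult.commute)
  have "(\<lambda>k. E k b - e b) \<longlonglongrightarrow> 0"
    using dE[of b] ab by (intro tendsto_0_le[OF LIMSEQ_inverse_real_of_nat, of _ 1] eventuallyI)
       (simp add: inverse_eq_divide)
  then have "(\<lambda>k. E k b) \<longlonglongrightarrow> e b" by (rule LIM_zero_cancel)
  then have "(\<lambda>k. (S (E k b) (E k b) - S (E k a) (E k a)) - I) \<longlonglongrightarrow> (S (e b) (e b) - S (e a) (e a)) - I"
    by (intro tendsto_intros tendsto) (simp_all add: E_def)
  with lim have "I = S (e b) (e b) - S (e a) (e a)"
    using LIMSEQ_unique by fastforce
  moreover have "((\<lambda>u. S (e u) (g u) + S (g u) (e u)) has_integral I) {a..b}"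
    using int unfolding I_def by (simp add: absolutely_integrable_on_def has_integral_iff)
  ultimately show ?thesis by simp
qed

lemma absolutely_integrable_shift:
  fixes f :: "real \<Rightarrow> 'a::euclidean_space"
  assumes "f absolutely_integrable_on {a + c..b + c}"
  shows "(\<lambda>x. f (x + c)) absolutely_integrable_on {a..b}"
proof -
  have "f integrable_on {a + c..b + c}" "(\<lambda>x. norm (f x)) integrable_on {a + c..b + c}"
    using assms by (auto simp: absolutely_integrable_on_def)
  from this[THEN integrable_shift_real_ivl, of c] show ?thesis
    by (auto simp: absolutely_integrable_on_def)
qed

lemma integral_shift_interval:
  fixes f :: "real \<Rightarrow> 'a::real_normed_vector"
  shows "integral {a..b} (\<lambda>x. f (x + c)) = integral {a + c..b + c} f"
  using integral_shift_real_ivl[of "a + c" c "b + c" f] by simp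

text \<open>Clear for uniformly continuous functions, and the error is stable under approximation in
  the mean. Integrability on an interval longer by 1 at both ends keeps the shifted arguments
  inside. The continuity of the Bochner transform comes from here.\<close>

lemma L1_translation_continuous:
  fixes f :: "real \<Rightarrow> 'a::euclidean_space"
  assumes f: "f absolutely_integrable_on {a - 1..b + 1}" and ab: "a \<le> b" and e: "e > 0"
  obtains d where "0 < d" "d \<le> 1"
    "\<And>h. \<bar>h\<bar> < d \<Longrightarrow> integral {a..b} (\<lambda>x. norm (f (x + h) - f x)) < e"
proof -
  obtain g where gc: "continuous_on UNIV g" and g: "integral {a - 1..b + 1} (\<lambda>x. norm (f x - g x)) < e / 4"
    by (rule L1_dense_continuous[OF f, of "e / 4"]) (use e in auto)
  have "uniformly_continuous_on {a - 1..b + 1} g"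
    by (intro compact_uniformly_continuous continuous_on_subset[OF gc]) auto
  \<comment> \<open>\<open>b - a + 1\<close> in place of \<open>b - a\<close> admits a degenerate
    interval; uniform continuity then contributes at most \<open>e / 4\<close>.\<close>
  moreover define e' where "e' = e / (4 * (b - a + 1))"
  ultimately obtain d where d: "d > 0"
    "\<And>x x'. x \<in> {a - 1..b + 1} \<Longrightarrow> x' \<in> {a - 1..b + 1} \<Longrightarrow> dist x' x < d \<Longrightarrow> dist (g x') (g x) < e'"
    unfolding uniformly_continuous_on_def using e ab by (metis divide_pos_pos e'_def mult_pos_pos zero_less_numeral add_nonneg_pos diff_ge_0_iff_ge zero_less_one)
  have gi: "g absolutely_integrable_on {u..v}" for u v
    by (intro absolutely_integrable_continuous_real continuous_on_subset[OF gc]) auto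
  have fi: "f absolutely_integrable_on {u..v}" if "a - 1 \<le> u" "v \<le> b + 1" for u v
    using that by (intro absolutely_integrable_on_subinterval[OF f]) auto
  have small: "integral {u..v} (\<lambda>x. norm (f x - g x)) \<le> e / 4" if "a - 1 \<le> u" "v \<le> b + 1" for u v
  proof -
    have "integral {u..v} (\<lambda>x. norm (f x - g x)) \<le> integral {a - 1..b + 1} (\<lambda>x. norm (f x - g x))"
      using that by (intro integral_subset_le absolutely_integrable_diff_norm fi gi) auto
    then show ?thesis using g by simp
  qed
  show thesis
  proof (rule that[of "min d 1"])
    fix h :: real assume h: "\<bar>h\<bar> < min d 1"
    have fh: "(\<lambda>x. f (x + h)) absolutely_integrable_on {a..b}" "(\<lambda>x. g (x + h)) absolutely_integrable_on {a..b}"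
      using h by (auto intro!: absolutely_integrable_shift fi gi)
    have f0: "f absolutely_integrable_on {a..b}" by (rule fi) auto
    have i: "(\<lambda>x. norm (f (x + h) - g (x + h))) integrable_on {a..b}" "(\<lambda>x. norm (f x - g x)) integrable_on {a..b}"
      using fh f0 gi by (auto intro!: absolutely_integrable_diff_norm)
    have "integral {a..b} (\<lambda>x. norm (f (x + h) - f x))
       \<le> integral {a..b} (\<lambda>x. norm (f (x + h) - g (x + h)) + norm (f x - g x) + e')"
    proof (rule integral_le)
      fix x assume x: "x \<in> {a..b}"
      have "norm (g (x + h) - g x) < e'"
        using d(2)[of x "x + h"] x h by (simp add: dist_norm abs_less_iff)
      moreover have "norm (f (x + h) - f x) \<le> norm (f (x + h) - g (x + h)) + norm (g (x + h) - g x) + norm (f x - g x)"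
        by norm
      ultimately show "norm (f (x + h) - f x) \<le> norm (f (x + h) - g (x + h)) + norm (f x - g x) + e'" by simp
    qed (use i fh f0 in \<open>auto intro!: absolutely_integrable_diff_norm integrable_add\<close>)
    also have "\<dots> = integral {a..b} (\<lambda>x. norm (f (x + h) - g (x + h))) + integral {a..b} (\<lambda>x. norm (f x - g x)) + (b - a) * e'"
      using ab by (simp add: integral_add[OF integrable_add[OF i] integrable_const_ivl] integral_add[OF i])
    also have "\<dots> \<le> e / 4 + e / 4 + e / 4"
    proof (intro add_mono)
      show "integral {a..b} (\<lambda>x. norm (f (x + h) - g (x + h))) \<le> e / 4"
        using small[of "a + h" "b + h"] h by (simp add: abs_less_iff integral_shift_interval[of a b "\<lambda>x. norm (f x - g x)"])
      show "(b - a) * e' \<le> e / 4"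
        using e ab by (simp add: e'_def field_simps)
    qed (use small in auto)
    also have "\<dots> < e" using e by simp
    finally show "integral {a..b} (\<lambda>x. norm (f (x + h) - f x)) < e" .
  qed (use d in auto)
qed

section \<open>Lebesgue's differentiation theorem by the maximal inequality\<close>

text \<open>Hardy and Littlewood: Vitali's covering selects disjoint balls whose fivefold
  enlargements cover the set. A ball of radius \<open>5 * h\<close> has length
  \<open>10 * h\<close>, which is less than \<open>10 / c\<close> times the integral over the
  original ball. The conclusion speaks of a measurable superset, so that measurability of the
  superlevel set does not arise. The covering argument asks for a bound \<open>H\<close> on the
  radii.\<close>

lemma maximal_function_weak_type:
  fixes r :: "real \<Rightarrow> real"
  assumes r: "r integrable_on UNIV" and nn: "\<And>x. r x \<ge> 0" and c: "c > 0"
  obtains U where "U \<in> lmeasurable" "measure lebesgue U \<le> 10 / c * integral UNIV r"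
    "{t. \<exists>h>0. h \<le> H \<and> integral (cball t h) r > c * h} \<subseteq> U"
proof -
  define K where "K = {i :: real \<times> real. 0 < snd i \<and> snd i \<le> H \<and> integral (cball (fst i) (snd i)) r > c * snd i}"
  define E where "E = {t. \<exists>h>0. h \<le> H \<and> integral (cball t h) r > c * h}"
  have "E \<subseteq> (\<Union>i\<in>K. cball (fst i) (snd i))"
    unfolding E_def K_def by force
  then obtain C where C: "countable C" "C \<subseteq> K"
     "pairwise (\<lambda>i j. disjnt (cball (fst i) (snd i)) (cball (fst j) (snd j))) C"
     "E \<subseteq> (\<Union>i\<in>C. cball (fst i) (5 * snd i))"
    by (rule Vitali_covering_lemma_cballs[where S=E and K=K and a=fst and r=snd and B=H]) (auto simp: K_def)
  have ri: "r integrable_on cball x h" for x h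
    using r by (metis cball_eq_atLeastAtMost integrable_on_subinterval subset_UNIV)
  have bound: "measure lebesgue (\<Union>i\<in>I. cball (fst i) (5 * snd i)) \<le> 10 / c * integral UNIV r"
    if I: "I \<subseteq> C" "finite I" for I
  proof -
    have pos: "snd i > 0" "c * snd i < integral (cball (fst i) (snd i)) r" if "i \<in> I" for i
      using that I C(2) by (auto simp: K_def)
    have "measure lebesgue (\<Union>i\<in>I. cball (fst i) (5 * snd i)) \<le> (\<Sum>i\<in>I. measure lebesgue (cball (fst i) (5 * snd i)))"
      by (rule measure_UNION_le) (use I in auto)
    also have "\<dots> = (\<Sum>i\<in>I. 10 * snd i)"
      using pos by (intro sum.cong refl) (force simp: cball_eq_atLeastAtMost)
    also have "\<dots> \<le> (\<Sum>i\<in>I. 10 / c * integral (cball (fst i) (snd i)) r)"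
      using pos c by (intro sum_mono) (force simp: field_simps)
    also have "\<dots> = 10 / c * (\<Sum>i\<in>I. integral (cball (fst i) (snd i)) r)"
      by (simp add: sum_distrib_left)
    also have "(\<Sum>i\<in>I. integral (cball (fst i) (snd i)) r) = integral (\<Union>i\<in>I. cball (fst i) (snd i)) r"
    proof -
      have "(r has_integral (\<Sum>i\<in>I. integral (cball (fst i) (snd i)) r)) (\<Union>i\<in>I. cball (fst i) (snd i))"
      proof (rule has_integral_UN)
        show "pairwise (\<lambda>i i'. negligible (cball (fst i) (snd i) \<inter> cball (fst i') (snd i'))) I"
          using pairwise_subset[OF C(3) I(1)] by (auto simp: pairwise_def disjnt_def)
      qed (use I ri in \<open>auto simp: has_integral_integral[symmetric]\<close>)
      then show ?thesis by (simp add: integral_unique)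
    qed
    also have "\<dots> \<le> integral UNIV r"
    proof (rule integral_subset_le)
      show "r integrable_on (\<Union>i\<in>I. cball (fst i) (snd i))"
        using I(2) nn by (intro set_lebesgue_integral_eq_integral(1) set_integrable_subset[OF nonnegative_absolutely_integrable_1[OF r]]) auto
    qed (use r nn in auto)
    finally show ?thesis using c by (simp add: mult_left_mono divide_right_mono)
  qed
  show thesis
  proof (rule that)
    show "(\<Union>i\<in>C. cball (fst i) (5 * snd i)) \<in> lmeasurable"
      by (rule fmeasurable_UN_bound[OF C(1) _ bound]) auto
    show "measure lebesgue (\<Union>i\<in>C. cball (fst i) (5 * snd i)) \<le> 10 / c * integral UNIV r"
      by (rule measure_UN_bound[OF C(1) _ bound]) auto
  qed (use C(4) in \<open>simp add: E_def\<close>)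
qed

lemma Markov_superlevel:
  fixes r :: "real \<Rightarrow> real"
  assumes r: "r integrable_on UNIV" and nn: "\<And>x. r x \<ge> 0" and c: "c > 0"
  shows "{x. r x \<ge> c} \<in> lmeasurable" "measure lebesgue {x. r x \<ge> c} \<le> integral UNIV r / c"
proof -
  have "r absolutely_integrable_on UNIV"
    using nonnegative_absolutely_integrable_1[OF r] nn by auto
  then have i: "integrable lebesgue r" by (simp add: set_integrable_def)
  then have [measurable]: "r \<in> borel_measurable lebesgue" by auto
  have "integral\<^sup>L lebesgue r = integral UNIV r" using integral_lebesgue[OF i] by simp
  moreover have s: "{x. r x \<ge> c} \<in> sets lebesgue"
  proof -
    have "{x \<in> space lebesgue. r x \<ge> c} \<in> sets lebesgue" by measurable
    then show ?thesis by simp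
  qed
  moreover have "emeasure lebesgue {x \<in> space lebesgue. r x \<ge> c} \<le> (1/c) * (\<integral>x. r x \<partial>lebesgue)"
    using i nn c by (intro integral_Markov_inequality) auto
  ultimately show "{x. r x \<ge> c} \<in> lmeasurable"
    by (intro fmeasurableI) (auto intro: le_less_trans)
  show "measure lebesgue {x. r x \<ge> c} \<le> integral UNIV r / c"
    using integral_Markov_inequality_measure[of lebesgue r "{}" c] i nn c integral_lebesgue[OF i] by simp
qed

text \<open>Replace \<open>g\<close> by a continuous \<open>f\<close> close in the mean. The
  increment error of \<open>g\<close> is that of \<open>f\<close>, eventually at most
  \<open>c / 3\<close> per unit, plus two contributions of \<open>s = g - f\<close>: its value at
  \<open>t\<close>, large only on \<open>W\<close>, and its averages around \<open>t\<close>, large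
  only on \<open>U\<close>. Both sets have measure proportional to the distance of \<open>f\<close>
  and \<open>g\<close> in the mean.\<close>

lemma primitive_increment_negligible:
  fixes g :: "real \<Rightarrow> 'a::euclidean_space"
  assumes g: "g absolutely_integrable_on {a..b}" and c: "c > 0"
  shows "negligible {t \<in> {a..b}. \<forall>d>0. \<exists>u\<in>{a..b}. u \<noteq> t \<and> \<bar>u - t\<bar> < d \<and>
    norm (integral {a..u} g - integral {a..t} g - (u - t) *\<^sub>R g t) > c * \<bar>u - t\<bar>}" (is "negligible ?D")
  unfolding negligible_outer_le
proof (intro allI impI)
  fix e :: real assume e: "e > 0"
  \<comment> \<open>The measures of \<open>U\<close> and \<open>W\<close> add up to at most
    \<open>33 * e' / c\<close>; any denominator from 33 on would do.\<close>
  define e' where "e' = e * c / 60"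
  have e': "e' > 0" using e c by (simp add: e'_def)
  obtain f where fc: "continuous_on UNIV f" and f: "integral {a..b} (\<lambda>x. norm (g x - f x)) < e'"
    using L1_dense_continuous[OF g e'] by blast
  have fi: "f absolutely_integrable_on {u..v}" for u v
    by (intro absolutely_integrable_continuous_real continuous_on_subset[OF fc]) auto
  define r where "r = (\<lambda>x. if x \<in> {a..b} then norm (g x - f x) else 0)"
  have rab: "(\<lambda>x. norm (g x - f x)) integrable_on {a..b}"
    by (intro absolutely_integrable_diff_norm g fi)
  have r: "r integrable_on UNIV" and rI: "integral UNIV r = integral {a..b} (\<lambda>x. norm (g x - f x))"
    using rab unfolding r_def by (simp_all add: integrable_restrict_UNIV integral_restrict_UNIV del: atLeastAtMost_iff)
  have r0: "r x \<ge> 0" for x by (simp add: r_def)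
  have c3: "c / 3 > 0" using c by simp
  obtain U where U: "U \<in> lmeasurable" "measure lebesgue U \<le> 10 / (c / 3) * integral UNIV r"
    "{t. \<exists>h>0. h \<le> b - a \<and> integral (cball t h) r > (c / 3) * h} \<subseteq> U"
    by (rule maximal_function_weak_type[OF r r0 c3])
  define W where "W = {x. r x \<ge> c / 3}"
  have W: "W \<in> lmeasurable" "measure lebesgue W \<le> integral UNIV r / (c / 3)"
    unfolding W_def using Markov_superlevel[OF r r0 c3] by auto
  have sub: "?D \<subseteq> U \<union> W"
  proof
    fix t assume t: "t \<in> ?D"
    then have tab: "t \<in> {a..b}" by auto
    show "t \<in> U \<union> W"
    proof (cases "r t \<ge> c / 3")
      case True
      then show ?thesis by (auto simp: W_def)
    next
      case False
      have "((\<lambda>u. integral {a..u} f) has_vector_derivative f t) (at t within {a..b})"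
        by (intro integral_has_vector_derivative continuous_on_subset[OF fc] tab) auto
      then obtain d where d: "d > 0" "\<And>u. u \<in> {a..b} \<Longrightarrow> \<bar>u - t\<bar> < d \<Longrightarrow>
          norm (integral {a..u} f - integral {a..t} f - (u - t) *\<^sub>R f t) \<le> c / 3 * \<bar>u - t\<bar>"
        unfolding has_vector_derivative_def has_derivative_within_alt real_norm_def using c3 by meson
      from t obtain u where u: "u \<in> {a..b}" "u \<noteq> t" "\<bar>u - t\<bar> < d"
        "norm (integral {a..u} g - integral {a..t} g - (u - t) *\<^sub>R g t) > c * \<bar>u - t\<bar>"
        using d(1) by auto
      define h where "h = \<bar>u - t\<bar>"
      define s where "s = (\<lambda>x. g x - f x)"
      have si: "s integrable_on {x..y}" "(\<lambda>x. norm (s x)) integrable_on {x..y}" if "x \<ge> a" "y \<le> b" for x y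
      proof -
        have "g absolutely_integrable_on {x..y}" using that by (intro absolutely_integrable_on_subinterval[OF g]) auto
        then show "s integrable_on {x..y}" "(\<lambda>x. norm (s x)) integrable_on {x..y}"
          using fi[of x y] unfolding s_def by (auto intro!: absolutely_integrable_diff_norm integrable_diff simp: absolutely_integrable_on_def)
      qed
      have incr: "norm (integral {a..v} s - integral {a..w} s) \<le> integral (cball t h) r"
        if vw: "a \<le> w" "w \<le> v" "v \<le> b" "{w..v} \<subseteq> cball t h" for v w
      proof -
        have "integral {a..v} s - integral {a..w} s = integral {w..v} s"
          using Henstock_Kurzweil_Integration.integral_combine[of a w v s] si[of a v] vw by (simp add: algebra_simps)
        also have "norm \<dots> \<le> integral {w..v} (\<lambda>x. norm (s x))"
          using si[of w v] vw by (intro integral_norm_bound_integral) auto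
        also have "\<dots> = integral {w..v} r"
          using vw by (intro integral_cong) (auto simp: r_def s_def)
        also have "\<dots> \<le> integral (cball t h) r"
          using vw r by (intro integral_subset_le) (auto simp: cball_eq_atLeastAtMost r0 intro: integrable_on_subinterval)
        finally show ?thesis .
      qed
      have big: "norm (integral {a..u} s - integral {a..t} s) \<le> integral (cball t h) r"
      proof (cases "t \<le> u")
        case True
        then show ?thesis using incr[of t u] tab u by (auto simp: h_def cball_eq_atLeastAtMost)
      next
        case False
        then show ?thesis using incr[of u t] tab u by (auto simp: h_def cball_eq_atLeastAtMost norm_minus_commute)
      qed
      have eq: "integral {a..x} s = integral {a..x} g - integral {a..x} f" if "x \<in> {a..b}" for x
        unfolding s_def using that absolutely_integrable_on_subinterval[OF g, of a x] fi[of a x]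
        by (intro integral_diff) (auto simp: absolutely_integrable_on_def)
      have "c * h < norm (integral {a..u} g - integral {a..t} g - (u - t) *\<^sub>R g t)"
        using u by (simp add: h_def)
      also have "\<dots> = norm ((integral {a..u} s - integral {a..t} s) + (integral {a..u} f - integral {a..t} f - (u - t) *\<^sub>R f t)
          - (u - t) *\<^sub>R (g t - f t))"
        using u tab by (simp add: eq algebra_simps)
      also have "\<dots> \<le> norm (integral {a..u} s - integral {a..t} s) + c / 3 * h + h * (c / 3)"
      proof -
        have "norm (integral {a..u} f - integral {a..t} f - (u - t) *\<^sub>R f t) \<le> c / 3 * h"
          using d(2)[of u] u by (simp add: h_def)
        moreover have "norm (g t - f t) \<le> c / 3" using False tab by (simp add: r_def)
        then have "norm ((u - t) *\<^sub>R (g t - f t)) \<le> h * (c / 3)"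
          using mult_left_mono[of "norm (g t - f t)" "c / 3" "\<bar>u - t\<bar>"] by (simp add: h_def)
        ultimately show ?thesis
          using norm_triangle_ineq4[of "(integral {a..u} s - integral {a..t} s) + (integral {a..u} f - integral {a..t} f - (u - t) *\<^sub>R f t)"
              "(u - t) *\<^sub>R (g t - f t)"]
            norm_triangle_ineq[of "integral {a..u} s - integral {a..t} s" "integral {a..u} f - integral {a..t} f - (u - t) *\<^sub>R f t"]
          by linarith
      qed
      also have "\<dots> \<le> integral (cball t h) r + 2 * (c / 3 * h)"
        using big by simp
      finally have "c / 3 * h < integral (cball t h) r" by simp
      moreover have "h > 0" "h \<le> b - a" using u tab by (auto simp: h_def)
      ultimately show ?thesis using U(3) by blast
    qed
  qed
  have "measure lebesgue (U \<union> W) \<le> measure lebesgue U + measure lebesgue W"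
    using U W by (intro measure_Un_le) auto
  also have "\<dots> \<le> 10 / (c / 3) * integral UNIV r + integral UNIV r / (c / 3)"
    using U W by simp
  also have "\<dots> \<le> 10 / (c / 3) * e' + e' / (c / 3)"
    using f rI c by (intro add_mono mult_left_mono divide_right_mono) auto
  also have "\<dots> \<le> e" using c e by (simp add: e'_def)
  finally show "\<exists>T. ?D \<subseteq> T \<and> T \<in> lmeasurable \<and> measure lebesgue T \<le> e"
    using sub U W by (intro exI[of _ "U \<union> W"]) (auto intro: fmeasurable.Un)
qed

text \<open>A failure of the derivative at \<open>t\<close> is a failure with increment error
  \<open>1 / Suc n\<close> for some \<open>n\<close>, so the exceptional points form a countable
  union of the null sets just found.\<close>

theorem lebesgue_differentiation:
  fixes g :: "real \<Rightarrow> 'a::euclidean_space"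
  assumes g: "g absolutely_integrable_on {a..b}"
  obtains N where "negligible N" "\<And>t. t \<in> {a..b} - N \<Longrightarrow>
    ((\<lambda>u. integral {a..u} g) has_vector_derivative g t) (at t within {a..b})"
proof -
  define D where "D = (\<lambda>c::real. {t \<in> {a..b}. \<forall>d>0. \<exists>u\<in>{a..b}. u \<noteq> t \<and> \<bar>u - t\<bar> < d \<and>
    norm (integral {a..u} g - integral {a..t} g - (u - t) *\<^sub>R g t) > c * \<bar>u - t\<bar>})"
  define N where "N = (\<Union>n::nat. D (1 / real (Suc n)))"
  have "negligible (D (1 / real (Suc n)))" for n
    unfolding D_def by (rule primitive_increment_negligible[OF g]) simp
  then have "negligible N" unfolding N_def
    by (intro negligible_countable_Union) auto
  moreover have "((\<lambda>u. integral {a..u} g) has_vector_derivative g t) (at t within {a..b})" if t: "t \<in> {a..b} - N" for t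
    unfolding has_vector_derivative_def has_derivative_within_alt
  proof (intro conjI allI impI bounded_linear_scaleR_left)
    fix e :: real assume "e > 0"
    then obtain n where n: "1 / real (Suc n) < e" using nat_approx_posE by blast
    have "t \<notin> D (1 / real (Suc n))" using t by (auto simp: N_def)
    then have "\<not> (\<forall>d>0. \<exists>u\<in>{a..b}. u \<noteq> t \<and> \<bar>u - t\<bar> < d \<and>
       norm (integral {a..u} g - integral {a..t} g - (u - t) *\<^sub>R g t) > 1 / real (Suc n) * \<bar>u - t\<bar>)"
      using t unfolding D_def by blast
    then obtain d where d: "d > 0" "\<And>u. u \<in> {a..b} \<Longrightarrow> u \<noteq> t \<Longrightarrow> \<bar>u - t\<bar> < d \<Longrightarrow>
       norm (integral {a..u} g - integral {a..t} g - (u - t) *\<^sub>R g t) \<le> 1 / real (Suc n) * \<bar>u - t\<bar>"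
      by (meson not_less)
    show "\<exists>d>0. \<forall>y\<in>{a..b}. norm (y - t) < d \<longrightarrow>
       norm (integral {a..y} g - integral {a..t} g - (y - t) *\<^sub>R g t) \<le> e * norm (y - t)"
    proof (intro exI[of _ d] conjI ballI impI d(1))
      fix y assume y: "y \<in> {a..b}" "norm (y - t) < d"
      show "norm (integral {a..y} g - integral {a..t} g - (y - t) *\<^sub>R g t) \<le> e * norm (y - t)"
      proof (cases "y = t")
        case False
        have "1 / real (Suc n) * \<bar>y - t\<bar> \<le> e * \<bar>y - t\<bar>" using n by (intro mult_right_mono) auto
        then show ?thesis using d(2)[of y] y False by (simp del: of_nat_Suc)
      qed auto
    qed
  qed
  ultimately show thesis by (rule that)
qed

section \<open>The differential equation as an integral equation\<close>

lemma AE_lebesgue_iff_negligible: "(AE x in lebesgue. P x) \<longleftrightarrow> negligible {x. \<not> P x}"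
proof
  assume "AE x in lebesgue. P x"
  then obtain N where "N \<in> null_sets lebesgue" "{x \<in> space lebesgue. \<not> P x} \<subseteq> N"
    by (auto simp: eventually_ae_filter)
  then show "negligible {x. \<not> P x}"
    by (auto simp: negligible_iff_null_sets[symmetric] intro: negligible_subset)
next
  assume "negligible {x. \<not> P x}"
  then show "AE x in lebesgue. P x"
    by (intro AE_I'[of "{x. \<not> P x}"]) (auto simp: negligible_iff_null_sets)
qed

text \<open>Both time domains share what the arguments use: an interval that starts in
  \<open>T\<close> stays in \<open>T\<close>, and \<open>T\<close> is closed under addition.\<close>

definition halfline_or_line :: "real set \<Rightarrow> bool"
  where "halfline_or_line T \<longleftrightarrow> T = {0..} \<or> T = UNIV"

lemma halfline_or_line_simps [simp]: "halfline_or_line {0..}" "halfline_or_line UNIV"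
  by (auto simp: halfline_or_line_def)

lemma halfline_or_line_interval: "halfline_or_line T \<Longrightarrow> a \<in> T \<Longrightarrow> {a..b} \<subseteq> T"
  by (auto simp: halfline_or_line_def)

text \<open>The interval is a neighbourhood of every point of \<open>K\<close> relative to
  \<open>T\<close>: the right end is not attained, and the left end only at the origin of the
  half-line. Continuity within \<open>T\<close> can therefore be tested on intervals.\<close>

lemma halfline_or_line_exhaust:
  assumes "halfline_or_line T" "bounded K" "K \<subseteq> T"
  obtains a b where "a \<in> T" "{a..b} \<subseteq> T" "K \<subseteq> {a..b}" "K \<subseteq> {..<b}" "a \<le> b" "\<And>t. t \<in> K \<Longrightarrow> t = a \<longrightarrow> T = {0..} \<and> a = 0"
proof -
  obtain n where n: "n > 0" "\<And>t. t \<in> K \<Longrightarrow> \<bar>t\<bar> \<le> n" using assms(2) by (auto simp: bounded_pos)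
  show thesis
  proof (cases "T = {0..}")
    case True
    have "t \<in> {0..n + 1} \<and> t < n + 1" if "t \<in> K" for t
      using n(2)[OF that] that assms(3) True by auto
    then show ?thesis using n True by (intro that[of 0 "n + 1"]) auto
  next
    case False
    then have "T = UNIV" using assms(1) by (auto simp: halfline_or_line_def)
    moreover have "t \<in> {- n - 1<..n + 1} \<and> t < n + 1" if "t \<in> K" for t
      using n(2)[OF that] by auto
    ultimately show ?thesis using n by (intro that[of "- n - 1" "n + 1"]) force+
  qed
qed

lemma L1_loc_iff:
  fixes v :: "real \<Rightarrow> 'a::euclidean_space"
  assumes "halfline_or_line T"
  shows "v \<in> L1_loc T \<longleftrightarrow> (\<forall>a b. a \<in> T \<longrightarrow> v absolutely_integrable_on {a..b})"
proof (intro iffI allI impI)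
  fix a b assume "v \<in> L1_loc T" "a \<in> T"
  then show "v absolutely_integrable_on {a..b}"
    using halfline_or_line_interval[OF assms] by (auto simp: L1_loc_def)
next
  assume v: "\<forall>a b. a \<in> T \<longrightarrow> v absolutely_integrable_on {a..b}"
  show "v \<in> L1_loc T" unfolding L1_loc_def
  proof safe
    fix K assume K: "compact K" "K \<subseteq> T"
    obtain a b where "a \<in> T" "K \<subseteq> {a..b}"
      using halfline_or_line_exhaust[OF assms compact_imp_bounded[OF K(1)] K(2)] by metis
    with v K show "v absolutely_integrable_on K"
      by (intro set_integrable_subset[of lebesgue "{a..b}" v K]) (auto intro: lmeasurable_compact fmeasurableD)
  qed
qed

lemma primitive_has_vector_derivative_AE:
  fixes x g :: "real \<Rightarrow> 'a::euclidean_space"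
  assumes T: "halfline_or_line T" and g: "g \<in> L1_loc T"
    and x: "\<And>s t. s \<in> T \<Longrightarrow> t \<in> T \<Longrightarrow> s \<le> t \<Longrightarrow> x t - x s = integral {s..t} g"
  shows "AE t in lebesgue. t \<in> T \<longrightarrow> (x has_vector_derivative g t) (at t within T)"
proof -
  define l where "l = (\<lambda>n::nat. if T = {0..} then 0 else - real n)"
  have l: "l n \<in> T" "{l n..real n} \<subseteq> T" for n
    using T by (auto simp: l_def halfline_or_line_def)
  have "\<exists>N. negligible N \<and> (\<forall>t\<in>{l n..real n} - N.
    ((\<lambda>u. integral {l n..u} g) has_vector_derivative g t) (at t within {l n..real n}))" for n
    by (rule lebesgue_differentiation[where g=g and a="l n" and b="real n"])
       (use g l in \<open>auto simp: L1_loc_iff[OF T]\<close>)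
  then obtain N where N: "\<And>n. negligible (N n)" "\<And>n t. t \<in> {l n..real n} - N n \<Longrightarrow>
    ((\<lambda>u. integral {l n..u} g) has_vector_derivative g t) (at t within {l n..real n})"
    by metis
  have "(x has_vector_derivative g t) (at t within T)" if t: "t \<in> T" "t \<notin> (\<Union>n. N n)" for t
  proof -
    obtain n :: nat where n: "\<bar>t\<bar> < real n" using reals_Archimedean2 by blast
    have tn: "t \<in> {l n..real n}" using n t by (auto simp: l_def)
    have "((\<lambda>u. x (l n) + integral {l n..u} g) has_vector_derivative g t) (at t within {l n..real n})"
      using N(2)[of t n] t(2) tn by (auto intro!: derivative_eq_intros)
    then have "(x has_vector_derivative g t) (at t within {l n..real n})"
    proof (rule has_vector_derivative_transform[rotated 2])
      fix u assume u: "u \<in> {l n..real n}"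
      then show "x u = x (l n) + integral {l n..u} g"
        using x[of "l n" u] l[of n] by (auto simp: algebra_simps)
    qed (use tn in auto)
    moreover have "at t within T = at t within {l n..real n}"
      by (rule at_within_nhd[of t "{- real n<..<real n}"])
         (use n T in \<open>auto simp: l_def halfline_or_line_def\<close>)
    ultimately show ?thesis by simp
  qed
  then have "{t. \<not> (t \<in> T \<longrightarrow> (x has_vector_derivative g t) (at t within T))} \<subseteq> (\<Union>n. N n)" by blast
  moreover have "negligible (\<Union>n. N n)" using N(1) by (intro negligible_countable_Union) auto
  ultimately show ?thesis unfolding AE_lebesgue_iff_negligible by (rule negligible_subset[rotated])
qed

lemma matrix_absolutely_integrable:
  fixes v :: "real \<Rightarrow> real^'m" and B :: "real^'m^'n"
  assumes "v absolutely_integrable_on S"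
  shows "(\<lambda>t. B *v v t) absolutely_integrable_on S"
  using absolutely_integrable_linear[OF assms matrix_vector_mul_bounded_linear[of B]] by (simp add: o_def)

abbreviation (input) lure_field where
  "lure_field A B C f v x \<equiv> (\<lambda>t. A *v x t - B *v f (C *v x t) + B *v v t)"

lemma lure_field_absolutely_integrable:
  fixes A :: "real^'n^'n" and B :: "real^'m^'n" and C :: "real^'n^'m" and a b :: real
  assumes f: "continuous_on UNIV f" and x: "continuous_on {a..b} x" and v: "v absolutely_integrable_on {a..b}"
  shows "lure_field A B C f v x absolutely_integrable_on {a..b}"
proof (rule set_integral_add(1)[OF absolutely_integrable_continuous_real matrix_absolutely_integrable[OF v]])
  have "continuous_on {a..b} (\<lambda>t. f (C *v x t))"
    by (rule continuous_on_compose2[OF f bounded_linear.continuous_on[OF matrix_vector_mul_bounded_linear x]]) auto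
  then show "continuous_on {a..b} (\<lambda>t. A *v x t - B *v f (C *v x t))"
    by (intro continuous_on_diff bounded_linear.continuous_on[OF matrix_vector_mul_bounded_linear] x)
qed

lemma continuous_on_halfline_or_line:
  fixes x :: "real \<Rightarrow> 'a::euclidean_space"
  assumes T: "halfline_or_line T"
    and "\<And>a b. a \<in> T \<Longrightarrow> continuous_on {a..b} x"
  shows "continuous_on T x"
  unfolding continuous_on_eq_continuous_within
proof
  fix t assume t: "t \<in> T"
  have sub: "{t} \<subseteq> T" using t by simp
  obtain a b where ab: "a \<in> T" "{a..b} \<subseteq> T" "{t} \<subseteq> {a..b}" "{t} \<subseteq> {..<b}" "t = a \<longrightarrow> T = {0..} \<and> a = 0"
    using halfline_or_line_exhaust[OF T _ sub] by (metis bounded_empty bounded_insert insertI1)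
  have "at t within T = at t within {a..b}"
    by (rule at_within_nhd[of t "if T = {0..} \<and> a = 0 then {..<b} else {a<..<b}"]) (use ab in auto)
  then show "continuous (at t within T) x"
    using assms(2)[OF ab(1), of b] ab(3) by (auto simp: continuous_on_eq_continuous_within)
qed

text \<open>An element of \<open>W11_loc\<close> is a primitive of some \<open>g\<close>; by
  Lebesgue's theorem its derivative is \<open>g\<close> almost everywhere, so \<open>g\<close>
  agrees with the right-hand side off a null set. Conversely the right-hand side is locally
  integrable and its primitive is differentiable almost everywhere. The integrated equation has no
  exceptional sets and is the form used afterwards.\<close>

theorem behavior_iff:
  fixes A :: "real^'n^'n" and B :: "real^'m^'n" and C :: "real^'n^'m"
  assumes T: "halfline_or_line T" and f: "continuous_on UNIV f"
  shows "(v, x) \<in> behavior T A B C f \<longleftrightarrow> v \<in> L1_loc T \<and> continuous_on T x \<and>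
    (\<forall>s\<in>T. \<forall>t\<in>T. s \<le> t \<longrightarrow> x t - x s = integral {s..t} (lure_field A B C f v x))"
proof (intro iffI conjI ballI impI)
  assume "(v, x) \<in> behavior T A B C f"
  then have v: "v \<in> L1_loc T" and x: "x \<in> W11_loc T" and
    der: "AE t in lebesgue. t \<in> T \<longrightarrow> (x has_vector_derivative (lure_field A B C f v x t)) (at t within T)"
    by (auto simp: behavior_def)
  show "v \<in> L1_loc T" by fact
  obtain g where g: "g \<in> L1_loc T" and
    xg': "\<forall>s\<in>T. \<forall>t\<in>T. s \<le> t \<longrightarrow> x t - x s = (LINT u:{s..t}|lebesgue. g u)"
    using x by (auto simp: W11_loc_def)
  have gi: "g absolutely_integrable_on {a..b}" if "a \<in> T" for a b
    using g that by (auto simp: L1_loc_iff[OF T])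
  have xg: "x t - x s = integral {s..t} g" if "s \<in> T" "t \<in> T" "s \<le> t" for s t
    using xg' that set_lebesgue_integral_eq_integral(2)[OF gi[of s t]] by auto
  show "continuous_on T x"
  proof (rule continuous_on_halfline_or_line[OF T])
    fix a b assume a: "a \<in> T"
    have "continuous_on {a..b} (\<lambda>t. x a + integral {a..t} g)"
      using gi[OF a] by (intro continuous_intros indefinite_integral_continuous_1) (simp add: absolutely_integrable_on_def)
    then show "continuous_on {a..b} x"
    proof (rule continuous_on_eq)
      fix t assume "t \<in> {a..b}"
      then show "x a + integral {a..t} g = x t"
        using xg[of a t] a halfline_or_line_interval[OF T a, of b] by (auto simp: algebra_simps)
    qed
  qed
  fix s t assume st: "s \<in> T" "t \<in> T" "s \<le> t"
  have "AE t in lebesgue. t \<in> T \<longrightarrow> (x has_vector_derivative g t) (at t within T)"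
    by (rule primitive_has_vector_derivative_AE[OF T g xg])
  with der have "AE t in lebesgue. t \<in> T \<longrightarrow> g t = lure_field A B C f v x t"
  proof eventually_elim
    case (elim t)
    show ?case
    proof
      assume t: "t \<in> T"
      \<comment> \<open>Uniqueness of the derivative also has to hold at the left end of the
        half-line, where only the limit from the right exists.\<close>
      have "at t within T \<noteq> bot"
      proof -
        have "at_right t \<le> at t within T"
          by (rule at_le) (use T t in \<open>auto simp: halfline_or_line_def\<close>)
        then show ?thesis using trivial_limit_at_right_real[of t] by (auto simp: bot_unique)
      qed
      then show "g t = lure_field A B C f v x t"
        using elim t by (intro vector_derivative_unique_within) auto
    qed
  qed
  then have "negligible {t. \<not> (t \<in> T \<longrightarrow> g t = lure_field A B C f v x t)}"
    by (simp only: AE_lebesgue_iff_negligible)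
  then have "integral {s..t} g = integral {s..t} (lure_field A B C f v x)"
    by (rule integral_spike) (use halfline_or_line_interval[OF T st(1), of t] in auto)
  then show "x t - x s = integral {s..t} (lure_field A B C f v x)"
    using xg st by simp
next
  assume *: "v \<in> L1_loc T \<and> continuous_on T x \<and>
    (\<forall>s\<in>T. \<forall>t\<in>T. s \<le> t \<longrightarrow> x t - x s = integral {s..t} (lure_field A B C f v x))"
  have i: "lure_field A B C f v x absolutely_integrable_on {a..b}" if "a \<in> T" for a b
  proof (rule lure_field_absolutely_integrable[OF f])
    show "continuous_on {a..b} x"
      using * halfline_or_line_interval[OF T that, of b] by (auto intro: continuous_on_subset)
    show "v absolutely_integrable_on {a..b}" using * that by (auto simp: L1_loc_iff[OF T])
  qed
  have L: "lure_field A B C f v x \<in> L1_loc T" unfolding L1_loc_iff[OF T] using i by blast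
  have "x \<in> W11_loc T"
    unfolding W11_loc_def mem_Collect_eq
  proof (rule bexI[OF _ L], intro ballI impI)
    fix s t assume st: "s \<in> T" "t \<in> T" "s \<le> t"
    then have "x t - x s = integral {s..t} (lure_field A B C f v x)" using * by blast
    also have "\<dots> = (LINT u:{s..t}|lebesgue. lure_field A B C f v x u)"
      by (rule set_lebesgue_integral_eq_integral(2)[OF i[OF st(1)], symmetric])
    finally show "x t - x s = (LINT u:{s..t}|lebesgue. lure_field A B C f v x u)" .
  qed
  moreover have "AE t in lebesgue. t \<in> T \<longrightarrow>
      (x has_vector_derivative (lure_field A B C f v x t)) (at t within T)"
    by (rule primitive_has_vector_derivative_AE[OF T L]) (use * in blast)
  ultimately show "(v, x) \<in> behavior T A B C f"
    using * by (simp add: behavior_def)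
qed

section \<open>Almost periodic functions\<close>

lemma AP_UNIV_iff:
  "v \<in> AP UNIV \<longleftrightarrow> continuous_on UNIV v \<and>
    (\<forall>\<epsilon>>0. \<exists>l>0. \<forall>a. \<exists>\<tau>\<in>{a..a + l}. \<forall>t. norm (v t - v (t + \<tau>)) \<le> \<epsilon>)"
  by (simp add: AP_def relatively_dense_def almost_periods_def ex_in_conv[symmetric] Bex_def)

lemma AP_UNIV_period:
  assumes "v \<in> AP UNIV" "\<epsilon> > 0"
  obtains l where "l > 0" "\<And>a. \<exists>\<tau>\<in>{a..a + l}. \<forall>t. norm (v t - v (t + \<tau>)) \<le> \<epsilon>"
  using assms unfolding AP_UNIV_iff by blast

lemma AP_UNIV_continuous: "v \<in> AP UNIV \<Longrightarrow> continuous_on X v"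
  unfolding AP_UNIV_iff using continuous_on_subset by blast

lemma AP_UNIV_bounded:
  assumes "v \<in> AP UNIV"
  obtains K where "K > 0" "\<And>t. norm (v t) \<le> K"
proof -
  obtain l where l: "l > 0" "\<And>a. \<exists>\<tau>\<in>{a..a + l}. \<forall>t. norm (v t - v (t + \<tau>)) \<le> 1"
    by (rule AP_UNIV_period[OF assms, of 1]) auto
  obtain K where K: "K > 0" "\<And>t. t \<in> {0..l} \<Longrightarrow> norm (v t) \<le> K"
    using compact_imp_bounded[OF compact_continuous_image[OF AP_UNIV_continuous[OF assms] compact_Icc[of 0 l]]]
    by (auto simp: bounded_pos)
  have "norm (v t) \<le> K + 1" for t
  proof -
    obtain \<tau> where \<tau>: "\<tau> \<in> {-t..-t + l}" "norm (v t - v (t + \<tau>)) \<le> 1" using l(2) by blast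
    have "norm (v (t + \<tau>)) \<le> K" using \<tau>(1) by (intro K) auto
    then show ?thesis using \<tau>(2) norm_triangle_sub[of "v t" "v (t + \<tau>)"] by simp
  qed
  then show thesis using K(1) by (intro that[of "K + 1"]) auto
qed

lemma AP_UNIV_uniformly_continuous:
  assumes "v \<in> AP UNIV" "\<epsilon> > 0"
  obtains d where "d > 0" "\<And>s t. \<bar>s - t\<bar> \<le> d \<Longrightarrow> norm (v s - v t) \<le> \<epsilon>"
proof -
  obtain l where l: "l > 0" "\<And>a. \<exists>\<tau>\<in>{a..a + l}. \<forall>t. norm (v t - v (t + \<tau>)) \<le> \<epsilon> / 3"
    by (rule AP_UNIV_period[OF assms(1), of "\<epsilon> / 3"]) (use assms in auto)
  have "uniformly_continuous_on {-1..l + 1} v"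
    by (intro compact_uniformly_continuous AP_UNIV_continuous[OF assms(1)] compact_Icc)
  moreover have "\<epsilon> / 3 > 0" using assms by simp
  ultimately obtain d where d: "d > 0" "\<And>s t. s \<in> {-1..l + 1} \<Longrightarrow> t \<in> {-1..l + 1} \<Longrightarrow> dist s t < d \<Longrightarrow> dist (v s) (v t) < \<epsilon> / 3"
    unfolding uniformly_continuous_on_def by meson
  show thesis
  proof (rule that[of "min (d / 2) 1"])
    fix s t :: real assume st: "\<bar>s - t\<bar> \<le> min (d / 2) 1"
    obtain \<tau> where \<tau>: "\<tau> \<in> {-t..-t + l}" "\<And>t. norm (v t - v (t + \<tau>)) \<le> \<epsilon> / 3" using l(2) by blast
    have "dist (v (s + \<tau>)) (v (t + \<tau>)) < \<epsilon> / 3"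
      using \<tau>(1) st d(1) by (intro d) (auto simp: dist_real_def)
    moreover have "norm (v s - v t) \<le> norm (v s - v (s + \<tau>)) + norm (v (s + \<tau>) - v (t + \<tau>)) + norm (v t - v (t + \<tau>))"
      by norm
    ultimately show "norm (v s - v t) \<le> \<epsilon>"
      using \<tau>(2)[of s] \<tau>(2)[of t] by (simp add: dist_norm)
  qed (use d in auto)
qed

text \<open>Bochner's criterion, first half: an almost period moves any shift into
  \<open>{0..l}\<close>, and uniform continuity rounds it down to a grid of mesh
  \<open>d\<close>.\<close>

lemma AP_UNIV_translates_totally_bounded:
  assumes "v \<in> AP UNIV" "\<epsilon> > 0"
  obtains F where "finite F" "\<And>\<tau>. \<exists>\<sigma>\<in>F. \<forall>t. norm (v (t + \<tau>) - v (t + \<sigma>)) \<le> \<epsilon>"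
proof -
  obtain l where l: "l > 0" "\<And>a. \<exists>\<tau>\<in>{a..a + l}. \<forall>t. norm (v t - v (t + \<tau>)) \<le> \<epsilon> / 2"
    by (rule AP_UNIV_period[OF assms(1), of "\<epsilon> / 2"]) (use assms in auto)
  obtain d where d: "d > 0" "\<And>s t. \<bar>s - t\<bar> \<le> d \<Longrightarrow> norm (v s - v t) \<le> \<epsilon> / 2"
    by (rule AP_UNIV_uniformly_continuous[OF assms(1), of "\<epsilon> / 2"]) (use assms in auto)
  define F where "F = (\<lambda>j::nat. real j * d) ` {..nat \<lfloor>l / d\<rfloor>}"
  show thesis
  proof (rule that[of F])
    show "finite F" by (simp add: F_def)
    fix \<tau>
    obtain p where p: "p \<in> {-\<tau>..-\<tau> + l}" "\<And>t. norm (v t - v (t + p)) \<le> \<epsilon> / 2" using l(2) by blast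
    define s where "s = \<tau> + p"
    have s: "0 \<le> s" "s \<le> l" using p by (auto simp: s_def)
    define j where "j = nat \<lfloor>s / d\<rfloor>"
    have j: "real j * d \<le> s" "s \<le> real j * d + d"
    proof -
      have eq: "real j = of_int \<lfloor>s / d\<rfloor>" using s d by (simp add: j_def)
      have "real j \<le> s / d" "s / d \<le> real j + 1" unfolding eq by linarith+
      then show "real j * d \<le> s" "s \<le> real j * d + d" using d(1) by (auto simp: field_simps)
    qed
    have "real j * d \<in> F"
      unfolding F_def j_def using s d by (intro imageI) (auto intro!: nat_mono floor_mono divide_right_mono)
    moreover have "norm (v (t + \<tau>) - v (t + real j * d)) \<le> \<epsilon>" for t
    proof -
      have "norm (v (t + s) - v (t + real j * d)) \<le> \<epsilon> / 2" using j by (intro d) auto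
      moreover have "norm (v (t + \<tau>) - v (t + s)) \<le> \<epsilon> / 2" using p(2)[of "t + \<tau>"] by (simp add: s_def add.assoc)
      ultimately show ?thesis by norm
    qed
    ultimately show "\<exists>\<sigma>\<in>F. \<forall>t. norm (v (t + \<tau>) - v (t + \<sigma>)) \<le> \<epsilon>" by blast
  qed
qed

text \<open>Bochner's criterion, second half. Total boundedness of the translates survives when
  functions are combined, whereas it is not evident that two functions have relatively dense common
  almost periods; the closure properties below therefore go through translates.\<close>

lemma AP_UNIV_I_totally_bounded:
  assumes "continuous_on UNIV v"
    and tb: "\<And>\<epsilon>. \<epsilon> > 0 \<Longrightarrow> \<exists>F. finite F \<and> (\<forall>\<tau>. \<exists>\<sigma>\<in>F. \<forall>t. norm (v (t + \<tau>) - v (t + \<sigma>)) \<le> \<epsilon>)"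
  shows "v \<in> AP UNIV"
  unfolding AP_UNIV_iff
proof (intro conjI allI impI assms(1))
  fix \<epsilon> :: real assume "\<epsilon> > 0"
  then obtain F where F: "finite F" "\<And>\<tau>. \<exists>\<sigma>\<in>F. \<forall>t. norm (v (t + \<tau>) - v (t + \<sigma>)) \<le> \<epsilon>" using tb by blast
  obtain M where M: "M > 0" "\<And>\<sigma>. \<sigma> \<in> F \<Longrightarrow> \<bar>\<sigma>\<bar> \<le> M"
    using finite_imp_bounded[OF F(1)] by (auto simp: bounded_pos)
  show "\<exists>l>0. \<forall>a. \<exists>\<tau>\<in>{a..a + l}. \<forall>t. norm (v t - v (t + \<tau>)) \<le> \<epsilon>"
  proof (intro exI[of _ "2 * M"] conjI allI)
    fix a
    obtain \<sigma> where \<sigma>: "\<sigma> \<in> F" "\<And>t. norm (v (t + (a + M)) - v (t + \<sigma>)) \<le> \<epsilon>" using F(2) by blast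
    show "\<exists>\<tau>\<in>{a..a + 2 * M}. \<forall>t. norm (v t - v (t + \<tau>)) \<le> \<epsilon>"
    \<comment> \<open>The translate by \<open>a + M\<close> is close to that by some
      \<open>\<sigma>\<close> of the net, so \<open>a + M - \<sigma>\<close> is an almost period; as
      \<open>\<sigma>\<close> has modulus at most \<open>M\<close>, it lies in the window of length
      \<open>2 * M\<close>.\<close>
    proof (intro bexI[of _ "a + M - \<sigma>"] allI)
      show "norm (v t - v (t + (a + M - \<sigma>))) \<le> \<epsilon>" for t
        using \<sigma>(2)[of "t - \<sigma>"] by (simp add: norm_minus_commute algebra_simps)
    qed (use M(2)[OF \<sigma>(1)] in \<open>auto simp: abs_le_iff\<close>)
  qed (use M in auto)
qed

section \<open>Closure properties of almost periodic functions\<close>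

text \<open>A shift is classified by the pair of net points assigned to it. Such a pair is not
  itself a shift, so one shift is picked in every nonempty class; two shifts of one class move
  \<open>u\<close> alike and \<open>v\<close> alike up to \<open>\<delta>\<close>, and there are
  finitely many classes.\<close>

lemma AP_UNIV_combine:
  fixes h :: "real \<Rightarrow> 'c::real_normed_vector"
  assumes u: "u \<in> AP UNIV" and v: "v \<in> AP UNIV" and h: "continuous_on UNIV h"
    and dom: "\<And>\<epsilon>. \<epsilon> > 0 \<Longrightarrow> \<exists>\<delta>>0. \<forall>\<tau> \<sigma>. (\<forall>t. norm (u (t + \<tau>) - u (t + \<sigma>)) \<le> \<delta>) \<longrightarrow>
      (\<forall>t. norm (v (t + \<tau>) - v (t + \<sigma>)) \<le> \<delta>) \<longrightarrow> (\<forall>t. norm (h (t + \<tau>) - h (t + \<sigma>)) \<le> \<epsilon>)"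
  shows "h \<in> AP UNIV"
proof (rule AP_UNIV_I_totally_bounded[OF h])
  fix \<epsilon> :: real assume "\<epsilon> > 0"
  then obtain \<delta> where \<delta>: "\<delta> > 0" "\<And>\<tau> \<sigma> t. (\<And>t. norm (u (t + \<tau>) - u (t + \<sigma>)) \<le> \<delta>) \<Longrightarrow>
      (\<And>t. norm (v (t + \<tau>) - v (t + \<sigma>)) \<le> \<delta>) \<Longrightarrow> norm (h (t + \<tau>) - h (t + \<sigma>)) \<le> \<epsilon>"
    using dom by meson
  obtain F where F: "finite F" "\<And>\<tau>. \<exists>\<sigma>\<in>F. \<forall>t. norm (u (t + \<tau>) - u (t + \<sigma>)) \<le> \<delta> / 2"
    by (rule AP_UNIV_translates_totally_bounded[OF u, of "\<delta> / 2"]) (use \<delta> in auto)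
  obtain G where G: "finite G" "\<And>\<tau>. \<exists>\<sigma>\<in>G. \<forall>t. norm (v (t + \<tau>) - v (t + \<sigma>)) \<le> \<delta> / 2"
    by (rule AP_UNIV_translates_totally_bounded[OF v, of "\<delta> / 2"]) (use \<delta> in auto)
  from F(2) obtain cu where cu: "\<And>\<tau>. cu \<tau> \<in> F" "\<And>\<tau> t. norm (u (t + \<tau>) - u (t + cu \<tau>)) \<le> \<delta> / 2" by metis
  from G(2) obtain cv where cv: "\<And>\<tau>. cv \<tau> \<in> G" "\<And>\<tau> t. norm (v (t + \<tau>) - v (t + cv \<tau>)) \<le> \<delta> / 2" by metis
  define c where "c = (\<lambda>\<tau>. (cu \<tau>, cv \<tau>))"
  define r where "r = (\<lambda>p. SOME \<tau>. c \<tau> = p)"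
  have r: "c (r (c \<tau>)) = c \<tau>" for \<tau> unfolding r_def by (rule someI[of _ \<tau>]) simp
  have fin: "finite (r ` (F \<times> G))" using F(1) G(1) by simp
  have "\<exists>\<sigma>\<in>r ` (F \<times> G). \<forall>t. norm (h (t + \<tau>) - h (t + \<sigma>)) \<le> \<epsilon>" for \<tau>
  proof (intro bexI[of _ "r (c \<tau>)"] allI)
    have eq: "cu (r (c \<tau>)) = cu \<tau>" "cv (r (c \<tau>)) = cv \<tau>" using r[of \<tau>] by (auto simp: c_def)
    show "norm (h (t + \<tau>) - h (t + r (c \<tau>))) \<le> \<epsilon>" for t
    proof (rule \<delta>(2))
      show "norm (u (t + \<tau>) - u (t + r (c \<tau>))) \<le> \<delta>" for t
        using cu(2)[of t \<tau>] cu(2)[of t "r (c \<tau>)"] unfolding eq by norm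
      show "norm (v (t + \<tau>) - v (t + r (c \<tau>))) \<le> \<delta>" for t
        using cv(2)[of t \<tau>] cv(2)[of t "r (c \<tau>)"] unfolding eq by norm
    qed
    show "r (c \<tau>) \<in> r ` (F \<times> G)" using cu(1) cv(1) by (auto simp: c_def)
  qed
  then show "\<exists>F. finite F \<and> (\<forall>\<tau>. \<exists>\<sigma>\<in>F. \<forall>t. norm (h (t + \<tau>) - h (t + \<sigma>)) \<le> \<epsilon>)" using fin by blast
qed

lemma AP_UNIV_dominated:
  fixes h :: "real \<Rightarrow> 'c::real_normed_vector"
  assumes u: "u \<in> AP UNIV" and h: "continuous_on UNIV h"
    and dom: "\<And>\<epsilon> \<tau> \<sigma> t. (\<And>t. norm (u (t + \<tau>) - u (t + \<sigma>)) \<le> \<epsilon>) \<Longrightarrow> norm (h (t + \<tau>) - h (t + \<sigma>)) \<le> K * \<epsilon>"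
    and K: "K > 0"
  shows "h \<in> AP UNIV"
proof (rule AP_UNIV_combine[OF u u h])
  fix \<epsilon> :: real assume "\<epsilon> > 0"
  then show "\<exists>\<delta>>0. \<forall>\<tau> \<sigma>. (\<forall>t. norm (u (t + \<tau>) - u (t + \<sigma>)) \<le> \<delta>) \<longrightarrow>
      (\<forall>t. norm (u (t + \<tau>) - u (t + \<sigma>)) \<le> \<delta>) \<longrightarrow> (\<forall>t. norm (h (t + \<tau>) - h (t + \<sigma>)) \<le> \<epsilon>)"
    using dom[of _ _ "\<epsilon> / K"] K by (intro exI[of _ "\<epsilon> / K"]) auto
qed

lemma AP_UNIV_const: "(\<lambda>_. c) \<in> AP UNIV"
  unfolding AP_UNIV_iff
proof (intro conjI allI impI exI[of _ 1])
  fix \<epsilon> a :: real assume "\<epsilon> > 0"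
  then show "\<exists>\<tau>\<in>{a..a + 1}. \<forall>t::real. norm (c - c) \<le> \<epsilon>" by (intro bexI[of _ a]) auto
qed auto

lemma AP_UNIV_Pair:
  assumes u: "u \<in> AP UNIV" and v: "v \<in> AP UNIV"
  shows "(\<lambda>t. (u t, v t)) \<in> AP UNIV"
proof (rule AP_UNIV_combine[OF u v])
  show "continuous_on UNIV (\<lambda>t. (u t, v t))"
    by (intro continuous_intros AP_UNIV_continuous u v)
  fix \<epsilon> :: real assume e: "\<epsilon> > 0"
  have "norm ((u (t + \<tau>), v (t + \<tau>)) - (u (t + \<sigma>), v (t + \<sigma>))) \<le> \<epsilon>"
    if "\<forall>t. norm (u (t + \<tau>) - u (t + \<sigma>)) \<le> \<epsilon> / 2" "\<forall>t. norm (v (t + \<tau>) - v (t + \<sigma>)) \<le> \<epsilon> / 2" for \<tau> \<sigma> t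
    using norm_Pair_le[of "u (t + \<tau>) - u (t + \<sigma>)" "v (t + \<tau>) - v (t + \<sigma>)"] that[THEN spec, of t] by simp
  then show "\<exists>\<delta>>0. \<forall>\<tau> \<sigma>. (\<forall>t. norm (u (t + \<tau>) - u (t + \<sigma>)) \<le> \<delta>) \<longrightarrow>
      (\<forall>t. norm (v (t + \<tau>) - v (t + \<sigma>)) \<le> \<delta>) \<longrightarrow> (\<forall>t. norm ((u (t + \<tau>), v (t + \<tau>)) - (u (t + \<sigma>), v (t + \<sigma>))) \<le> \<epsilon>)"
    using e by (intro exI[of _ "\<epsilon> / 2"]) auto
qed

lemma AP_UNIV_bounded_linear:
  assumes "bounded_linear L" "u \<in> AP UNIV"
  shows "(\<lambda>t. L (u t)) \<in> AP UNIV"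
proof -
  interpret bounded_linear L by fact
  obtain K where K: "K > 0" "\<And>x. norm (L x) \<le> norm x * K" using pos_bounded by blast
  show ?thesis
  proof (rule AP_UNIV_dominated[OF assms(2) _ _ K(1)])
    show "continuous_on UNIV (\<lambda>t. L (u t))" by (intro continuous_on AP_UNIV_continuous assms)
    fix \<epsilon> \<tau> \<sigma> t assume *: "\<And>t. norm (u (t + \<tau>) - u (t + \<sigma>)) \<le> \<epsilon>"
    show "norm (L (u (t + \<tau>)) - L (u (t + \<sigma>))) \<le> K * \<epsilon>"
      unfolding diff[symmetric]
      by (rule order_trans[OF K(2)]) (use *[of t] K(1) in \<open>simp add: mult.commute mult_left_mono\<close>)
  qed
qed

lemma AP_UNIV_add:
  assumes "u \<in> AP UNIV" "v \<in> AP UNIV"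
  shows "(\<lambda>t. u t + v t) \<in> AP UNIV"
  using AP_UNIV_bounded_linear[OF bounded_linear_add[OF bounded_linear_fst bounded_linear_snd] AP_UNIV_Pair[OF assms]]
  by simp

lemma AP_UNIV_diff:
  assumes "u \<in> AP UNIV" "v \<in> AP UNIV"
  shows "(\<lambda>t. u t - v t) \<in> AP UNIV"
  using AP_UNIV_bounded_linear[OF bounded_linear_sub[OF bounded_linear_fst bounded_linear_snd] AP_UNIV_Pair[OF assms]]
  by simp

lemma AP_UNIV_bilinear:
  assumes "bounded_bilinear h" and u: "u \<in> AP UNIV" and v: "v \<in> AP UNIV"
  shows "(\<lambda>t. h (u t) (v t)) \<in> AP UNIV"
proof -
  interpret bounded_bilinear h by fact
  obtain K where K: "K > 0" "\<And>x y. norm (h x y) \<le> norm x * norm y * K" using pos_bounded by blast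
  obtain Ku where Ku: "Ku > 0" "\<And>t. norm (u t) \<le> Ku" using AP_UNIV_bounded[OF u] by blast
  obtain Kv where Kv: "Kv > 0" "\<And>t. norm (v t) \<le> Kv" using AP_UNIV_bounded[OF v] by blast
  show ?thesis
  proof (rule AP_UNIV_dominated[OF AP_UNIV_Pair[OF u v], where K="(Ku + Kv) * K"])
    show "continuous_on UNIV (\<lambda>t. h (u t) (v t))" by (intro continuous_on AP_UNIV_continuous u v)
    fix \<epsilon> \<tau> \<sigma> t assume *: "\<And>t. norm ((u (t + \<tau>), v (t + \<tau>)) - (u (t + \<sigma>), v (t + \<sigma>))) \<le> \<epsilon>"
    define du where "du = u (t + \<tau>) - u (t + \<sigma>)"
    define dv where "dv = v (t + \<tau>) - v (t + \<sigma>)"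
    have d: "norm du \<le> \<epsilon>" "norm dv \<le> \<epsilon>"
      using *[of t] norm_fst_le[of du dv] norm_snd_le[of dv du] by (auto simp: du_def dv_def)
    have e0: "\<epsilon> \<ge> 0" using d(1) norm_ge_zero[of du] by linarith
    have "h (u (t + \<tau>)) (v (t + \<tau>)) - h (u (t + \<sigma>)) (v (t + \<sigma>)) = h du (v (t + \<tau>)) + h (u (t + \<sigma>)) dv"
      by (simp add: du_def dv_def diff_left diff_right)
    also have "norm \<dots> \<le> norm du * norm (v (t + \<tau>)) * K + norm (u (t + \<sigma>)) * norm dv * K"
      by (intro norm_triangle_le add_mono K)
    also have "\<dots> \<le> \<epsilon> * Kv * K + Ku * \<epsilon> * K"
      using K(1) Ku Kv d e0 by (intro add_mono mult_right_mono mult_mono) (auto intro: less_imp_le)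
    also have "\<dots> = (Ku + Kv) * K * \<epsilon>" by (simp add: algebra_simps)
    finally show "norm (h (u (t + \<tau>)) (v (t + \<tau>)) - h (u (t + \<sigma>)) (v (t + \<sigma>))) \<le> (Ku + Kv) * K * \<epsilon>" .
  qed (use K Ku Kv in auto)
qed

lemma AP_UNIV_translate:
  assumes "u \<in> AP UNIV"
  shows "(\<lambda>t. u (t + s)) \<in> AP UNIV"
proof (rule AP_UNIV_dominated[OF assms, where K=1])
  show "continuous_on UNIV (\<lambda>t. u (t + s))"
    by (rule continuous_on_compose2[OF AP_UNIV_continuous[OF assms, of UNIV]]) (auto intro!: continuous_intros)
  fix \<epsilon> \<tau> \<sigma> t assume "\<And>t. norm (u (t + \<tau>) - u (t + \<sigma>)) \<le> \<epsilon>"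
  from this[of "t + s"] show "norm (u (t + \<tau> + s) - u (t + \<sigma> + s)) \<le> 1 * \<epsilon>" by (simp add: add_ac)
qed simp

lemma AP_UNIV_periodic:
  assumes "continuous_on UNIV u" "p > 0" "\<And>t. u (t + p) = u t"
  shows "u \<in> AP UNIV"
proof -
  have n: "u (t + real n * p) = u t" for n t
    by (induction n) (use assms(3) in \<open>auto simp: algebra_simps, metis add.assoc add.commute\<close>)
  have z: "u (t + of_int k * p) = u t" for k t
    using n[of t "nat k"] n[of "t + of_int k * p" "nat (- k)"] by (cases "k \<ge> 0") auto
  show ?thesis unfolding AP_UNIV_iff
  proof (intro conjI allI impI assms(1))
    fix \<epsilon> :: real assume e: "\<epsilon> > 0"
    show "\<exists>l>0. \<forall>a. \<exists>\<tau>\<in>{a..a + l}. \<forall>t. norm (u t - u (t + \<tau>)) \<le> \<epsilon>"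
    proof (intro exI[of _ p] conjI allI assms(2))
      fix a
      define k where "k = \<lceil>a / p\<rceil>"
      have "a / p \<le> k" "k \<le> a / p + 1" unfolding k_def by linarith+
      then have "of_int k * p \<in> {a..a + p}" using assms(2) by (auto simp: field_simps)
      then show "\<exists>\<tau>\<in>{a..a + p}. \<forall>t. norm (u t - u (t + \<tau>)) \<le> \<epsilon>"
        using z[of _ k] e by (intro bexI[of _ "of_int k * p"]) auto
    qed
  qed
qed

lemma AP_UNIV_cos: "(\<lambda>t. cos (\<omega> * t)) \<in> AP UNIV" and AP_UNIV_sin: "(\<lambda>t. sin (\<omega> * t)) \<in> AP UNIV"
proof -
  have "(\<lambda>t. cos (\<omega> * t)) \<in> AP UNIV \<and> (\<lambda>t. sin (\<omega> * t)) \<in> AP UNIV"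
  proof (cases "\<omega> = 0")
    case True
    then show ?thesis by (simp add: AP_UNIV_const)
  next
    case False
    have "\<omega> * (t + 2 * pi / \<bar>\<omega>\<bar>) = \<omega> * t + 2 * pi \<or> \<omega> * (t + 2 * pi / \<bar>\<omega>\<bar>) = \<omega> * t - 2 * pi" for t
      using False by (cases "\<omega> > 0") (auto simp: field_simps)
    then have "cos (\<omega> * (t + 2 * pi / \<bar>\<omega>\<bar>)) = cos (\<omega> * t)" "sin (\<omega> * (t + 2 * pi / \<bar>\<omega>\<bar>)) = sin (\<omega> * t)" for t
      using cos_periodic[of "\<omega> * t"] cos_periodic[of "\<omega> * t - 2 * pi"] sin_periodic[of "\<omega> * t"] sin_periodic[of "\<omega> * t - 2 * pi"]
      by (metis diff_add_cancel)+
    then show ?thesis using False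
      by (auto intro!: AP_UNIV_periodic[of _ "2 * pi / \<bar>\<omega>\<bar>"] continuous_intros)
  qed
  then show "(\<lambda>t. cos (\<omega> * t)) \<in> AP UNIV" "(\<lambda>t. sin (\<omega> * t)) \<in> AP UNIV" by auto
qed

text \<open>An almost period of the difference carries any given \<open>t\<close> into the region
  where the difference is already small.\<close>

lemma AP_UNIV_eqI:
  assumes u: "u \<in> AP UNIV" and v: "v \<in> AP UNIV" and lim: "((\<lambda>t. u t - v t) \<longlongrightarrow> 0) at_top"
  shows "u = v"
proof
  fix t
  define d where "d = (\<lambda>t. u t - v t)"
  have d: "d \<in> AP UNIV" unfolding d_def by (rule AP_UNIV_diff[OF u v])
  have "norm (d t) \<le> 2 * \<epsilon>" if e: "\<epsilon> > 0" for \<epsilon>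
  proof -
    have "\<forall>\<^sub>F t in at_top. norm (d t) < \<epsilon>"
      using lim e unfolding d_def tendsto_iff by (simp add: dist_norm)
    then obtain b where b: "\<And>t. t \<ge> b \<Longrightarrow> norm (d t) < \<epsilon>" by (auto simp: eventually_at_top_linorder)
    obtain l where l: "\<And>a. \<exists>\<tau>\<in>{a..a + l}. \<forall>t. norm (d t - d (t + \<tau>)) \<le> \<epsilon>" using AP_UNIV_period[OF d e] by blast
    obtain \<tau> where \<tau>: "\<tau> \<in> {b - t..b - t + l}" "norm (d t - d (t + \<tau>)) \<le> \<epsilon>" using l by blast
    have "norm (d (t + \<tau>)) < \<epsilon>" using \<tau>(1) by (intro b) auto
    then show ?thesis using \<tau>(2) norm_triangle_sub[of "d t" "d (t + \<tau>)"] by simp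
  qed
  from this[of "norm (d t) / 4"] have "d t = 0" by (cases "d t = 0") auto
  then show "u t = v t" by (simp add: d_def)
qed

lemma AP_UNIV_restrict:
  assumes "u \<in> AP UNIV"
  shows "u \<in> AP {0..}"
  unfolding AP_def relatively_dense_def
proof (intro CollectI conjI allI impI)
  show "continuous_on {0..} u" by (rule AP_UNIV_continuous[OF assms])
  fix \<epsilon> :: real assume "\<epsilon> > 0"
  then obtain l where l: "l > 0" "\<And>a. \<exists>\<tau>\<in>{a..a + l}. \<forall>t. norm (u t - u (t + \<tau>)) \<le> \<epsilon>"
    using AP_UNIV_period[OF assms] by blast
  show "\<exists>l>0. \<forall>a\<in>{0..}. {a..a + l} \<inter> almost_periods {0..} u \<epsilon> \<noteq> {}"
  proof (intro exI[of _ l] conjI ballI l(1))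
    fix a :: real assume "a \<in> {0..}"
    moreover obtain \<tau> where "\<tau> \<in> {a..a + l}" "\<forall>t. norm (u t - u (t + \<tau>)) \<le> \<epsilon>" using l(2) by blast
    ultimately have "\<tau> \<in> {a..a + l} \<inter> almost_periods {0..} u \<epsilon>" by (auto simp: almost_periods_def)
    then show "{a..a + l} \<inter> almost_periods {0..} u \<epsilon> \<noteq> {}" by blast
  qed
qed (auto simp: almost_periods_def)

section \<open>Mean values of almost periodic functions\<close>

definition has_mean :: "(real \<Rightarrow> 'a::real_normed_vector) \<Rightarrow> 'a \<Rightarrow> bool"
  where "has_mean v m \<longleftrightarrow> ((\<lambda>T. (1 / (2 * T)) *\<^sub>R integral {-T..T} v) \<longlongrightarrow> m) at_top"

text \<open>Uniformity in the position \<open>a\<close> of the window makes means invariant under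
  translation and lets long windows be cut into blocks; \<open>has_mean\<close>, with windows
  symmetric about 0, is the form that occurs in \<open>fourier_coeff\<close>.\<close>

definition uniform_mean :: "(real \<Rightarrow> 'a::real_normed_vector) \<Rightarrow> 'a \<Rightarrow> bool"
  where "uniform_mean v m \<longleftrightarrow> (\<forall>\<epsilon>>0. \<exists>T0>0. \<forall>T\<ge>T0. \<forall>a. norm ((1 / T) *\<^sub>R integral {a..a + T} v - m) \<le> \<epsilon>)"

lemma uniform_mean_has_mean:
  assumes "uniform_mean v m"
  shows "has_mean v m"
  unfolding has_mean_def
proof (rule tendstoI)
  fix e :: real assume "e > 0"
  then have "e / 2 > 0" by simp
  then obtain T0 where T0: "T0 > 0" "\<And>T a. T \<ge> T0 \<Longrightarrow> norm ((1 / T) *\<^sub>R integral {a..a + T} v - m) \<le> e / 2"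
    using assms unfolding uniform_mean_def by meson
  have "dist ((1 / (2 * T)) *\<^sub>R integral {-T..T} v) m < e" if "T \<ge> T0" for T
    using T0(2)[of "2 * T" "- T"] that T0(1) \<open>e > 0\<close> by (simp add: dist_norm)
  then show "\<forall>\<^sub>F T in at_top. dist ((1 / (2 * T)) *\<^sub>R integral {-T..T} v) m < e"
    unfolding eventually_at_top_linorder by blast
qed

lemma has_mean_unique: "has_mean v m \<Longrightarrow> has_mean v m' \<Longrightarrow> m = m'"
  unfolding has_mean_def by (rule tendsto_unique) auto

lemma continuous_primitive_exists:
  fixes v :: "real \<Rightarrow> 'a::banach"
  assumes "continuous_on UNIV v"
  obtains G where "\<And>s t. s \<le> t \<Longrightarrow> integral {s..t} v = G t - G s"
proof -
  have i: "v integrable_on {a..b}" for a b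
    by (intro integrable_continuous_real continuous_on_subset[OF assms]) auto
  define G where "G = (\<lambda>t. if 0 \<le> t then integral {0..t} v else - integral {t..0} v)"
  show thesis
  proof (rule that[of G])
    fix s t :: real assume st: "s \<le> t"
    have c: "integral {x..y} v + integral {y..z} v = integral {x..z} v" if "x \<le> y" "y \<le> z" for x y z
      by (rule Henstock_Kurzweil_Integration.integral_combine[OF that i])
    consider "0 \<le> s" | "s < 0" "0 \<le> t" | "t < 0" by linarith
    then show "integral {s..t} v = G t - G s"
    proof cases
      case 1 then show ?thesis using c[of 0 s t] st by (simp add: G_def algebra_simps)
    next
      case 2 then show ?thesis using c[of s 0 t] by (simp add: G_def algebra_simps)
    next
      case 3 then show ?thesis using c[of s t 0] st by (simp add: G_def algebra_simps)
    qed
  qed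
qed

text \<open>Shifting a window by an almost period changes its average little, and the mismatch at
  its two ends costs at most \<open>2 * K * l\<close>, so averages over long windows hardly depend
  on the position. A still longer window is an average of such windows up to a leftover, which makes
  the averages Cauchy in the length.\<close>

lemma AP_UNIV_uniform_mean_exists:
  fixes v :: "real \<Rightarrow> 'a::banach"
  assumes v: "v \<in> AP UNIV"
  obtains m where "uniform_mean v m"
proof -
  obtain K where K: "K > 0" "\<And>t. norm (v t) \<le> K" using AP_UNIV_bounded[OF v] by blast
  have i: "v integrable_on {a..b}" for a b
    by (intro integrable_continuous_real AP_UNIV_continuous v)
  obtain G where G: "\<And>s t. s \<le> t \<Longrightarrow> integral {s..t} v = G t - G s"
    using continuous_primitive_exists[OF AP_UNIV_continuous[OF v]] by blast
  have GK': "norm (G t - G s) \<le> K * (t - s)" if "s \<le> t" for s t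
    using integrable_bound[of K v s t] K i[of s t] that unfolding G[OF that, symmetric] by simp
  have GK: "norm (G t - G s) \<le> K * \<bar>t - s\<bar>" for s t
    using GK'[of s t] GK'[of t s] by (cases "s \<le> t") (auto simp: norm_minus_commute)
  define Av where "Av = (\<lambda>T a. (1 / T) *\<^sub>R (G (a + T) - G a))"
  have Av: "Av T a = (1 / T) *\<^sub>R integral {a..a + T} v" if "T > 0" for T a
    using G[of a "a + T"] that by (simp add: Av_def)
  have AvK: "norm (Av T a) \<le> K" if "T > 0" for T a
    using GK[of "a + T" a] that by (simp add: Av_def pos_divide_le_eq)
  have step1: "\<exists>T0>0. \<forall>T\<ge>T0. \<forall>a b. norm (Av T a - Av T b) \<le> \<epsilon>" if e: "\<epsilon> > 0" for \<epsilon>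
  proof -
    obtain l where l: "l > 0" "\<And>a. \<exists>\<tau>\<in>{a..a + l}. \<forall>t. norm (v t - v (t + \<tau>)) \<le> \<epsilon> / 2"
      by (rule AP_UNIV_period[OF v, of "\<epsilon> / 2"]) (use e in auto)
    \<comment> \<open>For \<open>T\<close> from this length on the boundary cost
      \<open>2 * K * l\<close> is at most half of \<open>\<epsilon> * T\<close>.\<close>
    define T0 where "T0 = 4 * K * l / \<epsilon>"
    have T0: "T0 > 0" using K l e by (simp add: T0_def)
    have "norm (Av T a - Av T b) \<le> \<epsilon>" if T: "T \<ge> T0" for T a b
    proof -
      have "T > 0" using T T0 by linarith
      moreover have "4 * K * l \<le> \<epsilon> * T" using T e by (auto simp: T0_def field_simps)
      ultimately have T': "T > 0" "4 * K * l \<le> \<epsilon> * T" by auto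
      obtain \<tau> where \<tau>: "\<tau> \<in> {b - a..b - a + l}" "\<And>t. norm (v t - v (t + \<tau>)) \<le> \<epsilon> / 2" using l(2) by blast
      have "integral {a..a + T} (\<lambda>t. v (t + \<tau>)) = integral {a + \<tau>..a + T + \<tau>} v"
        using integral_shift_real_ivl[of "a + \<tau>" \<tau> "a + T + \<tau>" v] by simp
      then have "(G (a + T) - G a) - (G (a + T + \<tau>) - G (a + \<tau>)) = integral {a..a + T} v - integral {a..a + T} (\<lambda>t. v (t + \<tau>))"
        using T' by (simp add: G)
      also have "\<dots> = integral {a..a + T} (\<lambda>t. v t - v (t + \<tau>))"
        by (rule integral_diff[symmetric])
           (auto intro!: i integrable_continuous_real AP_UNIV_continuous AP_UNIV_translate v)
      also have "norm \<dots> \<le> \<epsilon> / 2 * (a + T - a)"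
        by (rule integral_bound) (use T' \<tau>(2) in \<open>auto intro!: AP_UNIV_continuous AP_UNIV_diff AP_UNIV_translate v\<close>)
      finally have 1: "norm ((G (a + T) - G a) - (G (a + T + \<tau>) - G (a + \<tau>))) \<le> \<epsilon> / 2 * T" by simp
      have 2: "norm (G (a + T + \<tau>) - G (b + T)) \<le> K * l" "norm (G (a + \<tau>) - G b) \<le> K * l"
        using order_trans[OF GK mult_left_mono[of "\<bar>a + T + \<tau> - (b + T)\<bar>" l K]]
          order_trans[OF GK mult_left_mono[of "\<bar>a + \<tau> - b\<bar>" l K]] \<tau>(1) K by auto
      have "norm ((G (a + T) - G a) - (G (b + T) - G b)) \<le> \<epsilon> / 2 * T + 2 * (K * l)"
      proof -
        have "norm ((p - q) - (r - s)) \<le> c + 2 * e" if "norm ((p - q) - (p' - q')) \<le> c" "norm (p' - r) \<le> e" "norm (q' - s) \<le> e"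
          for p q r s p' q' :: 'a and c e :: real using that by norm
        from this[OF 1 2] show ?thesis .
      qed
      also have "\<dots> \<le> \<epsilon> * T" using T' by simp
      finally have "(1 / T) * norm ((G (a + T) - G a) - (G (b + T) - G b)) \<le> (1 / T) * (\<epsilon> * T)"
        using T' by (intro mult_left_mono) auto
      then show ?thesis using T' by (simp add: Av_def scaleR_diff_right[symmetric])
    qed
    then show ?thesis using T0 by blast
  qed
  have step2: "norm (Av (real n * T) a - Av T a) \<le> \<epsilon>"
    if T: "T > 0" and n: "n > 0" and e: "\<And>a b. norm (Av T a - Av T b) \<le> \<epsilon>" for n T a \<epsilon>
  proof -
    have "(\<Sum>k<n. G (a + real k * T + T) - G (a + real k * T)) = G (a + real n * T) - G a"
      by (induction n) (simp_all add: algebra_simps)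
    then have S: "(\<Sum>k<n. Av T (a + real k * T)) = (1 / T) *\<^sub>R (G (a + real n * T) - G a)"
      by (simp only: Av_def scaleR_sum_right[symmetric])
    have "real n *\<^sub>R (Av (real n * T) a - Av T a) = (1 / T) *\<^sub>R (G (a + real n * T) - G a) - real n *\<^sub>R Av T a"
      using n T by (simp add: Av_def scaleR_diff_right)
    also have "\<dots> = (\<Sum>k<n. Av T (a + real k * T) - Av T a)"
      by (simp only: sum_subtractf S sum_constant_scaleR card_lessThan)
    also have "norm \<dots> \<le> (\<Sum>k<n. \<epsilon>)"
      by (intro order_trans[OF norm_sum] sum_mono e)
    finally show ?thesis using n by simp
  qed
  \<comment> \<open>\<open>S\<close> exceeds a multiple of \<open>T\<close> by at most
    \<open>T\<close>. The leftover and the change of the normalising factor cost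
    \<open>K * T\<close> each, together at most \<open>\<epsilon> * S\<close> for these
    \<open>S\<close>; the other \<open>\<epsilon>\<close> comes from \<open>step2\<close>.\<close>
  have step3: "\<exists>S0>0. \<forall>S\<ge>S0. \<forall>a. norm (Av S a - Av T a) \<le> 2 * \<epsilon>"
    if T: "T > 0" and e0: "\<epsilon> > 0" and e: "\<And>a b. norm (Av T a - Av T b) \<le> \<epsilon>" for T \<epsilon>
  proof (intro exI[of _ "T + 2 * T * K / \<epsilon>"] conjI allI impI)
    show "T + 2 * T * K / \<epsilon> > 0" using T e0 K by (simp add: add_pos_pos)
    fix S a assume S: "S \<ge> T + 2 * T * K / \<epsilon>"
    have ST: "S \<ge> T" "2 * T * K \<le> \<epsilon> * S"
    proof -
      have "2 * T * K / \<epsilon> \<ge> 0" using T e0 K by simp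
      then show "S \<ge> T" using S by simp
      have "2 * T * K / \<epsilon> \<le> S" using S T by linarith
      then show "2 * T * K \<le> \<epsilon> * S" using e0 by (simp add: field_simps)
    qed
    define n where "n = nat \<lfloor>S / T\<rfloor>"
    have eqn: "real n = of_int \<lfloor>S / T\<rfloor>" using ST T by (simp add: n_def)
    have "1 \<le> \<lfloor>S / T\<rfloor>" using ST T by (simp add: le_floor_iff)
    then have n: "n > 0" by (simp add: n_def)
    have "real n \<le> S / T" "S / T \<le> real n + 1" unfolding eqn by linarith+
    then have nT: "real n * T \<le> S" "S \<le> real n * T + T" using T by (auto simp: field_simps)
    have pos: "real n * T > 0" "S > 0" using n T ST by auto
    have "S *\<^sub>R (Av S a - Av (real n * T) a) = (G (a + S) - G (a + real n * T)) - (S - real n * T) *\<^sub>R Av (real n * T) a"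
    proof -
      define N where "N = real n * T"
      have "S *\<^sub>R Av S a = G (a + S) - G a" "N *\<^sub>R Av N a = G (a + N) - G a"
        using pos by (simp_all add: Av_def N_def)
      then show ?thesis unfolding N_def[symmetric]
        by (simp add: scaleR_diff_right scaleR_diff_left)
    qed
    also have "norm \<dots> \<le> K * T + T * K"
    proof (rule order_trans[OF norm_triangle_ineq4 add_mono])
      show "norm (G (a + S) - G (a + real n * T)) \<le> K * T"
        using order_trans[OF GK mult_left_mono[of "\<bar>a + S - (a + real n * T)\<bar>" T K]] nT K by auto
      show "norm ((S - real n * T) *\<^sub>R Av (real n * T) a) \<le> T * K"
        using AvK[OF pos(1), of a] nT K T by (auto intro!: mult_mono)
    qed
    also have "\<dots> \<le> \<epsilon> * S" using ST by (simp add: mult_ac)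
    finally have "norm (Av S a - Av (real n * T) a) \<le> \<epsilon>" using pos by simp
    moreover have "norm (Av (real n * T) a - Av T a) \<le> \<epsilon>" by (rule step2[OF T n e])
    ultimately show "norm (Av S a - Av T a) \<le> 2 * \<epsilon>" by norm
  qed
  have cau: "\<exists>S0>0. \<forall>S\<ge>S0. \<forall>S'\<ge>S0. \<forall>a b. norm (Av S a - Av S' b) \<le> \<epsilon>" if "\<epsilon> > 0" for \<epsilon>
  proof -
    \<comment> \<open>Two passages from a long window to \<open>T\<close> cost two fifths each, one
      change of position costs one fifth.\<close>
    have e5: "\<epsilon> / 5 > 0" using that by simp
    obtain T where T: "T > 0" "\<And>a b. norm (Av T a - Av T b) \<le> \<epsilon> / 5"
      using step1[OF e5] by blast
    obtain S0 where S0: "S0 > 0" "\<And>S a. S \<ge> S0 \<Longrightarrow> norm (Av S a - Av T a) \<le> 2 * (\<epsilon> / 5)"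
      using step3[OF T(1) e5 T(2)] by blast
    have "norm (Av S a - Av S' b) \<le> \<epsilon>" if "S \<ge> S0" "S' \<ge> S0" for S S' a b
      using S0(2)[OF that(1), of a] S0(2)[OF that(2), of b] T(2)[of a b] by norm
    then show ?thesis using S0(1) by blast
  qed
  have "Cauchy (\<lambda>n. Av (real n) 0)"
  proof (rule CauchyI)
    fix e :: real assume e: "e > 0"
    then obtain S0 where S0: "\<And>S S' a b. S \<ge> S0 \<Longrightarrow> S' \<ge> S0 \<Longrightarrow> norm (Av S a - Av S' b) \<le> e / 2"
      using cau[of "e / 2"] half_gt_zero by meson
    have "norm (Av (real m) 0 - Av (real n) 0) < e" if "m \<ge> nat \<lceil>S0\<rceil>" "n \<ge> nat \<lceil>S0\<rceil>" for m n
    proof -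
      have "real m \<ge> S0" "real n \<ge> S0" using that by (auto simp: nat_le_iff ceiling_le_iff)
      from S0[OF this, of 0 0] show ?thesis using e by simp
    qed
    then show "\<exists>M. \<forall>m\<ge>M. \<forall>n\<ge>M. norm (Av (real m) 0 - Av (real n) 0) < e" by blast
  qed
  then obtain m where m: "(\<lambda>n. Av (real n) 0) \<longlonglongrightarrow> m" using Cauchy_convergent convergent_def by blast
  show thesis
  proof (rule that, unfold uniform_mean_def, intro allI impI)
    fix \<epsilon> :: real assume "\<epsilon> > 0"
    then obtain S0 where S0: "S0 > 0" "\<And>S S' a b. S \<ge> S0 \<Longrightarrow> S' \<ge> S0 \<Longrightarrow> norm (Av S a - Av S' b) \<le> \<epsilon>"
      using cau[of \<epsilon>] by meson
    have "norm (Av T a - m) \<le> \<epsilon>" if "T \<ge> S0" for T a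
    proof (rule tendsto_upperbound)
      show "(\<lambda>n. norm (Av T a - Av (real n) 0)) \<longlonglongrightarrow> norm (Av T a - m)"
        by (intro tendsto_intros m)
      show "\<forall>\<^sub>F n in sequentially. norm (Av T a - Av (real n) 0) \<le> \<epsilon>"
        unfolding eventually_sequentially
      proof (intro exI[of _ "nat \<lceil>S0\<rceil>"] allI impI)
        fix n assume "nat \<lceil>S0\<rceil> \<le> n"
        then have "real n \<ge> S0" by (auto simp: nat_le_iff ceiling_le_iff)
        then show "norm (Av T a - Av (real n) 0) \<le> \<epsilon>" by (rule S0(2)[OF that])
      qed
    qed simp
    then show "\<exists>T0>0. \<forall>T\<ge>T0. \<forall>a. norm ((1 / T) *\<^sub>R integral {a..a + T} v - m) \<le> \<epsilon>"
      using S0(1) Av by (metis less_le_trans)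
  qed
qed

lemma AP_UNIV_has_mean_uniform:
  fixes v :: "real \<Rightarrow> 'a::banach"
  assumes "v \<in> AP UNIV" "has_mean v m"
  shows "uniform_mean v m"
  using AP_UNIV_uniform_mean_exists[OF assms(1)] uniform_mean_has_mean has_mean_unique[OF assms(2)] by metis

lemma has_mean_bounded_linear:
  fixes v :: "real \<Rightarrow> 'a::banach" and L :: "'a \<Rightarrow> 'b::banach"
  assumes "bounded_linear L" "continuous_on UNIV v" "has_mean v m"
  shows "has_mean (\<lambda>t. L (v t)) (L m)"
proof -
  interpret bounded_linear L by fact
  have "integral {-T..T} (\<lambda>t. L (v t)) = L (integral {-T..T} v)" for T
    using integral_linear[OF integrable_continuous_real[OF continuous_on_subset[OF assms(2)]] assms(1), of "- T" T]
    by (simp add: o_def)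
  then show ?thesis using tendsto[OF assms(3)[unfolded has_mean_def]]
    unfolding has_mean_def by (simp add: scaleR)
qed

lemma has_mean_add:
  fixes u v :: "real \<Rightarrow> 'a::banach"
  assumes "continuous_on UNIV u" "continuous_on UNIV v" "has_mean u m" "has_mean v m'"
  shows "has_mean (\<lambda>t. u t + v t) (m + m')"
  using has_mean_bounded_linear[OF bounded_linear_fst] tendsto_add[OF assms(3,4)[unfolded has_mean_def]]
  unfolding has_mean_def
  by (subst integral_add) (auto simp: scaleR_add_right intro!: integrable_continuous_real continuous_on_subset[OF assms(1)] continuous_on_subset[OF assms(2)])

lemma has_mean_le:
  fixes u v :: "real \<Rightarrow> real"
  assumes "continuous_on UNIV u" "continuous_on UNIV v" "has_mean u m" "has_mean v m'" "\<And>t. u t \<le> v t"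
  shows "m \<le> m'"
proof (rule tendsto_le[OF _ assms(4,3)[unfolded has_mean_def]])
  show "\<forall>\<^sub>F T in at_top. (1 / (2 * T)) *\<^sub>R integral {-T..T} u \<le> (1 / (2 * T)) *\<^sub>R integral {-T..T} v"
    using eventually_gt_at_top[of 0]
  proof eventually_elim
    case (elim T)
    have "integral {-T..T} u \<le> integral {-T..T} v"
      by (intro integral_le integrable_continuous_real assms continuous_on_subset[OF assms(1)] continuous_on_subset[OF assms(2)]) auto
    then show ?case using elim by (simp add: divide_right_mono)
  qed
qed simp

lemma has_mean_const: "has_mean (\<lambda>_. c :: 'a::banach) c"
  unfolding has_mean_def
proof (rule tendsto_eventually)
  show "\<forall>\<^sub>F T in at_top. (1 / (2 * T)) *\<^sub>R integral {-T..T} (\<lambda>_. c) = c"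
    using eventually_gt_at_top[of 0]
    by eventually_elim (simp add: scaleR_scaleR[symmetric] del: scaleR_scaleR, simp)
qed

lemma has_mean_norm_le:
  fixes v :: "real \<Rightarrow> 'a::banach"
  assumes v: "continuous_on UNIV v" "has_mean v m" and K: "\<And>t. norm (v t) \<le> K"
  shows "norm m \<le> K"
proof (rule tendsto_upperbound[OF tendsto_norm[OF v(2)[unfolded has_mean_def]]])
  show "\<forall>\<^sub>F T in at_top. norm ((1 / (2 * T)) *\<^sub>R integral {-T..T} v) \<le> K"
    using eventually_gt_at_top[of 0]
  proof eventually_elim
    case (elim T)
    have "norm (integral {-T..T} v) \<le> K * (T - - T)"
      by (rule integral_bound) (use elim K in \<open>auto intro: continuous_on_subset[OF v(1)]\<close>)
    then show ?case using elim by (simp add: field_simps)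
  qed
qed simp

lemma AP_UNIV_mean_translate:
  fixes v :: "real \<Rightarrow> 'a::banach"
  assumes v: "v \<in> AP UNIV" and m: "has_mean v m"
  shows "has_mean (\<lambda>t. v (t + s)) m"
proof (rule uniform_mean_has_mean, unfold uniform_mean_def, intro allI impI)
  fix \<epsilon> :: real assume "\<epsilon> > 0"
  then obtain T0 where T0: "T0 > 0" "\<And>T a. T \<ge> T0 \<Longrightarrow> norm ((1 / T) *\<^sub>R integral {a..a + T} v - m) \<le> \<epsilon>"
    using AP_UNIV_has_mean_uniform[OF assms] unfolding uniform_mean_def by meson
  have "integral {a..a + T} (\<lambda>t. v (t + s)) = integral {a + s..a + s + T} v" for a T
    using integral_shift_real_ivl[of "a + s" s "a + s + T" v] by (simp add: algebra_simps)
  then show "\<exists>T0>0. \<forall>T\<ge>T0. \<forall>a. norm ((1 / T) *\<^sub>R integral {a..a + T} (\<lambda>t. v (t + s)) - m) \<le> \<epsilon>"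
    using T0 by (intro exI[of _ T0]) auto
qed

text \<open>A positive value at \<open>t0\<close> recurs near some \<open>t0 + \<tau>\<close> in
  every window of length \<open>l + d\<close>, with a bump of width \<open>d\<close> and height at
  least \<open>e\<close>; every such window therefore contributes at least \<open>d * e\<close> to
  the integral.\<close>

lemma AP_UNIV_mean_pos:
  fixes k :: "real \<Rightarrow> real"
  assumes k: "k \<in> AP UNIV" and nn: "\<And>t. k t \<ge> 0" and k0: "k t0 > 0" and m: "has_mean k m"
  shows "m > 0"
proof -
  \<comment> \<open>One \<open>e\<close> is lost through the almost period and one through uniform
    continuity; what remains is still at least \<open>e\<close>.\<close>
  define e where "e = k t0 / 4"
  have e: "e > 0" using k0 by (simp add: e_def)
  obtain l where l: "l > 0" "\<And>a. \<exists>\<tau>\<in>{a..a + l}. \<forall>t. norm (k t - k (t + \<tau>)) \<le> e"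
    using AP_UNIV_period[OF k e] by blast
  obtain d where d: "d > 0" "\<And>s t. \<bar>s - t\<bar> \<le> d \<Longrightarrow> norm (k s - k t) \<le> e"
    using AP_UNIV_uniformly_continuous[OF k e] by blast
  have ki: "k integrable_on {a..b}" for a b by (intro integrable_continuous_real AP_UNIV_continuous k)
  define L where "L = l + d"
  have L: "L > 0" using l d by (simp add: L_def)
  have lower: "d * e \<le> integral {a..a + L} k" for a
  proof -
    obtain \<tau> where \<tau>: "\<tau> \<in> {a - t0..a - t0 + l}" "norm (k t0 - k (t0 + \<tau>)) \<le> e" using l(2) by blast
    define s where "s = t0 + \<tau>"
    have "d * e = integral {s..s + d} (\<lambda>_. e)" using d by simp
    also have "\<dots> \<le> integral {s..s + d} k"
    proof (intro integral_le ki)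
      fix x assume x: "x \<in> {s..s + d}"
      then have "norm (k x - k s) \<le> e" using d(1) by (intro d(2)) auto
      then show "e \<le> k x" using \<tau>(2) k0 unfolding s_def e_def real_norm_def abs_le_iff by linarith
    qed auto
    also have "\<dots> \<le> integral {a..a + L} k"
      using \<tau>(1) by (intro integral_subset_le ki) (auto simp: s_def L_def nn)
    finally show ?thesis .
  qed
  have sum: "real n * (d * e) \<le> integral {0..0 + real n * L} k" for n
  proof (induction n)
    case (Suc n)
    have "integral {0..real n * L} k + integral {real n * L..real n * L + L} k = integral {0..real n * L + L} k"
      by (rule Henstock_Kurzweil_Integration.integral_combine) (use L in \<open>auto intro: ki\<close>)
    then show ?case using Suc lower[of "real n * L"] by (simp add: algebra_simps)
  qed simp
  define q where "q = d * e / L"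
  have q: "q > 0" using d e L by (simp add: q_def)
  then have "q / 2 > 0" by simp
  then obtain T0 where T0: "T0 > 0" "\<And>T a. T \<ge> T0 \<Longrightarrow> norm ((1 / T) *\<^sub>R integral {a..a + T} k - m) \<le> q / 2"
    using AP_UNIV_has_mean_uniform[OF k m] unfolding uniform_mean_def by meson
  obtain n :: nat where n: "T0 / L < real n" using reals_Archimedean2 by blast
  then have nL: "T0 \<le> real n * L" using L by (simp add: field_simps)
  then have pos: "real n * L > 0" using T0 by simp
  have "q = (1 / (real n * L)) * (real n * (d * e))" using pos L by (cases "n = 0") (simp_all add: q_def field_simps)
  also have "\<dots> \<le> (1 / (real n * L)) * integral {0..0 + real n * L} k"
    using sum[of n] pos by (intro mult_left_mono) auto
  also have "\<dots> \<le> m + q / 2" using T0(2)[OF nL, of 0] unfolding real_norm_def abs_le_iff real_scaleR_def by linarith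
  finally show ?thesis using q by simp
qed

section \<open>Extension from the half-line to the line\<close>

text \<open>Translates of \<open>v\<close> by its own almost periods \<open>\<tau> k \<ge> k\<close>
  are defined on longer and longer half-lines and converge uniformly on each of them, so the limit
  inherits continuity and the almost periods of \<open>v\<close>.\<close>

lemma AP_extension_exists:
  fixes v :: "real \<Rightarrow> 'a::banach"
  assumes v: "v \<in> AP {0..}"
  obtains u where "u \<in> AP UNIV" "\<And>t. t \<ge> 0 \<Longrightarrow> u t = v t"
proof -
  have vc: "continuous_on {0..} v" and
    rd: "\<And>\<epsilon>. \<epsilon> > 0 \<Longrightarrow> \<exists>l>0. \<forall>a\<ge>0. {a..a + l} \<inter> almost_periods {0..} v \<epsilon> \<noteq> {}"
    using v by (simp_all add: AP_def relatively_dense_def Ball_def)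
  have "\<exists>\<tau>. \<tau> \<ge> real k \<and> \<tau> \<in> almost_periods {0..} v (1 / real (Suc k))" for k
  proof -
    obtain l where "\<forall>a\<ge>0. {a..a + l} \<inter> almost_periods {0..} v (1 / real (Suc k)) \<noteq> {}"
      using rd[of "1 / real (Suc k)"] by auto
    then have "{real k..real k + l} \<inter> almost_periods {0..} v (1 / real (Suc k)) \<noteq> {}" by simp
    then show ?thesis by auto
  qed
  then obtain \<tau> where \<tau>: "\<And>k. \<tau> k \<ge> real k" "\<And>k. \<tau> k \<in> almost_periods {0..} v (1 / real (Suc k))" by metis
  have per: "norm (v t - v (t + \<tau> k)) \<le> 1 / real (Suc k)" if "t \<ge> 0" for t k
    using \<tau>(2)[of k] that by (auto simp: almost_periods_def)
  \<comment> \<open>Both translates are compared with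
    \<open>v (t + \<tau> j + \<tau> k)\<close>.\<close>
  have cl: "norm (v (t + \<tau> j) - v (t + \<tau> k)) \<le> 1 / real (Suc j) + 1 / real (Suc k)"
    if "t + \<tau> j \<ge> 0" "t + \<tau> k \<ge> 0" for t j k
    using per[OF that(1), of k] per[OF that(2), of j]
      norm_triangle_ineq4[of "v (t + \<tau> j) - v (t + \<tau> j + \<tau> k)" "v (t + \<tau> k) - v (t + \<tau> k + \<tau> j)"]
    by (simp add: add_ac)
  have conv: "convergent (\<lambda>k. v (t + \<tau> k))" for t
  proof (rule Cauchy_convergent, rule CauchyI)
    fix e :: real assume e: "e > 0"
    obtain N :: nat where N: "1 / real (Suc N) < e / 2" using nat_approx_posE[of "e / 2"] e by auto
    have "norm (v (t + \<tau> m) - v (t + \<tau> n)) < e" if "m \<ge> max N (nat \<lceil>\<bar>t\<bar>\<rceil>)" "n \<ge> max N (nat \<lceil>\<bar>t\<bar>\<rceil>)" for m n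
    proof -
      have "real m \<ge> \<bar>t\<bar>" "real n \<ge> \<bar>t\<bar>" using that by (auto simp: nat_le_iff ceiling_le_iff)
      then have "t + \<tau> m \<ge> 0" "t + \<tau> n \<ge> 0" using \<tau>(1)[of m] \<tau>(1)[of n] by linarith+
      moreover have "1 / real (Suc m) \<le> 1 / real (Suc N)" "1 / real (Suc n) \<le> 1 / real (Suc N)"
        using that by (auto intro!: divide_left_mono)
      ultimately show ?thesis using cl[of t m n] N by linarith
    qed
    then show "\<exists>M. \<forall>m\<ge>M. \<forall>n\<ge>M. norm (v (t + \<tau> m) - v (t + \<tau> n)) < e" by blast
  qed
  define u where "u = (\<lambda>t. lim (\<lambda>k. v (t + \<tau> k)))"
  have lim: "(\<lambda>k. v (t + \<tau> k)) \<longlonglongrightarrow> u t" for t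
    using conv[of t] by (simp add: u_def convergent_LIMSEQ_iff)
  have unif: "norm (u t - v (t + \<tau> k)) \<le> 1 / real (Suc k)" if t: "t + real k \<ge> 0" for t k
  proof (rule tendsto_le[OF _ _ tendsto_norm[OF tendsto_diff[OF lim tendsto_const]]])
    show "(\<lambda>j. 1 / real (Suc j) + 1 / real (Suc k)) \<longlonglongrightarrow> 1 / real (Suc k)"
      using tendsto_add[OF LIMSEQ_inverse_real_of_nat tendsto_const[of "1 / real (Suc k)"]]
      by (simp add: inverse_eq_divide)
    show "\<forall>\<^sub>F j in sequentially. norm (v (t + \<tau> j) - v (t + \<tau> k)) \<le> 1 / real (Suc j) + 1 / real (Suc k)"
      unfolding eventually_sequentially
    proof (intro exI[of _ k] allI impI cl)
      fix j assume "k \<le> j"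
      then show "0 \<le> t + \<tau> j" using t \<tau>(1)[of j] by (smt (verit) of_nat_mono)
      show "0 \<le> t + \<tau> k" using t \<tau>(1)[of k] by linarith
    qed
  qed simp
  have shift: "norm (u t - u (t + p)) \<le> \<epsilon>" if p: "p \<in> almost_periods {0..} v \<epsilon>" for p t \<epsilon>
  proof (rule tendsto_upperbound)
    show "(\<lambda>k. norm (v (t + \<tau> k) - v (t + p + \<tau> k))) \<longlonglongrightarrow> norm (u t - u (t + p))"
      by (intro tendsto_intros lim)
    show "\<forall>\<^sub>F k in sequentially. norm (v (t + \<tau> k) - v (t + p + \<tau> k)) \<le> \<epsilon>"
      unfolding eventually_sequentially
    proof (intro exI[of _ "nat \<lceil>\<bar>t\<bar>\<rceil>"] allI impI)
      fix k assume "nat \<lceil>\<bar>t\<bar>\<rceil> \<le> k"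
      then have "real k \<ge> \<bar>t\<bar>" by (auto simp: nat_le_iff ceiling_le_iff)
      then have "t + \<tau> k \<ge> 0" using \<tau>(1)[of k] by linarith
      then show "norm (v (t + \<tau> k) - v (t + p + \<tau> k)) \<le> \<epsilon>"
        using p by (auto simp: almost_periods_def add_ac)
    qed
  qed simp
  have ucont: "continuous_on UNIV u"
    unfolding continuous_on_eq_continuous_at[OF open_UNIV]
  proof
    fix t0 :: real
    define m where "m = nat \<lceil>\<bar>t0\<bar> + 1\<rceil>"
    have m: "real m \<ge> \<bar>t0\<bar> + 1" by (auto simp: m_def real_nat_ceiling_ge)
    have "continuous_on {- real m..} u"
    proof (rule uniform_limit_theorem[where F=sequentially and f="\<lambda>k t. v (t + \<tau> k)"])
      show "\<forall>\<^sub>F k in sequentially. continuous_on {- real m..} (\<lambda>t. v (t + \<tau> k))"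
        unfolding eventually_sequentially
      proof (intro exI[of _ m] allI impI)
        fix k assume "m \<le> k"
        then have "\<tau> k \<ge> real m" using \<tau>(1)[of k] by (smt (verit) of_nat_mono)
        then show "continuous_on {- real m..} (\<lambda>t. v (t + \<tau> k))"
          by (intro continuous_on_compose2[OF vc]) (auto intro!: continuous_intros)
      qed
      show "uniform_limit {- real m..} (\<lambda>k t. v (t + \<tau> k)) u sequentially"
      proof (rule uniform_limitI)
        fix e :: real assume "e > 0"
        then obtain N where N: "1 / real (Suc N) < e" using nat_approx_posE by blast
        show "\<forall>\<^sub>F k in sequentially. \<forall>t\<in>{- real m..}. dist (v (t + \<tau> k)) (u t) < e"
          unfolding eventually_sequentially
        proof (intro exI[of _ "max m N"] allI impI ballI)
          fix k t assume k: "max m N \<le> k" and t: "t \<in> {- real m..}"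
          have "norm (u t - v (t + \<tau> k)) \<le> 1 / real (Suc k)"
            by (rule unif) (use k t in \<open>auto simp: le_max_iff_disj intro: order_trans[of _ "t + real m"]\<close>)
          also have "\<dots> \<le> 1 / real (Suc N)" using k by (auto intro!: divide_left_mono)
          finally show "dist (v (t + \<tau> k)) (u t) < e" using N by (simp add: dist_norm norm_minus_commute)
        qed
      qed
    qed simp
    then show "isCont u t0"
      using m by (intro continuous_on_interior) auto
  qed
  show thesis
  proof (rule that)
    show "u t = v t" if "t \<ge> 0" for t
    proof -
      have "(\<lambda>k. v t - v (t + \<tau> k)) \<longlonglongrightarrow> 0"
        using per[OF that] by (intro tendsto_0_le[OF LIMSEQ_inverse_real_of_nat, of _ 1] eventuallyI)
          (simp add: inverse_eq_divide)
      then have "(\<lambda>k. v t - (v t - v (t + \<tau> k))) \<longlonglongrightarrow> v t - 0" by (intro tendsto_intros)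
      then show ?thesis using LIMSEQ_unique[OF lim[of t]] by simp
    qed
    show "u \<in> AP UNIV" unfolding AP_UNIV_iff
    proof (intro conjI ucont allI impI)
      fix \<epsilon> :: real assume "\<epsilon> > 0"
      then obtain l where l: "l > 0" "\<And>a. a \<ge> 0 \<Longrightarrow> \<exists>p. p \<in> {a..a + l} \<inter> almost_periods {0..} v \<epsilon>"
        using rd[of \<epsilon>] by (meson ex_in_conv)
      show "\<exists>l>0. \<forall>a. \<exists>\<tau>\<in>{a..a + l}. \<forall>t. norm (u t - u (t + \<tau>)) \<le> \<epsilon>"
      proof (intro exI[of _ l] conjI l(1) allI)
        fix a
        \<comment> \<open>Almost periods on the half-line are nonnegative. Their negatives serve
          windows to the left of the origin, and a window around the origin contains the trivial
          almost period 0.\<close>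
        consider "a \<ge> 0" | "a + l \<le> 0" | "a < 0" "a + l > 0" by linarith
        then show "\<exists>\<tau>\<in>{a..a + l}. \<forall>t. norm (u t - u (t + \<tau>)) \<le> \<epsilon>"
        proof cases
          case 1
          then show ?thesis using l(2)[of a] shift by blast
        next
          case 2
          then obtain p where p: "p \<in> {- a - l..- a - l + l}" "p \<in> almost_periods {0..} v \<epsilon>"
            using l(2)[of "- a - l"] by auto
          have "norm (u t - u (t + - p)) \<le> \<epsilon>" for t
            using shift[OF p(2), of "t - p"] by (simp add: norm_minus_commute)
          then show ?thesis using p(1) by (intro bexI[of _ "- p"]) auto
        next
          case 3
          then show ?thesis using \<open>\<epsilon> > 0\<close> by (intro bexI[of _ 0]) auto
        qed
      qed
    qed
  qed
qed

lemma AP_UNIV_eq_on_halfline: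
  assumes "u \<in> AP UNIV" "v \<in> AP UNIV" "\<And>t. t \<ge> 0 \<Longrightarrow> u t = v t"
  shows "u = v"
proof (rule AP_UNIV_eqI[OF assms(1,2)], rule tendsto_eventually)
  show "\<forall>\<^sub>F t in at_top. u t - v t = 0"
    using eventually_ge_at_top[of 0] by eventually_elim (simp add: assms(3))
qed

lemma ap_ext_eq:
  assumes "u \<in> AP UNIV" "\<And>t. t \<ge> 0 \<Longrightarrow> u t = v t"
  shows "ap_ext v = u"
  unfolding ap_ext_def
proof (rule the_equality)
  fix u' assume u': "u' \<in> AP UNIV \<and> (\<forall>t\<ge>0. u' t = v t)"
  then show "u' = u" using assms by (intro AP_UNIV_eq_on_halfline) auto
qed (use assms in auto)

lemma ap_ext_AP:
  fixes v :: "real \<Rightarrow> 'a::banach"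
  assumes "v \<in> AP {0..}"
  shows "ap_ext v \<in> AP UNIV" "\<And>t. t \<ge> 0 \<Longrightarrow> ap_ext v t = v t"
proof -
  obtain u where "u \<in> AP UNIV" "\<And>t. t \<ge> 0 \<Longrightarrow> u t = v t" using AP_extension_exists[OF assms] by blast
  with ap_ext_eq[of u v] show "ap_ext v \<in> AP UNIV" "\<And>t. t \<ge> 0 \<Longrightarrow> ap_ext v t = v t" by auto
qed

lemma AP_halfline_eqI:
  fixes u v :: "real \<Rightarrow> 'a::banach"
  assumes u: "u \<in> AP {0..}" and v: "v \<in> AP {0..}" and lim: "((\<lambda>t. u t - v t) \<longlongrightarrow> 0) at_top"
    and t: "t \<ge> 0"
  shows "u t = v t"
proof -
  have "((\<lambda>t. ap_ext u t - ap_ext v t) \<longlongrightarrow> 0) at_top"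
  proof (rule Lim_transform_eventually[OF lim])
    show "\<forall>\<^sub>F t in at_top. u t - v t = ap_ext u t - ap_ext v t"
      using eventually_ge_at_top[of 0] by eventually_elim (simp add: ap_ext_AP[OF u] ap_ext_AP[OF v])
  qed
  then have "ap_ext u = ap_ext v" by (intro AP_UNIV_eqI ap_ext_AP u v)
  then show ?thesis using ap_ext_AP(2)[OF u t] ap_ext_AP(2)[OF v t] by simp
qed

section \<open>Fourier coefficients and frequency modules\<close>

definition dft_kernel :: "nat \<Rightarrow> nat \<Rightarrow> nat \<Rightarrow> complex"
  where "dft_kernel N j k = cis (2 * pi * real j * real k / real N)"

lemma dft_kernel_add: "dft_kernel N j (k + r) = dft_kernel N j k * dft_kernel N j r"
  by (simp add: dft_kernel_def cis_mult add_divide_distrib[symmetric] algebra_simps)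

lemma dft_kernel_period:
  assumes "N > 0"
  shows "dft_kernel N j (k + N) = dft_kernel N j k"
proof -
  have "dft_kernel N j N = cis (2 * pi * real j)" using assms by (simp add: dft_kernel_def)
  also have "\<dots> = 1" by (metis cis_multiple_2pi Ints_of_nat)
  finally show ?thesis by (simp add: dft_kernel_add)
qed

lemma dft_kernel_mod:
  assumes "N > 0"
  shows "dft_kernel N j (k mod N) = dft_kernel N j k"
proof -
  have "dft_kernel N j (r + N * q) = dft_kernel N j r" for r q
    by (induction q) (use dft_kernel_period[OF assms] in \<open>simp_all add: algebra_simps\<close>, metis add.assoc add.commute)
  from this[of "k mod N" "k div N"] show ?thesis by simp
qed

lemma dft_orthogonality:
  assumes "N > 0" "j < N" "l < N"
  shows "(\<Sum>k<N. dft_kernel N j k * cnj (dft_kernel N l k)) = (if j = l then of_nat N else 0)"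
proof (cases "j = l")
  case True
  have "dft_kernel N j k * cnj (dft_kernel N j k) = 1" for k
    by (simp add: dft_kernel_def cis_cnj cis_mult)
  then show ?thesis using True by simp
next
  case False
  define z where "z = cis (2 * pi * (real j - real l) / real N)"
  have "dft_kernel N j k * cnj (dft_kernel N l k) = z ^ k" for k
  proof -
    have "z ^ k = cis (real k * (2 * pi * (real j - real l) / real N))"
      unfolding z_def by (rule Complex.DeMoivre)
    moreover have "2 * pi * real j * real k / real N - 2 * pi * real l * real k / real N
        = real k * (2 * pi * (real j - real l) / real N)"
      by (simp add: diff_divide_distrib[symmetric] algebra_simps)
    ultimately show ?thesis by (simp add: dft_kernel_def cis_cnj cis_mult)
  qed
  moreover have "z \<noteq> 1"
  proof
    assume "z = 1"
    then have "\<exists>i::int. 2 * pi * (real j - real l) / real N = 2 * of_int i * pi"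
      unfolding z_def by (simp add: cis_conv_exp exp_eq_1)
    then obtain i :: int where "2 * pi * (real j - real l) / real N = 2 * of_int i * pi" by blast
    then have "(2 * pi) * (real j - real l) = (2 * pi) * (of_int i * real N)" using assms by (simp add: field_simps)
    then have "real j - real l = of_int i * real N" by (subst (asm) mult_cancel_left) auto
    then have "of_int (int j - int l) = (of_int (i * int N) :: real)" by simp
    then have eq: "int j - int l = i * int N" by (simp only: of_int_eq_iff)
    have "\<bar>int j - int l\<bar> < int N" using assms by auto
    moreover have "i \<noteq> 0" using eq False by auto
    then have "1 * int N \<le> \<bar>i\<bar> * int N" by (intro mult_right_mono) auto
    then have "int N \<le> \<bar>i * int N\<bar>" by (simp add: abs_mult)
    ultimately show False using eq by simp
  qed
  moreover have "z ^ N = 1"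
  proof -
    have "z ^ N = cis (2 * pi * (real j - real l))" using assms by (simp add: z_def Complex.DeMoivre)
    also have "\<dots> = 1"
      using cis_multiple_2pi[of "real j - real l"] by (metis Ints_diff Ints_of_nat)
    finally show ?thesis .
  qed
  ultimately show ?thesis using False by (simp add: sum_gp_strict)
qed

text \<open>The polarised form is needed because a coefficient sequence is later paired with its own
  modulation \<open>F j * dft_kernel N j r\<close>, which represents a cyclic shift.\<close>

lemma dft_Parseval:
  assumes "N > 0"
  shows "(\<Sum>k<N. (\<Sum>j<N. c j * dft_kernel N j k) * cnj (\<Sum>j<N. d j * dft_kernel N j k))
    = of_nat N * (\<Sum>j<N. c j * cnj (d j))"
proof -
  have "(\<Sum>k<N. (\<Sum>j<N. c j * dft_kernel N j k) * cnj (\<Sum>j<N. d j * dft_kernel N j k))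
    = (\<Sum>k<N. \<Sum>j<N. \<Sum>l<N. c j * cnj (d l) * (dft_kernel N j k * cnj (dft_kernel N l k)))"
    by (simp add: sum_product cnj_sum mult_ac)
  also have "\<dots> = (\<Sum>j<N. \<Sum>k<N. \<Sum>l<N. c j * cnj (d l) * (dft_kernel N j k * cnj (dft_kernel N l k)))"
    by (rule sum.swap)
  also have "\<dots> = (\<Sum>j<N. \<Sum>l<N. \<Sum>k<N. c j * cnj (d l) * (dft_kernel N j k * cnj (dft_kernel N l k)))"
    by (intro sum.cong refl sum.swap)
  also have "\<dots> = (\<Sum>j<N. \<Sum>l<N. c j * cnj (d l) * (if j = l then of_nat N else 0))"
    unfolding sum_distrib_left[symmetric] using assms
    by (intro sum.cong refl arg_cong2[where f="(*)"]) (auto simp: dft_orthogonality)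
  also have "\<dots> = (\<Sum>j<N. c j * cnj (d j) * of_nat N)"
    by (intro sum.cong refl) (simp add: if_distrib[of "(*) _"] cong: if_cong)
  finally show ?thesis by (simp add: sum_distrib_left mult_ac)
qed

definition dft :: "nat \<Rightarrow> (nat \<Rightarrow> real) \<Rightarrow> nat \<Rightarrow> complex"
  where "dft N a j = (\<Sum>k<N. of_real (a k) * cnj (dft_kernel N j k)) / of_nat N"

lemma dft_inversion:
  assumes "N > 0" "k < N"
  shows "(\<Sum>j<N. dft N a j * dft_kernel N j k) = of_real (a k)"
proof -
  have sym: "dft_kernel N j l = dft_kernel N l j" for j l by (simp add: dft_kernel_def mult_ac)
  have "of_nat N * (\<Sum>j<N. dft N a j * dft_kernel N j k)
     = (\<Sum>j<N. (\<Sum>l<N. of_real (a l) * cnj (dft_kernel N j l)) * dft_kernel N j k)"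
    using assms by (simp add: dft_def sum_distrib_left)
  also have "\<dots> = (\<Sum>j<N. \<Sum>l<N. of_real (a l) * (dft_kernel N k j * cnj (dft_kernel N l j)))"
  proof -
    have "of_real (a l) * cnj (dft_kernel N j l) * dft_kernel N j k
        = of_real (a l) * (dft_kernel N k j * cnj (dft_kernel N l j))" for j l
      unfolding sym[of j l] sym[of j k] by (simp add: mult_ac)
    then show ?thesis unfolding sum_distrib_right by (simp only:)
  qed
  also have "\<dots> = (\<Sum>l<N. \<Sum>j<N. of_real (a l) * (dft_kernel N k j * cnj (dft_kernel N l j)))"
    by (rule sum.swap)
  also have "\<dots> = (\<Sum>l<N. of_real (a l) * (if k = l then of_nat N else 0))"
    unfolding sum_distrib_left[symmetric] using assms
    by (intro sum.cong refl arg_cong2[where f="(*)"]) (auto simp: dft_orthogonality)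
  also have "\<dots> = of_real (a k) * of_nat N"
    using assms by (simp add: if_distrib[of "(*) _"] cong: if_cong)
  finally show ?thesis using assms by (simp add: mult.commute)
qed

text \<open>
  With \<open>\<phi>\<close> the cyclic autocorrelation, \<open>mean \<phi>\<^sup>2 = \<Sum> |F\<^sub>j|\<^sup>4 \<le> (max |F\<^sub>j|)\<^sup>2 \<Sum> |F\<^sub>j|\<^sup>2\<close>, so a lower bound
  on \<open>\<phi>\<close> forces a large Fourier coefficient.
\<close>

lemma dft_autocorrelation_bound:
  fixes a :: "nat \<Rightarrow> real"
  assumes N: "N > 0" and F: "\<And>j. j < N \<Longrightarrow> norm (dft N a j) \<le> M"
  shows "(\<Sum>r<N. ((\<Sum>k<N. a ((k + r) mod N) * a k) / real N)\<^sup>2) \<le> M\<^sup>2 * (\<Sum>k<N. (a k)\<^sup>2)"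
proof -
  define F where "F = dft N a"
  define Ak where "Ak = (\<lambda>k. \<Sum>j<N. F j * dft_kernel N j k)"
  have Ak: "Ak k = of_real (a (k mod N))" for k
    using dft_inversion[OF N, of "k mod N" a] N by (simp add: Ak_def F_def dft_kernel_mod[OF N])
  have energy: "of_nat N * (\<Sum>j<N. F j * cnj (F j)) = of_real (\<Sum>k<N. (a k)\<^sup>2)"
    using dft_Parseval[OF N, of F F] unfolding Ak[unfolded Ak_def] by (simp add: power2_eq_square)
  have en: "real N * (\<Sum>j<N. (norm (F j))\<^sup>2) = (\<Sum>k<N. (a k)\<^sup>2)"
  proof -
    have "complex_of_real (real N * (\<Sum>j<N. (norm (F j))\<^sup>2)) = of_real (\<Sum>k<N. (a k)\<^sup>2)"
      unfolding energy[symmetric] by (simp only: of_real_mult of_real_sum complex_norm_square of_real_of_nat_eq)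
    then show ?thesis by (simp only: of_real_eq_iff)
  qed
  define \<phi> where "\<phi> = (\<lambda>r. (\<Sum>k<N. a ((k + r) mod N) * a k) / real N)"
  \<comment> \<open>Cyclic Wiener-Khinchin: a shift by \<open>r\<close> multiplies the
    \<open>j\<close>-th coefficient by \<open>dft_kernel N j r\<close>, so the coefficients of the
    autocorrelation are the squared moduli of those of \<open>a\<close>.\<close>
  have phi: "complex_of_real (\<phi> r) = (\<Sum>j<N. of_real ((norm (F j))\<^sup>2) * dft_kernel N j r)" for r
  proof -
    have "of_nat N * complex_of_real (\<phi> r) = (\<Sum>k<N. Ak (k + r) * cnj (Ak k))"
      using N by (simp add: \<phi>_def Ak)
    also have "\<dots> = (\<Sum>k<N. (\<Sum>j<N. (F j * dft_kernel N j r) * dft_kernel N j k) * cnj (\<Sum>j<N. F j * dft_kernel N j k))"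
    proof -
      have "Ak (k + r) = (\<Sum>j<N. (F j * dft_kernel N j r) * dft_kernel N j k)" for k
        by (simp add: Ak_def dft_kernel_add mult_ac)
      then show ?thesis by (simp only: Ak_def)
    qed
    also have "\<dots> = of_nat N * (\<Sum>j<N. (F j * dft_kernel N j r) * cnj (F j))"
      by (rule dft_Parseval[OF N])
    also have "(\<Sum>j<N. (F j * dft_kernel N j r) * cnj (F j)) = (\<Sum>j<N. of_real ((norm (F j))\<^sup>2) * dft_kernel N j r)"
      by (intro sum.cong refl) (simp only: complex_norm_square mult_ac)
    finally show ?thesis using N by simp
  qed
  have "complex_of_real (\<Sum>r<N. (\<phi> r)\<^sup>2) = (\<Sum>r<N. complex_of_real (\<phi> r) * cnj (complex_of_real (\<phi> r)))"
    by (simp add: power2_eq_square)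
  also have "\<dots> = of_nat N * (\<Sum>j<N. of_real ((norm (F j))\<^sup>2) * cnj (of_real ((norm (F j))\<^sup>2)))"
    unfolding phi by (rule dft_Parseval[OF N])
  also have "\<dots> = complex_of_real (real N * (\<Sum>j<N. (norm (F j))\<^sup>2 * (norm (F j))\<^sup>2))"
    by simp
  finally have "(\<Sum>r<N. (\<phi> r)\<^sup>2) = real N * (\<Sum>j<N. (norm (F j))\<^sup>2 * (norm (F j))\<^sup>2)"
    by (simp only: of_real_eq_iff)
  also have "\<dots> \<le> real N * (\<Sum>j<N. M\<^sup>2 * (norm (F j))\<^sup>2)"
    using F by (intro mult_left_mono sum_mono mult_right_mono power_mono) (auto simp: F_def)
  also have "\<dots> = M\<^sup>2 * (\<Sum>k<N. (a k)\<^sup>2)"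
    unfolding en[symmetric] by (simp add: sum_distrib_left mult_ac)
  finally show ?thesis by (simp add: \<phi>_def)
qed

section \<open>Riemann sums for mean values\<close>

lemma Riemann_sum_error:
  fixes g :: "real \<Rightarrow> 'a::banach"
  assumes g: "continuous_on UNIV g" and h: "h \<ge> 0" and e: "\<And>s t. \<bar>s - t\<bar> \<le> h \<Longrightarrow> norm (g s - g t) \<le> e"
  shows "norm ((\<Sum>k<n. h *\<^sub>R g (real k * h)) - integral {0..real n * h} g) \<le> real n * (h * e)"
proof (induction n)
  case (Suc n)
  have gi: "g integrable_on {a..b}" for a b
    by (intro integrable_continuous_real continuous_on_subset[OF g]) auto
  have comb: "integral {0..real n * h} g + integral {real n * h..real n * h + h} g = integral {0..real n * h + h} g"
    using h by (intro Henstock_Kurzweil_Integration.integral_combine gi) auto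
  have c: "integral {real n * h..real n * h + h} (\<lambda>_. g (real n * h)) = h *\<^sub>R g (real n * h)"
    using h by simp
  have "norm (h *\<^sub>R g (real n * h) - integral {real n * h..real n * h + h} g)
     = norm (integral {real n * h..real n * h + h} (\<lambda>t. g (real n * h) - g t))"
    unfolding c[symmetric] by (subst integral_diff) (auto intro: gi)
  also have "\<dots> \<le> e * (real n * h + h - real n * h)"
    by (rule integral_bound) (use h in \<open>auto intro!: e continuous_intros continuous_on_subset[OF g]\<close>)
  finally have "norm (h *\<^sub>R g (real n * h) - integral {real n * h..real n * h + h} g) \<le> h * e" by (simp add: mult.commute)
  moreover have "(\<Sum>k<Suc n. h *\<^sub>R g (real k * h)) - integral {0..real (Suc n) * h} g
     = ((\<Sum>k<n. h *\<^sub>R g (real k * h)) - integral {0..real n * h} g) + (h *\<^sub>R g (real n * h) - integral {real n * h..real n * h + h} g)"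
    using comb by (simp add: algebra_simps)
  ultimately have "norm ((\<Sum>k<Suc n. h *\<^sub>R g (real k * h)) - integral {0..real (Suc n) * h} g) \<le> real n * (h * e) + h * e"
    using Suc by (simp only:) (rule norm_triangle_le, rule add_mono)
  then show ?case by (simp add: algebra_simps)
qed simp

text \<open>Only the lower bound is kept. It holds for all long \<open>T\<close> and all fine grids
  at once, so that \<open>T\<close> may later be taken among the almost periods.\<close>

lemma AP_UNIV_Riemann_mean:
  fixes k :: "real \<Rightarrow> real"
  assumes k: "k \<in> AP UNIV" and m: "has_mean k m" and \<delta>: "\<delta> > 0"
  obtains h0 T0 where "h0 > 0" "T0 > 0"
    "\<And>T N. T \<ge> T0 \<Longrightarrow> N > 0 \<Longrightarrow> T / real N \<le> h0 \<Longrightarrow> m - \<delta> \<le> (\<Sum>j<N. k (real j * (T / real N))) / real N"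
proof -
  have d2: "\<delta> / 2 > 0" using \<delta> by simp
  obtain h0 where h0: "h0 > 0" "\<And>s t. \<bar>s - t\<bar> \<le> h0 \<Longrightarrow> norm (k s - k t) \<le> \<delta> / 2"
    using AP_UNIV_uniformly_continuous[OF k d2] by blast
  obtain T0 where T0: "T0 > 0" "\<And>T a. T \<ge> T0 \<Longrightarrow> norm ((1 / T) *\<^sub>R integral {a..a + T} k - m) \<le> \<delta> / 2"
    using AP_UNIV_has_mean_uniform[OF k m] d2 unfolding uniform_mean_def by meson
  show thesis
  proof (rule that[OF h0(1) T0(1)])
    fix T :: real and N :: nat assume T: "T \<ge> T0" and N: "N > 0" and h: "T / real N \<le> h0"
    define h where "h = T / real N"
    have hT: "real N * h = T" "h > 0" using N T T0 by (auto simp: h_def)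
    have "norm ((\<Sum>j<N. h *\<^sub>R k (real j * h)) - integral {0..real N * h} k) \<le> real N * (h * (\<delta> / 2))"
      by (rule Riemann_sum_error) (use h hT h0 AP_UNIV_continuous[OF k] in \<open>auto simp: h_def\<close>)
    then have "\<bar>h * (\<Sum>j<N. k (real j * h)) - integral {0..T} k\<bar> \<le> T * (\<delta> / 2)"
      unfolding mult.assoc[symmetric] hT(1) by (simp add: sum_distrib_left)
    then have "integral {0..T} k - T * (\<delta> / 2) \<le> h * (\<Sum>j<N. k (real j * h))" by linarith
    then have "(integral {0..T} k - T * (\<delta> / 2)) / T \<le> (h * (\<Sum>j<N. k (real j * h))) / T"
      using T T0 by (intro divide_right_mono) auto
    also have "(h * (\<Sum>j<N. k (real j * h))) / T = (\<Sum>j<N. k (real j * h)) / real N"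
      using N T T0 by (simp add: h_def)
    also have "(integral {0..T} k - T * (\<delta> / 2)) / T = integral {0..T} k / T - \<delta> / 2"
      using T T0 by (simp add: diff_divide_distrib)
    finally have "integral {0..T} k / T - \<delta> / 2 \<le> (\<Sum>j<N. k (real j * h)) / real N" .
    moreover have "m - \<delta> / 2 \<le> integral {0..T} k / T"
      using T0(2)[OF T, of 0] unfolding real_norm_def abs_le_iff by simp
    ultimately show "m - \<delta> \<le> (\<Sum>j<N. k (real j * (T / real N))) / real N"
      by (simp add: h_def)
  qed
qed

section \<open>Large discrete coefficients of a nonzero almost periodic function\<close>

definition translation_dist :: "(real \<Rightarrow> 'a::real_normed_vector) \<Rightarrow> real \<Rightarrow> real"
  where "translation_dist f t = (SUP s. norm (f (s + t) - f s))"

lemma translation_dist_upper: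
  assumes "f \<in> AP UNIV"
  shows "norm (f (s + t) - f s) \<le> translation_dist f t"
  unfolding translation_dist_def
proof (rule cSUP_upper)
  obtain K where K: "\<And>t. norm (f t) \<le> K" using AP_UNIV_bounded[OF assms] by blast
  have "norm (f (s + t) - f s) \<le> K + K" for s
    using norm_triangle_ineq4[of "f (s + t)" "f s"] K[of "s + t"] K[of s] by linarith
  then show "bdd_above (range (\<lambda>s. norm (f (s + t) - f s)))" by (intro bdd_aboveI[of _ "K + K"]) auto
qed simp

lemma translation_dist_least: "(\<And>s. norm (f (s + t) - f s) \<le> \<epsilon>) \<Longrightarrow> translation_dist f t \<le> \<epsilon>"
  unfolding translation_dist_def by (rule cSUP_least) auto

lemma translation_dist_zero [simp]: "translation_dist f 0 = 0"
  by (simp add: translation_dist_def)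

lemma translation_dist_diff:
  assumes f: "f \<in> AP UNIV" and e: "\<And>s. norm (f (s + t) - f (s + t')) \<le> \<epsilon>"
  shows "norm (translation_dist f t - translation_dist f t') \<le> \<epsilon>"
proof -
  have "norm (f (s + t) - f s) \<le> translation_dist f t' + \<epsilon>" for s
    using norm_triangle_ineq[of "f (s + t') - f s" "f (s + t) - f (s + t')"] translation_dist_upper[OF f, of s t'] e[of s] by simp
  then have "translation_dist f t \<le> translation_dist f t' + \<epsilon>"
    by (rule translation_dist_least)
  moreover have "norm (f (s + t') - f s) \<le> translation_dist f t + \<epsilon>" for s
    using norm_triangle_ineq4[of "f (s + t) - f s" "f (s + t) - f (s + t')"] translation_dist_upper[OF f, of s t] e[of s] by simp
  then have "translation_dist f t' \<le> translation_dist f t + \<epsilon>"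
    by (rule translation_dist_least)
  ultimately show ?thesis by (simp add: abs_le_iff)
qed

text \<open>Changing the shift from \<open>\<tau>\<close> to \<open>\<sigma>\<close> changes this
  distance by at most the uniform distance of the two translates. Being almost periodic in the
  shift, it can be averaged, and averages of functions of it measure how frequent the almost periods
  of \<open>f\<close> are.\<close>

lemma translation_dist_AP:
  assumes f: "f \<in> AP UNIV"
  shows "translation_dist f \<in> AP UNIV"
proof (rule AP_UNIV_dominated[OF f, where K=1])
  show "continuous_on UNIV (translation_dist f)"
    unfolding continuous_on_iff
  proof (intro ballI allI impI)
    fix x e :: real assume "e > 0"
    then have "e / 2 > 0" by simp
    then obtain d where d: "d > 0" "\<And>s t. \<bar>s - t\<bar> \<le> d \<Longrightarrow> norm (f s - f t) \<le> e / 2"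
      using AP_UNIV_uniformly_continuous[OF f] by blast
    have "dist (translation_dist f x') (translation_dist f x) < e" if "dist x' x < d" for x'
    proof -
      have "norm (translation_dist f x' - translation_dist f x) \<le> e / 2"
        by (rule translation_dist_diff[OF f d(2)]) (use that in \<open>simp add: dist_real_def\<close>)
      then show ?thesis using \<open>e > 0\<close> by (simp add: dist_norm)
    qed
    then show "\<exists>d>0. \<forall>x'\<in>UNIV. dist x' x < d \<longrightarrow> dist (translation_dist f x') (translation_dist f x) < e"
      using d(1) by blast
  qed
  fix \<epsilon> \<tau> \<sigma> t assume *: "\<And>t. norm (f (t + \<tau>) - f (t + \<sigma>)) \<le> \<epsilon>"
  have "norm (translation_dist f (t + \<tau>) - translation_dist f (t + \<sigma>)) \<le> \<epsilon>"
    by (rule translation_dist_diff[OF f]) (use *[of "s + t" for s] in \<open>simp add: add.assoc\<close>)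
  then show "norm (translation_dist f (t + \<tau>) - translation_dist f (t + \<sigma>)) \<le> 1 * \<epsilon>" by simp
qed simp

lemma AP_UNIV_real_compose_Lipschitz:
  fixes D :: "real \<Rightarrow> real"
  assumes D: "D \<in> AP UNIV" and K: "K > 0" and g: "\<And>x y. \<bar>g x - g y\<bar> \<le> K * \<bar>x - y\<bar>"
  shows "(\<lambda>t. g (D t) :: real) \<in> AP UNIV"
proof (rule AP_UNIV_dominated[OF D _ _ K])
  have "continuous_on UNIV g"
    by (rule lipschitz_on_continuous_on[of K]) (use K g in \<open>auto intro!: lipschitz_onI simp: dist_real_def\<close>)
  then show "continuous_on UNIV (\<lambda>t. g (D t))"
    by (rule continuous_on_compose2[OF _ AP_UNIV_continuous[OF D]]) auto
  fix \<epsilon> \<tau> \<sigma> t assume *: "\<And>t. norm (D (t + \<tau>) - D (t + \<sigma>)) \<le> \<epsilon>"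
  show "norm (g (D (t + \<tau>)) - g (D (t + \<sigma>))) \<le> K * \<epsilon>"
    unfolding real_norm_def by (rule order_trans[OF g mult_left_mono]) (use *[of t] K in auto)
qed

lemma AP_UNIV_mean_real_exists:
  fixes v :: "real \<Rightarrow> 'a::banach"
  assumes "v \<in> AP UNIV" obtains m where "has_mean v m"
  using AP_UNIV_uniform_mean_exists[OF assms] uniform_mean_has_mean by blast

text \<open>Let \<open>T\<close> be an almost period and wrap the samples cyclically. For a shift
  that is nearly an almost period the cyclic autocorrelation is at least a quarter of the mean of
  \<open>f\<^sup>2\<close>, and such shifts have positive density. Thus the mean square of the
  autocorrelation is bounded below independently of \<open>T\<close> and \<open>N\<close>, and
  \<open>dft_autocorrelation_bound\<close> excludes that all coefficients are small.\<close>

lemma large_dft_coefficient: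
  fixes f :: "real \<Rightarrow> real"
  assumes f: "f \<in> AP UNIV" and f0: "f t0 \<noteq> 0"
  obtains c \<epsilon> h0 T0 where "c > 0" "\<epsilon> > 0" "h0 > 0" "T0 > 0"
    "\<And>T N. T \<ge> T0 \<Longrightarrow> N > 0 \<Longrightarrow> T / real N \<le> h0 \<Longrightarrow> (\<And>t. \<bar>f t - f (t + T)\<bar> \<le> \<epsilon>) \<Longrightarrow>
      \<exists>j<N. norm (dft N (\<lambda>k. f (real k * (T / real N))) j) > c"
proof -
  obtain K where K: "K > 0" "\<And>t. \<bar>f t\<bar> \<le> K" using AP_UNIV_bounded[OF f] by (metis real_norm_def)
  have f2: "(\<lambda>t. (f t)\<^sup>2) \<in> AP UNIV"
    using AP_UNIV_bilinear[OF bounded_bilinear_mult f f] by (simp add: power2_eq_square)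
  obtain m where m: "has_mean (\<lambda>t. (f t)\<^sup>2) m" using AP_UNIV_mean_real_exists[OF f2] by blast
  have m0: "m > 0" by (rule AP_UNIV_mean_pos[OF f2 _ _ m, of t0]) (use f0 in auto)
  \<comment> \<open>The shift and the wrap-around change a sample by at most \<open>\<kappa>\<close>
    each, hence a product of samples by at most \<open>2 * \<kappa> * K = m / 4\<close>.\<close>
  define \<kappa> where "\<kappa> = m / (8 * K)"
  have \<kappa>: "\<kappa> > 0" using m0 K by (simp add: \<kappa>_def)
  define D where "D = translation_dist f"
  have D: "D \<in> AP UNIV" unfolding D_def by (rule translation_dist_AP[OF f])
  \<comment> \<open>A tent in place of the indicator of \<open>D t < \<kappa>\<close>: being
    Lipschitz it preserves almost periodicity, and its value 1 at \<open>D 0 = 0\<close> makes the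
    mean positive.\<close>
  define g where "g = (\<lambda>x::real. max 0 (1 - x / \<kappa>))"
  have gL: "\<bar>g x - g y\<bar> \<le> (1 / \<kappa>) * \<bar>x - y\<bar>" for x y
  proof -
    have "\<bar>g x - g y\<bar> \<le> \<bar>x / \<kappa> - y / \<kappa>\<bar>" unfolding g_def by (auto simp: max_def abs_if)
    also have "\<dots> = (1 / \<kappa>) * \<bar>x - y\<bar>" using \<kappa> by (simp add: diff_divide_distrib[symmetric])
    finally show ?thesis .
  qed
  have k: "(\<lambda>t. g (D t)) \<in> AP UNIV" by (rule AP_UNIV_real_compose_Lipschitz[OF D _ gL]) (use \<kappa> in auto)
  obtain \<rho> where \<rho>: "has_mean (\<lambda>t. g (D t)) \<rho>" using AP_UNIV_mean_real_exists[OF k] by blast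
  have \<rho>0: "\<rho> > 0" by (rule AP_UNIV_mean_pos[OF k _ _ \<rho>, of 0]) (auto simp: g_def D_def)
  obtain h1 T1 where 1: "h1 > 0" "T1 > 0" "\<And>T N. T \<ge> T1 \<Longrightarrow> N > 0 \<Longrightarrow> T / real N \<le> h1 \<Longrightarrow>
     m - m / 2 \<le> (\<Sum>j<N. (f (real j * (T / real N)))\<^sup>2) / real N"
    using AP_UNIV_Riemann_mean[OF f2 m, of "m / 2"] m0 by (metis half_gt_zero)
  obtain h2 T2 where 2: "h2 > 0" "T2 > 0" "\<And>T N. T \<ge> T2 \<Longrightarrow> N > 0 \<Longrightarrow> T / real N \<le> h2 \<Longrightarrow>
     \<rho> - \<rho> / 2 \<le> (\<Sum>j<N. g (D (real j * (T / real N)))) / real N"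
    using AP_UNIV_Riemann_mean[OF k \<rho>, of "\<rho> / 2"] \<rho>0 by (metis half_gt_zero)
  \<comment> \<open>Chosen so that \<open>c\<^sup>2 * K\<^sup>2\<close> is half of
    \<open>(m / 4)\<^sup>2 * \<rho> / 2\<close>, the lower bound for the mean square of the
    autocorrelation.\<close>
  define c where "c = sqrt ((m / 4)\<^sup>2 * \<rho> / 4) / K"
  have c: "c > 0" using m0 \<rho>0 K by (simp add: c_def)
  have c2: "c\<^sup>2 * K\<^sup>2 = (m / 4)\<^sup>2 * \<rho> / 4" using K m0 \<rho>0 by (simp add: c_def power_divide)
  show thesis
  proof (rule that[OF c \<kappa>])
    show "min h1 h2 > 0" "max T1 T2 > 0" using 1 2 by auto
    fix T N assume T: "T \<ge> max T1 T2" and N: "N > (0::nat)" and h: "T / real N \<le> min h1 h2"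
      and per: "\<And>t. \<bar>f t - f (t + T)\<bar> \<le> \<kappa>"
    define h where "h = T / real N"
    have hT: "real N * h = T" using N by (simp add: h_def)
    define a where "a = (\<lambda>k. f (real k * h))"
    define S where "S = (\<Sum>k<N. (a k)\<^sup>2)"
    define \<phi> where "\<phi> = (\<lambda>r. (\<Sum>k<N. a ((k + r) mod N) * a k) / real N)"
    have S1: "m / 2 * real N \<le> S"
      using 1(3)[of T N] T N h by (simp add: S_def a_def h_def pos_le_divide_eq)
    have S2: "S \<le> real N * K\<^sup>2"
    proof -
      have "S \<le> (\<Sum>k<N. K\<^sup>2)" unfolding S_def a_def
        using K by (intro sum_mono) (metis abs_ge_zero power2_abs power_mono)
      then show ?thesis by simp
    qed
    have phi: "(m / 4)\<^sup>2 * g (D (real r * h)) \<le> (\<phi> r)\<^sup>2" if r: "r < N" for r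
    proof (cases "D (real r * h) < \<kappa>")
      case False
      then have "g (D (real r * h)) = 0" using \<kappa> by (simp add: g_def field_simps)
      then show ?thesis by simp
    next
      case True
      have diagonal: "(a k)\<^sup>2 - 2 * \<kappa> * K \<le> a ((k + r) mod N) * a k" if k: "k < N" for k
      proof -
        have d1: "\<bar>f (real k * h + real r * h) - f (real k * h)\<bar> \<le> \<kappa>"
          using translation_dist_upper[OF f, of "real k * h" "real r * h"] True by (simp add: D_def)
        \<comment> \<open>Past the end of the sample the index wraps, which moves the argument by
          \<open>T\<close>, and \<open>T\<close> is an almost period by \<open>per\<close>.\<close>
        have d2: "\<bar>a ((k + r) mod N) - f (real k * h + real r * h)\<bar> \<le> \<kappa>"
        proof (cases "k + r < N")
          case True
          then show ?thesis using \<kappa> by (simp add: a_def distrib_right)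
        next
          case False
          then have "(k + r) mod N = k + r - N" using k r by (simp add: mod_if)
          then have "real ((k + r) mod N) * h + T = real k * h + real r * h"
            using False hT by (simp add: of_nat_diff algebra_simps)
          then show ?thesis using per[of "real ((k + r) mod N) * h"] by (simp add: a_def)
        qed
        have "\<bar>(a ((k + r) mod N) - a k) * a k\<bar> \<le> (2 * \<kappa>) * K"
          unfolding abs_mult using d1 d2 K \<kappa> by (intro mult_mono) (auto simp: a_def)
        then show ?thesis by (simp add: algebra_simps power2_eq_square abs_le_iff)
      qed
      have "S - real N * (2 * \<kappa> * K) \<le> (\<Sum>k<N. a ((k + r) mod N) * a k)"
        using sum_mono[of "{..<N}", OF diagonal] by (simp add: S_def sum_subtractf)
      moreover have "2 * \<kappa> * K = m / 4" using K by (simp add: \<kappa>_def)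
      ultimately have "S - real N * (m / 4) \<le> (\<Sum>k<N. a ((k + r) mod N) * a k)" by (simp only:)
      then have "real N * (m / 4) \<le> (\<Sum>k<N. a ((k + r) mod N) * a k)" using S1 by (simp add: field_simps)
      then have "m / 4 \<le> \<phi> r" using N by (simp add: \<phi>_def pos_le_divide_eq mult.commute)
      then have "(m / 4)\<^sup>2 \<le> (\<phi> r)\<^sup>2" using m0 by (intro power_mono) auto
      moreover have "0 \<le> D (real r * h)"
        using order_trans[OF norm_ge_zero translation_dist_upper[OF f, of 0 "real r * h"]] by (simp add: D_def)
      then have "g (D (real r * h)) \<le> 1" using \<kappa> by (simp add: g_def)
      then have "(m / 4)\<^sup>2 * g (D (real r * h)) \<le> (m / 4)\<^sup>2 * 1" by (intro mult_left_mono) auto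
      ultimately show ?thesis by simp
    qed
    show "\<exists>j<N. norm (dft N (\<lambda>k. f (real k * (T / real N))) j) > c"
    proof (rule ccontr)
      assume "\<not> ?thesis"
      then have F: "\<And>j. j < N \<Longrightarrow> norm (dft N a j) \<le> c" unfolding a_def h_def by (meson not_less)
      have "(m / 4)\<^sup>2 * (\<rho> / 2 * real N) \<le> (m / 4)\<^sup>2 * (\<Sum>r<N. g (D (real r * h)))"
        using 2(3)[of T N] T N h by (intro mult_left_mono) (auto simp: h_def pos_le_divide_eq)
      also have "\<dots> \<le> (\<Sum>r<N. (\<phi> r)\<^sup>2)"
        unfolding sum_distrib_left by (intro sum_mono phi) auto
      also have "\<dots> \<le> c\<^sup>2 * S"
        unfolding \<phi>_def S_def by (rule dft_autocorrelation_bound[OF N F])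
      also have "\<dots> \<le> c\<^sup>2 * (real N * K\<^sup>2)" using S2 by (intro mult_left_mono) auto
      also have "\<dots> = (m / 4)\<^sup>2 * (\<rho> / 4 * real N)" using c2 by (simp add: algebra_simps)
      finally have "(m / 4)\<^sup>2 * (\<rho> * real N) \<le> 0" by (simp add: algebra_simps)
      moreover have "(m / 4)\<^sup>2 * (\<rho> * real N) > 0" using m0 \<rho>0 N by simp
      ultimately show False by linarith
    qed
  qed
qed

section \<open>From discrete to continuous Fourier coefficients\<close>

text \<open>Rotated by the phase at the midpoint of the step, the integrand has real part
  \<open>cos (x * (h / 2 - t))\<close>, which is nonnegative on the step and at least
  \<open>1 / 2\<close> on its middle half. Integration over a step thus does not destroy a large
  discrete coefficient, provided its frequency has been reduced to
  \<open>\<bar>x * h\<bar> \<le> pi\<close>.\<close>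

lemma step_frequency_factor:
  assumes h: "h > 0" and x: "\<bar>x * h\<bar> \<le> pi"
  shows "h / 4 \<le> norm (integral {0..h} (\<lambda>t. cis (- x * t)))"
proof -
  define g where "g = (\<lambda>t. cis (- x * t))"
  have gc: "continuous_on X g" for X unfolding g_def by (intro continuous_intros)
  have gi: "g integrable_on {0..h}" by (intro integrable_continuous_real gc)
  have "integral {0..h} (\<lambda>t. Re (cis (x * h / 2) * g t)) = Re (cis (x * h / 2) * integral {0..h} g)"
    using integral_linear[OF gi bounded_linear_compose[OF bounded_linear_Re bounded_linear_mult_right], of "cis (x * h / 2)"]
    by (simp add: o_def)
  also have "\<dots> \<le> norm (cis (x * h / 2) * integral {0..h} g)" by (rule complex_Re_le_cmod)
  also have "\<dots> = norm (integral {0..h} g)" by (simp add: norm_mult)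
  finally have 1: "integral {0..h} (\<lambda>t. Re (cis (x * h / 2) * g t)) \<le> norm (integral {0..h} g)" .
  have Re: "Re (cis (x * h / 2) * g t) = cos (x * (h / 2 - t))" for t
    by (simp add: g_def cis_mult algebra_simps)
  have ci: "(\<lambda>t. cos (x * (h / 2 - t))) integrable_on {a..b}" for a b
    by (intro integrable_continuous_real continuous_intros)
  have bd: "\<bar>x * (h / 2 - t)\<bar> \<le> pi * (\<bar>h / 2 - t\<bar> / h)" for t
  proof -
    have "\<bar>x\<bar> \<le> pi / h" using x h by (simp add: abs_mult pos_le_divide_eq)
    then have "\<bar>x\<bar> * \<bar>h / 2 - t\<bar> \<le> pi / h * \<bar>h / 2 - t\<bar>" by (rule mult_right_mono) simp
    then show ?thesis by (simp add: abs_mult)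
  qed
  have nn: "0 \<le> cos (x * (h / 2 - t))" if "t \<in> {0..h}" for t
  proof -
    have "\<bar>h / 2 - t\<bar> / h \<le> 1 / 2" using that h by (auto simp: field_simps abs_le_iff)
    then have "pi * (\<bar>h / 2 - t\<bar> / h) \<le> pi * (1 / 2)" by (intro mult_left_mono) auto
    then have "\<bar>x * (h / 2 - t)\<bar> \<le> pi / 2" using bd[of t] by linarith
    then show ?thesis by (intro cos_ge_zero) (auto simp: abs_le_iff)
  qed
  have half: "1 / 2 \<le> cos (x * (h / 2 - t))" if "t \<in> {h / 4..3 * h / 4}" for t
  proof -
    have "\<bar>h / 2 - t\<bar> \<le> h / 4" using that by (intro abs_leI) auto
    then have "\<bar>h / 2 - t\<bar> / h \<le> 1 / 4" using h by (simp add: pos_divide_le_eq)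
    then have "pi * (\<bar>h / 2 - t\<bar> / h) \<le> pi * (1 / 4)" by (intro mult_left_mono) auto
    then have b: "\<bar>x * (h / 2 - t)\<bar> \<le> pi / 3" using bd[of t] pi_gt_zero by linarith
    have "cos (pi / 3) \<le> cos \<bar>x * (h / 2 - t)\<bar>" using b by (intro cos_monotone_0_pi_le) auto
    then show ?thesis by (simp add: cos_60)
  qed
  have "h / 4 = integral {h / 4..3 * h / 4} (\<lambda>_. 1 / 2)" using h by simp
  also have "\<dots> \<le> integral {h / 4..3 * h / 4} (\<lambda>t. cos (x * (h / 2 - t)))"
    by (intro integral_le ci half) auto
  also have "\<dots> \<le> integral {0..h} (\<lambda>t. cos (x * (h / 2 - t)))"
    using h nn by (intro integral_subset_le ci) auto
  finally show ?thesis using 1[unfolded Re] unfolding g_def by linarith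
qed

text \<open>For a function constant on the steps of the grid, the integral against
  \<open>cis (- x * t)\<close> is a discrete sum times the integral over a single step;
  \<open>f\<close> differs from such a function by at most \<open>\<omega>\<close>.\<close>

lemma step_approximation:
  fixes f :: "real \<Rightarrow> real"
  assumes f: "continuous_on UNIV f" and h: "h \<ge> 0" and e: "\<And>s t. \<bar>s - t\<bar> \<le> h \<Longrightarrow> \<bar>f s - f t\<bar> \<le> \<omega>"
  shows "norm ((\<Sum>k<n. of_real (f (real k * h)) * cis (- x * (real k * h))) * integral {0..h} (\<lambda>t. cis (- x * t))
     - integral {0..real n * h} (\<lambda>t. of_real (f t) * cis (- x * t))) \<le> real n * (h * \<omega>)"
proof (induction n)
  case (Suc n)
  define F where "F = (\<lambda>t. complex_of_real (f t) * cis (- x * t))"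
  define E where "E = (\<lambda>t. cis (- x * t))"
  have Fi: "F integrable_on {a..b}" for a b
    unfolding F_def by (intro integrable_continuous_real continuous_intros continuous_on_subset[OF f]) auto
  have Ei: "E integrable_on {a..b}" for a b
    unfolding E_def by (intro integrable_continuous_real continuous_intros)
  define s where "s = real n * h"
  define I0 where "I0 = integral {0..h} E"
  have shift: "integral {s..s + h} E = E s * I0"
  proof -
    have "integral {s..s + h} E = integral {0..h} (\<lambda>t. E (t + s))"
      using integral_shift_real_ivl[of s s "s + h" E] by simp
    also have "\<dots> = integral {0..h} (\<lambda>t. E s * E t)"
      by (simp add: E_def cis_mult algebra_simps)
    finally show ?thesis by (simp add: I0_def)
  qed
  have "of_real (f s) * (E s * I0) - integral {s..s + h} F = integral {s..s + h} (\<lambda>t. of_real (f s) * E t - F t)"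
    unfolding shift[symmetric] by (subst integral_diff) (auto intro!: integrable_on_mult_right Fi Ei)
  also have "norm \<dots> \<le> \<omega> * (s + h - s)"
  proof (rule integral_bound)
    show "continuous_on {s..s + h} (\<lambda>t. complex_of_real (f s) * E t - F t)"
      unfolding E_def F_def by (intro continuous_intros continuous_on_subset[OF f]) auto
    fix t assume "t \<in> {s..s + h}"
    then have "\<bar>f s - f t\<bar> \<le> \<omega>" by (intro e) auto
    moreover have "of_real (f s) * E t - F t = of_real (f s - f t) * E t" by (simp add: F_def E_def algebra_simps)
    moreover have "norm (of_real (f s - f t) * E t) = \<bar>f s - f t\<bar>"
      unfolding norm_mult norm_of_real by (simp add: E_def)
    ultimately show "norm (of_real (f s) * E t - F t) \<le> \<omega>" by simp
  qed (use h in auto)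
  finally have new: "norm (of_real (f s) * (E s * I0) - integral {s..s + h} F) \<le> h * \<omega>" by (simp add: mult.commute)
  have comb: "integral {0..s} F + integral {s..s + h} F = integral {0..s + h} F"
    using h by (intro Henstock_Kurzweil_Integration.integral_combine Fi) (auto simp: s_def)
  have IH: "norm ((\<Sum>k<n. of_real (f (real k * h)) * E (real k * h)) * I0 - integral {0..s} F) \<le> real n * (h * \<omega>)"
    using Suc by (simp add: E_def F_def I0_def s_def)
  have "(\<Sum>k<Suc n. of_real (f (real k * h)) * E (real k * h)) * I0 - integral {0..s + h} F
    = ((\<Sum>k<n. of_real (f (real k * h)) * E (real k * h)) * I0 - integral {0..s} F) + (of_real (f s) * (E s * I0) - integral {s..s + h} F)"
    unfolding comb[symmetric] by (simp add: s_def algebra_simps)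
  then have "norm ((\<Sum>k<Suc n. of_real (f (real k * h)) * E (real k * h)) * I0 - integral {0..s + h} F) \<le> real n * (h * \<omega>) + h * \<omega>"
    using norm_triangle_le[OF add_mono[OF IH new]] by simp
  moreover have "s + h = real (Suc n) * h" by (simp add: s_def algebra_simps)
  ultimately show ?case by (simp only: E_def F_def I0_def) (simp add: algebra_simps)
qed simp

definition fourier_integrand :: "(real \<Rightarrow> 'a::real_normed_vector) \<Rightarrow> real \<Rightarrow> real \<Rightarrow> 'a \<times> 'a"
  where "fourier_integrand v \<omega> t = (cos (\<omega> * t) *\<^sub>R v t, - sin (\<omega> * t) *\<^sub>R v t)"

lemma fourier_integrand_AP:
  assumes "v \<in> AP UNIV"
  shows "fourier_integrand v \<omega> \<in> AP UNIV"
proof -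
  have "(\<lambda>t. - sin (\<omega> * t)) \<in> AP UNIV"
    using AP_UNIV_bounded_linear[OF bounded_linear_minus[OF bounded_linear_ident] AP_UNIV_sin] by simp
  then have "(\<lambda>t. (cos (\<omega> * t) *\<^sub>R v t, - sin (\<omega> * t) *\<^sub>R v t)) \<in> AP UNIV"
    by (intro AP_UNIV_Pair AP_UNIV_bilinear[OF bounded_bilinear_scaleR] AP_UNIV_cos assms)
  then show ?thesis by (simp add: fourier_integrand_def[abs_def])
qed

lemma fourier_coeff_eqI:
  assumes "has_mean (fourier_integrand v \<omega>) m"
  shows "fourier_coeff v \<omega> = m"
  using assms unfolding has_mean_def fourier_coeff_def fourier_integrand_def[abs_def]
  by (intro tendsto_Lim) auto

lemma fourier_coeff_has_mean:
  fixes v :: "real \<Rightarrow> 'a::banach"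
  assumes "v \<in> AP UNIV"
  shows "has_mean (fourier_integrand v \<omega>) (fourier_coeff v \<omega>)"
  using AP_UNIV_mean_real_exists[OF fourier_integrand_AP[OF assms, of \<omega>]] fourier_coeff_eqI by metis

lemma norm_cis_diff_one: "norm (cis x - 1) \<le> \<bar>x\<bar>"
proof -
  have "norm (cis x - 1) = 2 * \<bar>sin (x / 2)\<bar>"
    using dist_exp_i_1[of x] by (simp add: cis_conv_exp)
  also have "\<dots> \<le> 2 * \<bar>x / 2\<bar>" using abs_sin_x_le_abs_x[of "x / 2"] by linarith
  finally show ?thesis by simp
qed

text \<open>A covering argument over frequencies needs one threshold for \<open>T\<close> that
  serves all \<open>y\<close> near \<open>x\<close>. On a block of length \<open>L\<close> the
  integrands for \<open>x\<close> and \<open>y\<close> agree up to a constant phase and an error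
  \<open>K * (d * L)\<close>, and the uniform mean bounds the block for \<open>x\<close> wherever it
  lies.\<close>

lemma uniform_mean_zero_nearby_frequencies:
  fixes f :: "real \<Rightarrow> real"
  assumes f: "continuous_on UNIV f" and K: "\<And>t. \<bar>f t\<bar> \<le> K"
    and m: "uniform_mean (\<lambda>t. of_real (f t) * cis (- x * t)) 0" and c: "c > 0"
  obtains d T1 where "d > 0" "T1 > 0"
    "\<And>y T. \<bar>y - x\<bar> < d \<Longrightarrow> T \<ge> T1 \<Longrightarrow> norm (integral {0..T} (\<lambda>t. of_real (f t) * cis (- y * t))) < c * T"
proof -
  define Z where "Z = (\<lambda>y t. complex_of_real (f t) * cis (- y * t))"
  have Zc: "continuous_on X (Z y)" for X y
    unfolding Z_def by (intro continuous_intros continuous_on_subset[OF f]) auto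
  have Zi: "Z y integrable_on {a..b}" for y a b by (intro integrable_continuous_real Zc)
  have K0: "K \<ge> 0" using order_trans[OF abs_ge_zero K] .
  have c4: "c / 4 > 0" using c by simp
  obtain L where L: "L > 0" "\<And>a. norm ((1 / L) *\<^sub>R integral {a..a + L} (Z x) - 0) \<le> c / 4"
    using m c4 unfolding uniform_mean_def Z_def by (meson order_refl)
  \<comment> \<open>\<open>K + 1\<close> avoids a vanishing denominator; \<open>d\<close> is then
    such that \<open>(K + 1) * (d * L) = c / 4\<close>.\<close>
  define q where "q = (K + 1) * L"
  have q: "q > 0" using K0 L by (simp add: q_def)
  define d where "d = c / 4 / q"
  have d: "d > 0" using c q by (simp add: d_def)
  \<comment> \<open>Makes the incomplete last block, which contributes at most \<open>K * L\<close>,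
    smaller than a quarter of \<open>c * T\<close>.\<close>
  define T1 where "T1 = 4 * K * L / c + 1"
  have T1: "T1 > 0" using c K0 L by (simp add: T1_def add_nonneg_pos)
  have block: "norm (integral {a..a + L} (Z y)) \<le> L * (c / 2)" if y: "\<bar>y - x\<bar> < d" for y a
  proof -
    define u where "u = cis (- (y - x) * a)"
    have "integral {a..a + L} (Z y) = u * integral {a..a + L} (Z x) + integral {a..a + L} (\<lambda>t. Z y t - u * Z x t)"
      by (subst integral_diff) (auto intro!: Zi integrable_on_mult_right)
    also have "norm \<dots> \<le> L * (c / 4) + (c / 4) * (a + L - a)"
    proof (intro norm_triangle_le add_mono)
      have "norm (integral {a..a + L} (Z x)) \<le> L * (c / 4)"
        using L(2)[of a] L(1) by (simp add: field_simps)
      then show "norm (u * integral {a..a + L} (Z x)) \<le> L * (c / 4)" by (simp add: norm_mult u_def)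
      show "norm (integral {a..a + L} (\<lambda>t. Z y t - u * Z x t)) \<le> (c / 4) * (a + L - a)"
      proof (rule integral_bound)
        fix t assume t: "t \<in> {a..a + L}"
        have "cis (- y * t) = u * cis (- x * t) * cis (- (y - x) * (t - a))"
          by (simp add: u_def cis_mult algebra_simps)
        then have "Z y t - u * Z x t = u * Z x t * (cis (- (y - x) * (t - a)) - 1)"
          by (simp add: Z_def algebra_simps)
        then have "norm (Z y t - u * Z x t) = \<bar>f t\<bar> * norm (cis (- (y - x) * (t - a)) - 1)"
          by (simp add: norm_mult u_def Z_def)
        also have "\<dots> \<le> K * (d * L)"
        proof (intro mult_mono K K0)
          have "norm (cis (- (y - x) * (t - a)) - 1) \<le> \<bar>y - x\<bar> * \<bar>t - a\<bar>"
            using norm_cis_diff_one[of "- (y - x) * (t - a)"] by (simp add: abs_mult abs_minus_commute)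
          also have "\<dots> \<le> d * L" using y t d by (intro mult_mono) auto
          finally show "norm (cis (- (y - x) * (t - a)) - 1) \<le> d * L" .
        qed simp
        also have "\<dots> \<le> (K + 1) * (d * L)" using d L by (intro mult_right_mono) auto
        also have "\<dots> = d * q" by (simp add: q_def mult_ac)
        also have "\<dots> = c / 4" using q by (simp add: d_def)
        finally show "norm (Z y t - u * Z x t) \<le> c / 4" .
      qed (use L in \<open>auto intro!: continuous_intros Zc\<close>)
    qed
    also have "\<dots> = L * (c / 2)" by simp
    finally show ?thesis .
  qed
  have blocks: "norm (integral {0..real n * L} (Z y)) \<le> real n * L * (c / 2)" if y: "\<bar>y - x\<bar> < d" for y n
  proof (induction n)
    case (Suc n)
    have "integral {0..real n * L} (Z y) + integral {real n * L..real n * L + L} (Z y) = integral {0..real n * L + L} (Z y)"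
      using L by (intro Henstock_Kurzweil_Integration.integral_combine Zi) auto
    moreover have "real (Suc n) * L = real n * L + L" by (simp add: algebra_simps)
    ultimately have "norm (integral {0..real (Suc n) * L} (Z y)) \<le> real n * L * (c / 2) + L * (c / 2)"
      using norm_triangle_le[OF add_mono[OF Suc block[OF y, of "real n * L"]]] by simp
    then show ?case by (simp add: algebra_simps)
  qed simp
  show thesis
  proof (rule that[OF d T1])
    fix y T assume y: "\<bar>y - x\<bar> < d" and T: "T \<ge> T1"
    have T0: "T > 0" using T T1 by linarith
    define n where "n = nat \<lfloor>T / L\<rfloor>"
    have eqn: "real n = of_int \<lfloor>T / L\<rfloor>" using T0 L by (simp add: n_def)
    have "real n \<le> T / L" "T / L \<le> real n + 1" unfolding eqn by linarith+
    then have nT: "real n * L \<le> T" "T \<le> real n * L + L" using L by (auto simp: field_simps)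
    have "norm (integral {real n * L..T} (Z y)) \<le> K * (T - real n * L)"
      by (rule integral_bound) (use nT K Zc in \<open>auto simp: Z_def norm_mult\<close>)
    also have "\<dots> \<le> K * L" using nT K0 by (intro mult_left_mono) auto
    finally have rest: "norm (integral {real n * L..T} (Z y)) \<le> K * L" .
    have "integral {0..T} (Z y) = integral {0..real n * L} (Z y) + integral {real n * L..T} (Z y)"
      using L nT by (intro Henstock_Kurzweil_Integration.integral_combine[symmetric] Zi) auto
    then have "norm (integral {0..T} (Z y)) \<le> real n * L * (c / 2) + K * L"
      using norm_triangle_le[OF add_mono[OF blocks[OF y] rest]] by simp
    also have "real n * L * (c / 2) \<le> T * (c / 2)" using nT c by (intro mult_right_mono) auto
    also have "T * (c / 2) + K * L < c * T"
    proof -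
      have "4 * K * L / c < T" using T by (simp add: T1_def)
      then have "4 * K * L < c * T" using c by (simp add: field_simps)
      moreover have "0 \<le> K * L" using K0 L by simp
      ultimately show ?thesis by (simp add: field_simps)
    qed
    finally show "norm (integral {0..T} (\<lambda>t. of_real (f t) * cis (- y * t))) < c * T" by (simp add: Z_def)
  qed
qed

lemma real_fourier_integrand_uniform_mean:
  fixes f :: "real \<Rightarrow> real"
  assumes f: "f \<in> AP UNIV" and z: "fourier_coeff f x = 0"
  shows "uniform_mean (\<lambda>t. of_real (f t) * cis (- x * t)) 0"
proof -
  define L where "L = (\<lambda>p::real \<times> real. Complex (fst p) (snd p))"
  have L: "bounded_linear L"
    unfolding L_def Complex_eq
    by (intro bounded_linear_add bounded_linear_const_mult
        bounded_linear_compose[OF bounded_linear_of_real bounded_linear_fst]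
        bounded_linear_compose[OF bounded_linear_of_real bounded_linear_snd])
  have eq: "L (fourier_integrand f x t) = of_real (f t) * cis (- x * t)" for t
    by (simp add: L_def fourier_integrand_def complex_eq_iff)
  have "has_mean (\<lambda>t. L (fourier_integrand f x t)) (L 0)"
    using has_mean_bounded_linear[OF L AP_UNIV_continuous[OF fourier_integrand_AP[OF f]]] fourier_coeff_has_mean[OF f, of x] z
    by metis
  moreover have "(\<lambda>t. L (fourier_integrand f x t)) \<in> AP UNIV"
    by (rule AP_UNIV_bounded_linear[OF L fourier_integrand_AP[OF f]])
  moreover have "L 0 = 0" by (simp add: L_def complex_eq_iff)
  ultimately show ?thesis using AP_UNIV_has_mean_uniform unfolding eq by fastforce
qed

text \<open>A nonzero \<open>f\<close> has discrete coefficients above \<open>c\<close> along long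
  almost periods \<open>T\<close>, at frequencies in an interval \<open>{-X..X}\<close> that does
  not depend on \<open>T\<close>. If all continuous coefficients vanish, compactness of this
  interval gives a common length beyond which all normalised integrals are below
  \<open>c / 8\<close>, whereas the step approximation forces one of them to be at least
  \<open>c / 8\<close>.\<close>

theorem real_AP_uniqueness:
  fixes f :: "real \<Rightarrow> real"
  assumes f: "f \<in> AP UNIV" and z: "\<And>\<omega>. fourier_coeff f \<omega> = 0"
  shows "f t = 0"
proof (rule ccontr)
  assume "f t \<noteq> 0"
  show False
  proof (rule large_dft_coefficient[OF f \<open>f t \<noteq> 0\<close>])
  fix c \<epsilon> h0 T0 :: real
  assume ce: "c > 0" "\<epsilon> > 0" "h0 > 0" "T0 > 0"
    and big: "\<And>T N. T \<ge> T0 \<Longrightarrow> N > 0 \<Longrightarrow> T / real N \<le> h0 \<Longrightarrow> (\<And>t. \<bar>f t - f (t + T)\<bar> \<le> \<epsilon>) \<Longrightarrow>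
      \<exists>j<N. norm (dft N (\<lambda>k. f (real k * (T / real N))) j) > c"
  obtain K where K: "\<And>t. \<bar>f t\<bar> \<le> K" using AP_UNIV_bounded[OF f] by (metis real_norm_def)
  have c8: "c / 8 > 0" using ce by simp
  obtain h1 where h1: "h1 > 0" "\<And>s t. \<bar>s - t\<bar> \<le> h1 \<Longrightarrow> norm (f s - f t) \<le> c / 8"
    using AP_UNIV_uniformly_continuous[OF f c8] by blast
  define H where "H = min h0 h1"
  have H: "H > 0" using ce h1 by (simp add: H_def)
  \<comment> \<open>The largest frequency compatible with \<open>\<bar>x * h\<bar> \<le> pi\<close>
    and \<open>h \<ge> H / 2\<close>.\<close>
  define X where "X = 2 * pi / H"
  define Z where "Z = (\<lambda>y t. complex_of_real (f t) * cis (- y * t))"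
  have fc: "continuous_on UNIV f" by (rule AP_UNIV_continuous[OF f])
  have "\<exists>d T1. d > 0 \<and> T1 > 0 \<and> (\<forall>y T. \<bar>y - x\<bar> < d \<longrightarrow> T \<ge> T1 \<longrightarrow> norm (integral {0..T} (Z y)) < (c / 8) * T)" for x
    using uniform_mean_zero_nearby_frequencies[OF fc K real_fourier_integrand_uniform_mean[OF f z] c8, of x]
    unfolding Z_def by metis
  then obtain d T1 where dT: "\<And>x. d x > 0" "\<And>x. T1 x > (0::real)"
    "\<And>x y T. \<bar>y - x\<bar> < d x \<Longrightarrow> T \<ge> T1 x \<Longrightarrow> norm (integral {0..T} (Z y)) < (c / 8) * T" by metis
  have cov: "{-X..X} \<subseteq> (\<Union>x\<in>{-X..X}. ball x (d x))" using dT(1) by force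
  obtain F where F: "F \<subseteq> {-X..X}" "finite F" "{-X..X} \<subseteq> (\<Union>x\<in>F. ball x (d x))"
    by (rule compactE_image[OF compact_Icc _ cov]) auto
  define T2 where "T2 = Max (insert 0 (T1 ` F))"
  have T2: "T1 x \<le> T2" if "x \<in> F" for x using that F(2) by (simp add: T2_def)
  obtain l where l: "\<And>a. \<exists>\<tau>\<in>{a..a + l}. \<forall>t. norm (f t - f (t + \<tau>)) \<le> \<epsilon>"
    using AP_UNIV_period[OF f ce(2)] by blast
  obtain T where T: "T \<ge> max (max T2 T0) H" "\<And>t. \<bar>f t - f (t + T)\<bar> \<le> \<epsilon>"
    using l[of "max (max T2 T0) H"] by auto
  have T0': "T > 0" using T H by linarith
  \<comment> \<open>Rounding up puts \<open>h = T / N\<close> between \<open>H / 2\<close> and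
    \<open>H\<close>; the lower bound uses \<open>T \<ge> H\<close>.\<close>
  define N where "N = nat \<lceil>T / H\<rceil>"
  have eqN: "real N = of_int \<lceil>T / H\<rceil>" using T0' H by (simp add: N_def)
  have N1: "T / H \<le> real N" "real N \<le> T / H + 1" unfolding eqN by linarith+
  have "T / H \<ge> 1" using T H by simp
  then have N: "N > 0" "real N \<le> 2 * (T / H)" using N1 by linarith+
  define h where "h = T / real N"
  have h: "h > 0" "h \<le> H" "H / 2 \<le> h" "real N * h = T"
    using N N1 T0' H by (auto simp: h_def field_simps)
  obtain j where j: "j < N" "norm (dft N (\<lambda>k. f (real k * h)) j) > c"
    using big[of T N] T N h unfolding h_def H_def by auto
  define \<theta> where "\<theta> = 2 * pi * real j / real N"
  have \<theta>: "0 \<le> \<theta>" "\<theta> < 2 * pi" using j(1) by (auto simp: \<theta>_def field_simps)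
  \<comment> \<open>Discrete frequencies matter only modulo \<open>2 * pi\<close>; the upper half of
    them is moved to negative values, to meet the hypothesis of
    \<open>step_frequency_factor\<close>.\<close>
  define p where "p = (if \<theta> \<le> pi then 0 else 1 :: nat)"
  define x where "x = (\<theta> - 2 * pi * real p) / h"
  have xh: "x * h = \<theta> - 2 * pi * real p" using h by (simp add: x_def)
  have xpi: "\<bar>x * h\<bar> \<le> pi" unfolding xh using \<theta> by (auto simp: p_def abs_le_iff)
  have "\<bar>x\<bar> * (H / 2) \<le> \<bar>x\<bar> * h" using h by (intro mult_left_mono) auto
  also have "\<dots> \<le> pi" using xpi h by (simp add: abs_mult)
  finally have "\<bar>x\<bar> \<le> X" using H by (simp add: X_def field_simps)
  then have "x \<in> {-X..X}" by auto
  then obtain y where y: "y \<in> F" "\<bar>x - y\<bar> < d y" using F(3) by (auto simp: dist_real_def abs_minus_commute)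
  have small: "norm (integral {0..T} (Z x)) < (c / 8) * T"
    using dT(3)[OF y(2)] T2[OF y(1)] T by simp
  define I0 where "I0 = integral {0..h} (\<lambda>t. cis (- x * t))"
  define Sm where "Sm = (\<Sum>k<N. of_real (f (real k * h)) * cis (- x * (real k * h)))"
  have ker: "cis (- x * (real k * h)) = cnj (dft_kernel N j k)" for k
  proof -
    have "- x * (real k * h) = - (x * h) * real k" by simp
    also have "\<dots> = - (\<theta> * real k) + 2 * pi * real (p * k)" unfolding xh by (simp add: algebra_simps)
    finally have "cis (- x * (real k * h)) = cis (- (\<theta> * real k)) * cis (2 * pi * real (p * k))"
      by (simp only: cis_mult)
    also have "cis (2 * pi * real (p * k)) = 1" by (metis cis_multiple_2pi Ints_of_nat)
    finally show ?thesis by (simp add: dft_kernel_def \<theta>_def cis_cnj)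
  qed
  have "Sm = of_nat N * dft N (\<lambda>k. f (real k * h)) j"
    using N unfolding Sm_def dft_def ker by simp
  then have "real N * c \<le> norm Sm" using mult_left_mono[OF less_imp_le[OF j(2)], of "real N"] by (simp add: norm_mult)
  then have "real N * c * (h / 4) \<le> norm Sm * norm I0"
    using step_frequency_factor[OF h(1) xpi] h ce unfolding I0_def by (intro mult_mono) auto
  moreover have "norm (Sm * I0 - integral {0..T} (Z x)) \<le> T * (c / 8)"
    using step_approximation[of f h "c / 8" x N] fc h h1 unfolding Sm_def I0_def Z_def H_def
    by (simp add: mult.assoc[symmetric])
  \<comment> \<open>The discrete part contributes at least \<open>T * c / 4\<close>, the
    approximation error takes away at most \<open>T * c / 8\<close>.\<close>
  ultimately have "real N * h * c / 4 - T * (c / 8) \<le> norm (integral {0..T} (Z x))"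
    using norm_triangle_ineq2[of "Sm * I0" "integral {0..T} (Z x)"] by (simp add: norm_mult mult_ac)
  then have "T * (c / 8) \<le> norm (integral {0..T} (Z x))" unfolding h(4) by simp
  then show False using small by (simp add: mult.commute)
  qed
qed

text \<open>\<open>cmul \<alpha> \<beta>\<close> is multiplication by \<open>\<alpha> + i \<beta>\<close> in the complexification.\<close>

definition cmul :: "real \<Rightarrow> real \<Rightarrow> 'a::real_normed_vector \<times> 'a \<Rightarrow> 'a \<times> 'a"
  where "cmul \<alpha> \<beta> p = (\<alpha> *\<^sub>R fst p - \<beta> *\<^sub>R snd p, \<beta> *\<^sub>R fst p + \<alpha> *\<^sub>R snd p)"

lemma norm_cmul: "norm (cmul \<alpha> \<beta> p) \<le> (\<bar>\<alpha>\<bar> + \<bar>\<beta>\<bar>) * norm p"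
proof -
  define q where "q = (- snd p, fst p)"
  have "cmul \<alpha> \<beta> p = \<alpha> *\<^sub>R p + \<beta> *\<^sub>R q"
    by (simp add: cmul_def q_def prod_eq_iff)
  moreover have "norm q = norm p"
    by (simp add: q_def norm_prod_def add.commute)
  ultimately show ?thesis
    using norm_triangle_ineq[of "\<alpha> *\<^sub>R p" "\<beta> *\<^sub>R q"] by (simp add: distrib_right)
qed

lemma bounded_linear_cmul: "bounded_linear (cmul \<alpha> \<beta>)"
  unfolding cmul_def
  by (intro bounded_linear_Pair bounded_linear_sub bounded_linear_add
      bounded_linear_compose[OF bounded_linear_scaleR_right bounded_linear_fst]
      bounded_linear_compose[OF bounded_linear_scaleR_right bounded_linear_snd])

lemma cmul_conj: "cmul \<alpha> (- \<beta>) (cmul \<alpha> \<beta> p) = (\<alpha>\<^sup>2 + \<beta>\<^sup>2) *\<^sub>R p"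
  by (simp add: cmul_def prod_eq_iff power2_eq_square algebra_simps)

lemma norm_cmul_lower:
  "(\<alpha>\<^sup>2 + \<beta>\<^sup>2) * norm p \<le> (\<bar>\<alpha>\<bar> + \<bar>\<beta>\<bar>) * norm (cmul \<alpha> \<beta> p)"
  using norm_cmul[of \<alpha> "- \<beta>" "cmul \<alpha> \<beta> p"] by (simp add: cmul_conj)

section \<open>Fourier coefficients under linear maps, differences and translations\<close>

lemma fourier_coeff_bounded_linear:
  fixes v :: "real \<Rightarrow> 'a::banach" and L :: "'a \<Rightarrow> 'b::banach"
  assumes v: "v \<in> AP UNIV" and L: "bounded_linear L"
  shows "fourier_coeff (\<lambda>t. L (v t)) \<omega> = (L (fst (fourier_coeff v \<omega>)), L (snd (fourier_coeff v \<omega>)))"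
proof (rule fourier_coeff_eqI)
  interpret bounded_linear L by fact
  have LL: "bounded_linear (\<lambda>p::'a \<times> 'a. (L (fst p), L (snd p)))"
    by (intro bounded_linear_Pair bounded_linear_compose[OF L] bounded_linear_fst bounded_linear_snd)
  have "(\<lambda>t. (L (fst (fourier_integrand v \<omega> t)), L (snd (fourier_integrand v \<omega> t)))) = fourier_integrand (\<lambda>t. L (v t)) \<omega>"
    by (simp add: fourier_integrand_def[abs_def] scaleR neg)
  then show "has_mean (fourier_integrand (\<lambda>t. L (v t)) \<omega>) (L (fst (fourier_coeff v \<omega>)), L (snd (fourier_coeff v \<omega>)))"
    using has_mean_bounded_linear[OF LL AP_UNIV_continuous[OF fourier_integrand_AP[OF v]] fourier_coeff_has_mean[OF v, of \<omega>]]
    by simp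
qed

lemma fourier_coeff_diff:
  fixes u v :: "real \<Rightarrow> 'a::banach"
  assumes u: "u \<in> AP UNIV" and v: "v \<in> AP UNIV"
  shows "fourier_coeff (\<lambda>t. u t - v t) \<omega> = fourier_coeff u \<omega> - fourier_coeff v \<omega>"
proof (rule fourier_coeff_eqI)
  have neg: "has_mean (\<lambda>t. - fourier_integrand v \<omega> t) (- fourier_coeff v \<omega>)"
    by (rule has_mean_bounded_linear[where v="fourier_integrand v \<omega>", OF bounded_linear_minus[OF bounded_linear_ident]
        AP_UNIV_continuous[OF fourier_integrand_AP[OF v]] fourier_coeff_has_mean[OF v]])
  have "has_mean (\<lambda>t. fourier_integrand u \<omega> t + - fourier_integrand v \<omega> t) (fourier_coeff u \<omega> + - fourier_coeff v \<omega>)"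
    by (rule has_mean_add[OF AP_UNIV_continuous[OF fourier_integrand_AP[OF u]]
        AP_UNIV_continuous[OF AP_UNIV_bounded_linear[OF bounded_linear_minus[OF bounded_linear_ident] fourier_integrand_AP[OF v]]]
        fourier_coeff_has_mean[OF u] neg])
  moreover have "(\<lambda>t. fourier_integrand u \<omega> t + - fourier_integrand v \<omega> t) = fourier_integrand (\<lambda>t. u t - v t) \<omega>"
    by (simp add: fourier_integrand_def[abs_def] scaleR_diff_right)
  ultimately show "has_mean (fourier_integrand (\<lambda>t. u t - v t) \<omega>) (fourier_coeff u \<omega> - fourier_coeff v \<omega>)" by simp
qed

lemma fourier_coeff_translate:
  fixes v :: "real \<Rightarrow> 'a::banach"
  assumes v: "v \<in> AP UNIV"
  shows "fourier_coeff (\<lambda>t. v (t + \<tau>)) \<omega> = cmul (cos (\<omega> * \<tau>)) (sin (\<omega> * \<tau>)) (fourier_coeff v \<omega>)"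
proof (rule fourier_coeff_eqI)
  have m: "has_mean (\<lambda>t. fourier_integrand v \<omega> (t + \<tau>)) (fourier_coeff v \<omega>)"
    by (rule AP_UNIV_mean_translate[OF fourier_integrand_AP[OF v] fourier_coeff_has_mean[OF v]])
  have "cmul (cos (\<omega> * \<tau>)) (sin (\<omega> * \<tau>)) (fourier_integrand v \<omega> (t + \<tau>)) = fourier_integrand (\<lambda>t. v (t + \<tau>)) \<omega> t" for t
  proof -
    have "cos (\<omega> * t) = cos (\<omega> * (t + \<tau>) - \<omega> * \<tau>)" "sin (\<omega> * t) = sin (\<omega> * (t + \<tau>) - \<omega> * \<tau>)"
      by (simp_all add: algebra_simps)
    then have "cos (\<omega> * t) = cos (\<omega> * \<tau>) * cos (\<omega> * (t + \<tau>)) - sin (\<omega> * \<tau>) * - sin (\<omega> * (t + \<tau>))"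
      "- sin (\<omega> * t) = sin (\<omega> * \<tau>) * cos (\<omega> * (t + \<tau>)) + cos (\<omega> * \<tau>) * - sin (\<omega> * (t + \<tau>))"
      by (simp_all add: cos_diff sin_diff)
    then show ?thesis
      by (simp only: cmul_def fourier_integrand_def fst_conv snd_conv scaleR_scaleR scaleR_add_left[symmetric] scaleR_diff_left[symmetric])
  qed
  then have "(\<lambda>t. cmul (cos (\<omega> * \<tau>)) (sin (\<omega> * \<tau>)) (fourier_integrand v \<omega> (t + \<tau>))) = fourier_integrand (\<lambda>t. v (t + \<tau>)) \<omega>"
    by (rule ext)
  then show "has_mean (fourier_integrand (\<lambda>t. v (t + \<tau>)) \<omega>) (cmul (cos (\<omega> * \<tau>)) (sin (\<omega> * \<tau>)) (fourier_coeff v \<omega>))"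
    using has_mean_bounded_linear[OF bounded_linear_cmul AP_UNIV_continuous[OF AP_UNIV_translate[OF fourier_integrand_AP[OF v]]] m]
    by metis
qed

text \<open>The factor 2 comes from bounding the norm of a pair by the sum of the norms of its
  components, with cosine and sine both at most 1 in modulus.\<close>

lemma fourier_coeff_norm_le:
  fixes v :: "real \<Rightarrow> 'a::banach"
  assumes v: "v \<in> AP UNIV" and K: "\<And>t. norm (v t) \<le> K"
  shows "norm (fourier_coeff v \<omega>) \<le> 2 * K"
proof (rule has_mean_norm_le[OF AP_UNIV_continuous[OF fourier_integrand_AP[OF v]] fourier_coeff_has_mean[OF v]])
  fix t
  have "norm (fourier_integrand v \<omega> t) \<le> \<bar>cos (\<omega> * t)\<bar> * norm (v t) + \<bar>sin (\<omega> * t)\<bar> * norm (v t)"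
    using norm_Pair_le[of "cos (\<omega> * t) *\<^sub>R v t" "- sin (\<omega> * t) *\<^sub>R v t"] by (simp add: fourier_integrand_def)
  also have "\<dots> \<le> 1 * K + 1 * K" by (intro add_mono mult_mono K) auto
  finally show "norm (fourier_integrand v \<omega> t) \<le> 2 * K" by simp
qed

section \<open>Uniqueness, compactness of the hull and Bohr neighbourhoods\<close>

text \<open>With enough bounded functionals, vector-valued uniqueness reduces to the scalar theorem.
  The condition is carried as a property of the type and is verified for \<open>L1\<close> by
  explicit functionals.\<close>

definition separated_by_functionals :: "'a::real_normed_vector itself \<Rightarrow> bool"
  where "separated_by_functionals _ \<longleftrightarrow> (\<forall>x::'a. (\<forall>L::'a \<Rightarrow> real. bounded_linear L \<longrightarrow> L x = 0) \<longrightarrow> x = 0)"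

theorem AP_uniqueness:
  fixes v :: "real \<Rightarrow> 'a::banach"
  assumes sep: "separated_by_functionals TYPE('a)" and v: "v \<in> AP UNIV" and z: "\<And>\<omega>. fourier_coeff v \<omega> = 0"
  shows "v t = 0"
proof -
  have "L (v t) = 0" if L: "bounded_linear L" for L :: "'a \<Rightarrow> real"
  proof (rule real_AP_uniqueness[OF AP_UNIV_bounded_linear[OF L v]])
    show "fourier_coeff (\<lambda>t. L (v t)) \<omega> = 0" for \<omega>
      unfolding fourier_coeff_bounded_linear[OF v L] z
      using linear_simps(3)[OF L] by (simp add: zero_prod_def)
  qed
  then show ?thesis using sep unfolding separated_by_functionals_def by blast
qed

lemma uniform_limit_of_AP:
  assumes c: "continuous_on UNIV u" and l: "\<And>\<epsilon>. \<epsilon> > 0 \<Longrightarrow> \<exists>v\<in>AP UNIV. \<forall>t. norm (u t - v t) \<le> \<epsilon>"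
  shows "u \<in> AP UNIV"
proof (rule AP_UNIV_I_totally_bounded[OF c])
  fix \<epsilon> :: real assume e: "\<epsilon> > 0"
  then obtain v where v: "v \<in> AP UNIV" "\<And>t. norm (u t - v t) \<le> \<epsilon> / 3" using l[of "\<epsilon> / 3"] by auto
  obtain F where F: "finite F" "\<And>\<tau>. \<exists>\<sigma>\<in>F. \<forall>t. norm (v (t + \<tau>) - v (t + \<sigma>)) \<le> \<epsilon> / 3"
    by (rule AP_UNIV_translates_totally_bounded[OF v(1), of "\<epsilon> / 3"]) (use e in auto)
  have "norm (u (t + \<tau>) - u (t + \<sigma>)) \<le> \<epsilon>" if "norm (v (t + \<tau>) - v (t + \<sigma>)) \<le> \<epsilon> / 3" for t \<tau> \<sigma>
    using v(2)[of "t + \<tau>"] v(2)[of "t + \<sigma>"] that by norm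
  then show "\<exists>F. finite F \<and> (\<forall>\<tau>. \<exists>\<sigma>\<in>F. \<forall>t. norm (u (t + \<tau>) - u (t + \<sigma>)) \<le> \<epsilon>)"
    using F by meson
qed

text \<open>
  Compactness of the hull: a net of translates whose phases converge to \<open>1\<close> on the spectrum has a
  cluster point with the Fourier coefficients of \<open>v\<close>, which is \<open>v\<close> by uniqueness.
\<close>

theorem Bohr_neighbourhood_in_almost_periods:
  fixes v :: "real \<Rightarrow> 'a::banach"
  assumes sep: "separated_by_functionals TYPE('a)" and v: "v \<in> AP UNIV" and \<delta>: "\<delta> > 0"
  shows "\<exists>F \<eta>. finite F \<and> F \<subseteq> fourier_spectrum v \<and> \<eta> > 0 \<and>
    (\<forall>\<tau>. (\<forall>\<omega>\<in>F. \<bar>cos (\<omega> * \<tau>) - 1\<bar> + \<bar>sin (\<omega> * \<tau>)\<bar> \<le> \<eta>) \<longrightarrow> \<tau> \<in> almost_periods UNIV v \<delta>)"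
proof (rule ccontr)
  assume contra: "\<not> ?thesis"
  define phase where "phase = (\<lambda>\<omega> \<tau>. \<bar>cos (\<omega> * \<tau>) - 1\<bar> + \<bar>sin (\<omega> * \<tau>)\<bar> :: real)"
  have bad: "\<exists>\<tau>. (\<forall>\<omega>\<in>F. phase \<omega> \<tau> \<le> \<eta>) \<and> \<tau> \<notin> almost_periods UNIV v \<delta>"
    if "finite F" "F \<subseteq> fourier_spectrum v" "\<eta> > 0" for F \<eta>
    using contra that unfolding phase_def by blast
  obtain K where K: "\<And>t. norm (v t) \<le> K" using AP_UNIV_bounded[OF v] by blast
  \<comment> \<open>Translates become points of the space of bounded continuous functions, where the
    distance is uniform and total boundedness of the translates means compactness of the hull
    \<open>Hl\<close>.\<close>
  define Tr where "Tr = (\<lambda>\<tau>. Bcontfun (\<lambda>t. v (t + \<tau>)))"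
  have Tr: "apply_bcontfun (Tr \<tau>) t = v (t + \<tau>)" for \<tau> t
    unfolding Tr_def
    by (subst Bcontfun_inverse)
       (auto intro!: bcontfun_normI[of _ K] K AP_UNIV_continuous AP_UNIV_translate v)
  have TrAP: "apply_bcontfun (Tr \<tau>) \<in> AP UNIV" for \<tau>
    using AP_UNIV_translate[OF v, of \<tau>] by (simp add: Tr[abs_def])
  have dist_le: "dist f g \<le> e" if "\<And>t. norm (apply_bcontfun f t - apply_bcontfun g t) \<le> e" for f g :: "real \<Rightarrow>\<^sub>C 'a" and e
    by (rule dist_bound) (use that in \<open>simp add: dist_norm\<close>)
  have le_dist: "norm (apply_bcontfun f t - apply_bcontfun g t) \<le> dist f g" for f g :: "real \<Rightarrow>\<^sub>C 'a" and t
    using dist_bounded[of f t g] by (simp add: dist_norm)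
  define Hl where "Hl = closure (range Tr)"
  have "compact Hl" unfolding compact_eq_totally_bounded
  proof (intro conjI allI impI)
    show "complete Hl" unfolding Hl_def by (simp add: complete_eq_closed)
    fix e :: real assume e: "e > 0"
    then have "e / 3 > 0" by simp
    then obtain F where F: "finite F" "\<And>\<tau>. \<exists>\<sigma>\<in>F. \<forall>t. norm (v (t + \<tau>) - v (t + \<sigma>)) \<le> e / 3"
      using AP_UNIV_translates_totally_bounded[OF v] by metis
    have "Hl \<subseteq> (\<Union>x\<in>Tr ` F. ball x e)"
    proof
      fix u assume "u \<in> Hl"
      then obtain \<tau> where \<tau>: "dist (Tr \<tau>) u < e / 3"
        using e unfolding Hl_def closure_approachable by (metis \<open>e / 3 > 0\<close> rangeE)
      obtain \<sigma> where \<sigma>: "\<sigma> \<in> F" "\<And>t. norm (v (t + \<tau>) - v (t + \<sigma>)) \<le> e / 3" using F(2) by blast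
      have "dist (Tr \<sigma>) (Tr \<tau>) \<le> e / 3"
        using \<sigma>(2) by (intro dist_le) (simp add: Tr norm_minus_commute)
      then have "dist (Tr \<sigma>) u < e" using \<tau> e dist_triangle[of "Tr \<sigma>" u "Tr \<tau>"] by linarith
      then show "u \<in> (\<Union>x\<in>Tr ` F. ball x e)" using \<sigma>(1) by auto
    qed
    then show "\<exists>k. finite k \<and> Hl \<subseteq> (\<Union>x\<in>k. ball x e)" using F(1) by (intro exI[of _ "Tr ` F"]) auto
  qed
  \<comment> \<open>\<open>G p\<close> collects the translates that violate the claim although their
    phases on \<open>fst p\<close> are within \<open>snd p\<close> of 1. Taking unions of frequency
    sets and minima of bounds shows that the closures have the finite intersection property, so they
    share a point \<open>u\<close> of the hull.\<close>
  define G where "G = (\<lambda>p. Tr ` {\<tau>. (\<forall>\<omega>\<in>fst p. phase \<omega> \<tau> \<le> snd p) \<and> \<tau> \<notin> almost_periods UNIV v \<delta>})"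
  define I where "I = {p :: real set \<times> real. finite (fst p) \<and> fst p \<subseteq> fourier_spectrum v \<and> snd p > 0}"
  have "Hl \<inter> \<Inter> ((\<lambda>p. closure (G p)) ` I) \<noteq> {}"
  proof (rule compact_imp_fip_image[OF \<open>compact Hl\<close>])
    fix J assume J: "finite J" "J \<subseteq> I"
    define F where "F = (\<Union>p\<in>J. fst p)"
    \<comment> \<open>The extra 1 covers the empty family.\<close>
    define \<eta> where "\<eta> = Min (insert 1 (snd ` J))"
    have F: "finite F" "F \<subseteq> fourier_spectrum v" using J by (auto simp: F_def I_def)
    have "\<eta> > 0" using J by (auto simp: \<eta>_def I_def)
    then obtain \<tau> where \<tau>: "\<And>\<omega>. \<omega> \<in> F \<Longrightarrow> phase \<omega> \<tau> \<le> \<eta>" "\<tau> \<notin> almost_periods UNIV v \<delta>"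
      using bad[OF F] by blast
    have "Tr \<tau> \<in> closure (G p)" if p: "p \<in> J" for p
    proof -
      have "\<eta> \<le> snd p" using J(1) p by (auto simp: \<eta>_def)
      have "phase \<omega> \<tau> \<le> snd p" if "\<omega> \<in> fst p" for \<omega>
        by (rule order_trans[OF \<tau>(1) \<open>\<eta> \<le> snd p\<close>]) (use that p in \<open>auto simp: F_def\<close>)
      then have "Tr \<tau> \<in> G p" unfolding G_def using \<tau>(2) by simp
      then show ?thesis by (rule subsetD[OF closure_subset])
    qed
    moreover have "Tr \<tau> \<in> Hl" unfolding Hl_def by (rule subsetD[OF closure_subset]) simp
    ultimately show "Hl \<inter> (\<Inter>p\<in>J. closure (G p)) \<noteq> {}" by blast
  qed auto
  then obtain u where u: "\<And>p. p \<in> I \<Longrightarrow> u \<in> closure (G p)" by auto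
  have uAP: "apply_bcontfun u \<in> AP UNIV"
  proof (rule uniform_limit_of_AP)
    show "continuous_on UNIV (apply_bcontfun u)" by (simp add: continuous_on_apply_bcontfun)
    fix \<epsilon> :: real assume "\<epsilon> > 0"
    have "({}, 1) \<in> I" by (simp add: I_def)
    then obtain \<tau> where "dist (Tr \<tau>) u < \<epsilon>" using u \<open>\<epsilon> > 0\<close> unfolding G_def closure_approachable by blast
    then have "norm (apply_bcontfun u t - apply_bcontfun (Tr \<tau>) t) \<le> \<epsilon>" for t
      using le_dist[of u t "Tr \<tau>"] by (simp add: dist_commute)
    then show "\<exists>v\<in>AP UNIV. \<forall>t. norm (apply_bcontfun u t - v t) \<le> \<epsilon>" using TrAP by blast
  qed
  have coeff: "fourier_coeff (apply_bcontfun u) \<omega> = fourier_coeff v \<omega>" for \<omega>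
  proof (rule ccontr)
    define D where "D = norm (fourier_coeff (apply_bcontfun u) \<omega> - fourier_coeff v \<omega>)"
    define k where "k = norm (fourier_coeff v \<omega>)"
    assume "\<not> ?thesis"
    then have D: "D > 0" by (simp add: D_def)
    have k0: "k \<ge> 0" by (simp add: k_def)
    \<comment> \<open>Makes the total error \<open>2 * \<eta> + \<eta> * k\<close> equal to
      \<open>D / 2\<close>: the first summand is due to the distance between \<open>u\<close> and a
      translate, the second to the phase error of that translate.\<close>
    define s where "s = 2 + k"
    have s: "s > 0" using k0 by (simp add: s_def)
    define \<eta> where "\<eta> = D / 2 / s"
    have \<eta>: "\<eta> > 0" using D s by (simp add: \<eta>_def)
    \<comment> \<open>Off the spectrum the coefficient of \<open>v\<close> is zero, and so is that
      of every translate; no phase has to be controlled there.\<close>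
    define F where "F = (if \<omega> \<in> fourier_spectrum v then {\<omega>} else {})"
    have "(F, \<eta>) \<in> I" using \<eta> by (simp add: I_def F_def)
    then obtain \<tau> where \<tau>: "dist (Tr \<tau>) u < \<eta>" "\<forall>\<omega>\<in>F. phase \<omega> \<tau> \<le> \<eta>"
      using u \<eta> unfolding G_def closure_approachable by force
    have "norm (fourier_coeff (\<lambda>t. apply_bcontfun u t - apply_bcontfun (Tr \<tau>) t) \<omega>) \<le> 2 * \<eta>"
      by (rule fourier_coeff_norm_le[OF AP_UNIV_diff[OF uAP TrAP]])
         (use \<tau>(1) order_trans[OF le_dist] in \<open>auto simp: dist_commute less_imp_le\<close>)
    then have 1: "norm (fourier_coeff (apply_bcontfun u) \<omega> - fourier_coeff (apply_bcontfun (Tr \<tau>)) \<omega>) \<le> 2 * \<eta>"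
      by (simp add: fourier_coeff_diff[OF uAP TrAP])
    have "fourier_coeff (apply_bcontfun (Tr \<tau>)) \<omega> = cmul (cos (\<omega> * \<tau>)) (sin (\<omega> * \<tau>)) (fourier_coeff v \<omega>)"
      using fourier_coeff_translate[OF v, of \<tau> \<omega>] by (simp add: Tr[abs_def])
    then have "fourier_coeff (apply_bcontfun (Tr \<tau>)) \<omega> - fourier_coeff v \<omega> = cmul (cos (\<omega> * \<tau>) - 1) (sin (\<omega> * \<tau>)) (fourier_coeff v \<omega>)"
      by (simp add: cmul_def prod_eq_iff algebra_simps)
    then have "norm (fourier_coeff (apply_bcontfun (Tr \<tau>)) \<omega> - fourier_coeff v \<omega>) \<le> phase \<omega> \<tau> * k"
      by (simp only: phase_def k_def norm_cmul)
    also have "\<dots> \<le> \<eta> * k"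
    proof (cases "\<omega> \<in> fourier_spectrum v")
      case True
      then show ?thesis using \<tau>(2) k0 by (intro mult_right_mono) (auto simp: F_def)
    next
      case False
      then show ?thesis by (simp add: fourier_spectrum_def k_def)
    qed
    finally have "D \<le> 2 * \<eta> + \<eta> * k"
      using 1 norm_triangle_ineq[of "fourier_coeff (apply_bcontfun u) \<omega> - fourier_coeff (apply_bcontfun (Tr \<tau>)) \<omega>"
          "fourier_coeff (apply_bcontfun (Tr \<tau>)) \<omega> - fourier_coeff v \<omega>"] by (simp add: D_def)
    also have "\<dots> = \<eta> * s" by (simp add: s_def algebra_simps)
    also have "\<dots> = D / 2" using s by (simp add: \<eta>_def)
    finally show False using D by simp
  qed
  have "apply_bcontfun u t - v t = 0" for t
    by (rule AP_uniqueness[OF sep AP_UNIV_diff[OF uAP v]])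
       (simp add: fourier_coeff_diff[OF uAP v] coeff)
  then have uv: "apply_bcontfun u t = v t" for t by simp
  have "({}, 1) \<in> I" by (simp add: I_def)
  then obtain \<tau> where \<tau>: "dist (Tr \<tau>) u < \<delta>" "\<tau> \<notin> almost_periods UNIV v \<delta>"
    using u \<delta> unfolding G_def closure_approachable by force
  have "norm (v t - v (t + \<tau>)) \<le> \<delta>" for t
    using le_dist[of u t "Tr \<tau>"] \<tau>(1) by (simp add: uv Tr dist_commute)
  then show False using \<tau>(2) by (simp add: almost_periods_def)
qed

section \<open>Integer spans and Kronecker's theorem\<close>

definition int_span :: "real set \<Rightarrow> real set"
  where "int_span F = {\<Sum>\<omega> | \<omega> \<in> F \<and> m \<omega> \<noteq> 0. of_int (m \<omega>) * \<omega> |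
      m :: real \<Rightarrow> int. finite {\<omega>. \<omega> \<in> F \<and> m \<omega> \<noteq> 0}}"

lemma frequency_module_eq: "frequency_module v = int_span (fourier_spectrum v)"
  by (simp add: frequency_module_def int_span_def)

lemma int_span_sum:
  assumes "finite G" "{\<omega>. \<omega> \<in> F \<and> m \<omega> \<noteq> 0} \<subseteq> G" "G \<subseteq> F"
  shows "(\<Sum>\<omega> | \<omega> \<in> F \<and> m \<omega> \<noteq> 0. of_int (m \<omega>) * \<omega>) = (\<Sum>\<omega>\<in>G. of_int (m \<omega>) * (\<omega>::real))"
  by (rule sum.mono_neutral_left) (use assms in auto)

lemma int_spanI:
  assumes "finite G" "G \<subseteq> F"
  shows "(\<Sum>\<omega>\<in>G. of_int (m \<omega>) * \<omega>) \<in> int_span F"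
proof -
  define m' where "m' = (\<lambda>\<omega>. if \<omega> \<in> G then m \<omega> else 0)"
  have sub: "{\<omega>. \<omega> \<in> F \<and> m' \<omega> \<noteq> 0} \<subseteq> G" by (auto simp: m'_def)
  have "(\<Sum>\<omega>\<in>G. of_int (m \<omega>) * \<omega>) = (\<Sum>\<omega>\<in>G. of_int (m' \<omega>) * \<omega>)"
    by (rule sum.cong) (auto simp: m'_def)
  also have "\<dots> = (\<Sum>\<omega> | \<omega> \<in> F \<and> m' \<omega> \<noteq> 0. of_int (m' \<omega>) * \<omega>)"
    by (rule int_span_sum[OF assms(1) sub assms(2), symmetric])
  finally show ?thesis
    unfolding int_span_def using finite_subset[OF sub assms(1)] by blast
qed

lemma int_spanE:
  assumes "x \<in> int_span F"
  obtains G m where "finite G" "G \<subseteq> F" "x = (\<Sum>\<omega>\<in>G. of_int (m \<omega>) * \<omega>)"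
  using assms unfolding int_span_def by (blast intro: that)

lemma int_span_zero: "0 \<in> int_span F"
  using int_spanI[of "{}" F] by simp

lemma int_span_superset: "\<omega> \<in> F \<Longrightarrow> \<omega> \<in> int_span F"
  using int_spanI[of "{\<omega>}" F "\<lambda>_. 1"] by simp

text \<open>The integer factor makes one statement serve for sums, differences and
  multiples.\<close>

lemma int_span_add:
  assumes "x \<in> int_span F" "y \<in> int_span F"
  shows "x + of_int k * y \<in> int_span F"
proof -
  obtain G m where G: "finite G" "G \<subseteq> F" "x = (\<Sum>\<omega>\<in>G. of_int (m \<omega>) * \<omega>)" using assms(1) by (rule int_spanE)
  obtain H n where H: "finite H" "H \<subseteq> F" "y = (\<Sum>\<omega>\<in>H. of_int (n \<omega>) * \<omega>)" using assms(2) by (rule int_spanE)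
  define m' where "m' = (\<lambda>\<omega>. if \<omega> \<in> G then m \<omega> else 0)"
  define n' where "n' = (\<lambda>\<omega>. if \<omega> \<in> H then n \<omega> else 0)"
  have x: "x = (\<Sum>\<omega>\<in>G \<union> H. of_int (m' \<omega>) * \<omega>)"
    unfolding G(3) by (rule sum.mono_neutral_cong_left) (use G H in \<open>auto simp: m'_def\<close>)
  have y: "y = (\<Sum>\<omega>\<in>G \<union> H. of_int (n' \<omega>) * \<omega>)"
    unfolding H(3) by (rule sum.mono_neutral_cong_left) (use G H in \<open>auto simp: n'_def\<close>)
  have "x + of_int k * y = (\<Sum>\<omega>\<in>G \<union> H. of_int (m' \<omega> + k * n' \<omega>) * \<omega>)"
    unfolding x y by (simp add: sum_distrib_left sum.distrib[symmetric] algebra_simps)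
  also have "\<dots> \<in> int_span F" using G H by (intro int_spanI) auto
  finally show ?thesis .
qed

lemma int_span_least:
  assumes "F \<subseteq> int_span F'"
  shows "int_span F \<subseteq> int_span F'"
proof
  fix x assume "x \<in> int_span F"
  then obtain G m where G: "finite G" "G \<subseteq> F" "x = (\<Sum>\<omega>\<in>G. of_int (m \<omega>) * \<omega>)" by (rule int_spanE)
  have "(\<Sum>\<omega>\<in>G. of_int (m \<omega>) * \<omega>) \<in> int_span F'"
    using G(1,2)
  proof induction
    case (insert \<omega> G)
    then show ?case using int_span_add[of "\<Sum>\<omega>\<in>G. of_int (m \<omega>) * \<omega>" F' \<omega> "m \<omega>"] assms
      by (auto simp: add.commute)
  qed (simp add: int_span_zero)
  then show "x \<in> int_span F'" using G(3) by simp
qed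

lemma has_mean_diff_real:
  fixes u v :: "real \<Rightarrow> real"
  assumes "continuous_on UNIV u" "continuous_on UNIV v" "has_mean u m" "has_mean v m'"
  shows "has_mean (\<lambda>t. u t + c * v t) (m + c * m')"
  by (rule has_mean_add[OF assms(1) _ assms(3) has_mean_bounded_linear[OF bounded_linear_mult_right assms(2,4)]])
     (intro continuous_intros assms)

lemma has_mean_cos: "\<omega> \<noteq> 0 \<Longrightarrow> has_mean (\<lambda>t. cos (\<omega> * t)) 0"
  unfolding has_mean_def
proof (rule tendsto_0_le[where K="1 / \<bar>\<omega>\<bar>"])
  assume w: "\<omega> \<noteq> 0"
  show "((\<lambda>T::real. 1 / T) \<longlongrightarrow> 0) at_top" by (rule tendsto_divide_0[OF tendsto_const filterlim_at_top_imp_at_infinity]) (rule filterlim_ident)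
  show "\<forall>\<^sub>F T in at_top. norm ((1 / (2 * T)) *\<^sub>R integral {- T..T} (\<lambda>t. cos (\<omega> * t))) \<le> norm (1 / T) * (1 / \<bar>\<omega>\<bar>)"
    using eventually_gt_at_top[of 0]
  proof eventually_elim
    case (elim T)
    have "((\<lambda>t. cos (\<omega> * t)) has_integral (sin (\<omega> * T) / \<omega> - sin (\<omega> * - T) / \<omega>)) {- T..T}"
      by (rule fundamental_theorem_of_calculus)
         (use w elim in \<open>auto intro!: derivative_eq_intros simp: has_real_derivative_iff_has_vector_derivative[symmetric]\<close>)
    then have "integral {- T..T} (\<lambda>t. cos (\<omega> * t)) = 2 * (sin (\<omega> * T) / \<omega>)"
      by (simp add: integral_unique)
    then have "norm ((1 / (2 * T)) *\<^sub>R integral {- T..T} (\<lambda>t. cos (\<omega> * t))) = \<bar>sin (\<omega> * T)\<bar> * (1 / (T * \<bar>\<omega>\<bar>))"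
      using elim by (simp add: abs_mult)
    also have "\<dots> \<le> 1 * (1 / (T * \<bar>\<omega>\<bar>))" using elim by (intro mult_right_mono) auto
    finally show ?case using elim by simp
  qed
qed

text \<open>A substitute for having all frequencies in \<open>G\<close> that is easily propagated
  through products; cosines suffice as test functions because the kernel is only integrated against
  \<open>cos (\<zeta> * t)\<close>.\<close>

definition avoids :: "real set \<Rightarrow> (real \<Rightarrow> real) \<Rightarrow> bool"
  where "avoids G p \<longleftrightarrow> p \<in> AP UNIV \<and> (\<forall>\<zeta>. \<zeta> \<notin> G \<longrightarrow> has_mean (\<lambda>t. p t * cos (\<zeta> * t)) 0)"

lemma AP_UNIV_mult:
  fixes u v :: "real \<Rightarrow> real"
  shows "u \<in> AP UNIV \<Longrightarrow> v \<in> AP UNIV \<Longrightarrow> (\<lambda>t. u t * v t) \<in> AP UNIV"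
  by (rule AP_UNIV_bilinear[OF bounded_bilinear_mult])

text \<open>Multiplication by \<open>cos (\<omega> * t)\<close> replaces the test frequency
  \<open>\<zeta>\<close> by \<open>\<zeta> + \<omega>\<close> and \<open>\<zeta> - \<omega>\<close>,
  and both stay outside the span since \<open>\<omega>\<close> lies in it.\<close>

lemma avoids_step:
  assumes p: "avoids (int_span F) p" and \<omega>: "\<omega> \<in> F"
  shows "avoids (int_span F) (\<lambda>t. p t * ((1 + cos (\<omega> * t)) / 2))"
  unfolding avoids_def
proof (intro conjI allI impI)
  have pA: "p \<in> AP UNIV" using p by (simp add: avoids_def)
  have "(\<lambda>t. (1 + cos (\<omega> * t)) / 2) \<in> AP UNIV"
    using AP_UNIV_bounded_linear[OF bounded_linear_divide[of 2] AP_UNIV_add[OF AP_UNIV_const[of 1] AP_UNIV_cos[of \<omega>]]] .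
  then show "(\<lambda>t. p t * ((1 + cos (\<omega> * t)) / 2)) \<in> AP UNIV" by (rule AP_UNIV_mult[OF pA])
  fix \<zeta> assume l: "\<zeta> \<notin> int_span F"
  have l1: "\<zeta> + \<omega> \<notin> int_span F" "\<zeta> - \<omega> \<notin> int_span F"
    using int_span_add[of "\<zeta> + \<omega>" F \<omega> "-1"] int_span_add[of "\<zeta> - \<omega>" F \<omega> 1] int_span_superset[OF \<omega>] l by auto
  have m: "has_mean (\<lambda>t. p t * cos (\<nu> * t)) 0" if "\<nu> \<notin> int_span F" for \<nu> using p that by (simp add: avoids_def)
  have c: "continuous_on UNIV (\<lambda>t. p t * cos (\<nu> * t))" for \<nu>
    by (intro AP_UNIV_continuous AP_UNIV_mult pA AP_UNIV_cos)
  have h: "has_mean (\<lambda>t. (1/2) * (p t * cos (\<zeta> * t))) (1/2 * 0)"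
    by (rule has_mean_bounded_linear[OF bounded_linear_mult_right c m[OF l]])
  have "has_mean (\<lambda>t. ((1/2) * (p t * cos (\<zeta> * t)) + (1/4) * (p t * cos ((\<zeta> + \<omega>) * t))) + (1/4) * (p t * cos ((\<zeta> - \<omega>) * t))) ((1/2 * 0 + (1/4) * 0) + (1/4) * 0)"
    by (intro has_mean_diff_real c h m l1 continuous_intros)
  moreover have "((1/2) * (p t * cos (\<zeta> * t)) + (1/4) * (p t * cos ((\<zeta> + \<omega>) * t))) + (1/4) * (p t * cos ((\<zeta> - \<omega>) * t))
      = p t * ((1 + cos (\<omega> * t)) / 2) * cos (\<zeta> * t)" for t
  proof -
    have "cos ((\<zeta> + \<omega>) * t) + cos ((\<zeta> - \<omega>) * t) = 2 * cos (\<omega> * t) * cos (\<zeta> * t)"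
      by (simp add: distrib_right left_diff_distrib cos_add cos_diff)
    then have "p t * (cos ((\<zeta> + \<omega>) * t) + cos ((\<zeta> - \<omega>) * t)) = p t * (2 * cos (\<omega> * t) * cos (\<zeta> * t))" by simp
    then show ?thesis by (simp add: algebra_simps)
  qed
  ultimately show "has_mean (\<lambda>t. p t * ((1 + cos (\<omega> * t)) / 2) * cos (\<zeta> * t)) 0"
    by (simp only: mult_zero_right add_0_right)
qed

lemma avoids_kernel:
  assumes "finite G" "G \<subseteq> F"
  shows "avoids (int_span F) (\<lambda>t. (\<Prod>\<omega>\<in>G. (1 + cos (\<omega> * t)) / 2) ^ M)"
proof -
  have p1: "avoids (int_span F) (\<lambda>t. p t * (\<Prod>\<omega>\<in>G. (1 + cos (\<omega> * t)) / 2))" if "avoids (int_span F) p" for p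
    using assms that
  proof (induction arbitrary: p)
    case (insert \<omega> G)
    then have "avoids (int_span F) (\<lambda>t. (p t * ((1 + cos (\<omega> * t)) / 2)) * (\<Prod>\<omega>\<in>G. (1 + cos (\<omega> * t)) / 2))"
      by (intro insert.IH avoids_step) auto
    then show ?case using insert.hyps by (simp add: mult_ac)
  qed simp
  show ?thesis
  proof (induction M)
    case 0
    show ?case unfolding avoids_def
    proof (intro conjI allI impI)
      fix \<zeta> assume "\<zeta> \<notin> int_span F"
      then have "\<zeta> \<noteq> 0" using int_span_zero by metis
      then show "has_mean (\<lambda>t. (\<Prod>\<omega>\<in>G. (1 + cos (\<omega> * t)) / 2) ^ 0 * cos (\<zeta> * t)) 0"
        using has_mean_cos by simp
    qed (simp add: AP_UNIV_const)
  next
    case (Suc M)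
    from p1[OF this] show ?case by (simp add: mult.commute)
  qed
qed

text \<open>
  The kernel \<open>q\<^sup>M\<close>, \<open>q = \<Prod> (1 + cos \<omega>t)/2\<close>, has frequencies in the span of \<open>G\<close> only, so it cannot
  correlate with \<open>cos \<lambda>t\<close>; for large \<open>M\<close> it lives on the Bohr set of \<open>G\<close>.
\<close>

theorem Kronecker_separation:
  fixes \<zeta> :: real
  assumes G: "finite G" and \<zeta>: "\<zeta> \<notin> int_span G" and \<kappa>0: "0 < \<kappa>0"
  shows "\<exists>\<tau>. (\<forall>\<omega>\<in>G. 1 - cos (\<omega> * \<tau>) \<le> \<kappa>0) \<and> 1 / 2 \<le> 1 - cos (\<zeta> * \<tau>)"
proof (rule ccontr)
  assume "\<not> ?thesis"
  then have no: "1 - cos (\<zeta> * \<tau>) < 1 / 2" if "\<forall>\<omega>\<in>G. 1 - cos (\<omega> * \<tau>) \<le> \<kappa>0" for \<tau>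
    using that by (meson not_le)
  \<comment> \<open>Off the Bohr set one factor of \<open>q\<close> is at most
    \<open>1 - \<kappa>0 / 2 \<le> 1 - \<kappa>\<close>; the bound \<open>1 / 2\<close> keeps the
    bases of the powers positive.\<close>
  define \<kappa> where "\<kappa> = min (\<kappa>0 / 2) (1 / 2)"
  have \<kappa>: "0 < \<kappa>" "\<kappa> < 1" "\<kappa> \<le> \<kappa>0 / 2" using \<kappa>0 by (auto simp: \<kappa>_def)
  define q where "q = (\<lambda>t. \<Prod>\<omega>\<in>G. (1 + cos (\<omega> * t)) / 2)"
  have fac: "0 \<le> (1 + cos (\<omega> * t)) / 2" "(1 + cos (\<omega> * t)) / 2 \<le> 1" for \<omega> t :: real
  proof -
    have "0 \<le> (1 + c) / 2 \<and> (1 + c) / 2 \<le> 1" if "- 1 \<le> c" "c \<le> 1" for c :: real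
      using that by simp
    from this[OF cos_ge_minus_one cos_le_one, of "\<omega> * t"]
    show "0 \<le> (1 + cos (\<omega> * t)) / 2" "(1 + cos (\<omega> * t)) / 2 \<le> 1" by auto
  qed
  have q01: "0 \<le> q t" "q t \<le> 1" for t
    unfolding q_def by (auto intro!: prod_nonneg prod_le_1 fac)
  have q_off: "q t \<le> 1 - \<kappa>" if off: "\<not> (\<forall>\<omega>\<in>G. 1 - cos (\<omega> * t) \<le> \<kappa>0)" for t
  proof -
    obtain \<omega> where w: "\<omega> \<in> G" "\<kappa>0 < 1 - cos (\<omega> * t)" using off by (meson not_le)
    have "q t = (1 + cos (\<omega> * t)) / 2 * (\<Prod>\<omega>\<in>G - {\<omega>}. (1 + cos (\<omega> * t)) / 2)"
      unfolding q_def by (rule prod.remove[OF G w(1)])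
    also have "\<dots> \<le> (1 + cos (\<omega> * t)) / 2 * 1"
      by (intro mult_left_mono prod_le_1 fac conjI)
    finally show ?thesis using w(2) \<kappa> by simp
  qed
  have av: "avoids (int_span G) (\<lambda>t. q t ^ M)" for M
    unfolding q_def by (rule avoids_kernel[OF G order_refl])
  have qA: "(\<lambda>t. q t ^ M) \<in> AP UNIV" for M using av by (simp add: avoids_def)
  \<comment> \<open>A tent over the set where \<open>q\<close> exceeds
    \<open>1 - \<kappa> / 2\<close>, with values between 0 and 1. It bounds \<open>q t ^ M\<close>
    from below by \<open>(1 - \<kappa> / 2) ^ M * r t\<close> and has positive mean since
    \<open>q 0 = 1\<close>.\<close>
  define r where "r = (\<lambda>t. max 0 (q t - (1 - \<kappa> / 2)) / (\<kappa> / 2))"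
  have rA: "r \<in> AP UNIV"
  proof -
    have "(\<lambda>t. (\<lambda>x. max 0 (x - (1 - \<kappa> / 2)) / (\<kappa> / 2)) (q t)) \<in> AP UNIV"
    proof (rule AP_UNIV_real_compose_Lipschitz[where K="1 / (\<kappa> / 2)" and D=q and g="\<lambda>x. max 0 (x - (1 - \<kappa> / 2)) / (\<kappa> / 2)"])
      show "q \<in> AP UNIV" using qA[of 1] by simp
      fix x y :: real
      have scale: "\<bar>X / d - Y / d\<bar> \<le> 1 / d * z" if "\<bar>X - Y\<bar> \<le> z" "d > 0" for X Y z d :: real
        using that by (simp add: diff_divide_distrib[symmetric] divide_right_mono)
      have "\<bar>max 0 (x - (1 - \<kappa> / 2)) - max 0 (y - (1 - \<kappa> / 2))\<bar> \<le> \<bar>x - y\<bar>" by (auto simp: max_def abs_if)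
      then show "\<bar>max 0 (x - (1 - \<kappa> / 2)) / (\<kappa> / 2) - max 0 (y - (1 - \<kappa> / 2)) / (\<kappa> / 2)\<bar> \<le> 1 / (\<kappa> / 2) * \<bar>x - y\<bar>"
        by (rule scale) (use \<kappa> in simp)
    qed (use \<kappa> in simp)
    then show ?thesis by (simp add: r_def)
  qed
  obtain \<rho> where \<rho>: "has_mean r \<rho>" using AP_UNIV_mean_real_exists[OF rA] by blast
  have "q 0 = 1" by (simp add: q_def)
  then have "r 0 = 1" using \<kappa> by (simp add: r_def)
  then have r0: "r 0 > 0" by simp
  have "r t \<ge> 0" for t using \<kappa> by (simp add: r_def)
  then have \<rho>0: "\<rho> > 0" by (rule AP_UNIV_mean_pos[OF rA _ r0 \<rho>])
  \<comment> \<open>The mean \<open>m\<close> of \<open>q t ^ M\<close> is also the mean of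
    \<open>q t ^ M * (1 - cos (\<zeta> * t))\<close>. On the Bohr set the second factor is below
    \<open>1 / 2\<close> by assumption, so half of \<open>m\<close> is absorbed; off it
    \<open>q t ^ M\<close> is at most \<open>(1 - \<kappa>) ^ M\<close>. The resulting upper bound
    for \<open>m\<close> loses geometrically against the lower bound by \<open>r\<close>.\<close>
  have key: "\<rho> * (1 - \<kappa> / 2) ^ M \<le> 4 * (1 - \<kappa>) ^ M" for M
  proof -
    obtain m where m: "has_mean (\<lambda>t. q t ^ M) m" using AP_UNIV_mean_real_exists[OF qA] by blast
    have c: "continuous_on UNIV (\<lambda>t. q t ^ M)" by (rule AP_UNIV_continuous[OF qA])
    have cc: "continuous_on UNIV (\<lambda>t. q t ^ M * cos (\<zeta> * t))" by (intro continuous_intros c)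
    have z: "has_mean (\<lambda>t. q t ^ M * cos (\<zeta> * t)) 0" using av[of M] \<zeta> by (simp add: avoids_def)
    have "has_mean (\<lambda>t. q t ^ M + (-1) * (q t ^ M * cos (\<zeta> * t))) (m + (-1) * 0)"
      by (rule has_mean_diff_real[OF c cc m z])
    then have m1: "has_mean (\<lambda>t. q t ^ M * (1 - cos (\<zeta> * t))) m" by (simp add: algebra_simps)
    have m2: "has_mean (\<lambda>t. 2 * (1 - \<kappa>) ^ M + 1 / 2 * (q t ^ M)) (2 * (1 - \<kappa>) ^ M + 1 / 2 * m)"
      by (rule has_mean_diff_real[OF continuous_on_const c has_mean_const m])
    have "m \<le> 2 * (1 - \<kappa>) ^ M + 1 / 2 * m"
    proof (rule has_mean_le[OF _ _ m1 m2])
      fix t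
      show "q t ^ M * (1 - cos (\<zeta> * t)) \<le> 2 * (1 - \<kappa>) ^ M + 1 / 2 * (q t ^ M)"
      proof (cases "\<forall>\<omega>\<in>G. 1 - cos (\<omega> * t) \<le> \<kappa>0")
        case True
        have "q t ^ M * (1 - cos (\<zeta> * t)) \<le> q t ^ M * (1 / 2)"
          using no[OF True] q01 by (intro mult_left_mono) auto
        moreover have "0 \<le> 2 * (1 - \<kappa>) ^ M" using \<kappa> by simp
        ultimately show ?thesis by simp
      next
        case False
        have "q t ^ M * (1 - cos (\<zeta> * t)) \<le> (1 - \<kappa>) ^ M * 2"
          using q_off[OF False] q01[of t] \<kappa> cos_ge_minus_one[of "\<zeta> * t"] cos_le_one[of "\<zeta> * t"]
          by (intro mult_mono power_mono) auto
        moreover have "0 \<le> q t ^ M" using q01 by simp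
        ultimately show ?thesis by simp
      qed
    qed (intro continuous_intros c)+
    then have mu: "m \<le> 4 * (1 - \<kappa>) ^ M" by simp
    have m3: "has_mean (\<lambda>t. (1 - \<kappa> / 2) ^ M * r t) ((1 - \<kappa> / 2) ^ M * \<rho>)"
      by (rule has_mean_bounded_linear[OF bounded_linear_mult_right AP_UNIV_continuous[OF rA] \<rho>])
    have "(1 - \<kappa> / 2) ^ M * \<rho> \<le> m"
    proof (rule has_mean_le[OF _ c m3 m])
      fix t
      show "(1 - \<kappa> / 2) ^ M * r t \<le> q t ^ M"
      proof (cases "q t \<le> 1 - \<kappa> / 2")
        case True
        then show ?thesis using q01[of t] by (simp add: r_def)
      next
        case False
        have "max 0 (q t - (1 - \<kappa> / 2)) \<le> \<kappa> / 2"
          using q01(2)[of t] \<kappa> by (intro max.boundedI) auto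
        then have "r t \<le> 1" using \<kappa> by (simp add: r_def pos_divide_le_eq)
        then have "(1 - \<kappa> / 2) ^ M * r t \<le> (1 - \<kappa> / 2) ^ M * 1" using \<kappa> by (intro mult_left_mono) auto
        also have "\<dots> \<le> q t ^ M" using False \<kappa> by (simp add: power_mono)
        finally show ?thesis .
      qed
    qed (intro continuous_intros AP_UNIV_continuous rA)
    then show ?thesis using mu by (simp add: mult.commute)
  qed
  define b where "b = (1 - \<kappa>) / (1 - \<kappa> / 2)"
  have b: "0 \<le> b" "b < 1" using \<kappa> by (auto simp: b_def)
  have "\<rho> \<le> 4 * b ^ M" for M
  proof -
    have "(1 - \<kappa> / 2) ^ M > 0" using \<kappa> by simp
    then have "\<rho> \<le> 4 * (1 - \<kappa>) ^ M / (1 - \<kappa> / 2) ^ M" using key[of M] by (simp add: pos_le_divide_eq)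
    then show ?thesis by (simp add: b_def power_divide)
  qed
  moreover have "(\<lambda>M. 4 * b ^ M) \<longlonglongrightarrow> 4 * 0" using b by (intro tendsto_intros LIMSEQ_power_zero) auto
  ultimately have "\<rho> \<le> 0" by (intro tendsto_lowerbound[of "\<lambda>M. 4 * b ^ M" _ sequentially]) auto
  then show False using \<rho>0 by simp
qed

theorem frequency_module_mono:
  fixes u :: "real \<Rightarrow> 'a::banach" and v :: "real \<Rightarrow> 'b::banach"
  assumes sep: "separated_by_functionals TYPE('b)" and u: "u \<in> AP UNIV" and v: "v \<in> AP UNIV"
    and per: "\<And>\<epsilon>. \<epsilon> > 0 \<Longrightarrow> \<exists>\<delta>>0. almost_periods UNIV v \<delta> \<subseteq> almost_periods UNIV u \<epsilon>"
  shows "frequency_module u \<subseteq> frequency_module v"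
  unfolding frequency_module_eq
proof (rule int_span_least, rule ccontr)
  assume "\<not> fourier_spectrum u \<subseteq> int_span (fourier_spectrum v)"
  then obtain \<zeta> where \<zeta>: "\<zeta> \<in> fourier_spectrum u" "\<zeta> \<notin> int_span (fourier_spectrum v)" by blast
  define k where "k = norm (fourier_coeff u \<zeta>)"
  have k: "k > 0" using \<zeta>(1) by (simp add: fourier_spectrum_def k_def)
  \<comment> \<open>The final estimate reads \<open>k \<le> 6 * \<epsilon>\<close>, which
    \<open>k / 8\<close> contradicts.\<close>
  define \<epsilon> where "\<epsilon> = k / 8"
  have \<epsilon>: "\<epsilon> > 0" using k by (simp add: \<epsilon>_def)
  obtain \<delta> where \<delta>: "\<delta> > 0" "almost_periods UNIV v \<delta> \<subseteq> almost_periods UNIV u \<epsilon>" using per[OF \<epsilon>] by blast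
  obtain F \<eta> where F: "finite F" "F \<subseteq> fourier_spectrum v" "\<eta> > 0"
    "\<And>\<tau>. (\<forall>\<omega>\<in>F. \<bar>cos (\<omega> * \<tau>) - 1\<bar> + \<bar>sin (\<omega> * \<tau>)\<bar> \<le> \<eta>) \<Longrightarrow> \<tau> \<in> almost_periods UNIV v \<delta>"
    using Bohr_neighbourhood_in_almost_periods[OF sep v \<delta>(1)] by blast
  have nF: "\<zeta> \<notin> int_span F"
  proof
    assume "\<zeta> \<in> int_span F"
    moreover have "int_span F \<subseteq> int_span (fourier_spectrum v)"
      using F(2) int_span_superset by (intro int_span_least) blast
    ultimately show False using \<zeta>(2) by blast
  qed
  \<comment> \<open>From \<open>1 - cos \<le> \<kappa>\<close> follows
    \<open>sin\<^sup>2 \<le> 2 * \<kappa>\<close>; the two entries of the minimum leave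
    \<open>\<eta> / 2\<close> for the cosine and for the sine.\<close>
  define \<kappa> where "\<kappa> = min (\<eta> / 2) (\<eta>\<^sup>2 / 8)"
  have \<kappa>: "\<kappa> > 0" using F(3) by (simp add: \<kappa>_def)
  obtain \<tau> where \<tau>: "\<And>\<omega>. \<omega> \<in> F \<Longrightarrow> 1 - cos (\<omega> * \<tau>) \<le> \<kappa>" "1 / 2 \<le> 1 - cos (\<zeta> * \<tau>)"
    using Kronecker_separation[OF F(1) nF \<kappa>] by blast
  have "\<bar>cos (\<omega> * \<tau>) - 1\<bar> + \<bar>sin (\<omega> * \<tau>)\<bar> \<le> \<eta>" if w: "\<omega> \<in> F" for \<omega>
  proof -
    define c where "c = cos (\<omega> * \<tau>)"
    have c: "- 1 \<le> c" "c \<le> 1" "1 - c \<le> \<kappa>" using \<tau>(1)[OF w] by (auto simp: c_def)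
    have "(sin (\<omega> * \<tau>))\<^sup>2 = (1 - c) * (1 + c)"
      using sin_cos_squared_add[of "\<omega> * \<tau>"] by (simp add: c_def power2_eq_square algebra_simps)
    also have "\<dots> \<le> \<kappa> * 2" using c \<kappa> by (intro mult_mono) auto
    also have "\<dots> \<le> (\<eta> / 2)\<^sup>2" by (simp add: \<kappa>_def power_divide min_def)
    finally have "\<bar>sin (\<omega> * \<tau>)\<bar> \<le> \<eta> / 2" by (subst (asm) power2_le_iff_abs_le) (use F(3) in auto)
    moreover have "\<bar>c - 1\<bar> \<le> \<eta> / 2" using c by (simp add: \<kappa>_def)
    ultimately show ?thesis by (simp add: c_def)
  qed
  then have "\<tau> \<in> almost_periods UNIV u \<epsilon>" using F(4) \<delta>(2) by blast
  then have per_u: "norm (u (t + \<tau>) - u t) \<le> \<epsilon>" for t by (simp add: almost_periods_def norm_minus_commute)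
  define \<alpha> where "\<alpha> = cos (\<zeta> * \<tau>) - 1"
  define \<beta> where "\<beta> = sin (\<zeta> * \<tau>)"
  have "norm (fourier_coeff (\<lambda>t. u (t + \<tau>) - u t) \<zeta>) \<le> 2 * \<epsilon>"
    by (rule fourier_coeff_norm_le[OF AP_UNIV_diff[OF AP_UNIV_translate[OF u] u] per_u])
  also have "fourier_coeff (\<lambda>t. u (t + \<tau>) - u t) \<zeta> = cmul \<alpha> \<beta> (fourier_coeff u \<zeta>)"
    by (simp add: fourier_coeff_diff[OF AP_UNIV_translate[OF u] u] fourier_coeff_translate[OF u]
        cmul_def \<alpha>_def \<beta>_def prod_eq_iff algebra_simps)
  finally have small: "norm (cmul \<alpha> \<beta> (fourier_coeff u \<zeta>)) \<le> 2 * \<epsilon>" .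
  \<comment> \<open>The squared modulus of \<open>exp (i \<zeta> \<tau>) - 1\<close>, at least 1 by
    the choice of \<open>\<tau>\<close>.\<close>
  have ab: "\<alpha>\<^sup>2 + \<beta>\<^sup>2 = 2 * (1 - cos (\<zeta> * \<tau>))"
    using sin_cos_squared_add[of "\<zeta> * \<tau>"] by (simp add: \<alpha>_def \<beta>_def power2_eq_square algebra_simps)
  have "\<bar>\<alpha>\<bar> + \<bar>\<beta>\<bar> \<le> 3"
    using cos_ge_minus_one[of "\<zeta> * \<tau>"] cos_le_one[of "\<zeta> * \<tau>"] abs_sin_le_one[of "\<zeta> * \<tau>"] unfolding \<alpha>_def \<beta>_def by linarith
  have "1 * k \<le> (\<alpha>\<^sup>2 + \<beta>\<^sup>2) * k" unfolding ab using \<tau>(2) k by (intro mult_right_mono) auto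
  also have "\<dots> \<le> (\<bar>\<alpha>\<bar> + \<bar>\<beta>\<bar>) * norm (cmul \<alpha> \<beta> (fourier_coeff u \<zeta>))" unfolding k_def by (rule norm_cmul_lower)
  also have "\<dots> \<le> 3 * (2 * \<epsilon>)" using small \<open>\<bar>\<alpha>\<bar> + \<bar>\<beta>\<bar> \<le> 3\<close> by (intro mult_mono) auto
  finally show False using k by (simp add: \<epsilon>_def)
qed

section \<open>Lyapunov functions\<close>

lemma scaleR_complex_vector: "r *\<^sub>R v = complex_of_real r *s v" for v :: "complex^'n"
  by (subst vec_eq_iff) (simp add: scaleR_complex.ctr complex_eq_iff)

lemma shifted_matrix_smult: "M *v (c *s v) - z *s (c *s v) = c *s (M *v v - z *s v)"
  for M :: "complex^'n^'n"
  by (simp add: vector_scalar_commute vec_eq_iff algebra_simps)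

text \<open>The product of the factors \<open>M - z\<close>, applied to a vector. Acting on vectors
  keeps products of matrices out of the way.\<close>

primrec factor_chain :: "complex^'n^'n \<Rightarrow> complex list \<Rightarrow> complex^'n \<Rightarrow> complex^'n" where
  "factor_chain M [] v = v"
| "factor_chain M (z # zs) v = factor_chain M zs (M *v v - z *s v)"

lemma factor_chain_add: "factor_chain M zs (u + v) = factor_chain M zs u + factor_chain M zs v"
proof (induction zs arbitrary: u v)
  case (Cons z zs)
  have "M *v (u + v) - z *s (u + v) = (M *v u - z *s u) + (M *v v - z *s v)"
    by (simp add: matrix_vector_right_distrib vector_add_ldistrib)
  then show ?case by (simp only: factor_chain.simps Cons)
qed simp

lemma factor_chain_smult: "factor_chain M zs (c *s v) = c *s factor_chain M zs v"
proof (induction zs arbitrary: v)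
  case (Cons z zs)
  then show ?case by (simp only: factor_chain.simps shifted_matrix_smult)
qed simp

lemma factor_chain_diff: "factor_chain M zs (u - v) = factor_chain M zs u - factor_chain M zs v"
  using factor_chain_add[of M zs "u - v" v] by (simp add: algebra_simps)

lemma factor_chain_zero [simp]: "factor_chain M zs 0 = 0"
  using factor_chain_smult[of M zs 0 0] by simp

lemma factor_chain_commute: "factor_chain M zs (M *v v) = M *v factor_chain M zs v"
proof (induction zs arbitrary: v)
  case (Cons z zs)
  have "M *v (M *v v) - z *s (M *v v) = M *v (M *v v - z *s v)"
    by (simp add: matrix_vector_mult_diff_distrib vector_scalar_commute)
  then show ?case by (simp only: factor_chain.simps Cons)
qed simp

lemma factor_chain_append: "factor_chain M (xs @ ys) v = factor_chain M ys (factor_chain M xs v)"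
  by (induction xs arbitrary: v) simp_all

lemma factor_chain_swap: "factor_chain M xs (factor_chain M ys v) = factor_chain M ys (factor_chain M xs v)"
  by (induction ys arbitrary: v)
     (simp_all add: factor_chain_diff factor_chain_smult factor_chain_commute)

text \<open>The vector \<open>p(M) v\<close>, computed by recursion on the coefficients of
  \<open>p\<close>.\<close>

definition poly_act :: "complex^'n^'n \<Rightarrow> complex poly \<Rightarrow> complex^'n \<Rightarrow> complex^'n"
  where "poly_act M p = fold_coeffs (\<lambda>a g v. a *s v + g (M *v v)) p (\<lambda>_. 0)"

lemma poly_act_0 [simp]: "poly_act M 0 v = 0"
  by (simp add: poly_act_def)

lemma poly_act_pCons [simp]: "poly_act M (pCons a p) v = a *s v + poly_act M p (M *v v)"
  by (cases "a = 0 \<and> p = 0") (auto simp: poly_act_def fold_coeffs_pCons_coeff_not_0_eq fold_coeffs_pCons_not_0_0_eq)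

lemma poly_act_add: "poly_act M (p + q) v = poly_act M p v + poly_act M q v"
  by (induction p q arbitrary: v rule: poly_induct2) (simp_all add: vector_sadd_rdistrib algebra_simps)

lemma poly_act_smult: "poly_act M (smult c p) v = c *s poly_act M p v"
  by (induction p arbitrary: v) (simp_all add: vector_add_ldistrib)

lemma poly_act_diff: "poly_act M (p - q) v = poly_act M p v - poly_act M q v"
  using poly_act_add[of M "p - q" q v] by simp

lemma poly_act_vector_add: "poly_act M p (u + v) = poly_act M p u + poly_act M p v"
  by (induction p arbitrary: u v) (simp_all add: vector_add_ldistrib matrix_vector_right_distrib algebra_simps)

lemma poly_act_vector_smult: "poly_act M p (c *s v) = c *s poly_act M p v"
  by (induction p arbitrary: v) (simp_all add: vector_add_ldistrib vector_scalar_commute mult.commute)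

lemma poly_act_linear_factor: "poly_act M ([:- z, 1:] * p) v = poly_act M p (M *v v - z *s v)"
proof -
  have "poly_act M p (M *v v + (- z) *s v) = poly_act M p (M *v v) + (- z) *s poly_act M p v"
    by (simp only: poly_act_vector_add poly_act_vector_smult)
  moreover have "M *v v + (- z) *s v = M *v v - z *s v" by (simp add: vec_eq_iff)
  ultimately show ?thesis by (simp add: poly_act_add poly_act_diff poly_act_smult)
qed

lemma poly_act_monom: "poly_act M (monom c i) v = c *s (((*v) M) ^^ i) v"
  by (induction i arbitrary: v) (simp_all add: monom_0 monom_Suc funpow_swap1)

lemma poly_act_sum: "poly_act M (\<Sum>i\<in>I. p i) v = (\<Sum>i\<in>I. poly_act M (p i) v)"
  by (induction I rule: infinite_finite_induct) (simp_all add: poly_act_add)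

text \<open>The iterates of \<open>v\<close> under \<open>M\<close> up to the real dimension are too
  many to be independent, and the real coefficients of a dependence give the polynomial. If two
  iterates coincide, a difference of two monomials does.\<close>

lemma exists_annihilating_poly: "\<exists>p. p \<noteq> 0 \<and> poly_act M p v = 0"
proof -
  define w where "w = (\<lambda>i. (((*v) M) ^^ i) v)"
  define N where "N = DIM(complex^'a)"
  show ?thesis
  proof (cases "inj_on w {..N}")
    case False
    then obtain i j where ij: "i \<noteq> j" "w i = w j" by (auto simp: inj_on_def)
    have "coeff (monom 1 i + monom (- 1) j :: complex poly) i = 1" using ij by simp
    then have "monom 1 i + monom (- 1) j \<noteq> (0 :: complex poly)" by (metis coeff_0 zero_neq_one)
    moreover have "poly_act M (monom 1 i + monom (- 1) j) v = 0"
      using ij(2) by (simp add: poly_act_add poly_act_monom w_def vec_eq_iff)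
    ultimately show ?thesis by blast
  next
    case True
    then have "card (w ` {..N}) = N + 1" by (simp add: card_image)
    then have "dependent (w ` {..N})"
      by (intro dependent_biggerset) (auto simp: N_def)
    then obtain u where u: "\<exists>y\<in>w ` {..N}. u y \<noteq> 0" "(\<Sum>y\<in>w ` {..N}. u y *\<^sub>R y) = 0"
      by (subst (asm) dependent_finite) auto
    define p where "p = (\<Sum>i\<le>N. monom (complex_of_real (u (w i))) i)"
    obtain i where i: "i \<le> N" "u (w i) \<noteq> 0" using u(1) by auto
    have "coeff p i = of_real (u (w i))"
      using i(1) by (simp add: p_def coeff_sum sum.delta if_distrib cong: if_cong)
    with i(2) have "p \<noteq> 0" by auto
    moreover have "poly_act M p v = (\<Sum>i\<le>N. u (w i) *\<^sub>R w i)"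
      by (simp add: p_def poly_act_sum poly_act_monom w_def scaleR_complex_vector)
    then have "poly_act M p v = 0"
      using u(2) True by (simp add: sum.reindex)
    ultimately show ?thesis by blast
  qed
qed

definition eigval :: "complex^'n^'n \<Rightarrow> complex \<Rightarrow> bool"
  where "eigval M z \<longleftrightarrow> (\<exists>v. v \<noteq> 0 \<and> M *v v = z *s v)"

lemma annihilating_factors_of_poly:
  assumes "p \<noteq> 0" "poly_act M p v = 0"
  shows "\<exists>zs. (\<forall>z\<in>set zs. eigval M z) \<and> factor_chain M zs v = 0"
  using assms
proof (induction "degree p" arbitrary: p v)
  case 0
  then obtain a where "p = [:a:]" "a \<noteq> 0" using degree_eq_zeroE by (metis pCons_0_0)
  with 0 have "v = 0" by (simp add: vec_eq_iff)
  then show ?case by (intro exI[of _ "[]"]) simp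
next
  case (Suc n)
  have "\<not> constant (poly p)" using Suc(2) constant_degree[of p] by simp
  then obtain z where "poly p z = 0" using fundamental_theorem_of_algebra by blast
  then obtain q where q: "p = [:- z, 1:] * q" by (auto simp: poly_eq_0_iff_dvd)
  have q0: "q \<noteq> 0" using q Suc(3) by auto
  then have "degree p = 1 + degree q" unfolding q by (subst degree_mult_eq) auto
  with q0 have "q \<noteq> 0" "degree q = n" using Suc(2) by auto
  moreover define u where "u = M *v v - z *s v"
  ultimately obtain zs where zs: "\<forall>z\<in>set zs. eigval M z" "factor_chain M zs u = 0"
  proof -
    have "poly_act M q u = 0" using Suc(4) unfolding q u_def poly_act_linear_factor .
    then show ?thesis using Suc(1)[of q u] \<open>q \<noteq> 0\<close> \<open>degree q = n\<close> that by blast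
  qed
  show ?case
  proof (cases "eigval M z")
    case True
    then show ?thesis using zs by (intro exI[of _ "z # zs"]) (simp add: u_def)
  next
    case False
    have "M *v factor_chain M zs v = z *s factor_chain M zs v"
      using zs(2) by (simp add: u_def factor_chain_diff factor_chain_smult factor_chain_commute)
    then have "factor_chain M zs v = 0" using False unfolding eigval_def by blast
    then show ?thesis using zs(1) by blast
  qed
qed

text \<open>The lists for the basis vectors are concatenated; as the factors commute, each list
  still annihilates its own vector. This is Cayley-Hamilton without determinants, with eigenvalues
  as the only roots.\<close>

lemma annihilating_factors:
  fixes M :: "complex^'n^'n"
  shows "\<exists>zs. (\<forall>z\<in>set zs. eigval M z) \<and> (\<forall>v. factor_chain M zs v = 0)"
proof -
  have fin: "\<exists>zs. (\<forall>z\<in>set zs. eigval M z) \<and> (\<forall>v\<in>F. factor_chain M zs v = 0)" if "finite F" for F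
    using that
  proof induction
    case empty
    show ?case by (intro exI[of _ "[]"]) simp
  next
    case (insert v F)
    then obtain zs where zs: "\<forall>z\<in>set zs. eigval M z" "\<forall>v\<in>F. factor_chain M zs v = 0" by blast
    obtain ys where ys: "\<forall>z\<in>set ys. eigval M z" "factor_chain M ys v = 0"
      using exists_annihilating_poly[of M v] annihilating_factors_of_poly[of _ M v] by blast
    have "factor_chain M (zs @ ys) u = 0" if "u \<in> insert v F" for u
    proof (cases "u = v")
      case True
      then show ?thesis using ys(2) factor_chain_swap[of M ys zs v] by (simp add: factor_chain_append)
    next
      case False
      then show ?thesis using zs(2) that by (simp add: factor_chain_append)
    qed
    then show ?case using zs ys by (intro exI[of _ "zs @ ys"]) auto
  qed
  obtain zs where zs: "\<forall>z\<in>set zs. eigval M z" "\<forall>v\<in>range (\<lambda>i::'n. axis i 1). factor_chain M zs v = 0"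
    using fin[of "range (\<lambda>i::'n. axis i 1)"] by auto
  have sum: "factor_chain M zs (\<Sum>i\<in>I. g i) = (\<Sum>i\<in>I. factor_chain M zs (g i))" for g :: "'n \<Rightarrow> _" and I
    by (induction I rule: infinite_finite_induct) (simp_all add: factor_chain_add)
  have "factor_chain M zs v = 0" for v
  proof -
    have "v = (\<Sum>i\<in>UNIV. v $ i *s axis i 1)"
      by (simp add: vec_eq_iff axis_def if_distrib sum.delta cong: if_cong)
    then have "factor_chain M zs v = (\<Sum>i\<in>UNIV. v $ i *s factor_chain M zs (axis i 1))"
      by (metis (no_types, lifting) sum factor_chain_smult sum.cong)
    then show ?thesis using zs by simp
  qed
  then show ?thesis using zs by blast
qed

section \<open>Lyapunov forms of Hurwitz matrices\<close>

text \<open>Multiplication by the imaginary unit is skew for the real inner product of complex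
  vectors, so only the real part of \<open>z\<close> is seen.\<close>

lemma inner_complex_scale: "y \<bullet> (z *s y) = Re z * (norm y)\<^sup>2" for y :: "complex^'n"
proof -
  have "y \<bullet> (z *s y) = (\<Sum>i\<in>UNIV. Re z * (y $ i \<bullet> y $ i))"
    by (simp add: inner_vec_def inner_complex_def algebra_simps)
  also have "\<dots> = Re z * (y \<bullet> y)" by (simp add: inner_vec_def sum_distrib_left)
  finally show ?thesis by (simp add: power2_norm_eq_inner)
qed

lemma Young_inequality:
  fixes y y1 :: "'a::real_inner"
  assumes "m > 0"
  shows "y \<bullet> y1 \<le> m / 2 * (norm y)\<^sup>2 + 1 / (2 * m) * (norm y1)\<^sup>2"
proof -
  have "0 \<le> (m * norm y - norm y1)\<^sup>2 / (2 * m)" using assms by simp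
  also have "\<dots> = m / 2 * (norm y)\<^sup>2 + 1 / (2 * m) * (norm y1)\<^sup>2 - norm y * norm y1"
    using assms by (simp add: power2_eq_square field_simps)
  finally show ?thesis using norm_cauchy_schwarz[of y y1] by linarith
qed

lemma bounded_bilinear_comp2:
  assumes "bounded_bilinear S" "bounded_linear g"
  shows "bounded_bilinear (\<lambda>x y. S (g x) (g y))"
  using bounded_bilinear.comp[OF assms assms(2)] .

lemma bounded_bilinear_scale_real:
  assumes "bounded_bilinear (S :: _ \<Rightarrow> _ \<Rightarrow> real)"
  shows "bounded_bilinear (\<lambda>x y. c * S x y)"
proof -
  interpret bounded_bilinear S by fact
  obtain K where K: "\<And>x y. norm (S x y) \<le> norm x * norm y * K" using bounded by blast
  show ?thesis
  proof
    have "norm (c * S x y) \<le> norm x * norm y * (\<bar>c\<bar> * K)" for x y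
      using mult_left_mono[OF K[of x y], of "\<bar>c\<bar>"] by (simp add: abs_mult algebra_simps)
    then show "\<exists>K. \<forall>x y. norm (c * S x y) \<le> norm x * norm y * K" by blast
  qed (simp_all add: add_left add_right scaleR_left scaleR_right algebra_simps)
qed

lemma bounded_bilinear_add_real:
  assumes "bounded_bilinear (S :: _ \<Rightarrow> _ \<Rightarrow> real)" "bounded_bilinear (S' :: _ \<Rightarrow> _ \<Rightarrow> real)"
  shows "bounded_bilinear (\<lambda>x y. S x y + S' x y)"
proof -
  interpret S: bounded_bilinear S by fact
  interpret S': bounded_bilinear S' by fact
  obtain K K' where K: "\<And>x y. norm (S x y) \<le> norm x * norm y * K"
    "\<And>x y. norm (S' x y) \<le> norm x * norm y * K'" using S.bounded S'.bounded by blast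
  show ?thesis
  proof
    have "norm (S x y + S' x y) \<le> norm x * norm y * (K + K')" for x y
      using norm_triangle_le[OF add_mono[OF K(1)[of x y] K(2)[of x y]]] by (simp add: algebra_simps)
    then show "\<exists>K. \<forall>x y. norm (S x y + S' x y) \<le> norm x * norm y * K" by blast
  qed (simp_all add: S.add_left S.add_right S.scaleR_left S.scaleR_right
      S'.add_left S'.add_right S'.scaleR_left S'.scaleR_right algebra_simps)
qed

lemma bounded_linear_shifted_matrix: "bounded_linear (\<lambda>y :: complex^'n. M *v y - z *s y)"
proof (rule linear_conv_bounded_linear[THEN iffD1], rule linearI)
  fix x y :: "complex^'n" and r :: real
  show "M *v (x + y) - z *s (x + y) = M *v x - z *s x + (M *v y - z *s y)"
    by (simp add: matrix_vector_right_distrib vector_add_ldistrib)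
  show "M *v (r *\<^sub>R x) - z *s (r *\<^sub>R x) = r *\<^sub>R (M *v x - z *s x)"
    by (simp only: scaleR_complex_vector shifted_matrix_smult)
qed

lemma bounded_bilinear_zero_real: "bounded_bilinear (\<lambda>x y. 0::real)"
  by standard (auto intro: exI[of _ 0])

text \<open>Along \<open>y' = M y\<close> the vector \<open>g y = M y - z y\<close> solves the same
  equation, so a form \<open>S\<close> for the remaining factors can be evaluated on it. In the
  decay of \<open>y \<bullet> y\<close> Young's inequality leaves a multiple of the square of
  \<open>norm (g y)\<close>, which the term with \<open>S\<close> compensates. Nothing is
  diagonalised, so repeated eigenvalues need no separate treatment.\<close>

lemma Lyapunov_chain:
  fixes M :: "complex^'n^'n"
  assumes "\<forall>z\<in>set zs. Re z < 0"
  shows "\<exists>S \<mu> K. bounded_bilinear S \<and> (\<forall>x y. S x y = (S y x :: real)) \<and> (\<forall>y. 0 \<le> S y y) \<and> \<mu> > 0 \<and> K \<ge> 0 \<and>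
    (\<forall>y. S y (M *v y) \<le> - \<mu> * (norm y)\<^sup>2 + K * (norm (factor_chain M zs y))\<^sup>2)"
  using assms
proof (induction zs)
  case Nil
  \<comment> \<open>The empty chain leaves \<open>y\<close> itself as remainder, so the zero form
    works with equal constants.\<close>
  show ?case
    by (intro exI[of _ "\<lambda>x y. 0"] exI[of _ 1]) (auto intro!: bounded_bilinear_zero_real)
next
  case (Cons z zs)
  then obtain S \<mu> K where S: "bounded_bilinear S" "\<And>x y. S x y = (S y x :: real)" "\<And>y. 0 \<le> S y y"
    and \<mu>: "\<mu> > 0" and K: "K \<ge> 0"
    and le: "\<And>y. S y (M *v y) \<le> - \<mu> * (norm y)\<^sup>2 + K * (norm (factor_chain M zs y))\<^sup>2"
    by auto
  define m where "m = - Re z"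
  have m: "m > 0" using Cons by (simp add: m_def)
  \<comment> \<open>With \<open>c * \<mu> = 1 / (2 * m)\<close> the two terms in the square of
    \<open>norm (g y)\<close> cancel exactly.\<close>
  define c where "c = 1 / (2 * m * \<mu>)"
  have c: "c > 0" using m \<mu> by (simp add: c_def)
  define g where "g = (\<lambda>y. M *v y - z *s y)"
  have g: "bounded_linear g" unfolding g_def by (rule bounded_linear_shifted_matrix)
  define S' where "S' = (\<lambda>x y. x \<bullet> y + c * S (g x) (g y))"
  have "bounded_bilinear S'"
    unfolding S'_def
    by (rule bounded_bilinear_add_real[OF bounded_bilinear_inner bounded_bilinear_scale_real[OF bounded_bilinear_comp2[OF S(1) g]]])
  moreover have "S' x y = S' y x" for x y
    unfolding S'_def using S(2)[of "g x" "g y"] by (simp add: inner_commute)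
  moreover have "0 \<le> S' y y" for y unfolding S'_def using S(3)[of "g y"] c by simp
  moreover have "S' y (M *v y) \<le> - (m / 2) * (norm y)\<^sup>2 + c * K * (norm (factor_chain M (z # zs) y))\<^sup>2" for y
  proof -
    have gM: "g (M *v y) = M *v g y"
      by (simp add: g_def matrix_vector_mult_diff_distrib vector_scalar_commute)
    have "M *v y = z *s y + g y" by (simp add: g_def)
    then have "y \<bullet> (M *v y) = - m * (norm y)\<^sup>2 + y \<bullet> g y"
      by (simp only: inner_add_right inner_complex_scale m_def)
    also have "\<dots> \<le> - m * (norm y)\<^sup>2 + (m / 2 * (norm y)\<^sup>2 + 1 / (2 * m) * (norm (g y))\<^sup>2)"
      using Young_inequality[OF m, of y "g y"] by simp
    finally have 1: "y \<bullet> (M *v y) \<le> - (m / 2) * (norm y)\<^sup>2 + 1 / (2 * m) * (norm (g y))\<^sup>2" by simp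
    have "c * S (g y) (g (M *v y)) \<le> c * (- \<mu> * (norm (g y))\<^sup>2 + K * (norm (factor_chain M zs (g y)))\<^sup>2)"
      using le[of "g y"] c by (simp add: gM)
    also have "\<dots> = - (1 / (2 * m)) * (norm (g y))\<^sup>2 + c * K * (norm (factor_chain M (z # zs) y))\<^sup>2"
      using \<mu> m by (simp add: c_def g_def algebra_simps)
    finally show ?thesis using 1 unfolding S'_def by simp
  qed
  ultimately show ?case using m c K
    by (intro exI[of _ S'] exI[of _ "m / 2"] exI[of _ "c * K"] conjI allI) auto
qed

text \<open>A chain of eigenvalue factors annihilates every complex vector, so the remainder term of
  \<open>Lyapunov_chain\<close> vanishes; the form is then pulled back along the isometric embedding
  of real vectors.\<close>

theorem hurwitz_Lyapunov:
  fixes M :: "real^'n^'n"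
  assumes "hurwitz M"
  obtains S \<mu> where "bounded_bilinear S" "\<And>x y. S x y = (S y x :: real)" "\<And>y. 0 \<le> S y y" "\<mu> > 0"
    "\<And>x. S x (M *v x) \<le> - \<mu> * (norm x)\<^sup>2"
proof -
  define Mc where "Mc = map_matrix complex_of_real M"
  obtain zs where zs: "\<forall>z\<in>set zs. eigval Mc z" "\<And>v. factor_chain Mc zs v = 0"
    using annihilating_factors[of Mc] by blast
  have "\<forall>z\<in>set zs. Re z < 0"
    using zs(1) assms unfolding hurwitz_def eigval_def Mc_def by blast
  from Lyapunov_chain[OF this, of Mc] obtain S \<mu> where S: "bounded_bilinear S" "\<And>x y. S x y = (S y x :: real)"
    "\<And>y. 0 \<le> S y y" "\<mu> > 0" "\<And>y. S y (Mc *v y) \<le> - \<mu> * (norm y)\<^sup>2"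
    using zs(2) by auto
  define g where "g = (\<lambda>x::real^'n. (\<chi> i. complex_of_real (x $ i)))"
  have "linear g" by (rule linearI) (simp_all add: g_def vec_eq_iff complex_eq_iff)
  then have g: "bounded_linear g" by (simp add: linear_conv_bounded_linear)
  have Mg: "Mc *v g x = g (M *v x)" for x
    by (simp add: Mc_def g_def vec_eq_iff matrix_vector_mult_def map_matrix_def)
  have ng: "norm (g x) = norm x" for x by (simp add: g_def norm_vec_def)
  show thesis
  proof (rule that)
    show "bounded_bilinear (\<lambda>x y. S (g x) (g y))" by (rule bounded_bilinear_comp2[OF S(1) g])
    show "S (g x) (g (M *v x)) \<le> - \<mu> * (norm x)\<^sup>2" for x
      using S(5)[of "g x"] by (simp add: Mg ng)
  qed (use S in auto)
qed

section \<open>The matrix inequality as statements on quadratic forms\<close>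

lemma block_matrix_quadratic:
  fixes x :: "real^'n" and u :: "real^'m"
  defines "w \<equiv> (\<chi> k. case k of Inl i \<Rightarrow> x $ i | Inr i \<Rightarrow> u $ i)"
  shows "w \<bullet> (block_matrix M11 M12 M21 M22 *v w) = x \<bullet> (M11 *v x) + x \<bullet> (M12 *v u) + u \<bullet> (M21 *v x) + u \<bullet> (M22 *v u)"
proof -
  have split: "(\<Sum>k\<in>UNIV. h k) = (\<Sum>i\<in>UNIV. h (Inl i)) + (\<Sum>i\<in>UNIV. h (Inr i))" for h :: "'n + 'm \<Rightarrow> real"
    by (subst UNIV_Plus_UNIV[symmetric], subst sum.Plus) simp_all
  show ?thesis
    by (simp add: inner_vec_def matrix_vector_mult_def split block_matrix_def w_def sum.distrib algebra_simps)
qed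

text \<open>Since the lower right block vanishes, the quadratic form is affine in the second vector.
  An affine function that is bounded above has no linear part, which is the identity
  \<open>P B = C\<^sup>T\<close> tested on vectors.\<close>

lemma KYP_inequality:
  fixes A :: "real^'n^'n" and B :: "real^'m^'n" and C :: "real^'n^'m" and P :: "real^'n^'n"
  assumes P: "transpose P = P"
    and neg: "negative_semidefinite (block_matrix (transpose A ** P + P ** A) (P ** B - transpose C)
                      (transpose B ** P - C) 0)"
  shows "x \<bullet> (P *v (A *v x)) \<le> 0" "x \<bullet> (P *v (B *v u)) = (C *v x) \<bullet> u"
proof -
  have sym: "a \<bullet> (P *v b) = (P *v a) \<bullet> b" for a b
    using dot_lmul_matrix[of a P b] transpose_matrix_vector[of P a] P by simp
  have tr: "a \<bullet> (transpose D *v b) = (D *v a) \<bullet> b" for a :: "real^'p" and D :: "real^'p^'q" and b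
    using dot_lmul_matrix[of a "transpose D" b] transpose_matrix_vector[of "transpose D" a]
    by (simp add: transpose_transpose del: transpose_matrix_vector)
  have q: "2 * (a \<bullet> (P *v (A *v a))) + 2 * (a \<bullet> (P *v (B *v b)) - (C *v a) \<bullet> b) \<le> 0" for a b
  proof -
    have "a \<bullet> ((transpose A ** P + P ** A) *v a) = 2 * (a \<bullet> (P *v (A *v a)))"
      using sym[of "A *v a" a] sym[of a "A *v a"]
      by (simp add: matrix_vector_mult_add_rdistrib inner_add_right matrix_vector_mul_assoc[symmetric] tr inner_commute del: transpose_matrix_vector)
    moreover have "a \<bullet> ((P ** B - transpose C) *v b) = a \<bullet> (P *v (B *v b)) - (C *v a) \<bullet> b"
      by (simp add: matrix_vector_mult_diff_rdistrib inner_diff_right matrix_vector_mul_assoc[symmetric] tr del: transpose_matrix_vector)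
    moreover have "b \<bullet> ((transpose B ** P - C) *v a) = a \<bullet> (P *v (B *v b)) - (C *v a) \<bullet> b"
      using sym[of a "B *v b"]
      by (simp add: matrix_vector_mult_diff_rdistrib inner_diff_right matrix_vector_mul_assoc[symmetric] tr inner_commute del: transpose_matrix_vector)
    ultimately show ?thesis
    proof -
      assume *: "a \<bullet> ((transpose A ** P + P ** A) *v a) = 2 * (a \<bullet> (P *v (A *v a)))"
        "a \<bullet> ((P ** B - transpose C) *v b) = a \<bullet> (P *v (B *v b)) - (C *v a) \<bullet> b"
        "b \<bullet> ((transpose B ** P - C) *v a) = a \<bullet> (P *v (B *v b)) - (C *v a) \<bullet> b"
      have "a \<bullet> ((transpose A ** P + P ** A) *v a) + a \<bullet> ((P ** B - transpose C) *v b) +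
          b \<bullet> ((transpose B ** P - C) *v a) + b \<bullet> (0 *v b) \<le> 0"
        unfolding block_matrix_quadratic[symmetric] using neg unfolding negative_semidefinite_def by blast
      then show ?thesis unfolding * by simp
    qed
  qed
  show "x \<bullet> (P *v (A *v x)) \<le> 0" using q[of x 0] by simp
  define y where "y = x \<bullet> (P *v (B *v u)) - (C *v x) \<bullet> u"
  have "x \<bullet> (P *v (A *v x)) + s * y \<le> 0" for s
    using q[of x "s *\<^sub>R u"]
    by (simp add: y_def matrix_vector_mult_scaleR algebra_simps)
  then have "y = 0"
  proof -
    assume *: "\<And>s. x \<bullet> (P *v (A *v x)) + s * y \<le> 0"
    show ?thesis
    proof (rule ccontr)
      assume "y \<noteq> 0"
      then have "x \<bullet> (P *v (A *v x)) + ((1 - x \<bullet> (P *v (A *v x))) / y) * y = 1" by simp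
      then show False using *[of "(1 - x \<bullet> (P *v (A *v x))) / y"] by simp
    qed
  qed
  then show "x \<bullet> (P *v (B *v u)) = (C *v x) \<bullet> u" by (simp add: y_def)
qed

lemma positive_definite_lower_bound:
  fixes P :: "real^'n^'n"
  assumes "positive_definite P"
  obtains c where "c > 0" "\<And>x. c * (norm x)\<^sup>2 \<le> x \<bullet> (P *v x)"
proof -
  have "continuous_on (sphere 0 1) (\<lambda>x. x \<bullet> (P *v x))"
    by (intro continuous_intros bounded_linear.continuous_on[OF matrix_vector_mul_bounded_linear])
  moreover have "sphere 0 1 \<noteq> ({} :: (real^'n) set)" by (simp add: sphere_eq_empty)
  ultimately obtain y where y: "y \<in> sphere 0 1" "\<And>x. x \<in> sphere 0 1 \<Longrightarrow> y \<bullet> (P *v y) \<le> x \<bullet> (P *v x)"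
    using continuous_attains_inf[of "sphere 0 1 :: (real^'n) set"] compact_sphere by blast
  have "y \<noteq> 0" using y(1) by auto
  then have "y \<bullet> (P *v y) > 0" using assms by (auto simp: positive_definite_def)
  moreover have "(y \<bullet> (P *v y)) * (norm x)\<^sup>2 \<le> x \<bullet> (P *v x)" for x
  proof (cases "x = 0")
    case False
    define z where "z = x /\<^sub>R norm x"
    have "x = norm x *\<^sub>R z" "z \<in> sphere 0 1" using False by (auto simp: z_def)
    moreover have "(norm x *\<^sub>R z) \<bullet> (P *v (norm x *\<^sub>R z)) = (norm x)\<^sup>2 * (z \<bullet> (P *v z))"
      by (simp add: matrix_vector_mult_scaleR power2_eq_square)
    ultimately show ?thesis using y(2)[of z] by (metis mult.commute mult_left_mono zero_le_power2)
  qed auto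
  ultimately show thesis by (rule that)
qed

section \<open>Incremental stability of the Lur'e equation\<close>

text \<open>The integrated equation on a compact interval, common to both time domains. It is stable
  under restriction, time shifts, changes of the input on null sets and limits.\<close>

definition lure_solution ::
  "real^'n^'n \<Rightarrow> real^'m^'n \<Rightarrow> real^'n^'m \<Rightarrow> (real^'m \<Rightarrow> real^'m) \<Rightarrow>
    (real \<Rightarrow> real^'m) \<Rightarrow> (real \<Rightarrow> real^'n) \<Rightarrow> real \<Rightarrow> real \<Rightarrow> bool"
  where "lure_solution A B C f v x a b \<longleftrightarrow> v absolutely_integrable_on {a..b} \<and> continuous_on {a..b} x \<and>
    (\<forall>t\<in>{a..b}. x t = x a + integral {a..t} (lure_field A B C f v x))"

text \<open>Near 0 the left-hand side is below \<open>\<eta>\<close> by continuity; on the compact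
  rest \<open>s * \<alpha> s\<close> has a positive minimum. Nothing relates \<open>\<theta>\<close>
  to \<open>\<alpha>\<close> at 0, which is why \<open>\<eta>\<close> remains.\<close>

lemma comparison_gauge:
  assumes "\<theta> \<in> class_K_inf" "\<alpha> \<in> class_P" "\<eta> > 0" "p \<ge> 0" "q \<ge> 0"
  obtains k where "k \<ge> 0" "\<And>s. 0 \<le> s \<Longrightarrow> s \<le> s0 \<Longrightarrow> p * s + q * \<theta> s \<le> \<eta> + k * (s * \<alpha> s)"
proof -
  define G where "G = (\<lambda>s. p * s + q * \<theta> s)"
  have th: "continuous_on {0..} \<theta>" "\<theta> 0 = 0" and al: "continuous_on {0..} \<alpha>" "\<And>s. s > 0 \<Longrightarrow> \<alpha> s > 0"
    "\<alpha> 0 = 0" using assms by (auto simp: class_K_inf_def class_P_def)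
  have Gc: "continuous_on {0..} G" unfolding G_def by (intro continuous_intros th)
  then have "continuous (at 0 within {0..}) G" by (auto simp: continuous_on_eq_continuous_within)
  then obtain d where d0: "d > 0" "\<forall>s\<in>{0..}. dist s 0 < d \<longrightarrow> dist (G s) (G 0) < \<eta>"
    using assms(3) unfolding continuous_within_eps_delta by blast
  have d: "d > 0" "\<And>s. 0 \<le> s \<Longrightarrow> s < d \<Longrightarrow> G s < \<eta>"
    using d0 th(2) by (auto simp: dist_real_def G_def)
  have nn: "0 \<le> s * \<alpha> s" if "0 \<le> s" for s using al(2)[of s] al(3) that by (cases "s = 0") auto
  show thesis
  proof (cases "d \<le> s0")
    case False
    then show ?thesis using d(2) by (intro that[of 0]) (auto simp: G_def intro: less_imp_le)
  next
    case True
    have sub: "{d..s0} \<subseteq> {0..}" using d(1) by auto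
    have "continuous_on {d..s0} (\<lambda>s. s * \<alpha> s)" "continuous_on {d..s0} G"
      using sub by (auto intro!: continuous_intros continuous_on_subset[OF al(1)] continuous_on_subset[OF Gc])
    then obtain s1 s2 where s1: "s1 \<in> {d..s0}" "\<And>s. s \<in> {d..s0} \<Longrightarrow> s1 * \<alpha> s1 \<le> s * \<alpha> s"
      and s2: "\<And>s. s \<in> {d..s0} \<Longrightarrow> G s \<le> G s2"
      using continuous_attains_inf[of "{d..s0}" "\<lambda>s. s * \<alpha> s"] continuous_attains_sup[of "{d..s0}" G] True
      by (metis atLeastatMost_empty_iff compact_Icc)
    define m where "m = s1 * \<alpha> s1"
    have m: "m > 0" using s1(1) d(1) al(2)[of s1] by (auto simp: m_def)
    define k where "k = \<bar>G s2\<bar> / m"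
    show ?thesis
    proof (rule that[of k])
      show "k \<ge> 0" using m by (simp add: k_def)
      fix s assume s: "0 \<le> s" "s \<le> s0"
      show "p * s + q * \<theta> s \<le> \<eta> + k * (s * \<alpha> s)"
      proof (cases "s < d")
        case True
        then have "G s < \<eta>" using d(2) s by auto
        moreover have "0 \<le> k * (s * \<alpha> s)" using nn[of s] s m by (auto simp: k_def)
        ultimately show ?thesis by (simp add: G_def)
      next
        case False
        then have "G s \<le> \<bar>G s2\<bar>" "m \<le> s * \<alpha> s" using s s1(2)[of s] s2[of s] by (auto simp: m_def)
        moreover have "\<bar>G s2\<bar> = k * m" using m by (simp add: k_def)
        moreover have "k * m \<le> k * (s * \<alpha> s)" using m \<open>m \<le> s * \<alpha> s\<close> by (intro mult_left_mono) (auto simp: k_def)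
        ultimately show ?thesis using assms(3) by (simp add: G_def)
      qed
    qed
  qed
qed

text \<open>
  \<open>W\<close> is the storage form of the passivity inequality and \<open>S\<close> a Lyapunov form of the output
  injection system \<open>A - H C\<close>.
\<close>

locale lure =
  fixes A :: "real^'n^'n" and B :: "real^'m^'n" and C :: "real^'n^'m" and f :: "real^'m \<Rightarrow> real^'m"
    and H :: "real^'m^'n" and W S :: "real^'n \<Rightarrow> real^'n \<Rightarrow> real" and c \<mu> :: real
  assumes f_continuous: "continuous_on UNIV f"
    and W: "bounded_bilinear W" "\<And>x y. W x y = W y x" "c > 0" "\<And>x. c * (norm x)\<^sup>2 \<le> W x x"
      "\<And>x. W x (A *v x) \<le> 0" "\<And>x u. W x (B *v u) = (C *v x) \<bullet> u"
    and S: "bounded_bilinear S" "\<And>x y. S x y = S y x" "\<And>x. 0 \<le> S x x" "\<mu> > 0"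
      "\<And>x. S x ((A - H ** C) *v x) \<le> - \<mu> * (norm x)\<^sup>2"
    and sector: "\<And>\<Gamma> :: (real^'m) set. compact \<Gamma> \<Longrightarrow>
      \<exists>\<theta>\<in>class_K_inf. \<exists>\<alpha>\<in>class_P. \<forall>y. \<forall>z\<in>\<Gamma>.
        norm (f (y + z) - f z) \<le> \<theta> (norm y) \<and>
        norm y * \<alpha> (norm y) \<le> y \<bullet> (f (y + z) - f z)"
begin

abbreviation field where "field \<equiv> lure_field A B C f"
abbreviation sol where "sol \<equiv> lure_solution A B C f"

lemma monotone_f: "0 \<le> (y - z) \<bullet> (f y - f z)"
proof -
  obtain \<alpha> where "\<alpha> \<in> class_P" "norm (y - z) * \<alpha> (norm (y - z)) \<le> (y - z) \<bullet> (f ((y - z) + z) - f z)"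
    using sector[of "{z}"] by (metis compact_sing singletonI)
  moreover from this have "0 \<le> \<alpha> (norm (y - z))"
    by (cases "y = z") (auto simp: class_P_def less_imp_le)
  then have "0 \<le> norm (y - z) * \<alpha> (norm (y - z))" by simp
  ultimately show ?thesis by simp
qed

lemma sol_integrable:
  assumes "sol v x a b"
  shows "field v x absolutely_integrable_on {a..b}"
  using assms lure_field_absolutely_integrable[OF f_continuous] by (auto simp: lure_solution_def)

lemma sol_subinterval:
  assumes s: "sol v x a b" and ab: "a \<le> a'" "b' \<le> b"
  shows "sol v x a' b'"
  unfolding lure_solution_def
proof (intro conjI ballI)
  show "v absolutely_integrable_on {a'..b'}" "continuous_on {a'..b'} x"
    using s ab unfolding lure_solution_def
    by (auto intro: absolutely_integrable_on_subinterval continuous_on_subset)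
  fix t assume t: "t \<in> {a'..b'}"
  have i: "field v x integrable_on {a..t}"
    using absolutely_integrable_on_subinterval[OF sol_integrable[OF s], of a t] t ab
    by (auto simp: absolutely_integrable_on_def)
  have comb: "integral {a..t} (field v x) = integral {a..a'} (field v x) + integral {a'..t} (field v x)"
    by (rule Henstock_Kurzweil_Integration.integral_combine[symmetric]) (use i t ab in auto)
  have pr: "x u = x a + integral {a..u} (field v x)" if "u \<in> {a..b}" for u
    using s that unfolding lure_solution_def by blast
  have "x t = x a + integral {a..t} (field v x)"
    by (rule pr) (use t ab in auto)
  also have "\<dots> = (x a + integral {a..a'} (field v x)) + integral {a'..t} (field v x)"
    by (simp only: comb add.assoc)
  also have "x a + integral {a..a'} (field v x) = x a'"
    by (rule pr[symmetric]) (use t ab in auto)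
  finally show "x t = x a' + integral {a'..t} (field v x)" .
qed

section \<open>Energy estimates for a pair of solutions\<close>

context
  fixes v1 v2 :: "real \<Rightarrow> real^'m" and x1 x2 :: "real \<Rightarrow> real^'n" and a b :: real
  assumes s1: "sol v1 x1 a b" and s2: "sol v2 x2 a b" and ab: "a \<le> b"
begin

abbreviation "err \<equiv> \<lambda>t. x1 t - x2 t"
abbreviation "derr \<equiv> \<lambda>t. A *v err t - B *v (f (C *v x1 t) - f (C *v x2 t)) + B *v (v1 t - v2 t)"
abbreviation "pow \<equiv> \<lambda>t. (C *v err t) \<bullet> (f (C *v x1 t) - f (C *v x2 t))"

lemma continuous_err: "continuous_on {a..b} err"
  using s1 s2 by (auto simp: lure_solution_def intro!: continuous_intros)

lemma inputs_integrable: "(\<lambda>t. v1 t - v2 t) absolutely_integrable_on {a..b}"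
  using s1 s2 by (auto simp: lure_solution_def intro: set_integral_diff)

lemma norm_inputs_integrable: "(\<lambda>t. norm (v1 t - v2 t)) integrable_on {a..b}"
  using inputs_integrable by (simp add: absolutely_integrable_on_def)

lemma continuous_pow: "continuous_on {a..b} pow"
proof -
  have "continuous_on {a..b} (\<lambda>t. f (C *v x t))" if "continuous_on {a..b} x" for x :: "real \<Rightarrow> real^'n"
    by (rule continuous_on_compose2[OF f_continuous bounded_linear.continuous_on[OF matrix_vector_mul_bounded_linear that]]) auto
  then show ?thesis
    using s1 s2 by (intro continuous_intros bounded_linear.continuous_on[OF matrix_vector_mul_bounded_linear])
      (auto simp: lure_solution_def)
qed

lemma derr_integrable: "derr absolutely_integrable_on {a..b}"
  and err_primitive: "t \<in> {a..b} \<Longrightarrow> err t = err a + integral {a..t} derr"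
proof -
  have eq: "derr = (\<lambda>t. field v1 x1 t - field v2 x2 t)"
    by (auto simp: matrix_vector_mult_diff_distrib algebra_simps)
  show "derr absolutely_integrable_on {a..b}"
    unfolding eq by (rule set_integral_diff(1)[OF sol_integrable[OF s1] sol_integrable[OF s2]])
  assume t: "t \<in> {a..b}"
  have "field v1 x1 integrable_on {a..t}" "field v2 x2 integrable_on {a..t}"
    using t absolutely_integrable_on_subinterval[OF sol_integrable[OF s1], of a t]
      absolutely_integrable_on_subinterval[OF sol_integrable[OF s2], of a t]
    by (auto simp: absolutely_integrable_on_def)
  then have "integral {a..t} derr = integral {a..t} (field v1 x1) - integral {a..t} (field v2 x2)"
    unfolding eq by (rule integral_diff)
  moreover have "x1 t = x1 a + integral {a..t} (field v1 x1)" "x2 t = x2 a + integral {a..t} (field v2 x2)"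
    using s1 s2 t unfolding lure_solution_def by blast+
  ultimately show "err t = err a + integral {a..t} derr"
    by (simp only: add_diff_add)
qed

lemma quadratic_form_increment:
  assumes Q: "bounded_bilinear Q" "\<And>x y. Q x y = (Q y x :: real)"
  shows "((\<lambda>t. 2 * Q (err t) (derr t)) has_integral Q (err b) (err b) - Q (err a) (err a)) {a..b}"
proof -
  have "((\<lambda>u. Q (err u) (derr u) + Q (derr u) (err u)) has_integral Q (err b) (err b) - Q (err a) (err a)) {a..b}"
    by (rule quadratic_primitive[OF Q(1) derr_integrable ab err_primitive])
  moreover have "Q (err u) (derr u) + Q (derr u) (err u) = 2 * Q (err u) (derr u)" for u
    using Q(2)[of "derr u" "err u"] by simp
  ultimately show ?thesis by simp
qed

text \<open>Testing \<open>derr\<close> with \<open>W\<close>, the part with \<open>A\<close> is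
  nonpositive, the nonlinearity gives \<open>- pow\<close>, and the forcing is at most
  \<open>KC * R * norm (v1 t - v2 t)\<close>. The bound \<open>R\<close> on the error makes the
  forcing enter through its integral alone.\<close>

lemma storage_dissipation:
  assumes KC: "\<And>x. norm (C *v x) \<le> KC * norm x" and R: "\<And>t. t \<in> {a..b} \<Longrightarrow> norm (err t) \<le> R"
    and KC0: "KC \<ge> 0"
  shows "W (err b) (err b) + 2 * integral {a..b} pow \<le> W (err a) (err a) + 2 * KC * R * integral {a..b} (\<lambda>t. norm (v1 t - v2 t))"
proof -
  interpret W: bounded_bilinear W by (rule W(1))
  have pi: "pow integrable_on {a..b}" by (intro integrable_continuous_real continuous_pow)
  note inc = quadratic_form_increment[OF W(1,2)]
  have "W (err b) (err b) - W (err a) (err a)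
     \<le> integral {a..b} (\<lambda>t. - 2 * pow t + 2 * KC * R * norm (v1 t - v2 t))"
    unfolding integral_unique[OF inc, symmetric]
  proof (rule integral_le)
    show "(\<lambda>t. 2 * W (err t) (derr t)) integrable_on {a..b}" using inc by blast
    show "(\<lambda>t. - 2 * pow t + 2 * KC * R * norm (v1 t - v2 t)) integrable_on {a..b}"
      by (intro integrable_add integrable_on_mult_right pi norm_inputs_integrable)
    fix t assume t: "t \<in> {a..b}"
    have "W (err t) (derr t) = W (err t) (A *v err t) - pow t + (C *v err t) \<bullet> (v1 t - v2 t)"
      by (simp only: W.add_right W.diff_right W(6))
    also have "\<dots> \<le> 0 - pow t + norm (C *v err t) * norm (v1 t - v2 t)"
      by (intro add_mono diff_right_mono W(5) norm_cauchy_schwarz)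
    also have "norm (C *v err t) * norm (v1 t - v2 t) \<le> KC * R * norm (v1 t - v2 t)"
      using KC[of "err t"] mult_left_mono[OF R[OF t] KC0] by (intro mult_right_mono) auto
    finally show "2 * W (err t) (derr t) \<le> - 2 * pow t + 2 * KC * R * norm (v1 t - v2 t)" by simp
  qed
  also have "\<dots> = integral {a..b} (\<lambda>t. - 2 * pow t) + integral {a..b} (\<lambda>t. 2 * KC * R * norm (v1 t - v2 t))"
    by (intro integral_add integrable_on_mult_right pi norm_inputs_integrable)
  also have "\<dots> = - 2 * integral {a..b} pow + 2 * KC * R * integral {a..b} (\<lambda>t. norm (v1 t - v2 t))"
    by (simp only: integral_mult_right)
  finally show ?thesis by simp
qed

lemma pow_nonneg: "0 \<le> pow t"
  using monotone_f[of "C *v x1 t" "C *v x2 t"] by (simp add: matrix_vector_mult_diff_distrib)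

text \<open>Output injection: \<open>derr\<close> is \<open>(A - H C) err\<close> plus a
  perturbation in which the output error and the nonlinearity appear with gains \<open>KH\<close>
  and \<open>KB\<close>. Hypothesis \<open>G\<close> trades both for \<open>\<eta>\<close> and a
  multiple of \<open>pow\<close>, whose integral is under control.\<close>

lemma Lyapunov_estimate:
  assumes KS: "\<And>x y. \<bar>S x y\<bar> \<le> KS * norm x * norm y" "KS \<ge> 0"
    and K: "\<And>y. norm (H *v y) \<le> KH * norm y" "\<And>y. norm (B *v y) \<le> KB * norm y" "KB \<ge> 0"
    and R: "\<And>t. t \<in> {a..b} \<Longrightarrow> norm (err t) \<le> R"
    and G: "\<And>t. t \<in> {a..b} \<Longrightarrow> KH * norm (C *v err t) + KB * norm (f (C *v x1 t) - f (C *v x2 t)) \<le> \<eta> + k * pow t"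
  shows "2 * \<mu> * integral {a..b} (\<lambda>t. (norm (err t))\<^sup>2) \<le> S (err a) (err a) +
    2 * KS * R * (\<eta> * (b - a) + k * integral {a..b} pow + KB * integral {a..b} (\<lambda>t. norm (v1 t - v2 t)))"
proof -
  interpret S: bounded_bilinear S by (rule S(1))
  have pi: "pow integrable_on {a..b}" by (intro integrable_continuous_real continuous_pow)
  have ei: "(\<lambda>t. (norm (err t))\<^sup>2) integrable_on {a..b}"
    by (intro integrable_continuous_real continuous_intros continuous_err)
  note inc = quadratic_form_increment[OF S(1,2)]
  have "S (err b) (err b) - S (err a) (err a)
     \<le> integral {a..b} (\<lambda>t. (- 2 * \<mu>) * (norm (err t))\<^sup>2 + 2 * KS * R * (\<eta> + k * pow t + KB * norm (v1 t - v2 t)))"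
    unfolding integral_unique[OF inc, symmetric]
  proof (rule integral_le)
    show "(\<lambda>t. 2 * S (err t) (derr t)) integrable_on {a..b}" using inc by blast
    show "(\<lambda>t. (- 2 * \<mu>) * (norm (err t))\<^sup>2 + 2 * KS * R * (\<eta> + k * pow t + KB * norm (v1 t - v2 t))) integrable_on {a..b}"
      by (intro integrable_add integrable_on_mult_right pi ei norm_inputs_integrable integrable_const_ivl)
    fix t assume t: "t \<in> {a..b}"
    define u where "u = H *v (C *v err t) - B *v (f (C *v x1 t) - f (C *v x2 t)) + B *v (v1 t - v2 t)"
    have "derr t = (A - H ** C) *v err t + u"
      by (simp add: u_def matrix_vector_mult_diff_rdistrib matrix_vector_mul_assoc)
    then have "S (err t) (derr t) = S (err t) ((A - H ** C) *v err t) + S (err t) u"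
      by (simp only: S.add_right)
    also have "\<dots> \<le> - \<mu> * (norm (err t))\<^sup>2 + KS * norm (err t) * norm u"
      using S(5)[of "err t"] KS(1)[of "err t" u] by linarith
    also have "KS * norm (err t) * norm u \<le> KS * R * (\<eta> + k * pow t + KB * norm (v1 t - v2 t))"
    proof (rule mult_mono)
      show "KS * norm (err t) \<le> KS * R" using R[OF t] KS(2) by (rule mult_left_mono)
      have "norm u \<le> norm (H *v (C *v err t)) + norm (B *v (f (C *v x1 t) - f (C *v x2 t))) + norm (B *v (v1 t - v2 t))"
        unfolding u_def by norm
      also have "\<dots> \<le> KH * norm (C *v err t) + KB * norm (f (C *v x1 t) - f (C *v x2 t)) + KB * norm (v1 t - v2 t)"
        by (intro add_mono K)
      finally show "norm u \<le> \<eta> + k * pow t + KB * norm (v1 t - v2 t)" using G[OF t] by linarith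
      show "0 \<le> KS * R" using R[OF t] KS(2) norm_ge_zero[of "err t"] by (metis mult_nonneg_nonneg order_trans)
    qed simp
    finally show "2 * S (err t) (derr t) \<le> (- 2 * \<mu>) * (norm (err t))\<^sup>2 + 2 * KS * R * (\<eta> + k * pow t + KB * norm (v1 t - v2 t))"
      by simp
  qed
  also have "\<dots> = integral {a..b} (\<lambda>t. (- 2 * \<mu>) * (norm (err t))\<^sup>2) +
     integral {a..b} (\<lambda>t. 2 * KS * R * (\<eta> + k * pow t + KB * norm (v1 t - v2 t)))"
    by (intro integral_add integrable_add integrable_on_mult_right pi ei norm_inputs_integrable integrable_const_ivl)
  also have "integral {a..b} (\<lambda>t. 2 * KS * R * (\<eta> + k * pow t + KB * norm (v1 t - v2 t)))
      = 2 * KS * R * integral {a..b} (\<lambda>t. \<eta> + k * pow t + KB * norm (v1 t - v2 t))"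
    by (simp only: integral_mult_right)
  also have "integral {a..b} (\<lambda>t. \<eta> + k * pow t + KB * norm (v1 t - v2 t))
     = integral {a..b} (\<lambda>t. \<eta> + k * pow t) + integral {a..b} (\<lambda>t. KB * norm (v1 t - v2 t))"
    by (intro integral_add integrable_add integrable_on_mult_right pi norm_inputs_integrable integrable_const_ivl)
  also have "integral {a..b} (\<lambda>t. \<eta> + k * pow t) = integral {a..b} (\<lambda>t. \<eta>) + integral {a..b} (\<lambda>t. k * pow t)"
    by (intro integral_add integrable_on_mult_right pi integrable_const_ivl)
  finally show ?thesis using ab S(3)[of "err b"]
    by (simp only: integral_mult_right) (simp add: algebra_simps)
qed

end

text \<open>An a priori bound that does not presuppose bounded solutions. The dissipation inequality
  is stopped at the time \<open>s\<close> where \<open>W\<close> is largest, so the bound on the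
  error in the forcing term is governed by the maximum \<open>m\<close> itself; being of order
  \<open>sqrt m\<close>, that term can be absorbed.\<close>

lemma growth_estimate:
  assumes s1: "sol v1 x1 a b" and s2: "sol v2 x2 a b" and ab: "a \<le> b"
    and KC: "\<And>x. norm (C *v x) \<le> KC * norm x" "KC \<ge> 0"
    and \<rho>: "integral {a..b} (\<lambda>t. norm (v1 t - v2 t)) \<le> \<rho>"
  shows "c * (norm (x1 b - x2 b))\<^sup>2 \<le> 2 * W (x1 a - x2 a) (x1 a - x2 a) + 4 * KC\<^sup>2 * \<rho>\<^sup>2 / c"
proof -
  define e where "e = (\<lambda>t. x1 t - x2 t)"
  have ec: "continuous_on {a..b} e"
    using continuous_err[OF s1 s2 ab] by (simp add: e_def)
  have "continuous_on {a..b} (\<lambda>t. W (e t) (e t))"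
    by (rule bounded_bilinear.continuous_on[OF W(1) ec ec])
  from continuous_attains_sup[OF compact_Icc _ this] ab
  obtain s where "s \<in> {a..b} \<and> (\<forall>t\<in>{a..b}. W (e t) (e t) \<le> W (e s) (e s))"
    by (meson atLeastatMost_empty_iff)
  then have s: "s \<in> {a..b}" "\<And>t. t \<in> {a..b} \<Longrightarrow> W (e t) (e t) \<le> W (e s) (e s)"
    by blast+
  define m where "m = W (e s) (e s)"
  \<comment> \<open>The bound on the error that \<open>W \<le> m\<close> implies by
    coercivity.\<close>
  define R where "R = sqrt (m / c)"
  have m0: "m \<ge> 0" using order_trans[OF _ W(4)[of "e s"]] W(3) by (simp add: m_def)
  then have R: "c * R\<^sup>2 = m" "R \<ge> 0" using W(3) by (simp_all add: R_def)
  have eR: "norm (e t) \<le> R" if "t \<in> {a..s}" for t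
  proof -
    have "c * (norm (e t))\<^sup>2 \<le> m" unfolding m_def
      by (rule order_trans[OF W(4) s(2)]) (use that s(1) in auto)
    then have "(norm (e t))\<^sup>2 \<le> m / c" using W(3) by (simp add: field_simps)
    then show ?thesis unfolding R_def by (rule real_le_rsqrt)
  qed
  have sub: "sol v1 x1 a s" "sol v2 x2 a s" using sol_subinterval[OF s1, of a s] sol_subinterval[OF s2, of a s] s(1) by auto
  have as: "a \<le> s" using s(1) by simp
  define J where "J = integral {a..s} (\<lambda>t. norm (v1 t - v2 t))"
  have J: "0 \<le> J" "J \<le> \<rho>"
  proof -
    show "0 \<le> J" unfolding J_def by (intro integral_nonneg norm_inputs_integrable[OF sub as]) auto
    have "J \<le> integral {a..b} (\<lambda>t. norm (v1 t - v2 t))"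
      unfolding J_def using s(1)
      by (intro integral_subset_le norm_inputs_integrable[OF sub as] norm_inputs_integrable[OF s1 s2 ab]) auto
    then show "J \<le> \<rho>" using \<rho> by simp
  qed
  have "0 \<le> integral {a..s} (\<lambda>t. (C *v (x1 t - x2 t)) \<bullet> (f (C *v x1 t) - f (C *v x2 t)))"
    by (intro integral_nonneg integrable_continuous_real continuous_pow[OF sub as] pow_nonneg[OF sub as])
  then have "m \<le> W (e a) (e a) + 2 * KC * R * J"
    using storage_dissipation[OF sub as KC(1) _ KC(2), of R] eR by (simp add: e_def m_def J_def)
  also have "2 * KC * R * J \<le> 2 * KC * R * \<rho>" using J KC(2) R by (intro mult_left_mono) auto
  also have "2 * KC * R * \<rho> \<le> m / 2 + 2 * KC\<^sup>2 * \<rho>\<^sup>2 / c"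
  proof -
    \<comment> \<open>Completing the square turns the forcing term into \<open>m / 2\<close>,
      absorbed on the left, and a constant.\<close>
    have "0 \<le> (c * R - 2 * KC * \<rho>)\<^sup>2 / (2 * c)" using W(3) by simp
    also have "\<dots> = c * R\<^sup>2 / 2 + 2 * KC\<^sup>2 * \<rho>\<^sup>2 / c - 2 * KC * R * \<rho>"
      using W(3) by (simp add: power2_eq_square field_simps)
    finally show ?thesis using R by simp
  qed
  finally have "m \<le> 2 * W (e a) (e a) + 4 * KC\<^sup>2 * \<rho>\<^sup>2 / c" by simp
  moreover have "c * (norm (e b))\<^sup>2 \<le> m" unfolding m_def
    by (rule order_trans[OF W(4) s(2)]) (use ab in auto)
  ultimately show ?thesis by (simp add: e_def)
qed

end

context lure
begin

section \<open>Incremental stability, uniform over bounded solutions\<close>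

text \<open>If the squared error stayed above \<open>q\<close> on the whole window, the decay
  \<open>2 * \<mu> * q * T\<close> would be at most \<open>D + \<mu> * q * T\<close> with
  \<open>D\<close> independent of \<open>T\<close>. So it is at most \<open>q\<close> at some time,
  and the storage form carries this to the end of the window. \<open>T\<close> and
  \<open>\<delta>\<close> depend on the solutions only through \<open>R\<close>.\<close>

lemma incremental_stability:
  assumes R: "R > 0" and eps: "\<epsilon> > 0"
  obtains T \<delta> where "T > 0" "\<delta> > 0"
    "\<And>v1 v2 x1 x2 a. sol v1 x1 a (a + T) \<Longrightarrow> sol v2 x2 a (a + T) \<Longrightarrow>
      (\<And>t. t \<in> {a..a + T} \<Longrightarrow> norm (x1 t) \<le> R) \<Longrightarrow> (\<And>t. t \<in> {a..a + T} \<Longrightarrow> norm (x2 t) \<le> R) \<Longrightarrow>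
      integral {a..a + T} (\<lambda>t. norm (v1 t - v2 t)) \<le> \<delta> \<Longrightarrow> norm (x1 (a + T) - x2 (a + T)) \<le> \<epsilon>"
proof -
  obtain KC where KC: "KC > 0" "\<And>x. norm (C *v x) \<le> norm x * KC"
    using bounded_linear.pos_bounded[OF matrix_vector_mul_bounded_linear[of C]] by blast
  obtain KB where KB: "KB > 0" "\<And>x. norm (B *v x) \<le> norm x * KB"
    using bounded_linear.pos_bounded[OF matrix_vector_mul_bounded_linear[of B]] by blast
  obtain KH where KH: "KH > 0" "\<And>x. norm (H *v x) \<le> norm x * KH"
    using bounded_linear.pos_bounded[OF matrix_vector_mul_bounded_linear[of H]] by blast
  obtain KS where KS: "KS > 0" "\<And>x y. norm (S x y) \<le> norm x * norm y * KS"
    using bounded_bilinear.pos_bounded[OF S(1)] by blast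
  obtain KW where KW: "KW > 0" "\<And>x y. norm (W x y) \<le> norm x * norm y * KW"
    using bounded_bilinear.pos_bounded[OF W(1)] by blast
  have WW: "W x x \<le> KW * (norm x)\<^sup>2" for x
    using KW(2)[of x x] by (simp add: power2_eq_square mult_ac)
  have W0: "0 \<le> W x x" for x
    using order_trans[OF _ W(4)[of x], of 0] W(3) by simp
  obtain \<theta> \<alpha> where ta: "\<theta> \<in> class_K_inf" "\<alpha> \<in> class_P"
    and sec: "\<And>y z. z \<in> cball 0 (KC * R) \<Longrightarrow> norm (f (y + z) - f z) \<le> \<theta> (norm y)"
      "\<And>y z. z \<in> cball 0 (KC * R) \<Longrightarrow> norm y * \<alpha> (norm y) \<le> y \<bullet> (f (y + z) - f z)"
    using sector[of "cball 0 (KC * R)"] by (metis compact_cball)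
  define r where "r = 2 * R"
  \<comment> \<open>\<open>KW * q\<close> is half of the target
    \<open>c * \<epsilon>\<^sup>2\<close>; the other half is left to the forcing by the second entry
    of \<open>\<delta>\<close>.\<close>
  define q where "q = c * \<epsilon>\<^sup>2 / (2 * KW)"
  \<comment> \<open>Gives \<open>2 * KS * r * \<eta> = \<mu> * q\<close>, half of the decay rate
    \<open>2 * \<mu> * q\<close>.\<close>
  define \<eta> where "\<eta> = \<mu> * q / (2 * KS * r)"
  have r: "r > 0" and q: "q > 0" using R eps W(3) KW by (auto simp: r_def q_def)
  then have eta: "\<eta> > 0" using S(4) KS by (auto simp: \<eta>_def)
  obtain k where k: "k \<ge> 0" "\<And>s. 0 \<le> s \<Longrightarrow> s \<le> KC * r \<Longrightarrow> KH * s + KB * \<theta> s \<le> \<eta> + k * (s * \<alpha> s)"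
    by (rule comparison_gauge[OF ta eta, of KH KB "KC * r"]) (use KH KB in auto)
  \<comment> \<open>\<open>P1\<close> bounds the integral of the output products over a window of
    any length, and \<open>D\<close> collects everything in the Lyapunov estimate that does not grow
    with that length.\<close>
  define P1 where "P1 = (KW * r\<^sup>2 + 2 * KC * r) / 2"
  define D where "D = KS * r\<^sup>2 + 2 * KS * r * (k * P1 + KB)"
  define T where "T = D / (\<mu> * q) + 1"
  \<comment> \<open>The bound 1 allows \<open>P1\<close> and \<open>D\<close>, hence
    \<open>T\<close>, to be fixed without reference to \<open>\<delta>\<close>.\<close>
  define \<delta> where "\<delta> = min 1 (c * \<epsilon>\<^sup>2 / (4 * KC * r))"
  have "P1 \<ge> 0" using KW KC r by (simp add: P1_def)
  then have "D \<ge> 0" using KS r k KB by (simp add: D_def)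
  then have T: "T > 0" "\<mu> * q * T > D"
    using S(4) q by (auto simp: T_def field_simps add_nonneg_pos)
  have d: "\<delta> > 0" "\<delta> \<le> 1" "2 * KC * r * \<delta> \<le> c * \<epsilon>\<^sup>2 / 2"
  proof -
    show "\<delta> > 0" "\<delta> \<le> 1" using W(3) eps KC r by (auto simp: \<delta>_def)
    have "\<delta> \<le> c * \<epsilon>\<^sup>2 / (4 * KC * r)" by (simp add: \<delta>_def)
    then show "2 * KC * r * \<delta> \<le> c * \<epsilon>\<^sup>2 / 2" using KC r by (simp add: field_simps)
  qed
  show thesis
  proof (rule that[OF T(1) d(1)])
    fix v1 v2 x1 x2 a
    assume s1: "sol v1 x1 a (a + T)" and s2: "sol v2 x2 a (a + T)"
      and b1: "\<And>t. t \<in> {a..a + T} \<Longrightarrow> norm (x1 t) \<le> R" and b2: "\<And>t. t \<in> {a..a + T} \<Longrightarrow> norm (x2 t) \<le> R"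
      and J: "integral {a..a + T} (\<lambda>t. norm (v1 t - v2 t)) \<le> \<delta>"
    define b where "b = a + T"
    have ab: "a \<le> b" "b - a = T" using T by (auto simp: b_def)
    define e where "e = (\<lambda>t. x1 t - x2 t)"
    define pw where "pw = (\<lambda>t. (C *v e t) \<bullet> (f (C *v x1 t) - f (C *v x2 t)))"
    note s1 = s1[folded b_def] and s2 = s2[folded b_def]
    have er: "norm (e t) \<le> r" if "t \<in> {a..b}" for t
      using norm_triangle_ineq4[of "x1 t" "x2 t"] b1[of t] b2[of t] that by (simp add: e_def r_def b_def)
    have dis: "W (e b) (e b) + 2 * integral {t..b} pw \<le> W (e t) (e t) + 2 * KC * r * \<delta>" "0 \<le> integral {t..b} pw"
      if t: "t \<in> {a..b}" for t
    proof -
      have u1: "sol v1 x1 t b" "sol v2 x2 t b" and tb: "t \<le> b"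
        using sol_subinterval[OF s1, of t b] sol_subinterval[OF s2, of t b] t by auto
      have "integral {t..b} (\<lambda>t. norm (v1 t - v2 t)) \<le> integral {a..b} (\<lambda>t. norm (v1 t - v2 t))"
        using t by (intro integral_subset_le norm_inputs_integrable[OF u1 tb] norm_inputs_integrable[OF s1 s2 ab(1)]) auto
      also have "\<dots> \<le> \<delta>" using J by (simp add: b_def)
      finally have "2 * KC * r * integral {t..b} (\<lambda>t. norm (v1 t - v2 t)) \<le> 2 * KC * r * \<delta>"
        using KC r by (intro mult_left_mono) auto
      moreover have "W (e b) (e b) + 2 * integral {t..b} pw \<le> W (e t) (e t) + 2 * KC * r * integral {t..b} (\<lambda>t. norm (v1 t - v2 t))"
        unfolding pw_def e_def
        by (rule storage_dissipation[OF u1 tb]) (use KC er t in \<open>auto simp: e_def mult.commute\<close>)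
      ultimately show "W (e b) (e b) + 2 * integral {t..b} pw \<le> W (e t) (e t) + 2 * KC * r * \<delta>" by linarith
      show "0 \<le> integral {t..b} pw" unfolding pw_def e_def
        by (intro integral_nonneg integrable_continuous_real continuous_pow[OF u1 tb] pow_nonneg[OF u1 tb])
    qed
    have ea: "norm (e a) \<le> r" using er ab by auto
    then have ea2: "(norm (e a))\<^sup>2 \<le> r\<^sup>2" by (intro power_mono) auto
    have WK: "W (e t) (e t) \<le> KW * u" if "(norm (e t))\<^sup>2 \<le> u" for t u
      by (rule order_trans[OF WW mult_left_mono[OF that]]) (use KW in simp)
    have pwP: "integral {a..b} pw \<le> P1"
    proof -
      have "2 * integral {a..b} pw \<le> W (e a) (e a) + 2 * KC * r * \<delta>"
        using dis(1)[of a] W0[of "e b"] ab by simp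
      also have "\<dots> \<le> KW * r\<^sup>2 + 2 * KC * r * 1"
        using KC r d by (intro add_mono WK[OF ea2] mult_left_mono) auto
      finally show ?thesis by (simp add: P1_def)
    qed
    have "\<exists>t\<in>{a..b}. (norm (e t))\<^sup>2 \<le> q"
    proof (rule ccontr)
      assume "\<not> ?thesis"
      then have big: "q \<le> (norm (e t))\<^sup>2" if "t \<in> {a..b}" for t
        using that by (meson less_imp_le not_le)
      have "integral {a..b} (\<lambda>t. q) \<le> integral {a..b} (\<lambda>t. (norm (e t))\<^sup>2)"
        using continuous_err[OF s1 s2 ab(1)] big
        by (intro integral_le integrable_continuous_real continuous_intros) (auto simp: e_def)
      then have "q * T \<le> integral {a..b} (\<lambda>t. (norm (e t))\<^sup>2)"
        using ab by (simp add: mult.commute)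
      then have "2 * \<mu> * (q * T) \<le> 2 * \<mu> * integral {a..b} (\<lambda>t. (norm (e t))\<^sup>2)"
        using S(4) by (intro mult_left_mono) auto
      also have "\<dots> \<le> S (e a) (e a) +
          2 * KS * r * (\<eta> * (b - a) + k * integral {a..b} pw + KB * integral {a..b} (\<lambda>t. norm (v1 t - v2 t)))"
        unfolding e_def pw_def
      proof (rule Lyapunov_estimate[OF s1 s2 ab(1), where KH=KH])
        show "\<bar>S x y\<bar> \<le> KS * norm x * norm y" for x y using KS(2)[of x y] by (simp add: mult_ac)
        show "norm (H *v y) \<le> KH * norm y" for y using KH(2)[of y] by (simp add: mult_ac)
        show "norm (B *v y) \<le> KB * norm y" for y using KB(2)[of y] by (simp add: mult_ac)
        show "KS \<ge> 0" "KB \<ge> 0" using KS KB by auto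
        fix t assume t: "t \<in> {a..b}"
        show "norm (x1 t - x2 t) \<le> r" using er[OF t] by (simp add: e_def)
        define y where "y = C *v (x1 t - x2 t)"
        define z where "z = C *v x2 t"
        have yz: "C *v x1 t = y + z" by (simp add: y_def z_def matrix_vector_mult_diff_distrib)
        have "norm z \<le> norm (x2 t) * KC" unfolding z_def by (rule KC)
        also have "\<dots> \<le> R * KC" using b2[of t] t KC by (intro mult_right_mono) (auto simp: b_def)
        finally have z: "z \<in> cball 0 (KC * R)" by (simp add: mult.commute)
        have "norm y \<le> norm (e t) * KC" unfolding y_def e_def by (rule KC)
        also have "\<dots> \<le> r * KC" using er[OF t] KC by (intro mult_right_mono) auto
        finally have "norm y \<le> KC * r" by (simp add: mult.commute)
        then have "KH * norm y + KB * \<theta> (norm y) \<le> \<eta> + k * (norm y * \<alpha> (norm y))"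
          by (intro k) auto
        moreover have "KB * norm (f (y + z) - f z) \<le> KB * \<theta> (norm y)"
          using sec(1)[OF z, of y] KB by (intro mult_left_mono) auto
        moreover have "k * (norm y * \<alpha> (norm y)) \<le> k * (y \<bullet> (f (y + z) - f z))"
          using sec(2)[OF z, of y] k(1) by (intro mult_left_mono)
        ultimately show "KH * norm (C *v (x1 t - x2 t)) + KB * norm (f (C *v x1 t) - f (C *v x2 t))
            \<le> \<eta> + k * ((C *v (x1 t - x2 t)) \<bullet> (f (C *v x1 t) - f (C *v x2 t)))"
          unfolding yz unfolding y_def[symmetric] z_def[symmetric] by linarith
      qed
      also have "\<dots> \<le> KS * r\<^sup>2 + 2 * KS * r * (\<eta> * T + k * P1 + KB * 1)"
      proof (intro add_mono mult_left_mono)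
        have "S (e a) (e a) \<le> KS * (norm (e a))\<^sup>2" using KS(2)[of "e a" "e a"] by (simp add: power2_eq_square mult_ac)
        also have "\<dots> \<le> KS * r\<^sup>2" using ea2 KS by (intro mult_left_mono) auto
        finally show "S (e a) (e a) \<le> KS * r\<^sup>2" .
        show "integral {a..b} (\<lambda>t. norm (v1 t - v2 t)) \<le> 1" using J d by (simp add: b_def)
      qed (use ab eta pwP k KB KS r in auto)
      also have "\<dots> = D + 2 * KS * r * \<eta> * T" by (simp add: D_def algebra_simps)
      also have "2 * KS * r * \<eta> = \<mu> * q" using KS r by (simp add: \<eta>_def)
      finally have "\<mu> * q * T \<le> D" by (simp add: algebra_simps)
      then show False using T by simp
    qed
    then obtain t where t: "t \<in> {a..b}" "(norm (e t))\<^sup>2 \<le> q" by blast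
    have "c * (norm (e b))\<^sup>2 \<le> W (e b) (e b)" by (rule W(4))
    also have "\<dots> \<le> W (e t) (e t) + 2 * KC * r * \<delta>" using dis[OF t(1)] by linarith
    also have "\<dots> \<le> KW * q + c * \<epsilon>\<^sup>2 / 2"
      by (intro add_mono WK[OF t(2)] d(3))
    also have "\<dots> = c * \<epsilon>\<^sup>2" using KW by (simp add: q_def)
    finally have "(norm (e b))\<^sup>2 \<le> \<epsilon>\<^sup>2" using W(3) by simp
    then have "norm (e b) \<le> \<epsilon>" using eps by (simp add: power2_le_iff_abs_le)
    then show "norm (x1 (a + T) - x2 (a + T)) \<le> \<epsilon>" by (simp add: e_def b_def)
  qed
qed

end

section \<open>Stepanov almost periodic functions\<close>

definition L1_dist :: "(real \<Rightarrow> 'a::euclidean_space) \<Rightarrow> (real \<Rightarrow> 'a) \<Rightarrow> real \<Rightarrow> real \<Rightarrow> real"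
  where "L1_dist u v a b = integral {a..b} (\<lambda>s. norm (u s - v s))"

lemma L1_dist_nonneg:
  assumes "u absolutely_integrable_on {a..b}" "v absolutely_integrable_on {a..b}"
  shows "0 \<le> L1_dist u v a b"
  unfolding L1_dist_def by (intro integral_nonneg absolutely_integrable_diff_norm assms) auto

lemma L1_dist_triangle:
  assumes "u absolutely_integrable_on {a..b}" "v absolutely_integrable_on {a..b}" "w absolutely_integrable_on {a..b}"
  shows "L1_dist u w a b \<le> L1_dist u v a b + L1_dist v w a b"
proof -
  have i: "(\<lambda>s. norm (u s - v s)) integrable_on {a..b}" "(\<lambda>s. norm (v s - w s)) integrable_on {a..b}"
    "(\<lambda>s. norm (u s - w s)) integrable_on {a..b}"
    by (intro absolutely_integrable_diff_norm assms)+
  have "L1_dist u w a b \<le> integral {a..b} (\<lambda>s. norm (u s - v s) + norm (v s - w s))"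
    unfolding L1_dist_def by (intro integral_le i integrable_add) norm
  also have "\<dots> = L1_dist u v a b + L1_dist v w a b"
    unfolding L1_dist_def by (rule integral_add[OF i(1,2)])
  finally show ?thesis .
qed

lemma L1_dist_commute: "L1_dist u v a b = L1_dist v u a b"
  by (simp add: L1_dist_def norm_minus_commute)

lemma L1_dist_shift: "L1_dist (\<lambda>s. u (s + c)) (\<lambda>s. v (s + c)) a b = L1_dist u v (a + c) (b + c)"
  unfolding L1_dist_def using integral_shift_interval[of a b "\<lambda>s. norm (u s - v s)" c] .

lemma L1_dist_mono:
  assumes "u absolutely_integrable_on {a..b}" "v absolutely_integrable_on {a..b}" "a \<le> a'" "b' \<le> b"
  shows "L1_dist u v a' b' \<le> L1_dist u v a b"
  unfolding L1_dist_def using assms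
  by (intro integral_subset_le absolutely_integrable_diff_norm) (auto intro: absolutely_integrable_on_subinterval)

lemma L1_dist_combine:
  assumes "u absolutely_integrable_on {a..b}" "v absolutely_integrable_on {a..b}" "a \<le> c" "c \<le> b"
  shows "L1_dist u v a b = L1_dist u v a c + L1_dist u v c b"
  unfolding L1_dist_def using assms
  by (intro Henstock_Kurzweil_Integration.integral_combine[symmetric] absolutely_integrable_diff_norm)

lemma L1_dist_cong_AE:
  assumes "AE s in lebesgue. s \<in> {a..b} \<longrightarrow> u s = u' s" "AE s in lebesgue. s \<in> {a..b} \<longrightarrow> v s = v' s"
  shows "L1_dist u v a b = L1_dist u' v' a b"
proof -
  have "AE s in lebesgue. s \<in> {a..b} \<longrightarrow> norm (u s - v s) = norm (u' s - v' s)"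
    using assms by eventually_elim auto
  then have "negligible {s. \<not> (s \<in> {a..b} \<longrightarrow> norm (u s - v s) = norm (u' s - v' s))}"
    by (simp only: AE_lebesgue_iff_negligible)
  then show ?thesis unfolding L1_dist_def by (rule integral_spike) auto
qed

lemma L1_dist_zero_AE:
  assumes "u absolutely_integrable_on {a..b}" "v absolutely_integrable_on {a..b}" "L1_dist u v a b \<le> 0"
  shows "AE s in lebesgue. s \<in> {a..b} \<longrightarrow> u s = v s"
proof -
  define M where "M = lebesgue_on {a..b}"
  have i: "integrable M (\<lambda>s. norm (u s - v s))"
    unfolding M_def
    using absolutely_integrable_imp_integrable[OF set_integral_diff(1)[OF assms(1,2)]] by (intro integrable_norm) simp
  have "integral\<^sup>L M (\<lambda>s. norm (u s - v s)) = L1_dist u v a b"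
    unfolding L1_dist_def M_def by (rule lebesgue_integral_eq_integral) (use i in \<open>simp_all add: M_def\<close>)
  then have "integral\<^sup>L M (\<lambda>s. norm (u s - v s)) = 0"
    using assms(3) L1_dist_nonneg[OF assms(1,2)] by simp
  then have "AE s in M. norm (u s - v s) = 0"
    by (subst (asm) integral_nonneg_eq_0_iff_AE[OF i]) auto
  then show ?thesis unfolding M_def by (subst (asm) AE_restrict_space_iff) auto
qed

lemma L1_loc_shift:
  fixes v :: "real \<Rightarrow> 'a::euclidean_space"
  assumes "halfline_or_line T" "v \<in> L1_loc T" "a + \<tau> \<in> T"
  shows "(\<lambda>s. v (s + \<tau>)) absolutely_integrable_on {a..b}"
  using assms by (intro absolutely_integrable_shift) (auto simp: L1_loc_iff)

lemma stepanov_periods_iff: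
  fixes v :: "real \<Rightarrow> 'a::euclidean_space"
  assumes T: "halfline_or_line T" and v: "v \<in> L1_loc T"
  shows "\<tau> \<in> stepanov_periods T v \<epsilon> \<longleftrightarrow> \<tau> \<in> T \<and> (\<forall>a\<in>T. L1_dist (\<lambda>s. v (s + \<tau>)) v a (a + 1) \<le> \<epsilon>)"
proof -
  have "(LINT s:{a..a + 1}|lebesgue. norm (v (s + \<tau>) - v s)) = L1_dist (\<lambda>s. v (s + \<tau>)) v a (a + 1)"
    if "\<tau> \<in> T" "a \<in> T" for a
  proof -
    have at: "a + \<tau> \<in> T" using that T by (auto simp: halfline_or_line_def)
    have "(\<lambda>s. v (s + \<tau>) - v s) absolutely_integrable_on {a..a + 1}"
      using L1_loc_shift[OF T v at] v that by (intro set_integral_diff(1)) (auto simp: L1_loc_iff[OF T])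
    then have "(\<lambda>s. norm (v (s + \<tau>) - v s)) absolutely_integrable_on {a..a + 1}"
      by (rule absolutely_integrable_norm[unfolded o_def])
    then show ?thesis unfolding L1_dist_def by (rule set_lebesgue_integral_eq_integral(2))
  qed
  then show ?thesis unfolding stepanov_periods_def by auto
qed

lemma S1_iff:
  "v \<in> S1 T \<longleftrightarrow> v \<in> L1_loc T \<and> (\<forall>\<epsilon>>0. \<exists>l>0. \<forall>a\<in>T. \<exists>\<tau>\<in>stepanov_periods T v \<epsilon>. a \<le> \<tau> \<and> \<tau> \<le> a + l)"
proof -
  have "stepanov_periods T v \<epsilon> \<subseteq> T" for \<epsilon> by (auto simp: stepanov_periods_def)
  moreover have "{a..a + l} \<inter> X \<noteq> {} \<longleftrightarrow> (\<exists>\<tau>\<in>X. a \<le> \<tau> \<and> \<tau> \<le> a + l)" for a l :: real and X by auto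
  ultimately show ?thesis unfolding S1_def relatively_dense_def by simp
qed

section \<open>Unit intervals, the space \<open>L1\<close> and the extension of Stepanov
  functions\<close>

lemma integrable_leb01_iff:
  fixes f :: "real \<Rightarrow> 'a::euclidean_space"
  shows "integrable leb01 f \<longleftrightarrow> f absolutely_integrable_on {0..1}"
  by (simp add: integrable_restrict_space set_integrable_def)

lemma norm_diff_abs_L1:
  fixes f g :: "real \<Rightarrow> 'a::euclidean_space"
  assumes f: "f absolutely_integrable_on {0..1}" and g: "g absolutely_integrable_on {0..1}"
  shows "norm (abs_L1 f - abs_L1 g) = L1_dist f g 0 1"
proof -
  have i: "integrable leb01 (\<lambda>s. f s - g s)" using assms by (simp add: integrable_leb01_iff[symmetric])
  have "norm (abs_L1 f - abs_L1 g) = (\<integral>s. norm (f s - g s) \<partial>leb01)"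
    using assms i by (simp add: abs_L1_diff norm_abs_L1 integrable_leb01_iff[symmetric])
  also have "\<dots> = L1_dist f g 0 1"
    unfolding L1_dist_def by (rule lebesgue_integral_eq_integral) (use i in auto)
  finally show ?thesis .
qed

lemma absolutely_integrable_unit_blocks:
  fixes u :: "real \<Rightarrow> 'a::euclidean_space"
  assumes "\<And>k::int. u absolutely_integrable_on {of_int k..of_int k + 1}"
  shows "u absolutely_integrable_on {a..b}"
proof -
  have n: "u absolutely_integrable_on {of_int k..of_int k + real n}" for k :: int and n
  proof (induction n)
    case 0
    show ?case using absolutely_integrable_on_subinterval[OF assms[of k], of "of_int k" "of_int k"] by simp
  next
    case (Suc n)
    have "u absolutely_integrable_on ({of_int k..of_int k + real n} \<union> {of_int k + real n..of_int k + real n + 1})"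
      using Suc assms[of "k + int n"] by (intro set_integrable_Un) auto
    moreover have "{of_int k..of_int k + real n} \<union> {of_int k + real n..of_int k + real n + 1} = {of_int k..of_int k + real (Suc n)}"
      by auto
    ultimately show ?case by simp
  qed
  have "{a..b} \<subseteq> {of_int \<lfloor>a\<rfloor>..of_int \<lfloor>a\<rfloor> + real (nat \<lceil>b - of_int \<lfloor>a\<rfloor>\<rceil>)}"
  proof -
    have "b - of_int \<lfloor>a\<rfloor> \<le> real (nat \<lceil>b - of_int \<lfloor>a\<rfloor>\<rceil>)" by (rule real_nat_ceiling_ge)
    then show ?thesis by (auto intro: order_trans[OF of_int_floor_le])
  qed
  from absolutely_integrable_on_subinterval[OF n this] show ?thesis .
qed

text \<open>Translates by Stepanov periods \<open>\<tau> k \<ge> k\<close> are Cauchy in the mean on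
  every block between consecutive integers; the limits exist by completeness of \<open>L1\<close>,
  and representatives are glued along the integers. The last conclusion keeps the same
  \<open>\<epsilon>\<close>, so that periods are transferred without loss.\<close>

theorem S1_extension_exists:
  fixes w :: "real \<Rightarrow> 'a::euclidean_space"
  assumes w: "w \<in> S1 {0..}"
  obtains u where "u \<in> S1 UNIV" "AE t in lebesgue. 0 \<le> t \<longrightarrow> u t = w t"
    "\<And>\<epsilon>. stepanov_periods {0..} w \<epsilon> \<subseteq> stepanov_periods UNIV u \<epsilon>"
proof -
  have wL: "w \<in> L1_loc {0..}"
    and wd: "\<And>\<epsilon>. \<epsilon> > 0 \<Longrightarrow> \<exists>l>0. \<forall>a\<ge>0. \<exists>\<tau>\<in>stepanov_periods {0..} w \<epsilon>. a \<le> \<tau> \<and> \<tau> \<le> a + l"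
    using w unfolding S1_iff Ball_def atLeast_iff by blast+
  have wi: "(\<lambda>s. w (s + \<tau>)) absolutely_integrable_on {a..b}" if "a + \<tau> \<ge> 0" for a b \<tau>
    using that by (intro L1_loc_shift[OF _ wL]) auto
  have wi0: "w absolutely_integrable_on {a..b}" if "a \<ge> 0" for a b using wi[of a 0] that by simp
  have per: "L1_dist (\<lambda>s. w (s + \<tau>)) w a (a + 1) \<le> \<epsilon>" if "\<tau> \<in> stepanov_periods {0..} w \<epsilon>" "a \<ge> 0" for \<tau> \<epsilon> a
    using that stepanov_periods_iff[of "{0..}" w] wL by auto
  have per0: "\<tau> \<ge> 0" if "\<tau> \<in> stepanov_periods {0..} w \<epsilon>" for \<tau> \<epsilon>
    using that by (auto simp: stepanov_periods_def)
  have "\<exists>\<tau>. \<tau> \<ge> real k \<and> \<tau> \<in> stepanov_periods {0..} w (1 / real (Suc k))" for k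
    using wd[of "1 / real (Suc k)"] by (metis divide_pos_pos of_nat_0_le_iff of_nat_0_less_iff zero_less_Suc zero_less_one)
  then obtain \<tau> where \<tau>: "\<And>k. \<tau> k \<ge> real k" "\<And>k. \<tau> k \<in> stepanov_periods {0..} w (1 / real (Suc k))" by metis
  define wj where "wj = (\<lambda>j s. w (s + \<tau> j))"
  have cl: "L1_dist (wj i) (wj j) a (a + 1) \<le> 1 / real (Suc i) + 1 / real (Suc j)"
    if "a + \<tau> i \<ge> 0" "a + \<tau> j \<ge> 0" for a i j
  proof -
    define m where "m = (\<lambda>s. w (s + \<tau> i + \<tau> j))"
    have mi: "m absolutely_integrable_on {a..a + 1}"
      using wi[of a "\<tau> i + \<tau> j"] that \<tau>(1)[of i] by (simp add: m_def add.assoc)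
    have "L1_dist m (wj i) a (a + 1) \<le> 1 / real (Suc j)"
      using per[OF \<tau>(2)[of j] that(1)] L1_dist_shift[of "\<lambda>s. w (s + \<tau> j)" "\<tau> i" w a "a + 1"] by (simp add: m_def wj_def add_ac)
    moreover have "L1_dist m (wj j) a (a + 1) \<le> 1 / real (Suc i)"
      using per[OF \<tau>(2)[of i] that(2)] L1_dist_shift[of "\<lambda>s. w (s + \<tau> i)" "\<tau> j" w a "a + 1"] by (simp add: m_def wj_def add_ac)
    moreover have "L1_dist (wj i) (wj j) a (a + 1) \<le> L1_dist (wj i) m a (a + 1) + L1_dist m (wj j) a (a + 1)"
      unfolding wj_def using that by (intro L1_dist_triangle wi mi[unfolded m_def] mi)
    ultimately show ?thesis using L1_dist_commute[of "wj i" m] by simp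
  qed
  have blk: "\<exists>g. g absolutely_integrable_on {0..1} \<and>
      (\<forall>j. of_int k + real j \<ge> 0 \<longrightarrow> L1_dist g (\<lambda>s. w (s + (of_int k + \<tau> j))) 0 1 \<le> 1 / real (Suc j))" for k :: int
  proof -
    define p where "p = (\<lambda>j s. w (s + (of_int k + \<tau> j)))"
    \<comment> \<open>From this index on all translates are defined on the block.\<close>
    define n0 where "n0 = nat \<bar>k\<bar>"
    have ge: "of_int k + \<tau> j \<ge> 0" if "of_int k + real j \<ge> 0" for j using that \<tau>(1)[of j] by linarith
    have n0: "of_int k + real j \<ge> 0" if "j \<ge> n0" for j
      using that unfolding n0_def by linarith
    have pi: "p j absolutely_integrable_on {0..1}" if "of_int k + real j \<ge> 0" for j
      unfolding p_def using ge[OF that] by (intro wi) auto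
    have pd: "norm (abs_L1 (p i) - abs_L1 (p j)) \<le> 1 / real (Suc i) + 1 / real (Suc j)"
      if "of_int k + real i \<ge> 0" "of_int k + real j \<ge> 0" for i j
      using cl[OF ge ge, OF that] L1_dist_shift[of "wj i" "of_int k" "wj j" 0 1]
      unfolding norm_diff_abs_L1[OF pi pi, OF that] by (simp add: p_def wj_def add_ac)
    have "Cauchy (\<lambda>j. abs_L1 (p (j + n0)))"
    proof (rule CauchyI)
      fix e :: real assume "e > 0"
      then obtain N where N: "1 / real (Suc N) < e / 2" using nat_approx_posE[of "e / 2"] by auto
      have "norm (abs_L1 (p (i + n0)) - abs_L1 (p (j + n0))) < e" if "i \<ge> N" "j \<ge> N" for i j
      proof -
        have "1 / real (Suc (i + n0)) \<le> 1 / real (Suc N)" "1 / real (Suc (j + n0)) \<le> 1 / real (Suc N)"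
          using that by (auto intro!: divide_left_mono)
        then show ?thesis using pd[of "i + n0" "j + n0"] n0[of "i + n0"] n0[of "j + n0"] N by simp
      qed
      then show "\<exists>M. \<forall>m\<ge>M. \<forall>n\<ge>M. norm (abs_L1 (p (m + n0)) - abs_L1 (p (n + n0))) < e" by blast
    qed
    then obtain G where G: "(\<lambda>j. abs_L1 (p (j + n0))) \<longlonglongrightarrow> G" using Cauchy_convergent convergent_def by blast
    obtain g where g: "integrable leb01 g" "G = abs_L1 g" by (rule L1_repE)
    have gi: "g absolutely_integrable_on {0..1}" using g(1) by (simp add: integrable_leb01_iff)
    have "L1_dist g (p j) 0 1 \<le> 1 / real (Suc j)" if j: "of_int k + real j \<ge> 0" for j
    proof -
      have "norm (G - abs_L1 (p j)) \<le> 1 / real (Suc j)"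
      proof (rule tendsto_le[OF _ _ tendsto_norm[OF tendsto_diff[OF G tendsto_const]]])
        show "(\<lambda>i. 1 / real (Suc (i + n0)) + 1 / real (Suc j)) \<longlonglongrightarrow> 1 / real (Suc j)"
          using tendsto_add[OF LIMSEQ_ignore_initial_segment[OF LIMSEQ_inverse_real_of_nat, of n0] tendsto_const[of "1 / real (Suc j)"]]
          by (simp add: inverse_eq_divide)
        show "\<forall>\<^sub>F i in sequentially. norm (abs_L1 (p (i + n0)) - abs_L1 (p j)) \<le> 1 / real (Suc (i + n0)) + 1 / real (Suc j)"
          by (rule always_eventually, rule allI, rule pd[OF n0 j]) simp
      qed simp
      then show ?thesis unfolding g(2) norm_diff_abs_L1[OF gi pi[OF j]] .
    qed
    then show ?thesis using gi unfolding p_def by blast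
  qed
  then obtain g where g: "\<And>k. g k absolutely_integrable_on {0..1}"
    "\<And>k j. of_int k + real j \<ge> 0 \<Longrightarrow> L1_dist (g k) (\<lambda>s. w (s + (of_int k + \<tau> j))) 0 1 \<le> 1 / real (Suc j)"
    by metis
  \<comment> \<open>The blocks are taken half-open: the right end of a block belongs to the next
    one, which changes \<open>u\<close> only at a single point of the closed block.\<close>
  define u where "u = (\<lambda>t. g \<lfloor>t\<rfloor> (t - of_int \<lfloor>t\<rfloor>))"
  have gk: "AE s in lebesgue. s \<in> {of_int k..of_int k + 1} \<longrightarrow> u s = g k (s - of_int k)" for k
    unfolding AE_lebesgue_iff_negligible
  proof (rule negligible_subset[of "{of_int k + 1}"])
    have "\<lfloor>s\<rfloor> = k" if "of_int k \<le> s" "s \<le> of_int k + 1" "s \<noteq> of_int k + 1" for s :: real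
      using that by (simp add: floor_eq_iff)
    then show "{s. \<not> (s \<in> {of_int k..of_int k + 1} \<longrightarrow> u s = g k (s - of_int k))} \<subseteq> {of_int k + 1}"
      by (auto simp: u_def)
  qed simp
  have gs: "(\<lambda>s. g k (s - of_int k)) absolutely_integrable_on {of_int k..of_int k + 1}" for k
    using absolutely_integrable_shift[where f="g k" and a="of_int k" and c="- of_int k" and b="of_int k + 1"] g(1)[of k] by simp
  have ui: "u absolutely_integrable_on {a..b}" for a b
  proof (rule absolutely_integrable_unit_blocks)
    fix k :: int
    show "u absolutely_integrable_on {of_int k..of_int k + 1}"
      by (rule absolutely_integrable_spike[OF gs gk[unfolded AE_lebesgue_iff_negligible]]) auto
  qed
  have ublk: "L1_dist u (wj j) (of_int k) (of_int k + 1) \<le> 1 / real (Suc j)" if "of_int k + real j \<ge> 0" for k :: int and j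
  proof -
    have "L1_dist u (wj j) (of_int k) (of_int k + 1) = L1_dist (\<lambda>s. g k (s - of_int k)) (wj j) (of_int k) (of_int k + 1)"
      by (rule L1_dist_cong_AE[OF gk]) simp
    also have "\<dots> = L1_dist (g k) (\<lambda>s. w (s + (of_int k + \<tau> j))) 0 1"
      using L1_dist_shift[of "\<lambda>s. g k (s - of_int k)" "of_int k" "wj j" 0 1] by (simp add: wj_def add_ac)
    finally show ?thesis using g(2)[OF that] by simp
  qed
  \<comment> \<open>An arbitrary unit interval is covered by two blocks, hence the factor 2.\<close>
  have uw: "L1_dist u (wj j) a (a + 1) \<le> 2 / real (Suc j)" if "a - 1 + real j \<ge> 0" for a j
  proof -
    define k where "k = \<lfloor>a\<rfloor>"
    have k: "of_int k \<le> a" "a < of_int k + 1" by (auto simp: k_def)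
    have j0: "of_int k + real j \<ge> 0" "of_int (k + 1) + real j \<ge> 0" using k that by auto
    have wji: "wj j absolutely_integrable_on {of_int k..of_int k + 2}"
      unfolding wj_def using j0 \<tau>(1)[of j] by (intro wi) linarith
    have "L1_dist u (wj j) a (a + 1) \<le> L1_dist u (wj j) (of_int k) (of_int k + 2)"
      by (rule L1_dist_mono[OF ui wji]) (use k in auto)
    also have "\<dots> = L1_dist u (wj j) (of_int k) (of_int k + 1) + L1_dist u (wj j) (of_int k + 1) (of_int k + 2)"
      by (rule L1_dist_combine[OF ui wji]) auto
    also have "\<dots> \<le> 1 / real (Suc j) + 1 / real (Suc j)"
      using ublk[OF j0(1)] ublk[OF j0(2)] by (intro add_mono) (simp_all add: add.assoc)
    finally show ?thesis by simp
  qed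
  have lim: "(\<lambda>j. c / real (Suc j)) \<longlonglongrightarrow> 0" for c :: real
    using tendsto_mult[OF tendsto_const[of c] LIMSEQ_inverse_real_of_nat] by (simp add: inverse_eq_divide)
  have wji: "wj j absolutely_integrable_on {a..b}" if "a + real j \<ge> 0" for a b j
    unfolding wj_def using that \<tau>(1)[of j] by (intro wi) linarith
  show thesis
  proof (rule that)
    have blk0: "AE t in lebesgue. t \<in> {real k..real k + 1} \<longrightarrow> u t = w t" for k
    proof (rule L1_dist_zero_AE[OF ui wi0])
      show "L1_dist u w (real k) (real k + 1) \<le> 0"
      proof (rule tendsto_lowerbound[OF lim[of 3]])
        show "\<forall>\<^sub>F j in sequentially. L1_dist u w (real k) (real k + 1) \<le> 3 / real (Suc j)"
          unfolding eventually_sequentially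
        proof (intro exI[of _ 1] allI impI)
          fix j :: nat assume j: "1 \<le> j"
          have "L1_dist u w (real k) (real k + 1) \<le> L1_dist u (wj j) (real k) (real k + 1) + L1_dist (wj j) w (real k) (real k + 1)"
            by (intro L1_dist_triangle ui wji wi0) auto
          also have "\<dots> \<le> 2 / real (Suc j) + 1 / real (Suc j)"
            using uw[of "real k" j] per[OF \<tau>(2)[of j], of "real k"] j by (intro add_mono) (auto simp: wj_def)
          finally show "L1_dist u w (real k) (real k + 1) \<le> 3 / real (Suc j)" by simp
        qed
      qed simp
    qed simp
    have "AE t in lebesgue. \<forall>k::nat. t \<in> {real k..real k + 1} \<longrightarrow> u t = w t"
      using blk0 by (subst AE_all_countable) blast
    then show "AE t in lebesgue. 0 \<le> t \<longrightarrow> u t = w t"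
    proof eventually_elim
      case (elim t)
      show ?case
      proof
        assume "0 \<le> t"
        then have "t \<in> {real (nat \<lfloor>t\<rfloor>)..real (nat \<lfloor>t\<rfloor>) + 1}" by simp
        then show "u t = w t" using elim by blast
      qed
    qed
    have uL: "u \<in> L1_loc UNIV" using ui by (simp add: L1_loc_iff)
    have pos: "L1_dist (\<lambda>s. u (s + p)) u a (a + 1) \<le> \<epsilon>" if p: "p \<in> stepanov_periods {0..} w \<epsilon>" for p \<epsilon> a
    proof (rule tendsto_lowerbound)
      show "(\<lambda>j. 4 / real (Suc j) + \<epsilon>) \<longlonglongrightarrow> \<epsilon>" using tendsto_add[OF lim[of 4] tendsto_const[of \<epsilon>]] by simp
      show "\<forall>\<^sub>F j in sequentially. L1_dist (\<lambda>s. u (s + p)) u a (a + 1) \<le> 4 / real (Suc j) + \<epsilon>"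
        unfolding eventually_sequentially
      proof (intro exI[of _ "nat \<lceil>\<bar>a\<bar> + 1\<rceil>"] allI impI)
        fix j assume "nat \<lceil>\<bar>a\<bar> + 1\<rceil> \<le> j"
        then have j: "\<bar>a\<bar> + 1 \<le> real j"
          using real_nat_ceiling_ge[of "\<bar>a\<bar> + 1"] by linarith
        have p0: "p \<ge> 0" using per0[OF p] .
        have i: "(\<lambda>s. u (s + p)) absolutely_integrable_on {a..a + 1}" "(\<lambda>s. wj j (s + p)) absolutely_integrable_on {a..a + 1}"
          "wj j absolutely_integrable_on {a..a + 1}"
          using j p0 by (auto intro!: absolutely_integrable_shift ui wji)
        have "L1_dist (\<lambda>s. u (s + p)) u a (a + 1) \<le> L1_dist (\<lambda>s. u (s + p)) (\<lambda>s. wj j (s + p)) a (a + 1) +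
           (L1_dist (\<lambda>s. wj j (s + p)) (wj j) a (a + 1) + L1_dist (wj j) u a (a + 1))"
          using L1_dist_triangle[OF i(1,2) ui] L1_dist_triangle[OF i(2,3) ui] by linarith
        also have "L1_dist (\<lambda>s. u (s + p)) (\<lambda>s. wj j (s + p)) a (a + 1) \<le> 2 / real (Suc j)"
          using uw[of "a + p" j] j p0 by (simp add: L1_dist_shift add_ac)
        also have "L1_dist (\<lambda>s. wj j (s + p)) (wj j) a (a + 1) \<le> \<epsilon>"
        proof -
          have "a + \<tau> j \<ge> 0" using j \<tau>(1)[of j] by linarith
          then show ?thesis
            using per[OF p, of "a + \<tau> j"] L1_dist_shift[of "\<lambda>s. w (s + p)" "\<tau> j" w a "a + 1"] by (simp add: wj_def add_ac)
        qed
        also have "L1_dist (wj j) u a (a + 1) \<le> 2 / real (Suc j)"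
          using uw[of a j] j L1_dist_commute[of "wj j" u] by simp
        finally show "L1_dist (\<lambda>s. u (s + p)) u a (a + 1) \<le> 4 / real (Suc j) + \<epsilon>" by simp
      qed
    qed simp
    \<comment> \<open>All unit intervals of the line are controlled, so translating the interval
      turns \<open>p\<close> into \<open>- p\<close>; this provides periods in windows to the left
      of the origin.\<close>
    have neg: "L1_dist (\<lambda>s. u (s + - p)) u a (a + 1) \<le> \<epsilon>" if p: "p \<in> stepanov_periods {0..} w \<epsilon>" for p \<epsilon> a
      using pos[OF p, of "a - p"] L1_dist_shift[of "\<lambda>s. u (s + p)" "- p" u a "a + 1"] L1_dist_commute[of u "\<lambda>s. u (s - p)"]
      by (simp add: algebra_simps)
    show "stepanov_periods {0..} w \<epsilon> \<subseteq> stepanov_periods UNIV u \<epsilon>" for \<epsilon>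
      using pos by (auto simp: stepanov_periods_iff[OF halfline_or_line_simps(2) uL])
    show "u \<in> S1 UNIV" unfolding S1_iff
    proof (intro conjI uL allI impI)
      fix \<epsilon> :: real assume e: "\<epsilon> > 0"
      then obtain l where l: "l > 0" "\<And>a. a \<ge> 0 \<Longrightarrow> \<exists>p\<in>stepanov_periods {0..} w \<epsilon>. a \<le> p \<and> p \<le> a + l" using wd by blast
      show "\<exists>l>0. \<forall>a\<in>UNIV. \<exists>\<tau>\<in>stepanov_periods UNIV u \<epsilon>. a \<le> \<tau> \<and> \<tau> \<le> a + l"
      proof (intro exI[of _ l] conjI l(1) ballI)
        fix a :: real
        note iff = stepanov_periods_iff[OF halfline_or_line_simps(2) uL, of _ \<epsilon>]
        consider "a \<ge> 0" | "a + l \<le> 0" | "a < 0" "a + l > 0" by linarith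
        then show "\<exists>\<tau>\<in>stepanov_periods UNIV u \<epsilon>. a \<le> \<tau> \<and> \<tau> \<le> a + l"
        proof cases
          case 1
          then obtain p where "p \<in> stepanov_periods {0..} w \<epsilon>" "a \<le> p" "p \<le> a + l" using l(2) by blast
          then show ?thesis using pos by (intro bexI[of _ p]) (auto simp: iff)
        next
          case 2
          then obtain p where "p \<in> stepanov_periods {0..} w \<epsilon>" "- a - l \<le> p" "p \<le> - a - l + l" using l(2)[of "- a - l"] by auto
          then show ?thesis using neg by (intro bexI[of _ "- p"]) (auto simp: iff)
        next
          case 3
          have "L1_dist u u x y = 0" for x y by (simp add: L1_dist_def)
          then have "0 \<in> stepanov_periods UNIV u \<epsilon>" using e by (simp add: iff)
          then show ?thesis using 3 by (intro bexI[of _ 0]) auto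
        qed
      qed
    qed
  qed
qed

section \<open>The Bochner transform\<close>

lemma bochner_transform_dist:
  fixes v :: "real \<Rightarrow> 'a::euclidean_space"
  assumes v: "v \<in> L1_loc UNIV"
  shows "norm (bochner_transform v s - bochner_transform v t) = L1_dist (\<lambda>x. v (x + (s - t))) v t (t + 1)"
proof -
  have i: "(\<lambda>x. v (r + x)) absolutely_integrable_on {0..1}" for r
    using L1_loc_shift[OF halfline_or_line_simps(2) v, of 0 r 1] by (simp add: add.commute)
  have "norm (bochner_transform v s - bochner_transform v t) = L1_dist (\<lambda>x. v (s + x)) (\<lambda>x. v (t + x)) 0 1"
    unfolding bochner_transform_def by (rule norm_diff_abs_L1[OF i i])
  then show ?thesis using L1_dist_shift[of "\<lambda>x. v (x + (s - t))" t v 0 1] by (simp add: algebra_simps)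
qed

text \<open>The integral over a unit interval in the Stepanov condition is the norm of
  \<open>L1\<close>. Results on Bohr almost periodic functions, in particular the one on frequency
  modules, thus apply to Stepanov periods.\<close>

lemma bochner_almost_periods:
  fixes v :: "real \<Rightarrow> 'a::euclidean_space"
  assumes v: "v \<in> L1_loc UNIV"
  shows "almost_periods UNIV (bochner_transform v) \<epsilon> = stepanov_periods UNIV v \<epsilon>"
proof -
  have "norm (bochner_transform v t - bochner_transform v (t + \<tau>)) = L1_dist (\<lambda>x. v (x + \<tau>)) v t (t + 1)" for t \<tau>
    using bochner_transform_dist[OF v, of "t + \<tau>" t] by (simp add: norm_minus_commute)
  then show ?thesis using stepanov_periods_iff[OF halfline_or_line_simps(2) v] by (auto simp: almost_periods_def)
qed

lemma bochner_transform_AP: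
  fixes v :: "real \<Rightarrow> 'a::euclidean_space"
  assumes v: "v \<in> S1 UNIV"
  shows "bochner_transform v \<in> AP UNIV"
proof -
  have vL: "v \<in> L1_loc UNIV" using v by (simp add: S1_def)
  have "continuous_on UNIV (bochner_transform v)"
    unfolding continuous_on_iff
  proof (intro ballI allI impI)
    fix t e :: real assume e: "e > 0"
    have "v absolutely_integrable_on {t - 1..(t + 1) + 1}" using vL by (simp add: L1_loc_iff)
    then obtain d where d: "0 < d" "\<And>h. \<bar>h\<bar> < d \<Longrightarrow> integral {t..t + 1} (\<lambda>x. norm (v (x + h) - v x)) < e"
      using L1_translation_continuous[where f=v and a=t and b="t + 1" and e=e] e by auto
    have "dist (bochner_transform v s) (bochner_transform v t) < e" if "dist s t < d" for s
      using d(2)[of "s - t"] that unfolding dist_norm bochner_transform_dist[OF vL] L1_dist_def by simp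
    then show "\<exists>d>0. \<forall>s\<in>UNIV. dist s t < d \<longrightarrow> dist (bochner_transform v s) (bochner_transform v t) < e"
      using d(1) by blast
  qed
  then show ?thesis using v by (simp add: AP_def S1_def bochner_almost_periods[OF vL])
qed

section \<open>Separating functionals on \<open>L1\<close>\<close>

text \<open>For \<open>a\<close> in \<open>{0..1}\<close> the value does not depend on the
  representative. These maps separate points, and applied to a Bochner transform they give moving
  integrals of the function, which links the two kinds of Fourier coefficients.\<close>

definition primitive_functional :: "real \<Rightarrow> 'a::euclidean_space L1 \<Rightarrow> 'a"
  where "primitive_functional a F = integral {0..a} (rep_L1 F)"

lemma primitive_functional_abs:
  fixes f :: "real \<Rightarrow> 'a::euclidean_space"
  assumes f: "f absolutely_integrable_on {0..1}" and a: "0 \<le> a" "a \<le> 1"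
  shows "primitive_functional a (abs_L1 f) = integral {0..a} f"
proof -
  have i: "integrable leb01 f" using f by (simp add: integrable_leb01_iff)
  then have "L1_rel (rep_L1 (abs_L1 f)) f"
    using Quotient_rep_abs[OF Quotient_L1, of f] by (simp add: L1_rel_def)
  then have "AE s in leb01. f s = rep_L1 (abs_L1 f) s" by (simp add: L1_rel_def eq_commute)
  then have "AE s in lebesgue. s \<in> {0..1} \<longrightarrow> f s = rep_L1 (abs_L1 f) s"
    by (subst (asm) AE_restrict_space_iff) auto
  then have "negligible {s. \<not> (s \<in> {0..1} \<longrightarrow> f s = rep_L1 (abs_L1 f) s)}"
    by (simp only: AE_lebesgue_iff_negligible)
  then show ?thesis unfolding primitive_functional_def
    by (rule integral_spike) (use a in auto)
qed

lemma L1_cases: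
  fixes F :: "'a::euclidean_space L1"
  obtains f where "f absolutely_integrable_on {0..1}" "F = abs_L1 f"
  by (rule L1_repE[of F]) (simp add: integrable_leb01_iff)

lemma primitive_functional_bounded_linear:
  assumes a: "0 \<le> a" "a \<le> 1"
  shows "bounded_linear (primitive_functional a :: 'a::euclidean_space L1 \<Rightarrow> 'a)"
proof (rule bounded_linear_intro[where K=1])
  have sub: "f integrable_on {0..a}" if "f absolutely_integrable_on {0..1}" for f :: "real \<Rightarrow> 'a"
    using absolutely_integrable_on_subinterval[OF that, of 0 a] a by (auto simp: absolutely_integrable_on_def)
  fix F G :: "'a L1" and r :: real
  obtain f where f: "f absolutely_integrable_on {0..1}" "F = abs_L1 f" by (rule L1_cases)
  obtain g where g: "g absolutely_integrable_on {0..1}" "G = abs_L1 g" by (rule L1_cases)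
  have fg: "F + G = abs_L1 (\<lambda>s. f s + g s)" "r *\<^sub>R F = abs_L1 (\<lambda>s. r *\<^sub>R f s)"
    using f g unfolding f(2) g(2)
    by (subst plus_L1.abs_eq scaleR_L1.abs_eq; simp add: L1_rel_def integrable_leb01_iff)+
  show "primitive_functional a (F + G) = primitive_functional a F + primitive_functional a G"
    unfolding fg using primitive_functional_abs[OF set_integral_add(1)[OF f(1) g(1)] a] primitive_functional_abs[OF f(1) a]
      primitive_functional_abs[OF g(1) a] integral_add[OF sub[OF f(1)] sub[OF g(1)]] by (simp add: f(2) g(2))
  have "(\<lambda>s. r *\<^sub>R f s) absolutely_integrable_on {0..1}" using f(1) by (rule set_integrable_scaleR_right)
  then show "primitive_functional a (r *\<^sub>R F) = r *\<^sub>R primitive_functional a F"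
    unfolding fg by (simp add: f(2) primitive_functional_abs[OF _ a] f(1))
  have n: "(\<lambda>s. norm (f s)) integrable_on {0..1}" using f(1) by (simp add: absolutely_integrable_on_def)
  have "norm (primitive_functional a F) \<le> integral {0..a} (\<lambda>s. norm (f s))"
    unfolding f(2) primitive_functional_abs[OF f(1) a]
    using a by (intro integral_norm_bound_integral sub f integrable_on_subinterval[OF n]) auto
  also have "\<dots> \<le> integral {0..1} (\<lambda>s. norm (f s))"
    using a by (intro integral_subset_le n integrable_on_subinterval[OF n]) auto
  also have "\<dots> = norm F"
    using norm_diff_abs_L1[OF f(1), of "\<lambda>_. 0"] by (simp add: f(2) L1_dist_def zero_L1.abs_eq[symmetric])
  finally show "norm (primitive_functional a F) \<le> norm F * 1" by simp
qed

text \<open>By Lebesgue's differentiation theorem a representative whose primitive vanishes is zero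
  almost everywhere.\<close>

lemma L1_zero_of_primitives:
  fixes F :: "'a::euclidean_space L1"
  assumes z: "\<And>a. 0 \<le> a \<Longrightarrow> a \<le> 1 \<Longrightarrow> primitive_functional a F = 0"
  shows "F = 0"
proof -
  obtain f where f: "f absolutely_integrable_on {0..1}" "F = abs_L1 f" by (rule L1_cases)
  have pz: "integral {0..a} f = 0" if "a \<in> {0..1}" for a
    using z[of a] primitive_functional_abs[OF f(1), of a] that by (simp add: f(2))
  obtain N where N: "negligible N" "\<And>t. t \<in> {0..1} - N \<Longrightarrow>
    ((\<lambda>u. integral {0..u} f) has_vector_derivative f t) (at t within {0..1})"
    using lebesgue_differentiation[OF f(1)] by blast
  have "f t = 0" if t: "t \<in> {0..1} - N" for t
  proof -
    have "((\<lambda>u. 0) has_vector_derivative f t) (at t within {0..1})"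
      by (rule has_vector_derivative_transform[OF _ _ N(2)[OF t]]) (use t pz in auto)
    moreover have "((\<lambda>u. 0) has_vector_derivative 0) (at t within {0..1::real})" by simp
    moreover have "at t within {0..1} \<noteq> bot" using t by (auto simp: trivial_limit_within)
    ultimately show ?thesis by (rule vector_derivative_unique_within[rotated 1])
  qed
  then have "{t. \<not> (t \<in> {0..1} \<longrightarrow> f t = 0)} \<subseteq> N" by blast
  then have "negligible {t. \<not> (t \<in> {0..1} \<longrightarrow> f t = 0)}" by (rule negligible_subset[OF N(1)])
  then have "AE t in lebesgue. t \<in> {0..1} \<longrightarrow> f t = 0" by (simp only: AE_lebesgue_iff_negligible)
  then have "AE t in leb01. f t = 0" by (subst AE_restrict_space_iff) auto
  then have "abs_L1 f = abs_L1 (\<lambda>_. 0)"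
    using f(1) by (subst abs_L1_eq_iff) (auto simp: integrable_leb01_iff)
  then show ?thesis by (simp add: f(2) zero_L1.abs_eq)
qed

text \<open>The vector-valued \<open>primitive_functional\<close> becomes a scalar functional
  through the inner product with its own value at \<open>F\<close>.\<close>

lemma separated_by_functionals_L1: "separated_by_functionals TYPE('a::euclidean_space L1)"
  unfolding separated_by_functionals_def
proof (intro allI impI)
  fix F :: "'a L1" assume z: "\<forall>L::'a L1 \<Rightarrow> real. bounded_linear L \<longrightarrow> L F = 0"
  show "F = 0"
  proof (rule L1_zero_of_primitives)
    fix a :: real assume a: "0 \<le> a" "a \<le> 1"
    have "bounded_linear (\<lambda>G. primitive_functional a G \<bullet> primitive_functional a F)"
      by (rule bounded_linear_compose[OF bounded_linear_inner_left primitive_functional_bounded_linear[OF a]])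
    then have "primitive_functional a F \<bullet> primitive_functional a F = 0" using z by blast
    then show "primitive_functional a F = 0" by simp
  qed
qed

text \<open>Makes the Bochner transform, and with it the Stepanov periods and the frequency module,
  independent of the choice made by \<open>S1_ext\<close>. Agreement on the half-line propagates to
  the line by almost periodicity of the transforms.\<close>

lemma S1_eq_AE:
  fixes u v :: "real \<Rightarrow> 'a::euclidean_space"
  assumes u: "u \<in> S1 UNIV" and v: "v \<in> S1 UNIV" and eq: "AE t in lebesgue. 0 \<le> t \<longrightarrow> u t = v t"
  shows "bochner_transform u = bochner_transform v"
proof (rule AP_UNIV_eq_on_halfline[OF bochner_transform_AP[OF u] bochner_transform_AP[OF v]])
  fix t :: real assume t: "t \<ge> 0"
  have L: "u \<in> L1_loc UNIV" "v \<in> L1_loc UNIV" using u v by (auto simp: S1_def)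
  have i: "(\<lambda>x. h (t + x)) absolutely_integrable_on {0..1}" if "h \<in> L1_loc UNIV" for h :: "real \<Rightarrow> 'a"
    using L1_loc_shift[OF halfline_or_line_simps(2) that, of 0 t 1] by (simp add: add.commute)
  have "norm (bochner_transform u t - bochner_transform v t) = L1_dist (\<lambda>x. u (t + x)) (\<lambda>x. v (t + x)) 0 1"
    unfolding bochner_transform_def by (rule norm_diff_abs_L1[OF i i]) (use L in auto)
  also have "\<dots> = L1_dist u v t (t + 1)"
    using L1_dist_shift[of u t v 0 1] by (simp add: add.commute)
  also have "\<dots> = L1_dist v v t (t + 1)"
  proof (rule L1_dist_cong_AE)
    show "AE s in lebesgue. s \<in> {t..t + 1} \<longrightarrow> u s = v s" using eq by eventually_elim (use t in auto)
  qed simp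
  also have "\<dots> = 0" by (simp add: L1_dist_def)
  finally show "bochner_transform u t = bochner_transform v t" by simp
qed

lemma AP_UNIV_in_S1:
  fixes v :: "real \<Rightarrow> 'a::euclidean_space"
  assumes v: "v \<in> AP UNIV"
  shows "v \<in> S1 UNIV"
proof -
  have vL: "v \<in> L1_loc UNIV"
    by (auto simp: L1_loc_iff intro!: absolutely_integrable_continuous_real AP_UNIV_continuous v)
  have sub: "\<tau> \<in> stepanov_periods UNIV v \<epsilon>" if "\<tau> \<in> almost_periods UNIV v \<epsilon>" for \<tau> \<epsilon>
    unfolding stepanov_periods_iff[OF halfline_or_line_simps(2) vL]
  proof (intro conjI ballI UNIV_I)
    fix a :: real
    have "integral {a..a + 1} (\<lambda>s. norm (v (s + \<tau>) - v s)) \<le> integral {a..a + 1} (\<lambda>_. \<epsilon>)"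
      using that
      by (intro integral_le integrable_continuous_real continuous_intros AP_UNIV_continuous AP_UNIV_translate v)
         (auto simp: almost_periods_def norm_minus_commute)
    then show "L1_dist (\<lambda>s. v (s + \<tau>)) v a (a + 1) \<le> \<epsilon>" by (simp add: L1_dist_def)
  qed
  show ?thesis unfolding S1_iff
  proof (intro conjI vL allI impI)
    fix \<epsilon> :: real assume "\<epsilon> > 0"
    then obtain l where l: "l > 0" "\<And>a. \<exists>\<tau>\<in>{a..a + l}. \<forall>t. norm (v t - v (t + \<tau>)) \<le> \<epsilon>"
      using AP_UNIV_period[OF v] by blast
    show "\<exists>l>0. \<forall>a\<in>UNIV. \<exists>\<tau>\<in>stepanov_periods UNIV v \<epsilon>. a \<le> \<tau> \<and> \<tau> \<le> a + l"
    proof (intro exI[of _ l] conjI l(1) ballI)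
      fix a :: real
      obtain \<tau> where \<tau>: "\<tau> \<in> {a..a + l}" "\<forall>t. norm (v t - v (t + \<tau>)) \<le> \<epsilon>" using l(2) by blast
      then show "\<exists>\<tau>\<in>stepanov_periods UNIV v \<epsilon>. a \<le> \<tau> \<and> \<tau> \<le> a + l"
        by (intro bexI[of _ \<tau>] sub) (auto simp: almost_periods_def)
    qed
  qed
qed

text \<open>
  The coefficient \<open>c a\<close> of the moving primitive \<open>t \<mapsto> \<integral>\<^sub>0\<^sup>a v (t + s) ds\<close> satisfies
  \<open>c (a + b) = c a + e\<^sup>i\<^sup>\<omega>\<^sup>a c b\<close>, and \<open>c b / b\<close> tends to the coefficient of \<open>v\<close> as \<open>b \<rightarrow> 0\<close>.
\<close>

theorem bochner_spectrum_eq: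
  fixes v :: "real \<Rightarrow> 'a::euclidean_space"
  assumes v: "v \<in> AP UNIV"
  shows "fourier_spectrum (bochner_transform v) = fourier_spectrum v"
proof -
  have vS: "v \<in> S1 UNIV" by (rule AP_UNIV_in_S1[OF v])
  have vL: "v \<in> L1_loc UNIV" using vS by (simp add: S1_def)
  have bA: "bochner_transform v \<in> AP UNIV" by (rule bochner_transform_AP[OF vS])
  define J where "J = (\<lambda>a t. integral {0..a} (\<lambda>s. v (t + s)))"
  have vi: "(\<lambda>s. v (t + s)) absolutely_integrable_on {a..b}" for t a b
    using L1_loc_shift[OF halfline_or_line_simps(2) vL, of a t b] by (simp add: add.commute)
  have vi': "(\<lambda>s. v (t + s)) integrable_on {a..b}" for t a b
    using vi by (simp add: absolutely_integrable_on_def)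
  have J: "primitive_functional a (bochner_transform v t) = J a t" if "0 \<le> a" "a \<le> 1" for a t
    unfolding bochner_transform_def J_def by (rule primitive_functional_abs[OF vi that])
  have JA: "J a \<in> AP UNIV" if "0 \<le> a" "a \<le> 1" for a
    using AP_UNIV_bounded_linear[OF primitive_functional_bounded_linear[OF that] bA] by (simp add: J[OF that])
  have cJ: "fourier_coeff (J a) \<omega> = (primitive_functional a (fst (fourier_coeff (bochner_transform v) \<omega>)),
      primitive_functional a (snd (fourier_coeff (bochner_transform v) \<omega>)))" if a: "0 \<le> a" "a \<le> 1" for a \<omega>
    using fourier_coeff_bounded_linear[OF bA primitive_functional_bounded_linear[OF a], of \<omega>] by (simp add: J[OF a])
  \<comment> \<open>For short \<open>b\<close> the moving integral is nearly \<open>b\<close> times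
    \<open>v\<close>, uniformly in \<open>t\<close>, so the coefficients differ by
    \<open>o(b)\<close>.\<close>
  have small: "\<exists>d>0. \<forall>b. 0 \<le> b \<longrightarrow> b \<le> d \<longrightarrow> b \<le> 1 \<longrightarrow>
      norm (fourier_coeff (J b) \<omega> - b *\<^sub>R fourier_coeff v \<omega>) \<le> b * \<epsilon>" if e: "\<epsilon> > 0" for \<epsilon> \<omega>
  proof -
    have "\<epsilon> / 2 > 0" using e by simp
    then obtain d where d: "d > 0" "\<And>s t. \<bar>s - t\<bar> \<le> d \<Longrightarrow> norm (v s - v t) \<le> \<epsilon> / 2"
      using AP_UNIV_uniformly_continuous[OF v] by blast
    have "norm (fourier_coeff (J b) \<omega> - b *\<^sub>R fourier_coeff v \<omega>) \<le> b * \<epsilon>" if b: "0 \<le> b" "b \<le> d" "b \<le> 1" for b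
    proof -
      have bl: "bounded_linear (\<lambda>x::'a. b *\<^sub>R x)" by (rule bounded_linear_scaleR_right)
      have bv: "(\<lambda>t. b *\<^sub>R v t) \<in> AP UNIV" by (rule AP_UNIV_bounded_linear[OF bl v])
      have "norm (J b t - b *\<^sub>R v t) \<le> \<epsilon> / 2 * b" for t
      proof -
        have "J b t - b *\<^sub>R v t = integral {0..b} (\<lambda>s. v (t + s) - v t)"
          unfolding J_def using b by (subst integral_diff) (auto intro: vi')
        also have "norm \<dots> \<le> \<epsilon> / 2 * (b - 0)"
        proof (rule integral_bound)
          show "continuous_on {0..b} (\<lambda>s. v (t + s) - v t)"
            by (intro continuous_intros continuous_on_compose2[OF AP_UNIV_continuous[OF v, of UNIV]]) auto
        qed (use b d in auto)
        finally show ?thesis by simp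
      qed
      then have "norm (fourier_coeff (\<lambda>t. J b t - b *\<^sub>R v t) \<omega>) \<le> 2 * (\<epsilon> / 2 * b)"
        using b by (intro fourier_coeff_norm_le AP_UNIV_diff JA bv) auto
      also have "fourier_coeff (\<lambda>t. J b t - b *\<^sub>R v t) \<omega> = fourier_coeff (J b) \<omega> - b *\<^sub>R fourier_coeff v \<omega>"
        using b by (simp add: fourier_coeff_diff[OF JA bv] fourier_coeff_bounded_linear[OF v bl] prod_eq_iff)
      finally show ?thesis by (simp add: mult.commute)
    qed
    then show ?thesis using d(1) by blast
  qed
  have add: "fourier_coeff (J (a + b)) \<omega> = fourier_coeff (J a) \<omega> + cmul (cos (\<omega> * a)) (sin (\<omega> * a)) (fourier_coeff (J b) \<omega>)"
    if ab: "0 \<le> a" "0 \<le> b" "a + b \<le> 1" for a b \<omega>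
  proof -
    have JJ: "J (a + b) t - J a t = J b (t + a)" for t
    proof -
      have "integral {0..a} (\<lambda>s. v (t + s)) + integral {a..a + b} (\<lambda>s. v (t + s)) = integral {0..a + b} (\<lambda>s. v (t + s))"
        using ab by (intro Henstock_Kurzweil_Integration.integral_combine vi') auto
      moreover have "integral {0..b} (\<lambda>s. v (t + a + s)) = integral {a..a + b} (\<lambda>s. v (t + s))"
        using integral_shift_interval[of 0 b "\<lambda>s. v (t + s)" a] by (simp add: add_ac)
      ultimately show ?thesis by (simp add: J_def algebra_simps)
    qed
    have "fourier_coeff (\<lambda>t. J (a + b) t - J a t) \<omega> = fourier_coeff (J (a + b)) \<omega> - fourier_coeff (J a) \<omega>"
      using ab by (intro fourier_coeff_diff JA) auto
    moreover have "fourier_coeff (\<lambda>t. J b (t + a)) \<omega> = cmul (cos (\<omega> * a)) (sin (\<omega> * a)) (fourier_coeff (J b) \<omega>)"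
      using ab by (intro fourier_coeff_translate JA) auto
    ultimately show ?thesis unfolding JJ by (simp add: algebra_simps)
  qed
  have "fourier_coeff (bochner_transform v) \<omega> = 0 \<longleftrightarrow> fourier_coeff v \<omega> = 0" for \<omega>
  proof
    assume z: "fourier_coeff (bochner_transform v) \<omega> = 0"
    have cz: "fourier_coeff (J b) \<omega> = 0" if "0 \<le> b" "b \<le> 1" for b
      using cJ[OF that, of \<omega>] linear_simps(3)[OF primitive_functional_bounded_linear[OF that, where 'a='a]]
      by (simp add: z zero_prod_def)
    have le: "norm (fourier_coeff v \<omega>) \<le> \<epsilon>" if e: "\<epsilon> > 0" for \<epsilon>
    proof -
      obtain d where d: "d > 0" "\<And>b. 0 \<le> b \<Longrightarrow> b \<le> d \<Longrightarrow> b \<le> 1 \<Longrightarrow>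
        norm (fourier_coeff (J b) \<omega> - b *\<^sub>R fourier_coeff v \<omega>) \<le> b * \<epsilon>" using small[OF e] by blast
      define b where "b = min d 1"
      have b: "b > 0" "b \<le> d" "b \<le> 1" using d by (auto simp: b_def)
      then have "b * norm (fourier_coeff v \<omega>) \<le> b * \<epsilon>" using d(2)[of b] cz[of b] by simp
      then show ?thesis using b by simp
    qed
    show "fourier_coeff v \<omega> = 0"
      using le[of "norm (fourier_coeff v \<omega>) / 2"] by (cases "fourier_coeff v \<omega> = 0") auto
  next
    assume z: "fourier_coeff v \<omega> = 0"
    have "fourier_coeff (J a) \<omega> = 0" if a: "0 \<le> a" "a \<le> 1" for a
    proof -
      have le: "norm (fourier_coeff (J a) \<omega>) \<le> 2 * \<epsilon>" if e: "\<epsilon> > 0" for \<epsilon>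
      proof -
        obtain d where d: "d > 0" "\<And>b. 0 \<le> b \<Longrightarrow> b \<le> d \<Longrightarrow> b \<le> 1 \<Longrightarrow> norm (fourier_coeff (J b) \<omega>) \<le> b * \<epsilon>"
          using small[OF e, of \<omega>] z by auto
        \<comment> \<open>The interval \<open>{0..a}\<close> is cut into \<open>n\<close> pieces of
          length \<open>b \<le> d\<close>; by \<open>add\<close> each contributes at most
          \<open>2 * (b * \<epsilon>)\<close>, in total \<open>2 * \<epsilon> * a\<close>.\<close>
        obtain n :: nat where n: "a / d < real n" using reals_Archimedean2 by blast
        then have n0: "n > 0" using a d(1) by (metis divide_nonneg_pos not_gr_zero not_le of_nat_0)
        define b where "b = a / real n"
        have b: "0 \<le> b" "b \<le> d" "real n * b = a" using n n0 a d(1) by (auto simp: b_def field_simps)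
        have b1: "real k * b \<le> 1" if "k \<le> n" for k
          using mult_right_mono[of "real k" "real n" b] that b a by simp
        have "norm (fourier_coeff (J (real k * b)) \<omega>) \<le> real k * (2 * (b * \<epsilon>))" if "k \<le> n" for k
          using that
        proof (induction k)
          case 0
          have "J 0 = (\<lambda>_. 0)" by (simp add: J_def fun_eq_iff)
          moreover have "fourier_coeff (\<lambda>_::real. 0 :: 'a) \<omega> = 0"
            using fourier_coeff_norm_le[OF AP_UNIV_const[of "0::'a"], of 0 \<omega>] by simp
          ultimately show ?case by simp
        next
          case (Suc k)
          have eq: "real (Suc k) * b = real k * b + b" by (simp add: algebra_simps)
          have db: "norm (fourier_coeff (J b) \<omega>) \<le> b * \<epsilon>" using b b1[of 1] n0 by (intro d) auto
          have "norm (cmul (cos (\<omega> * (real k * b))) (sin (\<omega> * (real k * b))) (fourier_coeff (J b) \<omega>)) \<le> 2 * (b * \<epsilon>)"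
          proof (rule order_trans[OF norm_cmul mult_mono])
            show "\<bar>cos (\<omega> * (real k * b))\<bar> + \<bar>sin (\<omega> * (real k * b))\<bar> \<le> 2"
              using abs_cos_le_one[of "\<omega> * (real k * b)"] abs_sin_le_one[of "\<omega> * (real k * b)"] by linarith
          qed (use db in auto)
          then show ?case
            using Suc b b1[of "Suc k"] unfolding eq
            by (subst add) (auto simp: algebra_simps intro!: norm_triangle_le)
        qed
        from this[of n] have "norm (fourier_coeff (J (real n * b)) \<omega>) \<le> 2 * \<epsilon> * (real n * b)"
          by (simp add: mult_ac)
        moreover have "real n * b = a" using b by (simp add: mult.commute)
        ultimately have "norm (fourier_coeff (J a) \<omega>) \<le> 2 * \<epsilon> * a" by simp
        also have "\<dots> \<le> 2 * \<epsilon> * 1" using a e by (intro mult_left_mono) auto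
        finally show ?thesis by simp
      qed
      show ?thesis using le[of "norm (fourier_coeff (J a) \<omega>) / 4"] by (cases "fourier_coeff (J a) \<omega> = 0") auto
    qed
    then have "primitive_functional a (fst (fourier_coeff (bochner_transform v) \<omega>)) = 0 \<and>
       primitive_functional a (snd (fourier_coeff (bochner_transform v) \<omega>)) = 0" if "0 \<le> a" "a \<le> 1" for a
      using cJ[OF that, of \<omega>] that by (simp add: zero_prod_def)
    then show "fourier_coeff (bochner_transform v) \<omega> = 0"
      by (auto simp: prod_eq_iff intro!: L1_zero_of_primitives)
  qed
  then show ?thesis by (simp add: fourier_spectrum_def)
qed

section \<open>Almost periodic responses\<close>

lemma behavior_lure_solution:
  fixes A :: "real^'n^'n" and B :: "real^'m^'n" and C :: "real^'n^'m"
  assumes T: "halfline_or_line T" and f: "continuous_on UNIV f"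
    and s: "(v, x) \<in> behavior T A B C f" and a: "a \<in> T"
  shows "lure_solution A B C f v x a b"
proof -
  have v: "v \<in> L1_loc T" and x: "continuous_on T x"
    and eq: "\<And>t. t \<in> T \<Longrightarrow> a \<le> t \<Longrightarrow> x t - x a = integral {a..t} (lure_field A B C f v x)"
    using s a unfolding behavior_iff[OF T f] by blast+
  have sub: "{a..b} \<subseteq> T" by (rule halfline_or_line_interval[OF T a])
  have aux: "p = q + r" if "p - q = r" for p q r :: "real^'n" using that by auto
  show ?thesis unfolding lure_solution_def
  proof (intro conjI ballI)
    show "v absolutely_integrable_on {a..b}" using v a by (simp add: L1_loc_iff[OF T])
    show "continuous_on {a..b} x" by (rule continuous_on_subset[OF x sub])
    fix t assume t: "t \<in> {a..b}"
    show "x t = x a + integral {a..t} (lure_field A B C f v x)"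
      by (rule aux[OF eq]) (use t sub in auto)
  qed
qed

lemma lure_solutions_behavior:
  fixes A :: "real^'n^'n" and B :: "real^'m^'n" and C :: "real^'n^'m"
  assumes T: "halfline_or_line T" and f: "continuous_on UNIV f"
    and s: "\<And>a b. a \<in> T \<Longrightarrow> lure_solution A B C f v x a b"
  shows "(v, x) \<in> behavior T A B C f"
  unfolding behavior_iff[OF T f]
proof (intro conjI ballI impI)
  show "v \<in> L1_loc T" unfolding L1_loc_iff[OF T]
    using s unfolding lure_solution_def by blast
  show "continuous_on T x"
    by (rule continuous_on_halfline_or_line[OF T]) (use s in \<open>unfold lure_solution_def, blast\<close>)
  have aux: "p - q = r" if "p = q + r" for p q r :: "real^'n" using that by auto
  fix a t assume t: "a \<in> T" "t \<in> T" "a \<le> t"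
  have "t \<in> {a..t}" using t(3) by simp
  then have "x t = x a + integral {a..t} (lure_field A B C f v x)"
    using s[OF t(1), of t] unfolding lure_solution_def by blast
  then show "x t - x a = integral {a..t} (lure_field A B C f v x)" by (rule aux)
qed

lemma lure_solution_cong_AE:
  fixes A :: "real^'n^'n" and B :: "real^'m^'n" and C :: "real^'n^'m"
  assumes s: "lure_solution A B C f v x a b" and v: "AE s in lebesgue. s \<in> {a..b} \<longrightarrow> v s = v' s"
  shows "lure_solution A B C f v' x a b"
  unfolding lure_solution_def
proof (intro conjI ballI)
  define N where "N = {s. \<not> (s \<in> {a..b} \<longrightarrow> v s = v' s)}"
  have N: "negligible N" using v unfolding N_def by (simp only: AE_lebesgue_iff_negligible)
  have va: "v absolutely_integrable_on {a..b}" using s unfolding lure_solution_def by blast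
  show "v' absolutely_integrable_on {a..b}"
    by (rule absolutely_integrable_spike[OF va N]) (auto simp: N_def)
  show "continuous_on {a..b} x" using s unfolding lure_solution_def by blast
  fix t assume t: "t \<in> {a..b}"
  have I: "integral {a..t} (lure_field A B C f v' x) = integral {a..t} (lure_field A B C f v x)"
  proof (rule integral_spike[OF N])
    fix r assume "r \<in> {a..t} - N"
    then have "v r = v' r" using t by (simp add: N_def)
    then show "lure_field A B C f v x r = lure_field A B C f v' x r" by (simp only:)
  qed
  show "x t = x a + integral {a..t} (lure_field A B C f v' x)"
    unfolding I using s t unfolding lure_solution_def by blast
qed

lemma lure_solution_shift:
  fixes A :: "real^'n^'n" and B :: "real^'m^'n" and C :: "real^'n^'m"
  assumes s: "lure_solution A B C f v x (a + \<tau>) (b + \<tau>)"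
  shows "lure_solution A B C f (\<lambda>t. v (t + \<tau>)) (\<lambda>t. x (t + \<tau>)) a b"
  unfolding lure_solution_def
proof (intro conjI ballI)
  have v: "v absolutely_integrable_on {a + \<tau>..b + \<tau>}" and x: "continuous_on {a + \<tau>..b + \<tau>} x"
    and eq: "\<And>t. t \<in> {a + \<tau>..b + \<tau>} \<Longrightarrow> x t = x (a + \<tau>) + integral {a + \<tau>..t} (lure_field A B C f v x)"
    using s unfolding lure_solution_def by blast+
  show "(\<lambda>t. v (t + \<tau>)) absolutely_integrable_on {a..b}" by (rule absolutely_integrable_shift[OF v])
  show "continuous_on {a..b} (\<lambda>t. x (t + \<tau>))"
    by (rule continuous_on_compose2[OF x]) (auto intro!: continuous_intros)
  fix t assume t: "t \<in> {a..b}"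
  show "x (t + \<tau>) = x (a + \<tau>) + integral {a..t} (lure_field A B C f (\<lambda>t. v (t + \<tau>)) (\<lambda>t. x (t + \<tau>)))"
    unfolding integral_shift_interval[of a t "lure_field A B C f v x" \<tau>] by (rule eq) (use t in auto)
qed

text \<open>The state-dependent part \<open>G\<close> is uniformly continuous on a ball that
  contains all late states, so uniform convergence survives it; the input enters linearly, and for
  it convergence in the mean is enough.\<close>

lemma lure_solution_limit:
  fixes A :: "real^'n^'n" and B :: "real^'m^'n" and C :: "real^'n^'m"
  assumes f: "continuous_on UNIV f"
    and s: "\<And>k. lure_solution A B C f (vk k) (xk k) a b"
    and x: "uniform_limit {a..b} xk x sequentially"
    and v: "v absolutely_integrable_on {a..b}" and lim: "(\<lambda>k. L1_dist (vk k) v a b) \<longlonglongrightarrow> 0"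
  shows "lure_solution A B C f v x a b"
  unfolding lure_solution_def
proof (intro conjI ballI v)
  have vk: "vk k absolutely_integrable_on {a..b}" and c: "continuous_on {a..b} (xk k)"
    and eq: "\<And>t. t \<in> {a..b} \<Longrightarrow> xk k t = xk k a + integral {a..t} (lure_field A B C f (vk k) (xk k))" for k
    using s[of k] unfolding lure_solution_def by blast+
  show xc: "continuous_on {a..b} x"
    by (rule uniform_limit_theorem[OF _ x]) (use c in auto)
  define G where "G = (\<lambda>y. A *v y - B *v f (C *v y))"
  have Gc: "continuous_on X G" for X
    unfolding G_def
    by (intro continuous_intros bounded_linear.continuous_on[OF matrix_vector_mul_bounded_linear]
        continuous_on_compose2[OF f]) auto
  have "bounded (x ` {a..b})" by (rule compact_imp_bounded[OF compact_continuous_image[OF xc compact_Icc]])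
  then obtain K where K: "\<And>t. t \<in> {a..b} \<Longrightarrow> norm (x t) \<le> K" unfolding bounded_iff by blast
  have "\<forall>\<^sub>F k in sequentially. \<forall>t\<in>{a..b}. dist (xk k t) (x t) < 1"
    using uniform_limitD[OF x, of 1] by simp
  then have ev: "\<forall>\<^sub>F k in sequentially. \<forall>t\<in>{a..b}. xk k t \<in> cball 0 (K + 1)"
  proof eventually_elim
    case (elim k)
    have "norm (xk k t) \<le> K + 1" if t: "t \<in> {a..b}" for t
      using norm_triangle_sub[of "xk k t" "x t"] K[OF t] elim t by (fastforce simp: dist_norm)
    then show ?case by simp
  qed
  have "uniformly_continuous_on (cball 0 (K + 1)) G"
    by (rule compact_uniformly_continuous[OF Gc compact_cball])
  from uniform_limit_compose_uniformly_continuous_on[OF x this ev closed_cball]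
  have Gu: "uniform_limit {a..b} (\<lambda>k t. G (xk k t)) (\<lambda>t. G (x t)) sequentially" .
  fix t assume t: "t \<in> {a..b}"
  have Gck: "continuous_on {a..t} (\<lambda>s. G (xk k s))" for k
    by (rule continuous_on_compose2[OF Gc[of UNIV] continuous_on_subset[OF c[of k]]]) (use t in auto)
  have Gcx: "continuous_on {a..t} (\<lambda>s. G (x s))"
    by (rule continuous_on_compose2[OF Gc[of UNIV] continuous_on_subset[OF xc]]) (use t in auto)
  have ul: "uniform_limit {a..t} (\<lambda>k t. G (xk k t)) (\<lambda>t. G (x t)) sequentially"
    by (rule uniform_limit_on_subset[OF Gu]) (use t in auto)
  have lG: "(\<lambda>k. integral {a..t} (\<lambda>s. G (xk k s))) \<longlonglongrightarrow> integral {a..t} (\<lambda>s. G (x s))"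
  proof (rule uniform_limit_integral[OF ul Gck trivial_limit_sequentially])
    fix I J
    assume a: "\<And>k. ((\<lambda>s. G (xk k s)) has_integral I k) {a..t}" "((\<lambda>s. G (x s)) has_integral J) {a..t}" "I \<longlonglongrightarrow> J"
    show ?thesis using a(3) by (simp only: integral_unique[OF a(1)] integral_unique[OF a(2)])
  qed
  have it: "g integrable_on {a..t}" if "g absolutely_integrable_on {a..b}" for g :: "real \<Rightarrow> real^'m"
    using absolutely_integrable_on_subinterval[OF that, of a t] t by (auto simp: absolutely_integrable_on_def)
  have split: "integral {a..t} (lure_field A B C f g y) = integral {a..t} (\<lambda>s. G (y s)) + B *v integral {a..t} g"
    if "g absolutely_integrable_on {a..b}" "continuous_on {a..t} (\<lambda>s. G (y s))" for g y
  proof -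
    have B: "((\<lambda>s. B *v g s) has_integral B *v integral {a..t} g) {a..t}"
      using has_integral_linear[OF integrable_integral[OF it[OF that(1)]] matrix_vector_mul_bounded_linear[of B]]
      by (simp add: o_def)
    show ?thesis
      using integral_add[OF integrable_continuous_real[OF that(2)] has_integral_integrable[OF B]] integral_unique[OF B]
      by (simp add: G_def)
  qed
  have nk: "norm (integral {a..t} (vk k) - integral {a..t} v) \<le> L1_dist (vk k) v a b" for k
  proof -
    have d: "(\<lambda>s. norm (vk k s - v s)) integrable_on {a..b}" by (rule absolutely_integrable_diff_norm[OF vk v])
    then have d': "(\<lambda>s. norm (vk k s - v s)) integrable_on {a..t}"
      by (rule integrable_on_subinterval) (use t in auto)
    have "norm (integral {a..t} (vk k) - integral {a..t} v) = norm (integral {a..t} (\<lambda>s. vk k s - v s))"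
      by (simp add: integral_diff[OF it[OF vk] it[OF v]])
    also have "\<dots> \<le> integral {a..t} (\<lambda>s. norm (vk k s - v s))"
      by (intro integral_norm_bound_integral integrable_diff it vk v d') auto
    also have "\<dots> \<le> L1_dist (vk k) v a b"
      unfolding L1_dist_def by (rule integral_subset_le[OF _ d' d]) (use t in auto)
    finally show ?thesis .
  qed
  have "(\<lambda>k. integral {a..t} (vk k) - integral {a..t} v) \<longlonglongrightarrow> 0"
    by (rule Lim_null_comparison[OF _ lim]) (simp add: nk)
  then have "(\<lambda>k. integral {a..t} (vk k)) \<longlonglongrightarrow> integral {a..t} v" by (simp add: LIM_zero_iff)
  then have lv: "(\<lambda>k. B *v integral {a..t} (vk k)) \<longlonglongrightarrow> B *v integral {a..t} v"
    by (rule bounded_linear.tendsto[OF matrix_vector_mul_bounded_linear])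
  have pt: "(\<lambda>k. xk k r) \<longlonglongrightarrow> x r" if "r \<in> {a..b}" for r
    by (rule tendsto_uniform_limitI[OF x that])
  have l: "(\<lambda>k. xk k a + (integral {a..t} (\<lambda>s. G (xk k s)) + B *v integral {a..t} (vk k)))
      \<longlonglongrightarrow> x a + (integral {a..t} (\<lambda>s. G (x s)) + B *v integral {a..t} v)"
    by (intro tendsto_add lG lv pt) (use t in auto)
  have e: "xk k t = xk k a + (integral {a..t} (\<lambda>s. G (xk k s)) + B *v integral {a..t} (vk k))" for k
    unfolding split[OF vk Gck, symmetric] by (rule eq[OF t])
  show "x t = x a + integral {a..t} (lure_field A B C f v x)"
    unfolding split[OF v Gcx] by (rule LIMSEQ_unique[OF pt[OF t] l[folded e]])
qed

text \<open>\<open>T\<close> is rounded up to a whole number of unit blocks, at most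
  \<open>T + 1\<close> of them.\<close>

lemma L1_dist_unit_blocks:
  fixes u v :: "real \<Rightarrow> 'a::euclidean_space"
  assumes u: "\<And>b. u absolutely_integrable_on {a..b}" and v: "\<And>b. v absolutely_integrable_on {a..b}"
    and d: "\<And>s. s \<ge> a \<Longrightarrow> L1_dist u v s (s + 1) \<le> \<epsilon>" and T: "T \<ge> 0"
  shows "L1_dist u v a (a + T) \<le> (T + 1) * \<epsilon>"
proof -
  have n: "L1_dist u v a (a + real n) \<le> real n * \<epsilon>" for n
  proof (induction n)
    case 0
    show ?case by (simp add: L1_dist_def)
  next
    case (Suc n)
    have "L1_dist u v a (a + real (Suc n)) = L1_dist u v a (a + real n) + L1_dist u v (a + real n) (a + real n + 1)"
      using L1_dist_combine[OF u v, of "a + real n" "a + real (Suc n)"] by (simp add: add_ac)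
    with Suc d[of "a + real n"] show ?case by (simp add: algebra_simps)
  qed
  have "0 \<le> \<epsilon>" using d[of a] L1_dist_nonneg[OF u v, of "a + 1"] by simp
  have "L1_dist u v a (a + T) \<le> L1_dist u v a (a + real (nat \<lceil>T\<rceil>))"
    by (rule L1_dist_mono[OF u v]) (use real_nat_ceiling_ge[of T] in auto)
  also have "\<dots> \<le> real (nat \<lceil>T\<rceil>) * \<epsilon>" by (rule n)
  also have "\<dots> \<le> (T + 1) * \<epsilon>"
    by (intro mult_right_mono \<open>0 \<le> \<epsilon>\<close>) (use T in linarith)
  finally show ?thesis .
qed

section \<open>Construction, uniqueness and attractivity of the almost periodic response\<close>

context lure
begin

lemma sol_input_integrable: "sol v x a b \<Longrightarrow> v absolutely_integrable_on {a..b}"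
  and sol_continuous: "sol v x a b \<Longrightarrow> continuous_on {a..b} x"
  unfolding lure_solution_def by blast+

text \<open>\<open>T\<close> and \<open>\<delta>\<close> are fixed before the solutions, and all
  hypotheses start at \<open>t - T\<close>. Closeness of the inputs is measured on unit intervals,
  the form in which Stepanov periods provide it.\<close>

definition stable_window :: "real \<Rightarrow> real \<Rightarrow> real \<Rightarrow> real \<Rightarrow> bool" where
  "stable_window R \<epsilon> T \<delta> \<longleftrightarrow> (\<forall>v1 v2 x1 x2 t. (\<forall>b. sol v1 x1 (t - T) b) \<longrightarrow> (\<forall>b. sol v2 x2 (t - T) b) \<longrightarrow>
    (\<forall>s\<ge>t - T. norm (x1 s) \<le> R) \<longrightarrow> (\<forall>s\<ge>t - T. norm (x2 s) \<le> R) \<longrightarrow>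
    (\<forall>s\<ge>t - T. L1_dist v1 v2 s (s + 1) \<le> \<delta>) \<longrightarrow> norm (x1 t - x2 t) \<le> \<epsilon>)"

lemma stable_windowD:
  assumes "stable_window R \<epsilon> T \<delta>" "\<And>b. sol v1 x1 (t - T) b" "\<And>b. sol v2 x2 (t - T) b"
    "\<And>s. s \<ge> t - T \<Longrightarrow> norm (x1 s) \<le> R" "\<And>s. s \<ge> t - T \<Longrightarrow> norm (x2 s) \<le> R"
    "\<And>s. s \<ge> t - T \<Longrightarrow> L1_dist v1 v2 s (s + 1) \<le> \<delta>"
  shows "norm (x1 t - x2 t) \<le> \<epsilon>"
  using assms unfolding stable_window_def by blast

lemma stability:
  assumes "R > 0" "\<epsilon> > 0"
  obtains T \<delta> where "T > 0" "\<delta> > 0" "stable_window R \<epsilon> T \<delta>"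
proof (rule incremental_stability[OF assms])
  fix T \<delta> :: real
  assume T: "T > 0" "\<delta> > 0"
    and st: "\<And>v1 v2 x1 x2 a. sol v1 x1 a (a + T) \<Longrightarrow> sol v2 x2 a (a + T) \<Longrightarrow>
      (\<And>t. t \<in> {a..a + T} \<Longrightarrow> norm (x1 t) \<le> R) \<Longrightarrow> (\<And>t. t \<in> {a..a + T} \<Longrightarrow> norm (x2 t) \<le> R) \<Longrightarrow>
      integral {a..a + T} (\<lambda>t. norm (v1 t - v2 t)) \<le> \<delta> \<Longrightarrow> norm (x1 (a + T) - x2 (a + T)) \<le> \<epsilon>"
  show thesis
  \<comment> \<open>A window of length \<open>T\<close> is covered by at most \<open>T + 1\<close>
    unit intervals.\<close>
  proof (rule that[of T "\<delta> / (T + 1)"])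
    show "\<delta> / (T + 1) > 0" using T by simp
    show "stable_window R \<epsilon> T (\<delta> / (T + 1))"
      unfolding stable_window_def
    proof (intro allI impI)
      fix v1 v2 x1 x2 t
      assume s: "\<forall>b. sol v1 x1 (t - T) b" "\<forall>b. sol v2 x2 (t - T) b"
        and R: "\<forall>s\<ge>t - T. norm (x1 s) \<le> R" "\<forall>s\<ge>t - T. norm (x2 s) \<le> R"
        and d: "\<forall>s\<ge>t - T. L1_dist v1 v2 s (s + 1) \<le> \<delta> / (T + 1)"
      have "L1_dist v1 v2 (t - T) (t - T + T) \<le> (T + 1) * (\<delta> / (T + 1))"
        by (rule L1_dist_unit_blocks[OF sol_input_integrable[OF s(1)[rule_format]] sol_input_integrable[OF s(2)[rule_format]]])
          (use T d in auto)
      then have "integral {t - T..t - T + T} (\<lambda>t. norm (v1 t - v2 t)) \<le> \<delta>" using T by (simp add: L1_dist_def)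
      then have "norm (x1 (t - T + T) - x2 (t - T + T)) \<le> \<epsilon>"
        by (intro st[OF s(1)[rule_format] s(2)[rule_format]]) (use R in auto)
      then show "norm (x1 t - x2 t) \<le> \<epsilon>" by simp
    qed
  qed (rule T(1))
qed

theorem almost_periodic_response:
  assumes u: "u \<in> S1 UNIV" and z: "\<And>a b. 0 \<le> a \<Longrightarrow> sol u z a b"
    and R: "\<And>t. 0 \<le> t \<Longrightarrow> norm (z t) \<le> R" "R > 0"
  obtains y where "\<And>a b. sol u y a b" "\<And>t. norm (y t) \<le> R"
    "\<And>\<epsilon>. \<epsilon> > 0 \<Longrightarrow> \<exists>\<delta>>0. stepanov_periods UNIV u \<delta> \<subseteq> almost_periods UNIV y \<epsilon>"
proof -
  have uL: "u \<in> L1_loc UNIV" using u by (simp add: S1_def)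
  have ui: "(\<lambda>s. u (s + p)) absolutely_integrable_on {a..b}" for p a b
    by (rule L1_loc_shift[OF halfline_or_line_simps(2) uL]) simp
  have ui0: "u absolutely_integrable_on {a..b}" for a b using uL by (simp add: L1_loc_iff)
  note iff = stepanov_periods_iff[OF halfline_or_line_simps(2) uL]
  have "\<exists>p. p \<in> stepanov_periods UNIV u (1 / real (Suc k)) \<and> real k \<le> p" for k
  proof -
    have "1 / real (Suc k) > 0" by simp
    then show ?thesis using u unfolding S1_iff by blast
  qed
  then obtain \<tau> where \<tau>: "\<And>k. \<tau> k \<in> stepanov_periods UNIV u (1 / real (Suc k))" "\<And>k. real k \<le> \<tau> k"
    by metis
  have sh: "sol (\<lambda>s. u (s + p)) (\<lambda>s. z (s + p)) a b" if "0 \<le> a + p" for p a b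
    by (rule lure_solution_shift[OF z[OF that]])
  define zk where "zk = (\<lambda>k t. z (t + \<tau> k))"
  define uk where "uk = (\<lambda>k t. u (t + \<tau> k))"
  have solk: "sol (uk k) (zk k) a b" if "0 \<le> a + real k" for k a b
    unfolding uk_def zk_def by (rule sh) (use that \<tau>(2)[of k] in linarith)
  have zkR: "norm (zk k t) \<le> R" if "0 \<le> t + real k" for k t
    unfolding zk_def by (rule R(1)) (use that \<tau>(2)[of k] in linarith)
  have uki: "uk k absolutely_integrable_on {a..b}" for k a b unfolding uk_def by (rule ui)
  have ukd: "L1_dist (uk k) u c (c + 1) \<le> 1 / real (Suc k)" for k c
    using \<tau>(1)[of k] unfolding iff uk_def by blast
  have ukd2: "L1_dist (uk j) (uk k) c (c + 1) \<le> 1 / real (Suc j) + 1 / real (Suc k)" for j k c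
    using L1_dist_triangle[where u="uk j" and v=u and w="uk k" and a=c and b="c + 1", OF uki ui0 uki] ukd[of j c] ukd[of k c]
      L1_dist_commute[of u "uk k" c "c + 1"] by linarith
  \<comment> \<open>\<open>zk k\<close> solves its equation from \<open>- k\<close> on. For
    \<open>t \<ge> - m\<close> and large indices a history of length \<open>T\<close> is available,
    so the translates are uniformly close on a whole half-line and not only on compact sets.\<close>
  have cauchy: "\<exists>N. \<forall>j\<ge>N. \<forall>k\<ge>N. \<forall>t\<ge>- m. norm (zk j t - zk k t) \<le> \<epsilon>" if "\<epsilon> > 0" for \<epsilon> m
  proof -
    obtain T \<delta> where T: "T > 0" "\<delta> > 0"
      and st: "stable_window R \<epsilon> T \<delta>"
      by (rule stability[OF R(2) \<open>\<epsilon> > 0\<close>])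
    \<comment> \<open>\<open>m + T\<close> provides the history, \<open>2 / \<delta>\<close> brings
      each shifted input within \<open>\<delta> / 2\<close> of \<open>u\<close>.\<close>
    obtain N :: nat where N: "max (m + T) (2 / \<delta>) < real N" using reals_Archimedean2 by blast
    have small: "1 / real (Suc j) \<le> \<delta> / 2" if "j \<ge> N" for j
    proof -
      have "2 / \<delta> < real (Suc j)" using N that by simp
      then have "1 / real (Suc j) < 1 / (2 / \<delta>)" by (rule divide_strict_left_mono) (use T in auto)
      then show ?thesis by simp
    qed
    have "norm (zk j t - zk k t) \<le> \<epsilon>" if jk: "j \<ge> N" "k \<ge> N" and t: "t \<ge> - m" for j k t
    proof (rule stable_windowD[OF st])
      have p: "0 \<le> t - T + real j" "0 \<le> t - T + real k" using N jk t by auto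
      show "sol (uk j) (zk j) (t - T) b" "sol (uk k) (zk k) (t - T) b" for b
        using p by (auto intro: solk)
      show "norm (zk j s) \<le> R" "norm (zk k s) \<le> R" if "s \<ge> t - T" for s
        using p that by (auto intro!: zkR)
      show "L1_dist (uk j) (uk k) s (s + 1) \<le> \<delta>" for s
        using ukd2[of j k s] small[OF jk(1)] small[OF jk(2)] by linarith
    qed
    then show ?thesis by blast
  qed
  define y where "y = (\<lambda>t. lim (\<lambda>k. zk k t))"
  have y: "(\<lambda>k. zk k t) \<longlonglongrightarrow> y t" for t
  proof -
    have "Cauchy (\<lambda>k. zk k t)"
    proof (rule metric_CauchyI)
      fix e :: real assume "e > 0"
      then obtain N where "\<forall>j\<ge>N. \<forall>k\<ge>N. \<forall>r\<ge>- (- t). norm (zk j r - zk k r) \<le> e / 2"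
        using cauchy[of "e / 2" "- t"] by auto
      then have h: "norm (zk j t - zk k t) \<le> e / 2" if "j \<ge> N" "k \<ge> N" for j k using that by simp
      show "\<exists>M. \<forall>m\<ge>M. \<forall>n\<ge>M. dist (zk m t) (zk n t) < e"
      proof (intro exI[of _ N] allI impI)
        fix m n assume "m \<ge> N" "n \<ge> N"
        then have "norm (zk m t - zk n t) \<le> e / 2" by (rule h)
        then show "dist (zk m t) (zk n t) < e" unfolding dist_norm using \<open>e > 0\<close> by linarith
      qed
    qed
    then show ?thesis unfolding y_def using Cauchy_convergent convergent_LIMSEQ_iff by blast
  qed
  have unif: "\<exists>N. \<forall>k\<ge>N. \<forall>t\<ge>- m. norm (zk k t - y t) \<le> \<epsilon>" if e: "\<epsilon> > 0" for \<epsilon> m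
  proof -
    obtain N where N: "\<And>j k t. j \<ge> N \<Longrightarrow> k \<ge> N \<Longrightarrow> t \<ge> - m \<Longrightarrow> norm (zk j t - zk k t) \<le> \<epsilon>"
      using cauchy[OF e] by blast
    have "norm (zk k t - y t) \<le> \<epsilon>" if "k \<ge> N" "t \<ge> - m" for k t
    proof (rule tendsto_upperbound)
      show "(\<lambda>j. norm (zk k t - zk j t)) \<longlonglongrightarrow> norm (zk k t - y t)"
        by (intro tendsto_intros y)
      show "\<forall>\<^sub>F j in sequentially. norm (zk k t - zk j t) \<le> \<epsilon>"
        using eventually_ge_at_top[of N] by eventually_elim (rule N[OF that(1) _ that(2)])
    qed simp
    then show ?thesis by blast
  qed
  have yR: "norm (y t) \<le> R" for t
  proof (rule tendsto_upperbound)
    show "(\<lambda>k. norm (zk k t)) \<longlonglongrightarrow> norm (y t)" by (intro tendsto_norm y)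
    show "\<forall>\<^sub>F k in sequentially. norm (zk k t) \<le> R"
      using eventually_ge_at_top[of "nat \<lceil>\<bar>t\<bar>\<rceil>"]
    proof eventually_elim
      case (elim k)
      then show ?case using real_nat_ceiling_ge[of "\<bar>t\<bar>"] by (intro zkR) linarith
    qed
  qed simp
  have sol: "sol u y a b" for a b
  proof -
    \<comment> \<open>The maximum admits \<open>b < a\<close>, where the interval is empty.\<close>
    define T where "T = max 0 (b - a)"
    define K where "K = nat \<lceil>\<bar>a\<bar>\<rceil>"
    have K: "0 \<le> a + real (k + K)" for k using real_nat_ceiling_ge[of "\<bar>a\<bar>"] unfolding K_def by simp linarith
    have "sol u y a (a + T)"
    proof (rule lure_solution_limit[OF f_continuous])
      show "sol (uk (k + K)) (zk (k + K)) a (a + T)" for k by (rule solk[OF K])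
      show "uniform_limit {a..a + T} (\<lambda>k. zk (k + K)) y sequentially"
      proof (rule uniform_limitI)
        fix e :: real assume "e > 0"
        then obtain N where N: "\<forall>k\<ge>N. \<forall>t\<ge>- (- a). norm (zk k t - y t) \<le> e / 2"
          using unif[of "e / 2" "- a"] by auto
        show "\<forall>\<^sub>F k in sequentially. \<forall>t\<in>{a..a + T}. dist (zk (k + K) t) (y t) < e"
          using eventually_ge_at_top[of N]
        proof eventually_elim
          case (elim k)
          show ?case
          proof
            fix t assume "t \<in> {a..a + T}"
            then have "norm (zk (k + K) t - y t) \<le> e / 2" by (intro N[rule_format]) (use elim in auto)
            then show "dist (zk (k + K) t) (y t) < e" unfolding dist_norm using \<open>e > 0\<close> by linarith
          qed
        qed
      qed
      show "(\<lambda>k. L1_dist (uk (k + K)) u a (a + T)) \<longlonglongrightarrow> 0"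
      proof (rule Lim_null_comparison)
        have "T \<ge> 0" by (simp add: T_def)
        then have "L1_dist (uk (k + K)) u a (a + T) \<le> (T + 1) * (1 / real (Suc (k + K)))" for k
          by (intro L1_dist_unit_blocks uki ui0 ukd)
        then show "\<forall>\<^sub>F k in sequentially. norm (L1_dist (uk (k + K)) u a (a + T)) \<le> (T + 1) * (1 / real (Suc (k + K)))"
          by (simp add: L1_dist_nonneg[OF uki ui0])
        have "(\<lambda>k. 1 / real (Suc (k + K))) \<longlonglongrightarrow> 0"
          using LIMSEQ_ignore_initial_segment[OF LIMSEQ_inverse_real_of_nat, of K] by (simp add: inverse_eq_divide)
        then show "(\<lambda>k. (T + 1) * (1 / real (Suc (k + K)))) \<longlonglongrightarrow> 0" by (rule tendsto_mult_right_zero)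
      qed
    qed (rule ui0)
    then show ?thesis by (rule sol_subinterval) (auto simp: T_def)
  qed
  show thesis
  proof (rule that[OF sol yR])
    fix \<epsilon> :: real assume "\<epsilon> > 0"
    obtain T \<delta> where T: "T > 0" "\<delta> > 0"
      and st: "stable_window R \<epsilon> T \<delta>"
      by (rule stability[OF R(2) \<open>\<epsilon> > 0\<close>])
    \<comment> \<open>The shift of \<open>y\<close> by \<open>p\<close> solves the equation for the
      shifted input, which is \<open>\<delta>\<close>-close to \<open>u\<close>; as both solutions
      exist on the line, a window is available at every \<open>t\<close>.\<close>
    have "norm (y t - y (t + p)) \<le> \<epsilon>" if p: "p \<in> stepanov_periods UNIV u \<delta>" for p t
    proof (rule stable_windowD[OF st sol lure_solution_shift[OF sol] yR yR])
      show "L1_dist u (\<lambda>s. u (s + p)) s (s + 1) \<le> \<delta>" for s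
        using p unfolding iff L1_dist_commute[of u] by blast
    qed
    then have "stepanov_periods UNIV u \<delta> \<subseteq> almost_periods UNIV y \<epsilon>" by (auto simp: almost_periods_def)
    then show "\<exists>\<delta>>0. stepanov_periods UNIV u \<delta> \<subseteq> almost_periods UNIV y \<epsilon>" using T(2) by blast
  qed
qed

text \<open>On the line every \<open>t\<close> has an infinite past, so for each
  \<open>\<epsilon>\<close> the required window fits before it.\<close>

lemma bounded_solution_unique:
  assumes s: "\<And>a b. sol u x a b" "\<And>a b. sol u y a b" and R: "\<And>t. norm (x t) \<le> R" "\<And>t. norm (y t) \<le> R"
  shows "x = y"
proof
  fix t
  have "norm (x t) \<le> max R 1" "norm (y t) \<le> max R 1" for t using R[of t] by auto
  note R' = this
  have "norm (x t - y t) \<le> \<epsilon>" if e: "\<epsilon> > 0" for \<epsilon>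
  proof -
    have R0: "max R 1 > 0" by simp
    obtain T \<delta> where T: "T > 0" "\<delta> > 0"
      and st: "stable_window (max R 1) \<epsilon> T \<delta>"
      by (rule stability[OF R0 e])
    show ?thesis by (rule stable_windowD[OF st s R']) (use T in \<open>simp add: L1_dist_def\<close>)
  qed
  then have "norm (x t - y t) \<le> 0" by (rule field_le_epsilon[of _ 0, simplified])
  then show "x t = y t" by simp
qed

text \<open>\<open>x\<close> is not known to be bounded; \<open>growth_estimate\<close> bounds it in
  terms of the initial error and the total mass of \<open>v - w\<close>. As the tails of this mass
  vanish, the inputs are eventually \<open>\<delta>\<close>-close on unit intervals, and the
  stability estimate applies.\<close>

lemma integrable_perturbation_converges:
  assumes s: "\<And>a b. 0 \<le> a \<Longrightarrow> sol v x a b" "\<And>a b. 0 \<le> a \<Longrightarrow> sol w y a b"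
    and R: "\<And>t. 0 \<le> t \<Longrightarrow> norm (y t) \<le> R"
    and i: "(\<lambda>t. v t - w t) absolutely_integrable_on {0..}"
  shows "((\<lambda>t. x t - y t) \<longlongrightarrow> 0) at_top"
proof -
  define g where "g = (\<lambda>t. norm (v t - w t))"
  have g: "g integrable_on {0..}" using i by (simp add: g_def absolutely_integrable_on_def)
  have gi: "g integrable_on {a..b}" if "0 \<le> a" for a b
    using integrable_on_subinterval[OF g, of a b] that by auto
  define \<rho> where "\<rho> = integral {0..} g"
  have \<rho>: "integral {0..t} g \<le> \<rho>" for t
    unfolding \<rho>_def by (rule integral_subset_le[OF _ gi g]) (auto simp: g_def)
  obtain KC where KC: "KC > 0" "\<And>x. norm (C *v x) \<le> norm x * KC"
    using bounded_linear.pos_bounded[OF matrix_vector_mul_bounded_linear[of C]] by blast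
  define M where "M = 2 * W (x 0 - y 0) (x 0 - y 0) + 4 * KC\<^sup>2 * \<rho>\<^sup>2 / c"
  have M: "c * (norm (x t - y t))\<^sup>2 \<le> M" if "t \<ge> 0" for t
    unfolding M_def
  proof (rule growth_estimate[OF s(1) s(2)])
    show "integral {0..t} (\<lambda>t. norm (v t - w t)) \<le> \<rho>" using \<rho>[of t] by (simp add: g_def)
  qed (use that KC in \<open>auto simp: mult.commute\<close>)
  define R' where "R' = \<bar>R\<bar> + sqrt (M / c) + 1"
  have M0: "0 \<le> M / c" using M[of 0] W(3) by (meson divide_nonneg_pos dual_order.trans mult_nonneg_nonneg less_imp_le order_refl zero_le_power2)
  have R'0: "R' > 0" using M0 by (auto simp: R'_def add_nonneg_pos)
  have yR: "norm (y t) \<le> R'" if "t \<ge> 0" for t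
    using R[OF that] real_sqrt_ge_zero[OF M0] unfolding R'_def by linarith
  have xR: "norm (x t) \<le> R'" if t: "t \<ge> 0" for t
  proof -
    have "(norm (x t - y t))\<^sup>2 \<le> M / c" using M[OF t] W(3) by (simp add: field_simps)
    then have "norm (x t - y t) \<le> sqrt (M / c)" by (rule real_le_rsqrt)
    then show ?thesis using R[OF t] norm_triangle_sub[of "x t" "y t"] unfolding R'_def by linarith
  qed
  \<comment> \<open>The primitive of the norm of \<open>v - w\<close> is increasing and bounded;
    beyond a point where it is within \<open>\<delta>\<close> of its supremum no unit interval
    carries more than \<open>\<delta>\<close>.\<close>
  have tail: "\<exists>N\<ge>0. \<forall>a\<ge>N. L1_dist v w a (a + 1) \<le> \<delta>" if d: "\<delta> > 0" for \<delta>
  proof -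
    define \<Phi> where "\<Phi> = (\<lambda>t. integral {0..t} g)"
    have bdd: "bdd_above (\<Phi> ` {0..})" using \<rho> by (auto simp: \<Phi>_def bdd_above_def)
    have "Sup (\<Phi> ` {0..}) - \<delta> < Sup (\<Phi> ` {0..})" using d by simp
    then obtain N where N: "N \<ge> 0" "Sup (\<Phi> ` {0..}) - \<delta> < \<Phi> N"
      using less_cSup_iff[OF _ bdd, of "Sup (\<Phi> ` {0..}) - \<delta>"] by auto
    have "L1_dist v w a (a + 1) \<le> \<delta>" if a: "a \<ge> N" for a
    proof -
      have "\<Phi> (a + 1) \<le> Sup (\<Phi> ` {0..})" by (rule cSup_upper[OF _ bdd]) (use a N in auto)
      moreover have "\<Phi> (a + 1) = \<Phi> a + L1_dist v w a (a + 1)"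
        unfolding \<Phi>_def L1_dist_def g_def[symmetric]
        by (rule Henstock_Kurzweil_Integration.integral_combine[symmetric]) (use a N gi in auto)
      moreover have "\<Phi> N \<le> \<Phi> a" unfolding \<Phi>_def
        by (rule integral_subset_le[OF _ gi gi]) (use a in \<open>auto simp: g_def\<close>)
      ultimately show ?thesis using N by linarith
    qed
    then show ?thesis using N(1) by blast
  qed
  show ?thesis
  proof (rule tendstoI)
    fix e :: real assume e: "e > 0"
    then have e2: "e / 2 > 0" by simp
    obtain T \<delta> where T: "T > 0" "\<delta> > 0"
      and st: "stable_window R' (e / 2) T \<delta>"
      by (rule stability[OF R'0 e2])
    obtain N where N: "N \<ge> 0" "\<And>a. a \<ge> N \<Longrightarrow> L1_dist v w a (a + 1) \<le> \<delta>" using tail[OF T(2)] by blast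
    show "\<forall>\<^sub>F t in at_top. dist (x t - y t) 0 < e"
      using eventually_ge_at_top[of "N + T"]
    proof eventually_elim
      case (elim t)
      have "norm (x t - y t) \<le> e / 2"
        by (rule stable_windowD[OF st, of v x t w y]) (use elim N in \<open>auto intro!: s xR yR\<close>)
      then show ?case using e by simp
    qed
  qed
qed

end

section \<open>Verification of the stability assumptions and conclusion\<close>

lemma locally_lipschitz_imp_continuous:
  assumes "locally_lipschitz f"
  shows "continuous_on UNIV f"
proof (rule continuous_at_imp_continuous_on, rule ballI)
  fix x
  obtain u L where u: "u > 0" "L-lipschitz_on (cball x u) f"
    using assms unfolding locally_lipschitz_def by blast
  have "x \<in> ball x u" using u(1) by simp
  then have "x \<in> interior (cball x u)" using ball_subset_cball interior_maximal open_ball by blast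
  then show "isCont f x" by (rule continuous_on_interior[OF lipschitz_on_continuous_on[OF u(2)]])
qed

lemma bounded_bilinear_quadratic_form:
  fixes P :: "real^'n^'n"
  shows "bounded_bilinear (\<lambda>x y. x \<bullet> (P *v y))"
  by (rule bounded_bilinear.comp[OF bounded_bilinear_inner bounded_linear_ident matrix_vector_mul_bounded_linear])

lemma symmetric_matrix_inner:
  fixes P :: "real^'n^'n"
  assumes "transpose P = P"
  shows "x \<bullet> (P *v y) = y \<bullet> (P *v x)"
  using dot_lmul_matrix[of x P y] transpose_matrix_vector[of P x] assms by (simp add: inner_commute)

theorem proposition5p1:
  fixes A :: "real^'n^'n" and B :: "real^'m^'n" and C :: "real^'n^'m"
    and f :: "real^'m \<Rightarrow> real^'m" and w :: "real \<Rightarrow> real^'m"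
  assumes f: "locally_lipschitz f"
    and w: "w \<in> S1 {0..}"
    and i: "detectable C A"
    and ii: "\<exists>P :: real^'n^'n. positive_definite P \<and>
      negative_semidefinite
        (block_matrix (transpose A ** P + P ** A) (P ** B - transpose C)
                      (transpose B ** P - C)      0)"
    and iii: "\<And>\<Gamma> :: (real^'m) set. compact \<Gamma> \<Longrightarrow>
      \<exists>\<theta>\<in>class_K_inf. \<exists>\<alpha>\<in>class_P. \<forall>y. \<forall>z\<in>\<Gamma>.
        norm (f (y + z) - f z) \<le> \<theta> (norm y) \<and>
        norm y * \<alpha> (norm y) \<le> y \<bullet> (f (y + z) - f z)"
    and iv: "\<exists>z. (w, z) \<in> behavior {0..} A B C f \<and> bounded (z ` {0..})"
  shows "\<exists>zap :: real \<Rightarrow> real^'n.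
    (zap \<in> AP {0..} \<and> (w, zap) \<in> behavior {0..} A B C f \<and>
      (\<forall>\<epsilon>>0. \<exists>\<delta>>0. stepanov_periods {0..} w \<delta> \<subseteq> almost_periods {0..} zap \<epsilon>)) \<and>
    (\<forall>z'. z' \<in> AP {0..} \<and> (w, z') \<in> behavior {0..} A B C f \<and>
      (\<forall>\<epsilon>>0. \<exists>\<delta>>0. stepanov_periods {0..} w \<delta> \<subseteq> almost_periods {0..} z' \<epsilon>)
        \<longrightarrow> (\<forall>t\<ge>0. z' t = zap t)) \<and>
    (\<forall>v x. (v, x) \<in> behavior {0..} A B C f \<longrightarrow>
      ((\<lambda>t. v t - w t) absolutely_integrable_on {0..} \<longrightarrow>
        ((\<lambda>t. x t - zap t) \<longlongrightarrow> 0) at_top \<and> x \<in> AAP \<and> (\<forall>t\<ge>0. ap_part x t = zap t)) \<and>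
      (\<forall>\<tau>>0. (AE t in lebesgue. 0 \<le> t \<longrightarrow> w (t + \<tau>) = w t) \<longrightarrow>
        (\<forall>t\<ge>0. zap (t + \<tau>) = zap t)) \<and>
      ((S1_ext w, ap_ext zap) \<in> behavior UNIV A B C f \<and>
        (\<forall>xhat. bounded (range xhat) \<and> (S1_ext w, xhat) \<in> behavior UNIV A B C f \<longrightarrow>
          xhat = ap_ext zap)) \<and>
      (frequency_module (ap_ext zap) \<subseteq> frequency_module (bochner_transform (S1_ext w)) \<and>
        (w \<in> AP {0..} \<longrightarrow>
          frequency_module (bochner_transform (S1_ext w)) = frequency_module (ap_ext w))))"
proof -
  have fc: "continuous_on UNIV f" by (rule locally_lipschitz_imp_continuous[OF f])
  obtain P :: "real^'n^'n" where P: "positive_definite P" and neg: "negative_semidefinite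
        (block_matrix (transpose A ** P + P ** A) (P ** B - transpose C) (transpose B ** P - C) 0)"
    using ii by blast
  have PT: "transpose P = P" using P by (simp add: positive_definite_def)
  obtain H :: "real^'m^'n" where H: "hurwitz (A - H ** C)" using i unfolding detectable_def by blast
  obtain S \<mu> where S: "bounded_bilinear S" "\<And>x y. S x y = (S y x :: real)" "\<And>y. 0 \<le> S y y" "\<mu> > 0"
    "\<And>x. S x ((A - H ** C) *v x) \<le> - \<mu> * (norm x)\<^sup>2"
    using hurwitz_Lyapunov[OF H] by blast
  obtain c where c: "c > 0" "\<And>x. c * (norm x)\<^sup>2 \<le> x \<bullet> (P *v x)"
    using positive_definite_lower_bound[OF P] by blast
  note KYP = KYP_inequality[OF PT neg]
  note Wb = bounded_bilinear_quadratic_form[of P]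
  note Ws = symmetric_matrix_inner[OF PT]
  interpret lure A B C f H "\<lambda>x y. x \<bullet> (P *v y)" S c \<mu>
  proof (rule lure.intro)
    show "continuous_on UNIV f" by (rule fc)
  next
    fix \<Gamma> :: "(real^'m) set" assume "compact \<Gamma>"
    then show "\<exists>\<theta>\<in>class_K_inf. \<exists>\<alpha>\<in>class_P. \<forall>y. \<forall>z\<in>\<Gamma>. norm (f (y + z) - f z) \<le> \<theta> (norm y) \<and>
        norm y * \<alpha> (norm y) \<le> y \<bullet> (f (y + z) - f z)" by (rule iii)
  qed (rule Wb Ws c KYP S)+

  define u where "u = S1_ext w"
  obtain u' where u': "u' \<in> S1 UNIV" "AE t in lebesgue. 0 \<le> t \<longrightarrow> u' t = w t"
    "\<And>\<epsilon>. stepanov_periods {0..} w \<epsilon> \<subseteq> stepanov_periods UNIV u' \<epsilon>"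
    using S1_extension_exists[OF w] by blast
  have "u \<in> S1 UNIV \<and> (AE t in lebesgue. 0 \<le> t \<longrightarrow> u t = w t)"
    unfolding u_def S1_ext_def by (rule someI[of _ u']) (use u' in blast)
  then have u: "u \<in> S1 UNIV" and uw: "AE t in lebesgue. 0 \<le> t \<longrightarrow> u t = w t" by blast+
  have L: "u \<in> L1_loc UNIV" "u' \<in> L1_loc UNIV" using u u'(1) by (auto simp: S1_def)
  have "AE t in lebesgue. 0 \<le> t \<longrightarrow> u t = u' t" using uw u'(2) by eventually_elim simp
  \<comment> \<open>\<open>S1_ext\<close> chooses some extension \<open>u\<close>, while
    \<open>u'\<close> is the constructed one whose Stepanov periods are known. Both have the same
    Bochner transform, through which the inclusion of periods passes from \<open>u'\<close> to
    \<open>u\<close>.\<close>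
  then have "bochner_transform u = bochner_transform u'" by (rule S1_eq_AE[OF u u'(1)])
  then have wu: "stepanov_periods {0..} w \<epsilon> \<subseteq> stepanov_periods UNIV u \<epsilon>" for \<epsilon>
    using u'(3)[of \<epsilon>] bochner_almost_periods[OF L(1), of \<epsilon>] bochner_almost_periods[OF L(2), of \<epsilon>] by simp
  have uw_on: "AE s in lebesgue. s \<in> {a..b} \<longrightarrow> u s = w s" "AE s in lebesgue. s \<in> {a..b} \<longrightarrow> w s = u s"
    if "0 \<le> a" for a b
    using uw by (eventually_elim, use that in auto)+
  note half = halfline_or_line_simps(1) and line = halfline_or_line_simps(2)
  obtain z where z: "(w, z) \<in> behavior {0..} A B C f" "bounded (z ` {0..})" using iv by blast
  obtain R where R: "R > 0" "\<And>t. 0 \<le> t \<Longrightarrow> norm (z t) \<le> R"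
    using z(2) unfolding bounded_pos by auto
  have solz: "sol u z a b" if "0 \<le> a" for a b
    by (rule lure_solution_cong_AE[OF behavior_lure_solution[OF half fc z(1)] uw_on(2)[OF that]]) (use that in simp)
  obtain zap where zap: "\<And>a b. sol u zap a b" "\<And>t. norm (zap t) \<le> R"
    and per: "\<And>\<epsilon>. \<epsilon> > 0 \<Longrightarrow> \<exists>\<delta>>0. stepanov_periods UNIV u \<delta> \<subseteq> almost_periods UNIV zap \<epsilon>"
    using almost_periodic_response[OF u solz R(2,1)] by blast
  have zap_AP: "zap \<in> AP UNIV"
    unfolding AP_def
  proof (intro CollectI conjI allI impI)
    show "continuous_on UNIV zap" by (rule continuous_on_halfline_or_line[OF line]) (rule sol_continuous[OF zap(1)])
    fix \<epsilon> :: real assume "\<epsilon> > 0"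
    then obtain \<delta> where \<delta>: "\<delta> > 0" "stepanov_periods UNIV u \<delta> \<subseteq> almost_periods UNIV zap \<epsilon>" using per by blast
    have "relatively_dense UNIV (stepanov_periods UNIV u \<delta>)" using u \<delta>(1) by (simp add: S1_def)
    with \<delta>(2) show "relatively_dense UNIV (almost_periods UNIV zap \<epsilon>)" unfolding relatively_dense_def by blast
  qed
  have zap_half: "zap \<in> AP {0..}" by (rule AP_UNIV_restrict[OF zap_AP])
  have ext: "ap_ext zap = zap" by (rule ap_ext_eq[OF zap_AP]) simp
  have solw: "sol w zap a b" if "0 \<le> a" for a b
    by (rule lure_solution_cong_AE[OF zap(1) uw_on(1)[OF that]])
  have wzap: "(w, zap) \<in> behavior {0..} A B C f"
    by (rule lure_solutions_behavior[OF half fc]) (simp add: solw)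
  have per_half: "\<exists>\<delta>>0. stepanov_periods {0..} w \<delta> \<subseteq> almost_periods {0..} zap \<epsilon>" if e: "\<epsilon> > 0" for \<epsilon>
  proof -
    obtain \<delta> where \<delta>: "\<delta> > 0" "stepanov_periods UNIV u \<delta> \<subseteq> almost_periods UNIV zap \<epsilon>" using per[OF e] by blast
    have "stepanov_periods {0..} w \<delta> \<subseteq> {0..}" by (auto simp: stepanov_periods_def)
    moreover have "stepanov_periods {0..} w \<delta> \<subseteq> almost_periods UNIV zap \<epsilon>" using wu \<delta>(2) by blast
    ultimately have "stepanov_periods {0..} w \<delta> \<subseteq> almost_periods {0..} zap \<epsilon>" unfolding almost_periods_def by blast
    then show ?thesis using \<delta>(1) by blast
  qed
  have conv: "((\<lambda>t. x t - zap t) \<longlongrightarrow> 0) at_top"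
    if "(v, x) \<in> behavior {0..} A B C f" "(\<lambda>t. v t - w t) absolutely_integrable_on {0..}" for v x
    by (rule integrable_perturbation_converges[OF behavior_lure_solution[OF half fc that(1)] solw zap(2) that(2)]) auto
  \<comment> \<open>With the perturbation 0, any solution for \<open>w\<close> approaches
    \<open>zap\<close>; an almost periodic one must then coincide with it. So uniqueness holds
    already among all almost periodic solutions.\<close>
  have unique: "z' t = zap t"
    if z': "z' \<in> AP {0..}" "(w, z') \<in> behavior {0..} A B C f" and t: "t \<ge> 0" for z' t
  proof -
    have "(\<lambda>t. w t - w t) absolutely_integrable_on {0..}" by simp
    from AP_halfline_eqI[OF z'(1) zap_half conv[OF z'(2) this] t] show ?thesis .
  qed
  have part1: "((\<lambda>t. x t - zap t) \<longlongrightarrow> 0) at_top \<and> x \<in> AAP \<and> (\<forall>t\<ge>0. ap_part x t = zap t)"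
    if vx: "(v, x) \<in> behavior {0..} A B C f" and vw: "(\<lambda>t. v t - w t) absolutely_integrable_on {0..}" for v x
  proof -
    note lim = conv[OF vx vw]
    have "continuous_on {0..} x" using vx unfolding behavior_iff[OF half fc] by blast
    moreover have "continuous_on {0..} zap" using zap_half by (simp add: AP_def)
    ultimately have C0: "(\<lambda>t. x t - zap t) \<in> C0"
      unfolding C0_def using lim by (auto intro: continuous_on_diff)
    \<comment> \<open>\<open>ap_part\<close> is a choice, but two almost periodic parts differ by a
      function tending to 0, so the choice is determined on the half-line.\<close>
    have "ap_part x \<in> AP {0..} \<and> (\<lambda>t. x t - ap_part x t) \<in> C0"
      unfolding ap_part_def by (rule someI[of _ zap]) (use zap_half C0 in blast)
    then have p: "ap_part x \<in> AP {0..}" "((\<lambda>t. x t - ap_part x t) \<longlongrightarrow> 0) at_top" by (auto simp: C0_def)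
    have "((\<lambda>t. ap_part x t - zap t) \<longlongrightarrow> 0) at_top" using tendsto_diff[OF lim p(2)] by simp
    then show ?thesis using AP_halfline_eqI[OF p(1) zap_half] lim zap_half C0 unfolding AAP_def by blast
  qed
  \<comment> \<open>A period of \<open>w\<close> is a Stepanov period for every
    \<open>\<delta>\<close>, hence an almost period of \<open>zap\<close> for every
    \<open>\<epsilon>\<close>.\<close>
  have part2: "zap (t + \<tau>) = zap t"
    if \<tau>: "\<tau> > 0" and pw: "AE t in lebesgue. 0 \<le> t \<longrightarrow> w (t + \<tau>) = w t" and t: "t \<ge> 0" for \<tau> t
  proof -
    have wL: "w \<in> L1_loc {0..}" using w by (simp add: S1_def)
    have "L1_dist (\<lambda>s. w (s + \<tau>)) w a (a + 1) = L1_dist w w a (a + 1)" if "a \<ge> 0" for a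
    proof (rule L1_dist_cong_AE)
      show "AE s in lebesgue. s \<in> {a..a + 1} \<longrightarrow> w (s + \<tau>) = w s"
        using pw by eventually_elim (use that in auto)
    qed simp
    then have "\<tau> \<in> stepanov_periods {0..} w \<delta>" if "\<delta> > 0" for \<delta>
      using \<tau> that unfolding stepanov_periods_iff[OF half wL] by (simp add: L1_dist_def)
    then have "norm (zap t - zap (t + \<tau>)) \<le> \<epsilon>" if "\<epsilon> > 0" for \<epsilon>
      using per_half[OF that] t unfolding almost_periods_def by blast
    then have "norm (zap t - zap (t + \<tau>)) \<le> 0" by (rule field_le_epsilon[of _ 0, simplified])
    then show ?thesis by simp
  qed
  have part3: "(u, zap) \<in> behavior UNIV A B C f"
    by (rule lure_solutions_behavior[OF line fc zap(1)])
  have part3': "xhat = zap" if b: "bounded (range xhat)" and s: "(u, xhat) \<in> behavior UNIV A B C f" for xhat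
  proof -
    obtain K where K: "\<And>t. norm (xhat t) \<le> K" using b unfolding bounded_iff by auto
    show ?thesis
      by (rule bounded_solution_unique[OF behavior_lure_solution[OF line fc s UNIV_I] zap(1), of "max K R"])
        (use K zap(2) in \<open>auto simp: le_max_iff_disj\<close>)
  qed
  have part4: "frequency_module zap \<subseteq> frequency_module (bochner_transform u)"
    by (rule frequency_module_mono[OF separated_by_functionals_L1 zap_AP bochner_transform_AP[OF u]])
      (use per in \<open>simp add: bochner_almost_periods[OF L(1)]\<close>)
  \<comment> \<open>The Bohr extension of \<open>w\<close> is also a Stepanov extension and so has
    the Bochner transform of \<open>u\<close>; for it \<open>bochner_spectrum_eq\<close> compares
    the spectra.\<close>
  have part4': "frequency_module (bochner_transform u) = frequency_module (ap_ext w)" if wAP: "w \<in> AP {0..}"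
  proof -
    note e = ap_ext_AP[OF wAP]
    have "AE t in lebesgue. 0 \<le> t \<longrightarrow> u t = ap_ext w t" using uw by eventually_elim (simp add: e(2))
    then have "bochner_transform u = bochner_transform (ap_ext w)" by (rule S1_eq_AE[OF u AP_UNIV_in_S1[OF e(1)]])
    then show ?thesis by (simp add: frequency_module_eq bochner_spectrum_eq[OF e(1)])
  qed
  show ?thesis
    unfolding u_def[symmetric]
    by (rule exI[of _ zap], unfold ext)
      (use zap_half wzap per_half unique part1 part2 part3 part3' part4 part4' in blast)
qed

end
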